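(* Let $X$ be a totally disconnected locally compact Hausdorff space, and let $T\colon n\mapsto T_n$ be an action of $\mathbb N^k$ on $X$ by local homeomorphisms. Let $G$ be the associated Deaconu--Renault groupoid, let $R$ be a reduced and indecomposable commutative ring, and let $(\Sigma,i,q)$ be a discrete $R$-twist over $G$. Let $(A,B)=(A_R(G;\Sigma),A_R(G^{(0)};q^{-1}(G^{(0)})))$. Then $(A,B)$ is an algebraic quasi-Cartan pair, and the groupoid $G$ and the discrete twist $\Sigma$ are recovered from $(A,B)$, in the sense that the map $\Phi\colon\Sigma\to\Sigma'$, $\Phi(\sigma)=(\tilde1_YU_{s(\sigma)})^\uparrow$ (with $Y$ any compact open bisection of $\Sigma$ containing $\sigma$), into the groupoid $\Sigma'$ of ultrafilters of $N(B)$ is an isomorphism of topological groupoids inducing an isomorphism of twists from $(\Sigma,i,q)$ over $G$ to $(\Sigma',i',q')$ over $G'=\Sigma'/R^\times$.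
   Context: **Deaconu--Renault groupoid.** $T_0=\mathrm{id}$, $T_{m+n}=T_mT_n$, each $T_n\colon X\to X$ a local homeomorphism. $G=\{(x,m-n,y)\in X\times\mathbb Z^k\times X: m,n\in\mathbb N^k,\ T_mx=T_ny\}$ with $r(x,p,y)=x$, $s(x,p,y)=y$ (identifying $x$ with $(x,0,x)$), $(x,p,y)(y,p',z)=(x,p+p',z)$, $(x,p,y)^{-1}=(y,-p,x)$, and topology with basis the sets $\{(x,m-n,y):x\in U,y\in V,T_mx=T_ny\}$, $U,V\subseteq X$ open, $m,n\in\mathbb N^k$. It is an ample Hausdorff groupoid. **Rings and groupoids.** A commutative ring $R$ with identity is indecomposable if $0\neq1$ and its only idempotents are $0$ and $1$; reduced if it has no nonzero nilpotents. $R^\times$ is its group of units (discrete topology). A bisection is a subset $D$ of a topological groupoid contained in an open set $O$ such that $r|_O,s|_O$ are homeomorphisms onto open subsets of the unit space. A groupoid is étale if $r$ is a local homeomorphism, and ample if it is étale with a basis of compact open bisections. **Twists.** A discrete $R$-twist $(\Sigma,i,q)$ over an étale groupoid $G$ is a sequence $G^{(0)}\times R^\times\xrightarrow{i}\Sigma\xrightarrow{q}G$, where $G^{(0)}\times R^\times$ is the trivial group bundle, $\Sigma$ is a topological groupoid with $\Sigma^{(0)}=i(G^{(0)}\times\{1\})$ (identified with $G^{(0)}$), and $i,q$ are continuous groupoid homomorphisms restricting to homeomorphisms of unit spaces, such that: (DT1) $i(\{x\}\times R^\times)=q^{-1}(x)$ for $x\in G^{(0)}$, $i$ injective, $q$ surjective;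 (DT2) each $\alpha\in G$ has an open bisection $B_\alpha\ni\alpha$ and a continuous $P_\alpha\colon B_\alpha\to\Sigma$ with $q\circ P_\alpha=\mathrm{id}$ and $(\beta,t)\mapsto i(r(\beta),t)P_\alpha(\beta)$ a homeomorphism $B_\alpha\times R^\times\to q^{-1}(B_\alpha)$; (DT3) $i(r(\sigma),t)\sigma=\sigma i(s(\sigma),t)$. Write $t\cdot\sigma=i(r(\sigma),t)\sigma$. **Twisted Steinberg algebra.** $\operatorname{supp}(f)=\{f\neq0\}$, $\operatorname{supp}_G(f)=q(\operatorname{supp}(f))$. $A_R(G;\Sigma)$ is the set of locally constant $f\colon\Sigma\to R$ with $f(t\cdot\sigma)=t^{-1}f(\sigma)$ for $t\in R^\times$ and $q(\operatorname{supp}(f))$ compact; it is an $R$-algebra under pointwise operations and $(f*g)(\sigma)=\sum_{\alpha\in r^{-1}(r(\sigma))\cap\operatorname{supp}_G(f)}f(S(\alpha))g(S(\alpha)^{-1}\sigma)$, with $S\colon\operatorname{supp}_G(f)\to\operatorname{supp}(f)$ any section for $q$. $A_R(G^{(0)};q^{-1}(G^{(0)}))$ is the commutative subalgebra of those $f$ supported in $q^{-1}(G^{(0)})$. For a compact open bisection $Y\subseteq\Sigma$, $\tilde1_Y$ is the unique element of $A_R(G;\Sigma)$ with support in $R^\times\cdot Y$ and equal to $1$ on $Y$. **Normalisers and pairs.** $I(B)$ is the set of idempotents of $B$, called a set of local units for $A$ if every finite $\{a_1,\dots,a_n\}\subseteq A$ admits $e\in I(B)$ with $ea_i=a_i=a_ie$.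 $N(B)=\{n\in A:\exists k\in A,\ knk=k,\ nkn=n,\ kBn\cup nBk\subseteq B\}$; $k$ is unique, denoted $n^\dagger$; $n\le m\iff n=nn^\dagger m$. A conditional expectation $P\colon A\to B$ is $R$-linear with $P|_B=\mathrm{id}_B$, $P(bab')=bP(a)b'$; it is faithful if for each $a\neq0$ there is $n\in N(B)$ with $P(na)\neq0$, and implemented by idempotents if for each $n\in N(B)$ there is $e\in I(B)$ with $P(n)=ne=en$. $(A,B)$ is an algebraic quasi-Cartan pair if $te=0$ with $t\in R$, $e\in I(B)\setminus\{0\}$ implies $t=0$; $I(B)$ is a set of local units for $A$; $B=\operatorname{span}_RI(B)$; $A=\operatorname{span}_RN(B)$; and there is a faithful conditional expectation $A\to B$ implemented by idempotents. **The twist $\Sigma'$.** $U^\uparrow=\{m\in N(B):n\le m\text{ for some }n\in U\}$. A filter is $U\subseteq N(B)\setminus\{0\}$ with $U=U^\uparrow$ in which any two elements have a common lower bound in $U$; an ultrafilter is a maximal (nonempty) filter. $\Sigma'$ is the set of ultrafilters, with $U^{-1}=\{n^\dagger:n\in U\}$; $(U,V)$ composable iff $mn\ne0$ for all $m\in U,n\in V$, and then $UV=\{mn:m\in U,n\in V\}^\uparrow$; topology with basis $\mathcal V_n=\{U:n\in U\}$, $n\in N(B)$; $tU=\{tm:m\in U\}$ for $t\in R^\times$. $q'\colon\Sigma'\to G'$ is the quotient by $U\simeq W\iff U=tW$ for some $t\in R^\times$ (quotient topology, induced groupoid structure), and $i'(q'(U),t)=tU$ for $U\in\Sigma'^{(0)}$;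 $(\Sigma',i',q')$ is a discrete $R$-twist over $G'$. For $x\in\Sigma^{(0)}$, $U_x=\{e\in I(B):e(x)=1\}$; $\Phi(\sigma)$ is an ultrafilter independent of the choice of $Y$. Inducing an isomorphism of twists means that $\Phi_G\colon G\to G'$, $\Phi_G(q(\sigma))=q'(\Phi(\sigma))$, is a well-defined isomorphism of topological groupoids with $\Phi\circ i=i'\circ(\Phi_G|_{G^{(0)}}\times\mathrm{id})$. *)

theory Defs
  imports "HOL-Analysis.Analysis"
begin

section \<open>Topology\<close>

definition totally_disconnected_space :: "'a topology \<Rightarrow> bool" where
  "totally_disconnected_space X \<longleftrightarrow> (\<forall>S. connectedin X S \<longrightarrow> (\<exists>a. S \<subseteq> {a}))"

definition local_homeo :: "'a topology \<Rightarrow> 'b topology \<Rightarrow> ('a \<Rightarrow> 'b) \<Rightarrow> bool" where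
  "local_homeo X Y f \<longleftrightarrow>
     f ` topspace X \<subseteq> topspace Y \<and>
     (\<forall>x \<in> topspace X. \<exists>U. openin X U \<and> x \<in> U \<and> openin Y (f ` U) \<and>
        homeomorphic_map (subtopology X U) (subtopology Y (f ` U)) f)"

definition quotient_topology :: "'a topology \<Rightarrow> ('a \<Rightarrow> 'b) \<Rightarrow> 'b topology" where
  "quotient_topology X f =
     topology (\<lambda>V. V \<subseteq> f ` topspace X \<and> openin X {x \<in> topspace X. f x \<in> V})"

lemma openin_quotient_topology:
  "openin (quotient_topology X f) V \<longleftrightarrow>
     V \<subseteq> f ` topspace X \<and> openin X {x \<in> topspace X. f x \<in> V}"
proof -
  have "istopology (\<lambda>V. V \<subseteq> f ` topspace X \<and> openin X {x \<in> topspace X. f x \<in> V})"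
    unfolding istopology_def
  proof (intro conjI allI impI)
    fix S T
    assume S: "S \<subseteq> f ` topspace X \<and> openin X {x \<in> topspace X. f x \<in> S}"
      and T: "T \<subseteq> f ` topspace X \<and> openin X {x \<in> topspace X. f x \<in> T}"
    show "S \<inter> T \<subseteq> f ` topspace X" using S by blast
    have "{x \<in> topspace X. f x \<in> S \<inter> T} =
        {x \<in> topspace X. f x \<in> S} \<inter> {x \<in> topspace X. f x \<in> T}" by blast
    then show "openin X {x \<in> topspace X. f x \<in> S \<inter> T}" using S T by auto
  next
    fix K
    assume K: "\<forall>V\<in>K. V \<subseteq> f ` topspace X \<and> openin X {x \<in> topspace X. f x \<in> V}"
    show "\<Union> K \<subseteq> f ` topspace X" using K by blast
    have "{x \<in> topspace X. f x \<in> \<Union> K} = (\<Union>V\<in>K. {x \<in> topspace X. f x \<in> V})" by blast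
    then show "openin X {x \<in> topspace X. f x \<in> \<Union> K}" using K by auto
  qed
  then show ?thesis
    by (simp add: quotient_topology_def topology_inverse')
qed

section \<open>Topological groupoids\<close>

text \<open>A groupoid is presented by its arrows (the underlying set of its topology), its set of
  composable pairs, its product and its inversion. Units are arrows, and range and source are the
  maps \<open>a \<mapsto> a a\<inverse>\<close> and \<open>a \<mapsto> a\<inverse> a\<close>.\<close>

record 'g groupoid =
  g_top :: "'g topology"
  g_comp :: "('g \<times> 'g) set"
  g_mul :: "'g \<Rightarrow> 'g \<Rightarrow> 'g"
  g_inv :: "'g \<Rightarrow> 'g"

abbreviation g_arr :: "'g groupoid \<Rightarrow> 'g set" where
  "g_arr G \<equiv> topspace (g_top G)"

definition g_rng :: "'g groupoid \<Rightarrow> 'g \<Rightarrow> 'g" where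
  "g_rng G a = g_mul G a (g_inv G a)"

definition g_src :: "'g groupoid \<Rightarrow> 'g \<Rightarrow> 'g" where
  "g_src G a = g_mul G (g_inv G a) a"

definition g_units :: "'g groupoid \<Rightarrow> 'g set" where
  "g_units G = g_rng G ` g_arr G"

definition algebraic_groupoid :: "'g groupoid \<Rightarrow> bool" where
  "algebraic_groupoid G \<longleftrightarrow>
     g_comp G \<subseteq> g_arr G \<times> g_arr G \<and>
     (\<forall>(a, b) \<in> g_comp G. g_mul G a b \<in> g_arr G) \<and>
     (\<forall>a \<in> g_arr G. g_inv G a \<in> g_arr G \<and> g_inv G (g_inv G a) = a \<and> (g_inv G a, a) \<in> g_comp G) \<and>
     (\<forall>a b c. (a, b) \<in> g_comp G \<and> (b, c) \<in> g_comp G \<longrightarrow>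
        (g_mul G a b, c) \<in> g_comp G \<and> (a, g_mul G b c) \<in> g_comp G \<and>
        g_mul G (g_mul G a b) c = g_mul G a (g_mul G b c)) \<and>
     (\<forall>(a, b) \<in> g_comp G.
        g_mul G (g_inv G a) (g_mul G a b) = b \<and> g_mul G (g_mul G a b) (g_inv G b) = a)"

definition topological_groupoid :: "'g groupoid \<Rightarrow> bool" where
  "topological_groupoid G \<longleftrightarrow>
     algebraic_groupoid G \<and>
     continuous_map (subtopology (prod_topology (g_top G) (g_top G)) (g_comp G)) (g_top G)
       (\<lambda>(a, b). g_mul G a b) \<and>
     continuous_map (g_top G) (g_top G) (g_inv G)"

abbreviation unit_space :: "'g groupoid \<Rightarrow> 'g topology" where
  "unit_space G \<equiv> subtopology (g_top G) (g_units G)"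

definition etale_groupoid :: "'g groupoid \<Rightarrow> bool" where
  "etale_groupoid G \<longleftrightarrow> topological_groupoid G \<and> local_homeo (g_top G) (unit_space G) (g_rng G)"

definition bisection :: "'g groupoid \<Rightarrow> 'g set \<Rightarrow> bool" where
  "bisection G D \<longleftrightarrow>
     (\<exists>W. D \<subseteq> W \<and> openin (g_top G) W \<and>
        (\<forall>f \<in> {g_rng G, g_src G}. openin (unit_space G) (f ` W) \<and>
           homeomorphic_map (subtopology (g_top G) W) (subtopology (unit_space G) (f ` W)) f))"

definition compact_open_bisection :: "'g groupoid \<Rightarrow> 'g set \<Rightarrow> bool" where
  "compact_open_bisection G D \<longleftrightarrow> compactin (g_top G) D \<and> openin (g_top G) D \<and> bisection G D"

definition groupoid_hom :: "'g groupoid \<Rightarrow> 'h groupoid \<Rightarrow> ('g \<Rightarrow> 'h) \<Rightarrow> bool" where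
  "groupoid_hom G H f \<longleftrightarrow>
     f ` g_arr G \<subseteq> g_arr H \<and>
     (\<forall>(a, b) \<in> g_comp G. (f a, f b) \<in> g_comp H \<and> f (g_mul G a b) = g_mul H (f a) (f b))"

definition topological_groupoid_iso :: "'g groupoid \<Rightarrow> 'h groupoid \<Rightarrow> ('g \<Rightarrow> 'h) \<Rightarrow> bool" where
  "topological_groupoid_iso G H f \<longleftrightarrow>
     topological_groupoid G \<and> topological_groupoid H \<and>
     homeomorphic_map (g_top G) (g_top H) f \<and> groupoid_hom G H f \<and>
     (\<forall>a \<in> g_arr G. \<forall>b \<in> g_arr G. (f a, f b) \<in> g_comp H \<longrightarrow> (a, b) \<in> g_comp G)"

section \<open>Deaconu--Renault groupoids\<close>

definition local_homeo_action :: "'x topology \<Rightarrow> (nat ^ 'k::finite \<Rightarrow> 'x \<Rightarrow> 'x) \<Rightarrow> bool" where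
  "local_homeo_action X T \<longleftrightarrow>
     (\<forall>x \<in> topspace X. T 0 x = x) \<and>
     (\<forall>m n. \<forall>x \<in> topspace X. T (m + n) x = T m (T n x)) \<and>
     (\<forall>n. local_homeo X X (T n))"

definition vec_diff :: "nat ^ 'k::finite \<Rightarrow> nat ^ 'k \<Rightarrow> int ^ 'k" where
  "vec_diff m n = (\<chi> j. int (m $ j) - int (n $ j))"

definition dr_cylinder ::
  "(nat ^ 'k::finite \<Rightarrow> 'x \<Rightarrow> 'x) \<Rightarrow> 'x set \<Rightarrow> nat ^ 'k \<Rightarrow> nat ^ 'k \<Rightarrow> 'x set \<Rightarrow>
   ('x \<times> (int ^ 'k) \<times> 'x) set" where
  "dr_cylinder T U m n V = {(x, vec_diff m n, y) | x y. x \<in> U \<and> y \<in> V \<and> T m x = T n y}"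

definition deaconu_renault ::
  "'x topology \<Rightarrow> (nat ^ 'k::finite \<Rightarrow> 'x \<Rightarrow> 'x) \<Rightarrow> ('x \<times> (int ^ 'k) \<times> 'x) groupoid" where
  "deaconu_renault X T =
    (let arr = {(x, vec_diff m n, y) | x m n y.
                  x \<in> topspace X \<and> y \<in> topspace X \<and> T m x = T n y}
     in \<lparr> g_top = topology_generated_by
              {dr_cylinder T U m n V | U m n V. openin X U \<and> openin X V},
          g_comp = {((x, p, y), (y', p', z)).
                      (x, p, y) \<in> arr \<and> (y', p', z) \<in> arr \<and> y = y'},
          g_mul = (\<lambda>(x, p, y) (y', p', z). (x, p + p', z)),
          g_inv = (\<lambda>(x, p, y). (y, - p, x)) \<rparr>)"

section \<open>Discrete twists\<close>

abbreviation ring_units :: "'r::comm_ring_1 set" where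
  "ring_units \<equiv> {t. t dvd 1}"

definition unit_inv :: "'r::comm_ring_1 \<Rightarrow> 'r" where
  "unit_inv t = (THE u. t * u = 1)"

definition trivial_bundle :: "'g groupoid \<Rightarrow> ('g \<times> 'r::comm_ring_1) groupoid" where
  "trivial_bundle G =
     \<lparr> g_top = prod_topology (unit_space G) (discrete_topology ring_units),
       g_comp = {((x, t), (y, u)). x \<in> g_units G \<and> x = y \<and> t \<in> ring_units \<and> u \<in> ring_units},
       g_mul = (\<lambda>(x, t) (y, u). (x, t * u)),
       g_inv = (\<lambda>(x, t). (x, unit_inv t)) \<rparr>"

text \<open>The unit spaces of \<open>\<Sigma>\<close> and \<open>G\<close> are distinct sets here, identified via \<open>q\<close>; so the element
  written \<open>i(r(\<sigma>), t)\<close> on paper is \<open>i (q (r \<sigma>), t)\<close>.\<close>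

definition unit_act ::
  "'s groupoid \<Rightarrow> ('g \<times> 'r::comm_ring_1 \<Rightarrow> 's) \<Rightarrow> ('s \<Rightarrow> 'g) \<Rightarrow> 'r \<Rightarrow> 's \<Rightarrow> 's" where
  "unit_act \<Sigma> i q t \<sigma> = g_mul \<Sigma> (i (q (g_rng \<Sigma> \<sigma>), t)) \<sigma>"

definition discrete_twist ::
  "'g groupoid \<Rightarrow> 's groupoid \<Rightarrow> ('g \<times> 'r::comm_ring_1 \<Rightarrow> 's) \<Rightarrow> ('s \<Rightarrow> 'g) \<Rightarrow> bool" where
  "discrete_twist G \<Sigma> i q \<longleftrightarrow>
     etale_groupoid G \<and> topological_groupoid \<Sigma> \<and>
     g_units \<Sigma> = i ` (g_units G \<times> {1}) \<and>
     continuous_map (g_top (trivial_bundle G)) (g_top \<Sigma>) i \<and>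
     groupoid_hom (trivial_bundle G) \<Sigma> i \<and>
     homeomorphic_map (unit_space (trivial_bundle G)) (unit_space \<Sigma>) i \<and>
     continuous_map (g_top \<Sigma>) (g_top G) q \<and>
     groupoid_hom \<Sigma> G q \<and>
     homeomorphic_map (unit_space \<Sigma>) (unit_space G) q \<and>
     (\<forall>x \<in> g_units G. i ` ({x} \<times> ring_units) = {\<sigma> \<in> g_arr \<Sigma>. q \<sigma> = x}) \<and>
     inj_on i (g_units G \<times> ring_units) \<and>
     q ` g_arr \<Sigma> = g_arr G \<and>
     (\<forall>\<alpha> \<in> g_arr G. \<exists>D P.
        \<alpha> \<in> D \<and> openin (g_top G) D \<and> bisection G D \<and>
        continuous_map (subtopology (g_top G) D) (g_top \<Sigma>) P \<and>
        (\<forall>\<beta> \<in> D. q (P \<beta>) = \<beta>) \<and>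
        homeomorphic_map
          (prod_topology (subtopology (g_top G) D) (discrete_topology ring_units))
          (subtopology (g_top \<Sigma>) {\<sigma> \<in> g_arr \<Sigma>. q \<sigma> \<in> D})
          (\<lambda>(\<beta>, t). g_mul \<Sigma> (i (g_rng G \<beta>, t)) (P \<beta>))) \<and>
     (\<forall>\<sigma> \<in> g_arr \<Sigma>. \<forall>t \<in> ring_units.
        g_mul \<Sigma> (i (q (g_rng \<Sigma> \<sigma>), t)) \<sigma> = g_mul \<Sigma> \<sigma> (i (q (g_src \<Sigma> \<sigma>), t)))"

section \<open>Algebras, normalisers and algebraic quasi-Cartan pairs\<close>

record ('r, 'a) nu_algebra =
  alg_carrier :: "'a set"
  alg_zero :: 'a
  alg_add :: "'a \<Rightarrow> 'a \<Rightarrow> 'a"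
  alg_smult :: "'r \<Rightarrow> 'a \<Rightarrow> 'a"
  alg_mult :: "'a \<Rightarrow> 'a \<Rightarrow> 'a"

definition r_algebra :: "('r::comm_ring_1, 'a) nu_algebra \<Rightarrow> bool" where
  "r_algebra A \<longleftrightarrow>
    (let C = alg_carrier A; z = alg_zero A; add = alg_add A; sm = alg_smult A; mult = alg_mult A in
     z \<in> C \<and>
     (\<forall>a \<in> C. \<forall>b \<in> C. add a b \<in> C \<and> mult a b \<in> C) \<and>
     (\<forall>t. \<forall>a \<in> C. sm t a \<in> C) \<and>
     (\<forall>a \<in> C. \<forall>b \<in> C. \<forall>c \<in> C. add (add a b) c = add a (add b c)) \<and>
     (\<forall>a \<in> C. \<forall>b \<in> C. add a b = add b a) \<and>
     (\<forall>a \<in> C. add z a = a \<and> (\<exists>b \<in> C. add a b = z)) \<and>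
     (\<forall>t. \<forall>a \<in> C. \<forall>b \<in> C. sm t (add a b) = add (sm t a) (sm t b)) \<and>
     (\<forall>t u. \<forall>a \<in> C. sm (t + u) a = add (sm t a) (sm u a) \<and> sm (t * u) a = sm t (sm u a)) \<and>
     (\<forall>a \<in> C. sm 1 a = a) \<and>
     (\<forall>a \<in> C. \<forall>b \<in> C. \<forall>c \<in> C.
        mult (mult a b) c = mult a (mult b c) \<and>
        mult a (add b c) = add (mult a b) (mult a c) \<and>
        mult (add a b) c = add (mult a c) (mult b c)) \<and>
     (\<forall>t. \<forall>a \<in> C. \<forall>b \<in> C. mult (sm t a) b = sm t (mult a b) \<and> mult a (sm t b) = sm t (mult a b)))"

definition comm_subalgebra :: "('r::comm_ring_1, 'a) nu_algebra \<Rightarrow> 'a set \<Rightarrow> bool" where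
  "comm_subalgebra A B \<longleftrightarrow>
     B \<subseteq> alg_carrier A \<and> alg_zero A \<in> B \<and>
     (\<forall>a \<in> B. \<forall>b \<in> B. alg_add A a b \<in> B \<and> alg_mult A a b \<in> B \<and> alg_mult A a b = alg_mult A b a) \<and>
     (\<forall>t. \<forall>a \<in> B. alg_smult A t a \<in> B)"

definition idems :: "('r, 'a) nu_algebra \<Rightarrow> 'a set \<Rightarrow> 'a set" where
  "idems A B = {e \<in> B. alg_mult A e e = e}"

inductive_set alg_span :: "('r, 'a) nu_algebra \<Rightarrow> 'a set \<Rightarrow> 'a set"
  for A :: "('r, 'a) nu_algebra" and S :: "'a set" where
  zero: "alg_zero A \<in> alg_span A S"
| step: "v \<in> S \<Longrightarrow> w \<in> alg_span A S \<Longrightarrow> alg_add A (alg_smult A t v) w \<in> alg_span A S"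

definition is_dagger :: "('r, 'a) nu_algebra \<Rightarrow> 'a set \<Rightarrow> 'a \<Rightarrow> 'a \<Rightarrow> bool" where
  "is_dagger A B n k \<longleftrightarrow>
     k \<in> alg_carrier A \<and>
     alg_mult A (alg_mult A k n) k = k \<and> alg_mult A (alg_mult A n k) n = n \<and>
     (\<forall>b \<in> B. alg_mult A (alg_mult A k b) n \<in> B \<and> alg_mult A (alg_mult A n b) k \<in> B)"

definition normalisers :: "('r, 'a) nu_algebra \<Rightarrow> 'a set \<Rightarrow> 'a set" where
  "normalisers A B = {n \<in> alg_carrier A. \<exists>k. is_dagger A B n k}"

definition dagger :: "('r, 'a) nu_algebra \<Rightarrow> 'a set \<Rightarrow> 'a \<Rightarrow> 'a" where
  "dagger A B n = (THE k. is_dagger A B n k)"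

definition cond_expectation ::
  "('r::comm_ring_1, 'a) nu_algebra \<Rightarrow> 'a set \<Rightarrow> ('a \<Rightarrow> 'a) \<Rightarrow> bool" where
  "cond_expectation A B P \<longleftrightarrow>
     P ` alg_carrier A \<subseteq> B \<and>
     (\<forall>a \<in> alg_carrier A. \<forall>a' \<in> alg_carrier A. P (alg_add A a a') = alg_add A (P a) (P a')) \<and>
     (\<forall>t. \<forall>a \<in> alg_carrier A. P (alg_smult A t a) = alg_smult A t (P a)) \<and>
     (\<forall>b \<in> B. P b = b) \<and>
     (\<forall>a \<in> alg_carrier A. \<forall>b \<in> B. \<forall>b' \<in> B.
        P (alg_mult A (alg_mult A b a) b') = alg_mult A (alg_mult A b (P a)) b')"

definition faithful_expectation ::
  "('r, 'a) nu_algebra \<Rightarrow> 'a set \<Rightarrow> ('a \<Rightarrow> 'a) \<Rightarrow> bool" where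
  "faithful_expectation A B P \<longleftrightarrow>
     (\<forall>a \<in> alg_carrier A. a \<noteq> alg_zero A \<longrightarrow>
        (\<exists>n \<in> normalisers A B. P (alg_mult A n a) \<noteq> alg_zero A))"

definition implemented_by_idems ::
  "('r, 'a) nu_algebra \<Rightarrow> 'a set \<Rightarrow> ('a \<Rightarrow> 'a) \<Rightarrow> bool" where
  "implemented_by_idems A B P \<longleftrightarrow>
     (\<forall>n \<in> normalisers A B. \<exists>e \<in> idems A B. P n = alg_mult A n e \<and> P n = alg_mult A e n)"

definition alg_quasi_cartan_pair :: "('r::comm_ring_1, 'a) nu_algebra \<Rightarrow> 'a set \<Rightarrow> bool" where
  "alg_quasi_cartan_pair A B \<longleftrightarrow>
     r_algebra A \<and> comm_subalgebra A B \<and>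
     (\<forall>t. \<forall>e \<in> idems A B. e \<noteq> alg_zero A \<and> alg_smult A t e = alg_zero A \<longrightarrow> t = 0) \<and>
     (\<forall>F. finite F \<and> F \<subseteq> alg_carrier A \<longrightarrow>
        (\<exists>e \<in> idems A B. \<forall>a \<in> F. alg_mult A e a = a \<and> alg_mult A a e = a)) \<and>
     B = alg_span A (idems A B) \<and>
     alg_carrier A = alg_span A (normalisers A B) \<and>
     (\<exists>P. cond_expectation A B P \<and> faithful_expectation A B P \<and> implemented_by_idems A B P)"

section \<open>Twisted Steinberg algebras\<close>

definition locally_constant :: "'a topology \<Rightarrow> ('a \<Rightarrow> 'b) \<Rightarrow> bool" where
  "locally_constant X f \<longleftrightarrow>
     (\<forall>x \<in> topspace X. \<exists>U. openin X U \<and> x \<in> U \<and> (\<forall>y \<in> U. f y = f x))"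

definition supp :: "'s groupoid \<Rightarrow> ('s \<Rightarrow> 'r::zero) \<Rightarrow> 's set" where
  "supp \<Sigma> f = {\<sigma> \<in> g_arr \<Sigma>. f \<sigma> \<noteq> 0}"

text \<open>Functions on \<open>\<Sigma>\<close> are represented by their extension by zero to the ambient type.\<close>

definition steinberg_carrier ::
  "'g groupoid \<Rightarrow> 's groupoid \<Rightarrow> ('g \<times> 'r::comm_ring_1 \<Rightarrow> 's) \<Rightarrow> ('s \<Rightarrow> 'g) \<Rightarrow> ('s \<Rightarrow> 'r) set" where
  "steinberg_carrier G \<Sigma> i q =
     {f. (\<forall>\<sigma>. \<sigma> \<notin> g_arr \<Sigma> \<longrightarrow> f \<sigma> = 0) \<and>
         locally_constant (g_top \<Sigma>) f \<and>
         (\<forall>t \<in> ring_units. \<forall>\<sigma> \<in> g_arr \<Sigma>. f (unit_act \<Sigma> i q t \<sigma>) = unit_inv t * f \<sigma>) \<and>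
         compactin (g_top G) (q ` supp \<Sigma> f)}"

text \<open>The convolution sums over the finite set \<open>r\<inverse>(r(\<sigma>)) \<inter> supp\<^sub>G(f)\<close>, choosing a section of \<open>q\<close>
  with values in the support of \<open>f\<close>.\<close>

definition convolution ::
  "'g groupoid \<Rightarrow> 's groupoid \<Rightarrow> ('s \<Rightarrow> 'g) \<Rightarrow> ('s \<Rightarrow> 'r::comm_ring_1) \<Rightarrow> ('s \<Rightarrow> 'r) \<Rightarrow> 's \<Rightarrow> 'r" where
  "convolution G \<Sigma> q f g =
     (let S = (\<lambda>\<alpha>. SOME \<tau>. \<tau> \<in> supp \<Sigma> f \<and> q \<tau> = \<alpha>)
      in (\<lambda>\<sigma>. if \<sigma> \<in> g_arr \<Sigma>
             then (\<Sum>\<alpha> \<in> {\<alpha> \<in> q ` supp \<Sigma> f. g_rng G \<alpha> = q (g_rng \<Sigma> \<sigma>)}.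
                    f (S \<alpha>) * g (g_mul \<Sigma> (g_inv \<Sigma> (S \<alpha>)) \<sigma>))
             else 0))"

definition steinberg_algebra ::
  "'g groupoid \<Rightarrow> 's groupoid \<Rightarrow> ('g \<times> 'r::comm_ring_1 \<Rightarrow> 's) \<Rightarrow> ('s \<Rightarrow> 'g) \<Rightarrow>
   ('r, 's \<Rightarrow> 'r) nu_algebra" where
  "steinberg_algebra G \<Sigma> i q =
     \<lparr> alg_carrier = steinberg_carrier G \<Sigma> i q,
       alg_zero = (\<lambda>\<sigma>. 0),
       alg_add = (\<lambda>f g \<sigma>. f \<sigma> + g \<sigma>),
       alg_smult = (\<lambda>t f \<sigma>. t * f \<sigma>),
       alg_mult = convolution G \<Sigma> q \<rparr>"

definition diagonal_subalgebra ::
  "'g groupoid \<Rightarrow> 's groupoid \<Rightarrow> ('g \<times> 'r::comm_ring_1 \<Rightarrow> 's) \<Rightarrow> ('s \<Rightarrow> 'g) \<Rightarrow> ('s \<Rightarrow> 'r) set" where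
  "diagonal_subalgebra G \<Sigma> i q =
     {f \<in> steinberg_carrier G \<Sigma> i q. supp \<Sigma> f \<subseteq> {\<sigma> \<in> g_arr \<Sigma>. q \<sigma> \<in> g_units G}}"

definition tilde_one ::
  "'g groupoid \<Rightarrow> 's groupoid \<Rightarrow> ('g \<times> 'r::comm_ring_1 \<Rightarrow> 's) \<Rightarrow> ('s \<Rightarrow> 'g) \<Rightarrow> 's set \<Rightarrow> 's \<Rightarrow> 'r" where
  "tilde_one G \<Sigma> i q Y =
     (THE f. f \<in> steinberg_carrier G \<Sigma> i q \<and>
             supp \<Sigma> f \<subseteq> {unit_act \<Sigma> i q t y | t y. t \<in> ring_units \<and> y \<in> Y} \<and>
             (\<forall>y \<in> Y. f y = 1))"

section \<open>The twist of ultrafilters\<close>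

definition norm_le :: "('r, 'a) nu_algebra \<Rightarrow> 'a set \<Rightarrow> 'a \<Rightarrow> 'a \<Rightarrow> bool" where
  "norm_le A B n m \<longleftrightarrow> n = alg_mult A (alg_mult A n (dagger A B n)) m"

definition up_set :: "('r, 'a) nu_algebra \<Rightarrow> 'a set \<Rightarrow> 'a set \<Rightarrow> 'a set" where
  "up_set A B U = {m \<in> normalisers A B. \<exists>n \<in> U. norm_le A B n m}"

definition norm_filter :: "('r, 'a) nu_algebra \<Rightarrow> 'a set \<Rightarrow> 'a set \<Rightarrow> bool" where
  "norm_filter A B U \<longleftrightarrow>
     U \<subseteq> normalisers A B - {alg_zero A} \<and> U = up_set A B U \<and>
     (\<forall>m \<in> U. \<forall>n \<in> U. \<exists>l \<in> U. norm_le A B l m \<and> norm_le A B l n)"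

definition ultrafilters :: "('r, 'a) nu_algebra \<Rightarrow> 'a set \<Rightarrow> 'a set set" where
  "ultrafilters A B =
     {U. norm_filter A B U \<and> U \<noteq> {} \<and> (\<forall>V. norm_filter A B V \<and> U \<subseteq> V \<longrightarrow> V = U)}"

definition uf_groupoid :: "('r, 'a) nu_algebra \<Rightarrow> 'a set \<Rightarrow> 'a set groupoid" where
  "uf_groupoid A B =
     \<lparr> g_top = topology_generated_by {{U \<in> ultrafilters A B. n \<in> U} | n. n \<in> normalisers A B},
       g_comp = {(U, V). U \<in> ultrafilters A B \<and> V \<in> ultrafilters A B \<and>
                         (\<forall>m \<in> U. \<forall>n \<in> V. alg_mult A m n \<noteq> alg_zero A)},
       g_mul = (\<lambda>U V. up_set A B {alg_mult A m n | m n. m \<in> U \<and> n \<in> V}),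
       g_inv = (\<lambda>U. dagger A B ` U) \<rparr>"

definition smult_set :: "('r, 'a) nu_algebra \<Rightarrow> 'r \<Rightarrow> 'a set \<Rightarrow> 'a set" where
  "smult_set A t U = alg_smult A t ` U"

definition uf_q :: "('r::comm_ring_1, 'a) nu_algebra \<Rightarrow> 'a set \<Rightarrow> 'a set \<Rightarrow> 'a set set" where
  "uf_q A B U = {W \<in> ultrafilters A B. \<exists>t \<in> ring_units. U = smult_set A t W}"

definition uf_quotient :: "('r::comm_ring_1, 'a) nu_algebra \<Rightarrow> 'a set \<Rightarrow> 'a set set groupoid" where
  "uf_quotient A B =
    (let S = uf_groupoid A B; Q = uf_q A B in
     \<lparr> g_top = quotient_topology (g_top S) Q,
       g_comp = {(Q U, Q V) | U V. (U, V) \<in> g_comp S},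
       g_mul = (\<lambda>a b. THE c. \<exists>U V. (U, V) \<in> g_comp S \<and> a = Q U \<and> b = Q V \<and> c = Q (g_mul S U V)),
       g_inv = (\<lambda>a. THE c. \<exists>U \<in> g_arr S. a = Q U \<and> c = Q (g_inv S U)) \<rparr>)"

definition uf_i :: "('r::comm_ring_1, 'a) nu_algebra \<Rightarrow> 'a set \<Rightarrow> 'a set set \<times> 'r \<Rightarrow> 'a set" where
  "uf_i A B = (\<lambda>(a, t). smult_set A t (THE U. U \<in> g_units (uf_groupoid A B) \<and> uf_q A B U = a))"

definition unit_filter ::
  "('r, 's \<Rightarrow> 'r::one) nu_algebra \<Rightarrow> ('s \<Rightarrow> 'r) set \<Rightarrow> 's \<Rightarrow> ('s \<Rightarrow> 'r) set" where
  "unit_filter A B x = {e \<in> idems A B. e x = 1}"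

definition Phi_via ::
  "'g groupoid \<Rightarrow> 's groupoid \<Rightarrow> ('g \<times> 'r::comm_ring_1 \<Rightarrow> 's) \<Rightarrow> ('s \<Rightarrow> 'g) \<Rightarrow> 's set \<Rightarrow> 's \<Rightarrow>
   ('s \<Rightarrow> 'r) set" where
  "Phi_via G \<Sigma> i q Y \<sigma> =
    (let A = steinberg_algebra G \<Sigma> i q; B = diagonal_subalgebra G \<Sigma> i q
     in up_set A B (alg_mult A (tilde_one G \<Sigma> i q Y) ` unit_filter A B (g_src \<Sigma> \<sigma>)))"

definition Phi ::
  "'g groupoid \<Rightarrow> 's groupoid \<Rightarrow> ('g \<times> 'r::comm_ring_1 \<Rightarrow> 's) \<Rightarrow> ('s \<Rightarrow> 'g) \<Rightarrow> 's \<Rightarrow> ('s \<Rightarrow> 'r) set" where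
  "Phi G \<Sigma> i q \<sigma> = Phi_via G \<Sigma> i q (SOME Y. compact_open_bisection \<Sigma> Y \<and> \<sigma> \<in> Y) \<sigma>"

text \<open>Well-definedness of the induced map on the base groupoids is the existence of \<open>F\<close>.\<close>

definition induces_twist_iso ::
  "'g groupoid \<Rightarrow> 's groupoid \<Rightarrow> ('g \<times> 'r::comm_ring_1 \<Rightarrow> 's) \<Rightarrow> ('s \<Rightarrow> 'g) \<Rightarrow>
   'h groupoid \<Rightarrow> 'u groupoid \<Rightarrow> ('h \<times> 'r \<Rightarrow> 'u) \<Rightarrow> ('u \<Rightarrow> 'h) \<Rightarrow> ('s \<Rightarrow> 'u) \<Rightarrow> bool" where
  "induces_twist_iso G \<Sigma> i q G' \<Sigma>' i' q' f \<longleftrightarrow>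
     discrete_twist G \<Sigma> i q \<and> discrete_twist G' \<Sigma>' i' q' \<and>
     (\<exists>F. (\<forall>\<sigma> \<in> g_arr \<Sigma>. F (q \<sigma>) = q' (f \<sigma>)) \<and>
          topological_groupoid_iso G G' F \<and>
          (\<forall>x \<in> g_units G. \<forall>t \<in> ring_units. f (i (x, t)) = i' (F x, t)))"

end

theory Submission
  imports Defs
begin

text \<open>
  The normalisers of \<open>B\<close> in \<open>A\<close> turn out to be exactly the functions \<open>1\<^sub>Y\<close> for compact open
  bisections \<open>Y\<close> of \<open>\<Sigma>\<close>; products, daggers and the order of normalisers then become products,
  inverses and inclusion of bisections, an ultrafilter is the set of bisections through a point
  (by compactness), and \<open>\<Phi>(\<sigma>)\<close> is the filter of normalisers with value \<open>1\<close> at \<open>\<sigma>\<close>.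

  For the description of the normalisers, let \<open>k\<close> be the dagger of \<open>n\<close>. Compressing \<open>n b k \<in> B\<close> and
  \<open>k b n \<in> B\<close> to point masses (which makes sense in the larger convolution algebra of equivariant
  functions with finite support on each range fibre) shows that \<open>n\<close> vanishes on all but one of the
  sets \<open>{\<sigma>. r \<sigma> = y, s \<sigma> = x}\<close> with \<open>y\<close> fixed, and likewise with \<open>x\<close> fixed. On the
  remaining one the degree map of \<open>G\<close> to the orderable group \<open>\<int>\<^sup>k\<close> is injective, so there \<open>n\<close>
  behaves like an invertible Laurent polynomial over a reduced indecomposable ring: it is a
  monomial with unit coefficient.
\<close>

section \<open>Algebraic groupoids\<close>

text \<open>The obstacle is isotropy: \<open>G\<close> need not be effective, so a normaliser might
  a priori be spread over several arrows with the same ends. The two ring hypotheses act at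
  different places. The compression by point masses at \<open>y\<close> and \<open>x\<close> gives a
  scalar \<open>c\<close> such that, for \<open>\<tau>\<close> with range \<open>y\<close>,
  \<open>c * n \<tau>\<close> is \<open>n \<tau>\<close> or \<open>0\<close> according to whether
  the source of \<open>\<tau>\<close> is \<open>x\<close>; \<open>c\<close> is a nonzero idempotent,
  so indecomposability makes it \<open>1\<close>. Within one set of arrows with common ends, a
  product of values of \<open>n\<close> and \<open>k\<close> in extremal nonzero degree has square
  zero, so reducedness kills it; what remains is a decomposition of \<open>1\<close> into orthogonal
  idempotents, where indecomposability applies again. Point masses are in general not locally
  constant, which is why convolution is developed for functions with finite rows and only later
  restricted to the algebra. As for ultrafilters, no groupoid or twist axiom is checked on them: the
  bijections \<open>point_filter\<close> and \<open>fibre_filter\<close> are shown to respect the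
  raw data, and every axiom is carried over from \<open>\<Sigma>\<close> and
  \<open>G\<close>.\<close>

locale alg_groupoid =
  fixes G :: "'g groupoid"
  assumes algebraic: "algebraic_groupoid G"
begin

lemma comp_arr: "(a, b) \<in> g_comp G \<Longrightarrow> a \<in> g_arr G \<and> b \<in> g_arr G"
  using algebraic unfolding algebraic_groupoid_def by blast

lemma comp_mul: "(a, b) \<in> g_comp G \<Longrightarrow> g_mul G a b \<in> g_arr G"
  using algebraic unfolding algebraic_groupoid_def by blast

lemma inv_arr [simp]: "a \<in> g_arr G \<Longrightarrow> g_inv G a \<in> g_arr G"
  and inv_inv [simp]: "a \<in> g_arr G \<Longrightarrow> g_inv G (g_inv G a) = a"
  and inv_comp: "a \<in> g_arr G \<Longrightarrow> (g_inv G a, a) \<in> g_comp G"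
  using algebraic unfolding algebraic_groupoid_def by blast+

lemma comp_inv: "a \<in> g_arr G \<Longrightarrow> (a, g_inv G a) \<in> g_comp G"
  using inv_comp[of "g_inv G a"] by simp

lemma comp_assoc:
  assumes "(a, b) \<in> g_comp G" "(b, c) \<in> g_comp G"
  shows "(g_mul G a b, c) \<in> g_comp G" "(a, g_mul G b c) \<in> g_comp G"
    "g_mul G (g_mul G a b) c = g_mul G a (g_mul G b c)"
  using algebraic assms unfolding algebraic_groupoid_def by blast+

lemma comp_cancel:
  assumes "(a, b) \<in> g_comp G"
  shows "g_mul G (g_inv G a) (g_mul G a b) = b" "g_mul G (g_mul G a b) (g_inv G b) = a"
  using algebraic assms unfolding algebraic_groupoid_def by blast+

text \<open>The axioms contain no unit law. It is the cancellation law for the pair of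
  \<open>a\<close> and \<open>g_inv G a\<close>, read with
  \<open>g_inv G (g_inv G a) = a\<close>.\<close>

lemma rng_mul_self: assumes "a \<in> g_arr G" shows "(g_rng G a, a) \<in> g_comp G \<and> g_mul G (g_rng G a) a = a"
  using comp_assoc[OF comp_inv inv_comp] comp_cancel(2)[OF comp_inv] assms
  by (metis g_rng_def inv_inv)

lemma mul_src_self: assumes "a \<in> g_arr G" shows "(a, g_src G a) \<in> g_comp G \<and> g_mul G a (g_src G a) = a"
  using comp_assoc[OF comp_inv inv_comp] comp_cancel(2)[OF comp_inv] assms
  by (metis g_src_def inv_inv)

text \<open>By cancellation \<open>g_src G a\<close> is a left identity for \<open>b\<close>;
  cancelling \<open>b\<close> on the right identifies it with \<open>g_rng G b\<close>.\<close>

lemma comp_src_rng: assumes "(a, b) \<in> g_comp G" shows "g_src G a = g_rng G b"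
proof -
  have a: "a \<in> g_arr G" and b: "b \<in> g_arr G" using comp_arr assms by auto
  have 1: "(g_src G a, b) \<in> g_comp G"
    using comp_assoc(1)[OF inv_comp assms] a by (simp add: g_src_def)
  have 2: "g_mul G (g_src G a) b = b"
    using comp_assoc(3)[OF inv_comp assms] comp_cancel(1)[OF assms] a by (simp add: g_src_def)
  show ?thesis using comp_cancel(2)[OF 1] 2 by (simp add: g_rng_def)
qed

text \<open>Replaces the abstract set of composable pairs by an equation between units, the form in
  which all later simplification rules are stated.\<close>

lemma comp_iff: "(a, b) \<in> g_comp G \<longleftrightarrow> a \<in> g_arr G \<and> b \<in> g_arr G \<and> g_src G a = g_rng G b"
proof
  assume "a \<in> g_arr G \<and> b \<in> g_arr G \<and> g_src G a = g_rng G b"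
  then show "(a, b) \<in> g_comp G"
    using comp_assoc(1)[of a "g_src G a" b] mul_src_self[of a] rng_mul_self[of b] by simp
qed (use comp_arr comp_src_rng in auto)

lemma rng_arr [simp]: "a \<in> g_arr G \<Longrightarrow> g_rng G a \<in> g_arr G"
  unfolding g_rng_def using comp_inv comp_mul by blast

lemma src_arr [simp]: "a \<in> g_arr G \<Longrightarrow> g_src G a \<in> g_arr G"
  unfolding g_src_def using inv_comp comp_mul by blast

lemma rng_inv [simp]: "a \<in> g_arr G \<Longrightarrow> g_rng G (g_inv G a) = g_src G a"
  by (simp add: g_rng_def g_src_def)

lemma src_inv [simp]: "a \<in> g_arr G \<Longrightarrow> g_src G (g_inv G a) = g_rng G a"
  by (simp add: g_rng_def g_src_def)

lemma mul_arr [simp]: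
  "\<lbrakk>a \<in> g_arr G; b \<in> g_arr G; g_src G a = g_rng G b\<rbrakk> \<Longrightarrow> g_mul G a b \<in> g_arr G"
  using comp_iff comp_mul by blast

lemma src_rng [simp]: "a \<in> g_arr G \<Longrightarrow> g_src G (g_rng G a) = g_rng G a"
  using rng_mul_self comp_iff by blast

lemma rng_src [simp]: "a \<in> g_arr G \<Longrightarrow> g_rng G (g_src G a) = g_src G a"
  using mul_src_self comp_iff by metis

lemma rng_rng [simp]: "a \<in> g_arr G \<Longrightarrow> g_rng G (g_rng G a) = g_rng G a"
  using rng_src[of "g_inv G a"] by simp

lemma src_src [simp]: "a \<in> g_arr G \<Longrightarrow> g_src G (g_src G a) = g_src G a"
  using src_rng[of "g_inv G a"] by simp

lemma rng_mul_id [simp]: "a \<in> g_arr G \<Longrightarrow> g_mul G (g_rng G a) a = a"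
  using rng_mul_self by blast

lemma mul_src_id [simp]: "a \<in> g_arr G \<Longrightarrow> g_mul G a (g_src G a) = a"
  using mul_src_self by blast

lemma mul_inv [simp]: "g_mul G a (g_inv G a) = g_rng G a"
  by (simp add: g_rng_def)

lemma inv_mul [simp]: "g_mul G (g_inv G a) a = g_src G a"
  by (simp add: g_src_def)

lemma rng_mul [simp]:
  assumes "a \<in> g_arr G" "b \<in> g_arr G" "g_src G a = g_rng G b"
  shows "g_rng G (g_mul G a b) = g_rng G a"
proof -
  have ab: "(a, b) \<in> g_comp G" using assms comp_iff by blast
  have "(g_rng G a, g_mul G a b) \<in> g_comp G"
    using comp_assoc(2)[OF _ ab, of "g_rng G a"] rng_mul_self assms by simp
  then show ?thesis using comp_iff assms by simp
qed

lemma src_mul [simp]: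
  assumes "a \<in> g_arr G" "b \<in> g_arr G" "g_src G a = g_rng G b"
  shows "g_src G (g_mul G a b) = g_src G b"
proof -
  have ab: "(a, b) \<in> g_comp G" using assms comp_iff by blast
  have "(g_mul G a b, g_src G b) \<in> g_comp G"
    using comp_assoc(1)[OF ab, of "g_src G b"] mul_src_self assms by simp
  then show ?thesis using comp_iff assms by simp
qed

lemma mul_assoc:
  "\<lbrakk>a \<in> g_arr G; b \<in> g_arr G; c \<in> g_arr G; g_src G a = g_rng G b; g_src G b = g_rng G c\<rbrakk>
    \<Longrightarrow> g_mul G (g_mul G a b) c = g_mul G a (g_mul G b c)"
  using comp_assoc(3) comp_iff by blast

lemma inv_mul_cancel [simp]:
  "\<lbrakk>a \<in> g_arr G; b \<in> g_arr G; g_src G a = g_rng G b\<rbrakk> \<Longrightarrow> g_mul G (g_inv G a) (g_mul G a b) = b"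
  using comp_cancel(1) comp_iff by blast

lemma mul_inv_cancel [simp]:
  "\<lbrakk>a \<in> g_arr G; b \<in> g_arr G; g_src G a = g_rng G b\<rbrakk> \<Longrightarrow> g_mul G (g_mul G a b) (g_inv G b) = a"
  using comp_cancel(2) comp_iff by blast

lemma mul_inv_mul_cancel [simp]:
  "\<lbrakk>a \<in> g_arr G; b \<in> g_arr G; g_rng G a = g_rng G b\<rbrakk> \<Longrightarrow> g_mul G a (g_mul G (g_inv G a) b) = b"
  using inv_mul_cancel[of "g_inv G a" b] by simp

lemma mul_mul_inv_cancel [simp]:
  "\<lbrakk>a \<in> g_arr G; b \<in> g_arr G; g_src G a = g_src G b\<rbrakk> \<Longrightarrow> g_mul G (g_mul G a (g_inv G b)) b = a"
  using mul_inv_cancel[of a "g_inv G b"] by simp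

lemma inv_eqI:
  assumes "a \<in> g_arr G" "b \<in> g_arr G" "g_src G a = g_rng G b" "g_mul G a b = g_rng G a"
  shows "b = g_inv G a"
  using inv_mul_cancel[OF assms(1-3)] assms(4) mul_src_id[of "g_inv G a"] assms(1) by simp

lemma inv_mul_distrib:
  assumes "a \<in> g_arr G" "b \<in> g_arr G" "g_src G a = g_rng G b"
  shows "g_inv G (g_mul G a b) = g_mul G (g_inv G b) (g_inv G a)"
proof (rule inv_eqI[symmetric])
  have "g_mul G (g_mul G a b) (g_mul G (g_inv G b) (g_inv G a))
      = g_mul G (g_mul G (g_mul G a b) (g_inv G b)) (g_inv G a)"
    by (rule mul_assoc[symmetric]) (use assms in auto)
  then show "g_mul G (g_mul G a b) (g_mul G (g_inv G b) (g_inv G a)) = g_rng G (g_mul G a b)"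
    using assms by simp
qed (use assms in auto)

lemma units_iff_rng: "u \<in> g_units G \<longleftrightarrow> u \<in> g_arr G \<and> g_rng G u = u"
  unfolding g_units_def by (metis image_iff rng_arr rng_rng)

lemma units_iff_src: "u \<in> g_units G \<longleftrightarrow> u \<in> g_arr G \<and> g_src G u = u"
  unfolding units_iff_rng by (metis rng_src src_rng)

lemma rng_units [simp]: "a \<in> g_arr G \<Longrightarrow> g_rng G a \<in> g_units G"
  by (simp add: units_iff_rng)

lemma src_units [simp]: "a \<in> g_arr G \<Longrightarrow> g_src G a \<in> g_units G"
  by (simp add: units_iff_src)

lemma units_arr [simp]: "u \<in> g_units G \<Longrightarrow> u \<in> g_arr G"
  and unit_rng [simp]: "u \<in> g_units G \<Longrightarrow> g_rng G u = u"
  and unit_src [simp]: "u \<in> g_units G \<Longrightarrow> g_src G u = u"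
  using units_iff_rng units_iff_src by auto

lemma unit_inv [simp]: "u \<in> g_units G \<Longrightarrow> g_inv G u = u"
  using inv_eqI[of u u] mul_src_id[of u] by simp

lemma unit_mul [simp]: "\<lbrakk>u \<in> g_units G; a \<in> g_arr G; g_rng G a = u\<rbrakk> \<Longrightarrow> g_mul G u a = a"
  using rng_mul_id by blast

lemma mul_unit [simp]: "\<lbrakk>u \<in> g_units G; a \<in> g_arr G; g_src G a = u\<rbrakk> \<Longrightarrow> g_mul G a u = a"
  using mul_src_id by blast

lemma idem_unit:
  assumes "(a, a) \<in> g_comp G" "g_mul G a a = a" shows "a \<in> g_units G"
  using comp_cancel(1)[OF assms(1)] assms comp_arr[OF assms(1)] inv_mul[of a]
  unfolding units_iff_src by metis

text \<open>Isolates the one surviving summand in a convolution whose right factor lives over the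
  units.\<close>

lemma inv_mul_unitD:
  assumes "a \<in> g_arr G" "b \<in> g_arr G" "g_rng G a = g_rng G b" "g_mul G (g_inv G a) b \<in> g_units G"
  shows "a = b"
proof -
  have "g_mul G (g_inv G a) b = g_src G a"
    using assms unit_rng[OF assms(4)] rng_mul[of "g_inv G a" b] by (metis inv_arr src_inv rng_inv)
  then show ?thesis
    using mul_inv_mul_cancel[OF assms(1-3)] assms(1) by simp
qed

end

text \<open>A homomorphism is only required to respect products. The image of a range is idempotent,
  hence a unit, and this forces inverses to go to inverses.\<close>

lemma groupoid_hom_inv:
  assumes G: "algebraic_groupoid G" and H: "algebraic_groupoid H" and f: "groupoid_hom G H f"
    and a: "a \<in> g_arr G"
  shows "f (g_inv G a) = g_inv H (f a)" "f (g_rng G a) = g_rng H (f a)" "f (g_src G a) = g_src H (f a)"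
    "f a \<in> g_arr H"
proof -
  interpret G: alg_groupoid G by standard (rule G)
  interpret H: alg_groupoid H by standard (rule H)
  have hom: "(f b, f c) \<in> g_comp H" "f (g_mul G b c) = g_mul H (f b) (f c)"
    if "(b, c) \<in> g_comp G" for b c
    using f that by (auto simp: groupoid_hom_def)
  show fa: "f a \<in> g_arr H" using f a unfolding groupoid_hom_def by blast
  have u: "f (g_rng G a) \<in> g_units H"
  proof (rule H.idem_unit)
    have "(g_rng G a, g_rng G a) \<in> g_comp G" using a by (simp add: G.comp_iff)
    from hom[OF this]
    show "(f (g_rng G a), f (g_rng G a)) \<in> g_comp H"
      "g_mul H (f (g_rng G a)) (f (g_rng G a)) = f (g_rng G a)"
      using a by simp_all
  qed
  have c: "(f a, f (g_inv G a)) \<in> g_comp H" "f (g_rng G a) = g_mul H (f a) (f (g_inv G a))"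
    using hom[OF G.comp_inv[OF a]] by simp_all
  have c1: "f (g_inv G a) \<in> g_arr H" "g_src H (f a) = g_rng H (f (g_inv G a))"
    using c(1) unfolding H.comp_iff by blast+
  show r: "f (g_rng G a) = g_rng H (f a)"
    using H.unit_rng[OF u] unfolding c(2) H.rng_mul[OF fa c1] by (rule sym)
  show i: "f (g_inv G a) = g_inv H (f a)"
    by (rule H.inv_eqI[OF fa c1]) (use c(2) r in metis)
  show "f (g_src G a) = g_src H (f a)"
    using hom(2)[OF G.inv_comp[OF a]] unfolding i by simp
qed

section \<open>The unit action on a twist\<close>

lemma unit_inv_mult [simp]: "(t::'r::comm_ring_1) dvd 1 \<Longrightarrow> t * unit_inv t = 1"
  and unit_inv_mult' [simp]: "(t::'r::comm_ring_1) dvd 1 \<Longrightarrow> unit_inv t * t = 1"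
  and unit_inv_dvd [simp]: "(t::'r::comm_ring_1) dvd 1 \<Longrightarrow> unit_inv t dvd 1"
proof -
  assume "t dvd 1"
  then obtain u where u: "t * u = 1" by (metis dvd_def)
  have "v = u" if "t * v = 1" for v
    using that u by (metis mult.assoc mult.commute mult_1)
  then have *: "t * unit_inv t = 1"
    unfolding unit_inv_def using u by (metis (mono_tags, lifting) theI)
  then show "t * unit_inv t = 1" "unit_inv t * t = 1" "unit_inv t dvd 1"
    by (auto simp: mult.commute) (metis dvd_triv_right)
qed

lemma unit_inv_unique: "(t::'r::comm_ring_1) * u = 1 \<Longrightarrow> unit_inv t = u"
  by (metis dvd_triv_left unit_inv_mult' mult.assoc mult_1_left mult.right_neutral)

lemma unit_inv_one [simp]: "unit_inv (1::'r::comm_ring_1) = 1"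
  by (simp add: unit_inv_unique)

lemma unit_inv_inv [simp]: "(t::'r::comm_ring_1) dvd 1 \<Longrightarrow> unit_inv (unit_inv t) = t"
  by (simp add: unit_inv_unique)

lemma unit_mult [simp]: "(t::'r::comm_ring_1) dvd 1 \<Longrightarrow> u dvd 1 \<Longrightarrow> t * u dvd 1"
  by (metis mult_dvd_mono mult_1)

lemma unit_mult_eq_iff: "(t::'r::comm_ring_1) dvd 1 \<Longrightarrow> t * a = b \<longleftrightarrow> a = unit_inv t * b"
  by (metis mult.assoc mult_1 unit_inv_mult unit_inv_mult')

lemma unit_inv_eq_1 [simp]: "(t::'r::comm_ring_1) dvd 1 \<Longrightarrow> unit_inv t = 1 \<longleftrightarrow> t = 1"
  by (metis unit_inv_inv unit_inv_one)

lemma unit_inv_mult_eq_0 [simp]: "(t::'r::comm_ring_1) dvd 1 \<Longrightarrow> unit_inv t * a = 0 \<longleftrightarrow> a = 0"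
  by (metis unit_mult_eq_iff mult_zero_right)

locale twist =
  fixes G :: "'g groupoid" and \<Sigma> :: "'s groupoid"
    and i :: "'g \<times> 'r::comm_ring_1 \<Rightarrow> 's" and q :: "'s \<Rightarrow> 'g"
  assumes twist: "discrete_twist G \<Sigma> i q"
begin

abbreviation mulS (infixl "\<cdot>" 75) where "a \<cdot> b \<equiv> g_mul \<Sigma> a b"
abbreviation iv where "iv \<equiv> g_inv \<Sigma>"
abbreviation rg where "rg \<equiv> g_rng \<Sigma>"
abbreviation sr where "sr \<equiv> g_src \<Sigma>"
abbreviation arr where "arr \<equiv> g_arr \<Sigma>"
abbreviation act (infixr "\<odot>" 76) where "t \<odot> \<sigma> \<equiv> unit_act \<Sigma> i q t \<sigma>"

lemma top_groupoid_G: "topological_groupoid G"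
  and top_groupoid_S: "topological_groupoid \<Sigma>"
  and local_homeo_rng: "local_homeo (g_top G) (unit_space G) (g_rng G)"
  and units_S: "g_units \<Sigma> = i ` (g_units G \<times> {1})"
  and continuous_i: "continuous_map (g_top (trivial_bundle G)) (g_top \<Sigma>) i"
  and hom_i: "groupoid_hom (trivial_bundle G) \<Sigma> i"
  and continuous_q: "continuous_map (g_top \<Sigma>) (g_top G) q"
  and hom_q: "groupoid_hom \<Sigma> G q"
  and homeo_q_units: "homeomorphic_map (unit_space \<Sigma>) (unit_space G) q"
  and i_fibre: "x \<in> g_units G \<Longrightarrow> i ` ({x} \<times> ring_units) = {\<sigma> \<in> arr. q \<sigma> = x}"
  and inj_i: "inj_on i (g_units G \<times> ring_units)"
  and q_surj: "q ` arr = g_arr G"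
  using twist unfolding discrete_twist_def etale_groupoid_def
  by - (elim conjE; (assumption | erule (1) bspec))+

sublocale G: alg_groupoid G
  using top_groupoid_G unfolding topological_groupoid_def by unfold_locales blast

sublocale S: alg_groupoid \<Sigma>
  using top_groupoid_S unfolding topological_groupoid_def by unfold_locales blast

lemma q_arr [simp]: "\<sigma> \<in> arr \<Longrightarrow> q \<sigma> \<in> g_arr G"
  using q_surj by blast

lemma q_iv [simp]: "\<sigma> \<in> arr \<Longrightarrow> q (iv \<sigma>) = g_inv G (q \<sigma>)"
  and q_rg [simp]: "\<sigma> \<in> arr \<Longrightarrow> q (rg \<sigma>) = g_rng G (q \<sigma>)"
  and q_sr [simp]: "\<sigma> \<in> arr \<Longrightarrow> q (sr \<sigma>) = g_src G (q \<sigma>)"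
  using groupoid_hom_inv[OF S.algebraic G.algebraic hom_q] by auto

lemma q_mul [simp]:
  "\<lbrakk>\<sigma> \<in> arr; \<tau> \<in> arr; sr \<sigma> = rg \<tau>\<rbrakk> \<Longrightarrow> q (\<sigma> \<cdot> \<tau>) = g_mul G (q \<sigma>) (q \<tau>)"
  using hom_q S.comp_iff unfolding groupoid_hom_def by fastforce

lemma q_units [simp]: "u \<in> g_units \<Sigma> \<Longrightarrow> q u \<in> g_units G"
  by (metis G.rng_units S.unit_rng S.units_arr q_arr q_rg)

lemma units_subset: "g_units \<Sigma> \<subseteq> arr" "g_units G \<subseteq> g_arr G"
  by (auto simp del: S.unit_mul)

lemma inj_q_units: "inj_on q (g_units \<Sigma>)"
  using homeomorphic_imp_injective_map[OF homeo_q_units] units_subset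
  by (simp add: Int_absorb1)

lemma units_eq_iff: "u \<in> g_units \<Sigma> \<Longrightarrow> v \<in> g_units \<Sigma> \<Longrightarrow> q u = q v \<longleftrightarrow> u = v"
  using inj_q_units by (auto dest: inj_onD)

text \<open>The two unit spaces are different sets, identified by the injective restriction of
  \<open>q\<close>. This lemma and the next two move equations between ends across that
  identification.\<close>

lemma rg_eq_iff: "\<lbrakk>\<sigma> \<in> arr; \<tau> \<in> arr\<rbrakk> \<Longrightarrow> g_rng G (q \<sigma>) = g_rng G (q \<tau>) \<longleftrightarrow> rg \<sigma> = rg \<tau>"
  using units_eq_iff[of "rg \<sigma>" "rg \<tau>"] by simp

lemma sr_eq_iff: "\<lbrakk>\<sigma> \<in> arr; \<tau> \<in> arr\<rbrakk> \<Longrightarrow> g_src G (q \<sigma>) = g_src G (q \<tau>) \<longleftrightarrow> sr \<sigma> = sr \<tau>"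
  using units_eq_iff[of "sr \<sigma>" "sr \<tau>"] by simp

lemma sr_rg_eq_iff: "\<lbrakk>\<sigma> \<in> arr; \<tau> \<in> arr\<rbrakk> \<Longrightarrow> g_src G (q \<sigma>) = g_rng G (q \<tau>) \<longleftrightarrow> sr \<sigma> = rg \<tau>"
  using units_eq_iff[of "sr \<sigma>" "rg \<tau>"] by simp

lemma i_arr [simp]: "x \<in> g_units G \<Longrightarrow> t dvd 1 \<Longrightarrow> i (x, t) \<in> arr"
  and q_i [simp]: "x \<in> g_units G \<Longrightarrow> t dvd 1 \<Longrightarrow> q (i (x, t)) = x"
  using i_fibre by blast+

lemma i_one_unit [simp]: "x \<in> g_units G \<Longrightarrow> i (x, 1) \<in> g_units \<Sigma>"
  using units_S by auto

lemma i_q_unit [simp]: "u \<in> g_units \<Sigma> \<Longrightarrow> i (q u, 1) = u"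
  using units_S by auto

lemma rg_i [simp]: "x \<in> g_units G \<Longrightarrow> t dvd 1 \<Longrightarrow> rg (i (x, t)) = i (x, 1)"
  and sr_i [simp]: "x \<in> g_units G \<Longrightarrow> t dvd 1 \<Longrightarrow> sr (i (x, t)) = i (x, 1)"
  by (metis G.unit_rng S.rng_units i_arr i_q_unit q_i q_rg)
    (metis G.unit_src S.src_units i_arr i_q_unit q_i q_sr)

lemma i_mul [simp]: "\<lbrakk>x \<in> g_units G; t dvd 1; u dvd 1\<rbrakk> \<Longrightarrow> i (x, t) \<cdot> i (x, u) = i (x, t * u)"
  using hom_i unfolding groupoid_hom_def trivial_bundle_def by auto

lemma act_def: "t \<odot> \<sigma> = i (q (rg \<sigma>), t) \<cdot> \<sigma>"
  by (simp add: unit_act_def)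

lemma twist_commute: "\<lbrakk>\<sigma> \<in> arr; t dvd 1\<rbrakk> \<Longrightarrow> t \<odot> \<sigma> = \<sigma> \<cdot> i (q (sr \<sigma>), t)"
  using twist unfolding discrete_twist_def act_def by simp

lemma act_arr [simp]: "\<lbrakk>\<sigma> \<in> arr; t dvd 1\<rbrakk> \<Longrightarrow> t \<odot> \<sigma> \<in> arr"
  and rg_act [simp]: "\<lbrakk>\<sigma> \<in> arr; t dvd 1\<rbrakk> \<Longrightarrow> rg (t \<odot> \<sigma>) = rg \<sigma>"
  and sr_act [simp]: "\<lbrakk>\<sigma> \<in> arr; t dvd 1\<rbrakk> \<Longrightarrow> sr (t \<odot> \<sigma>) = sr \<sigma>"
  and q_act [simp]: "\<lbrakk>\<sigma> \<in> arr; t dvd 1\<rbrakk> \<Longrightarrow> q (t \<odot> \<sigma>) = q \<sigma>"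
proof -
  assume *: "\<sigma> \<in> arr" "t dvd 1"
  have u: "g_rng G (q \<sigma>) \<in> g_units G" using * by simp
  have r: "i (g_rng G (q \<sigma>), 1) = rg \<sigma>" using i_q_unit[of "rg \<sigma>"] * by simp
  have s: "sr (i (g_rng G (q \<sigma>), t)) = rg \<sigma>" using sr_i[OF u *(2)] r by simp
  show "t \<odot> \<sigma> \<in> arr" "sr (t \<odot> \<sigma>) = sr \<sigma>" "rg (t \<odot> \<sigma>) = rg \<sigma>"
    using * u s r unfolding act_def by simp_all
  show "q (t \<odot> \<sigma>) = q \<sigma>"
    using * u s unfolding act_def by simp
qed

lemma i_rg_one [simp]: "\<sigma> \<in> arr \<Longrightarrow> i (g_rng G (q \<sigma>), 1) = rg \<sigma>"
  and i_sr_one [simp]: "\<sigma> \<in> arr \<Longrightarrow> i (g_src G (q \<sigma>), 1) = sr \<sigma>"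
  using i_q_unit[of "rg \<sigma>"] i_q_unit[of "sr \<sigma>"] by simp_all

lemma act_one [simp]: "\<sigma> \<in> arr \<Longrightarrow> 1 \<odot> \<sigma> = \<sigma>"
  by (simp add: act_def)

lemma act_act [simp]: "\<lbrakk>\<sigma> \<in> arr; t dvd 1; u dvd 1\<rbrakk> \<Longrightarrow> t \<odot> u \<odot> \<sigma> = (t * u) \<odot> \<sigma>"
  using S.mul_assoc[of "i (g_rng G (q \<sigma>), t)" "i (g_rng G (q \<sigma>), u)" \<sigma>]
  unfolding act_def[of t "u \<odot> \<sigma>"] act_def[of "t * u"]
  by (simp add: act_def[of u \<sigma>])

lemma act_mul [simp]:
  "\<lbrakk>\<sigma> \<in> arr; \<tau> \<in> arr; sr \<sigma> = rg \<tau>; t dvd 1\<rbrakk> \<Longrightarrow> (t \<odot> \<sigma>) \<cdot> \<tau> = t \<odot> (\<sigma> \<cdot> \<tau>)"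
  using S.mul_assoc[of "i (g_rng G (q \<sigma>), t)" \<sigma> \<tau>] by (simp add: act_def del: q_mul)

lemma mul_act [simp]:
  assumes "\<sigma> \<in> arr" "\<tau> \<in> arr" "sr \<sigma> = rg \<tau>" "t dvd 1"
  shows "\<sigma> \<cdot> (t \<odot> \<tau>) = t \<odot> (\<sigma> \<cdot> \<tau>)"
proof -
  have u: "q (rg \<tau>) \<in> g_units G" "i (q (rg \<tau>), 1) = rg \<tau>" using assms by simp_all
  have "\<sigma> \<cdot> (t \<odot> \<tau>) = (\<sigma> \<cdot> i (q (rg \<tau>), t)) \<cdot> \<tau>"
    unfolding act_def[of t \<tau>]
    by (rule S.mul_assoc[symmetric]) (use assms u in \<open>simp_all del: q_rg\<close>)
  also have "\<dots> = (t \<odot> \<sigma>) \<cdot> \<tau>"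
    using twist_commute[of \<sigma> t] assms by simp
  finally show ?thesis using assms by simp
qed

text \<open>Right multiplication by \<open>iv \<sigma>\<close> strips the arrow and leaves
  \<open>i (q (rg \<sigma>), t)\<close>, so freeness of the action is injectivity of
  \<open>i\<close>.\<close>

lemma act_free: "\<lbrakk>\<sigma> \<in> arr; t dvd 1; u dvd 1; t \<odot> \<sigma> = u \<odot> \<sigma>\<rbrakk> \<Longrightarrow> t = u"
proof -
  assume *: "\<sigma> \<in> arr" "t dvd 1" "u dvd 1" "t \<odot> \<sigma> = u \<odot> \<sigma>"
  have "(v \<odot> \<sigma>) \<cdot> iv \<sigma> = i (q (rg \<sigma>), v)" if "v dvd 1" for v
    unfolding act_def
    by (rule S.mul_inv_cancel) (use that *(1) in simp_all)
  then have "i (q (rg \<sigma>), t) = i (q (rg \<sigma>), u)" using *(2-) by metis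
  then show "t = u"
    using inj_onD[OF inj_i, of "(q (rg \<sigma>), t)" "(q (rg \<sigma>), u)"] *(1-3) by simp
qed

text \<open>The quotient \<open>\<tau> \<cdot> iv \<sigma>\<close> lies over a unit, where (DT1)
  says that it comes from \<open>i\<close>. Fibres of \<open>q\<close> are thus orbits of the unit
  action.\<close>

lemma q_eqE:
  assumes "\<sigma> \<in> arr" "\<tau> \<in> arr" "q \<sigma> = q \<tau>"
  obtains t where "t dvd 1" "\<tau> = t \<odot> \<sigma>"
proof -
  have r: "rg \<sigma> = rg \<tau>" "sr \<sigma> = sr \<tau>"
    using assms rg_eq_iff sr_eq_iff by metis+
  have "q (\<tau> \<cdot> iv \<sigma>) = g_rng G (q \<sigma>)" "\<tau> \<cdot> iv \<sigma> \<in> arr" using assms r by simp_all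
  then have "\<tau> \<cdot> iv \<sigma> \<in> i ` ({g_rng G (q \<sigma>)} \<times> ring_units)"
    using i_fibre[of "g_rng G (q \<sigma>)"] assms(1) by simp
  then obtain t where t: "t dvd 1" "\<tau> \<cdot> iv \<sigma> = i (g_rng G (q \<sigma>), t)"
    by blast
  then have "\<tau> = t \<odot> \<sigma>"
    using S.mul_mul_inv_cancel[of \<tau> \<sigma>] assms r by (simp add: act_def)
  then show ?thesis using t that by blast
qed

lemma iv_i: "x \<in> g_units G \<Longrightarrow> t dvd 1 \<Longrightarrow> iv (i (x, t)) = i (x, unit_inv t)"
  by (rule S.inv_eqI[symmetric]) simp_all

lemma iv_act [simp]:
  assumes "\<sigma> \<in> arr" "t dvd 1"
  shows "iv (t \<odot> \<sigma>) = unit_inv t \<odot> iv \<sigma>"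
proof -
  have "iv (t \<odot> \<sigma>) = iv \<sigma> \<cdot> i (q (rg \<sigma>), unit_inv t)"
    unfolding act_def using assms by (subst S.inv_mul_distrib) (simp_all add: iv_i)
  also have "\<dots> = unit_inv t \<odot> iv \<sigma>"
    using twist_commute[of "iv \<sigma>" "unit_inv t"] assms by simp
  finally show ?thesis .
qed

section \<open>Convolution of equivariant functions\<close>

definition equivariant :: "('s \<Rightarrow> 'r) \<Rightarrow> bool" where
  "equivariant f \<longleftrightarrow> (\<forall>\<sigma>. \<sigma> \<notin> arr \<longrightarrow> f \<sigma> = 0) \<and>
     (\<forall>\<sigma> \<in> arr. \<forall>t. t dvd 1 \<longrightarrow> f (t \<odot> \<sigma>) = unit_inv t * f \<sigma>)"

text \<open>Asks only for what makes convolution sums finite, with no local constancy and no compact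
  support. Point masses at arbitrary units live here.\<close>

definition row_finite :: "('s \<Rightarrow> 'r) set" where
  "row_finite = {f. equivariant f \<and> (\<forall>x. finite {\<alpha> \<in> q ` supp \<Sigma> f. g_rng G \<alpha> = x})}"

definition diagonal :: "('s \<Rightarrow> 'r) set" where
  "diagonal = {f. equivariant f \<and> (\<forall>\<sigma> \<in> arr. f \<sigma> \<noteq> 0 \<longrightarrow> q \<sigma> \<in> g_units G)}"

abbreviation conv (infixl "\<star>" 72) where "f \<star> g \<equiv> convolution G \<Sigma> q f g"

lemma equivariantD:
  "equivariant f \<Longrightarrow> \<sigma> \<in> arr \<Longrightarrow> t dvd 1 \<Longrightarrow> f (t \<odot> \<sigma>) = unit_inv t * f \<sigma>"
  "equivariant f \<Longrightarrow> \<sigma> \<notin> arr \<Longrightarrow> f \<sigma> = 0"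
  "equivariant f \<Longrightarrow> f \<sigma> \<noteq> 0 \<Longrightarrow> \<sigma> \<in> arr"
  unfolding equivariant_def by blast+

lemma equivariant_zero_iff:
  assumes "equivariant f" "\<sigma> \<in> arr" "\<tau> \<in> arr" "q \<sigma> = q \<tau>"
  shows "f \<sigma> = 0 \<longleftrightarrow> f \<tau> = 0"
  using q_eqE[OF assms(2-4)] equivariantD(1)[OF assms(1,2)] by (metis unit_inv_mult_eq_0)

lemma row_finite_equivariant: "f \<in> row_finite \<Longrightarrow> equivariant f"
  by (simp add: row_finite_def)

lemma diagonal_equivariant: "f \<in> diagonal \<Longrightarrow> equivariant f"
  by (simp add: diagonal_def)

lemma in_supp_iff: "equivariant f \<Longrightarrow> \<sigma> \<in> supp \<Sigma> f \<longleftrightarrow> f \<sigma> \<noteq> 0"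
  using equivariantD(3) by (auto simp: supp_def)

text \<open>Convolution sums run over arrows of \<open>G\<close>, while the values are taken on
  \<open>\<Sigma>\<close>. A transversal lists one lift of each contributing arrow. The last clause
  lets a prescribed arrow be one of the chosen lifts.\<close>

lemma ex_transversal:
  assumes f: "f \<in> row_finite" and u: "u \<in> g_units \<Sigma>"
  obtains F where "finite F" "F \<subseteq> arr" "inj_on q F"
    "\<And>\<tau>. \<tau> \<in> F \<Longrightarrow> rg \<tau> = u" "\<And>\<tau>. \<tau> \<in> F \<Longrightarrow> f \<tau> \<noteq> 0"
    "\<And>\<tau>. \<tau> \<in> arr \<Longrightarrow> rg \<tau> = u \<Longrightarrow> f \<tau> \<noteq> 0 \<Longrightarrow> q \<tau> \<in> q ` F"
    "f \<tau>0 \<noteq> 0 \<Longrightarrow> rg \<tau>0 = u \<Longrightarrow> \<tau>0 \<in> F"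
proof -
  let ?K = "{\<alpha> \<in> q ` supp \<Sigma> f. g_rng G \<alpha> = q u}"
  define S where "S \<alpha> = (if \<tau>0 \<in> supp \<Sigma> f \<and> q \<tau>0 = \<alpha> then \<tau>0 else inv_into (supp \<Sigma> f) q \<alpha>)" for \<alpha>
  have eq: "equivariant f" using f row_finite_equivariant by blast
  have S: "S \<alpha> \<in> supp \<Sigma> f" "q (S \<alpha>) = \<alpha>" if "\<alpha> \<in> q ` supp \<Sigma> f" for \<alpha>
    using that by (auto simp: S_def inv_into_into f_inv_into_f)
  have rgS: "rg (S \<alpha>) = u" if "\<alpha> \<in> ?K" for \<alpha>
  proof -
    have a: "S \<alpha> \<in> arr" using S(1) that by (auto simp: supp_def)
    then have "q (rg (S \<alpha>)) = q u" using S(2) that by simp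
    then show ?thesis using units_eq_iff[OF S.rng_units[OF a] u] by blast
  qed
  show ?thesis
  proof (rule that[of "S ` ?K"])
    show "finite (S ` ?K)" using f by (auto simp: row_finite_def)
    show "S ` ?K \<subseteq> arr" using S(1) by (auto simp: supp_def)
    show "inj_on q (S ` ?K)" using S(2) by (auto simp: inj_on_def)
    show "rg \<tau> = u" if "\<tau> \<in> S ` ?K" for \<tau> using that rgS by blast
    show "f \<tau> \<noteq> 0" if "\<tau> \<in> S ` ?K" for \<tau> using that S(1) by (auto simp: supp_def)
    show "q \<tau> \<in> q ` S ` ?K" if "\<tau> \<in> arr" "rg \<tau> = u" "f \<tau> \<noteq> 0" for \<tau>
    proof -
      have k: "q \<tau> \<in> ?K" using that q_rg[of \<tau>] by (auto simp: supp_def)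
      then have "q (S (q \<tau>)) = q \<tau>" using S(2) by blast
      then show ?thesis using k by (metis (no_types, lifting) image_eqI)
    qed
    show "\<tau>0 \<in> S ` ?K" if "f \<tau>0 \<noteq> 0" "rg \<tau>0 = u"
    proof -
      have t: "\<tau>0 \<in> supp \<Sigma> f" using that in_supp_iff[OF eq] by blast
      then have "q \<tau>0 \<in> ?K" using that q_rg[of \<tau>0] by (auto simp: supp_def)
      moreover have "S (q \<tau>0) = \<tau>0" using t by (simp add: S_def)
      ultimately show ?thesis by (metis (no_types, lifting) image_eqI)
    qed
  qed
qed

text \<open>Replacing \<open>\<tau>\<close> by \<open>t \<odot> \<tau>\<close> multiplies the first
  value by \<open>unit_inv t\<close> and, through the inverse, the second by \<open>t\<close>; the
  factors cancel.\<close>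

lemma conv_term_invariant:
  assumes "equivariant f" "equivariant g" "\<sigma> \<in> arr" "\<tau> \<in> arr" "\<rho> \<in> arr" "rg \<tau> = rg \<sigma>" "q \<tau> = q \<rho>"
  shows "f \<tau> * g (iv \<tau> \<cdot> \<sigma>) = f \<rho> * g (iv \<rho> \<cdot> \<sigma>)"
proof -
  obtain t where t: "t dvd 1" "\<rho> = t \<odot> \<tau>" using q_eqE assms(4,5,7) by metis
  have "f \<rho> * g (iv \<rho> \<cdot> \<sigma>) = (unit_inv t * f \<tau>) * (t * g (iv \<tau> \<cdot> \<sigma>))"
    using t assms by (simp add: equivariantD(1))
  also have "\<dots> = (unit_inv t * t) * (f \<tau> * g (iv \<tau> \<cdot> \<sigma>))" by (simp only: mult_ac)
  finally show ?thesis using t by simp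
qed

text \<open>The section chosen in the definition of convolution is eliminated here once and for all.
  \<open>F\<close> need only cover the arrows with a nonzero summand and may contain arrows where
  \<open>f\<close> vanishes; later calculations rely on both freedoms.\<close>

lemma conv_eq_sum:
  assumes f: "f \<in> row_finite" and g: "equivariant g" and \<sigma>: "\<sigma> \<in> arr"
    and F: "finite F" "F \<subseteq> arr" "inj_on q F" "\<And>\<tau>. \<tau> \<in> F \<Longrightarrow> rg \<tau> = rg \<sigma>"
    and cover: "\<And>\<tau>. \<lbrakk>\<tau> \<in> arr; rg \<tau> = rg \<sigma>; f \<tau> \<noteq> 0; g (iv \<tau> \<cdot> \<sigma>) \<noteq> 0\<rbrakk> \<Longrightarrow> q \<tau> \<in> q ` F"
  shows "(f \<star> g) \<sigma> = (\<Sum>\<tau>\<in>F. f \<tau> * g (iv \<tau> \<cdot> \<sigma>))"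
proof -
  define K where "K = {\<alpha> \<in> q ` supp \<Sigma> f. g_rng G \<alpha> = q (rg \<sigma>)}"
  let ?h = "\<lambda>\<tau>. f \<tau> * g (iv \<tau> \<cdot> \<sigma>)"
  define S where "S \<alpha> = (SOME \<tau>. \<tau> \<in> supp \<Sigma> f \<and> q \<tau> = \<alpha>)" for \<alpha>
  have eq: "equivariant f" using f row_finite_equivariant by blast
  have "S \<alpha> \<in> supp \<Sigma> f \<and> q (S \<alpha>) = \<alpha>" if "\<alpha> \<in> q ` supp \<Sigma> f" for \<alpha>
    unfolding S_def by (rule someI_ex) (use that in auto)
  then have S: "S \<alpha> \<in> arr" "q (S \<alpha>) = \<alpha>" if "\<alpha> \<in> K" for \<alpha>
    using that by (auto simp: supp_def K_def)
  have rgS: "rg (S \<alpha>) = rg \<sigma>" if "\<alpha> \<in> K" for \<alpha>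
    using S[OF that] that rg_eq_iff[OF S(1)[OF that] \<sigma>] \<sigma> by (simp add: K_def)
  have K: "finite K" using f by (simp add: row_finite_def K_def)
  have "(f \<star> g) \<sigma> = (\<Sum>\<alpha>\<in>K. ?h (S \<alpha>))"
    using \<sigma> unfolding convolution_def S_def Let_def K_def by simp
  also have "\<dots> = (\<Sum>\<alpha>\<in>K \<inter> q ` F. ?h (S \<alpha>))"
  proof (rule sum.mono_neutral_right[OF K])
    show "\<forall>\<alpha>\<in>K - K \<inter> q ` F. ?h (S \<alpha>) = 0"
    proof
      fix \<alpha> assume a: "\<alpha> \<in> K - K \<inter> q ` F"
      then have k: "\<alpha> \<in> K" by blast
      show "?h (S \<alpha>) = 0"
      proof (rule ccontr)
        assume "?h (S \<alpha>) \<noteq> 0"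
        then have "q (S \<alpha>) \<in> q ` F"
          by (intro cover[OF S(1)[OF k] rgS[OF k]]) auto
        then have "\<alpha> \<in> q ` F" using S(2)[OF k] by simp
        then show False using a by blast
      qed
    qed
  qed auto
  also have "\<dots> = (\<Sum>\<tau>\<in>{\<tau> \<in> F. q \<tau> \<in> K}. ?h (S (q \<tau>)))"
  proof -
    have *: "K \<inter> q ` F = q ` {\<tau> \<in> F. q \<tau> \<in> K}" by blast
    have inj: "inj_on q {\<tau> \<in> F. q \<tau> \<in> K}" using F(3) by (rule inj_on_subset) blast
    show ?thesis unfolding * sum.reindex[OF inj] o_def ..
  qed
  also have "\<dots> = (\<Sum>\<tau>\<in>{\<tau> \<in> F. q \<tau> \<in> K}. ?h \<tau>)"
  proof (rule sum.cong[OF refl])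
    fix \<tau> assume t: "\<tau> \<in> {\<tau> \<in> F. q \<tau> \<in> K}"
    then have k: "q \<tau> \<in> K" "\<tau> \<in> arr" using F(2) by auto
    show "?h (S (q \<tau>)) = ?h \<tau>"
      by (rule conv_term_invariant[OF eq g \<sigma> S(1)[OF k(1)] k(2) rgS[OF k(1)] S(2)[OF k(1)]])
  qed
  also have "\<dots> = (\<Sum>\<tau>\<in>F. ?h \<tau>)"
  proof (rule sum.mono_neutral_left[OF F(1)])
    show "\<forall>\<tau>\<in>F - {\<tau> \<in> F. q \<tau> \<in> K}. ?h \<tau> = 0"
    proof
      fix \<tau> assume t: "\<tau> \<in> F - {\<tau> \<in> F. q \<tau> \<in> K}"
      then have "\<tau> \<in> arr" "rg \<tau> = rg \<sigma>" "q \<tau> \<notin> K" using F by auto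
      then have "f \<tau> = 0" using q_rg[of \<tau>] by (auto simp: supp_def K_def)
      then show "?h \<tau> = 0" by simp
    qed
  qed auto
  finally show ?thesis .
qed

lemma conv_outside: "\<sigma> \<notin> arr \<Longrightarrow> (f \<star> g) \<sigma> = 0"
  by (simp add: convolution_def)

lemma conv_nonzeroE:
  assumes f: "f \<in> row_finite" and g: "equivariant g" and nz: "(f \<star> g) \<sigma> \<noteq> 0"
  obtains \<tau> where "\<sigma> \<in> arr" "\<tau> \<in> arr" "rg \<tau> = rg \<sigma>" "f \<tau> \<noteq> 0" "g (iv \<tau> \<cdot> \<sigma>) \<noteq> 0"
proof -
  have \<sigma>: "\<sigma> \<in> arr" using nz conv_outside by blast
  have "\<exists>\<tau>. \<tau> \<in> arr \<and> rg \<tau> = rg \<sigma> \<and> f \<tau> \<noteq> 0 \<and> g (iv \<tau> \<cdot> \<sigma>) \<noteq> 0"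
  proof (rule ccontr)
    assume "\<nexists>\<tau>. \<tau> \<in> arr \<and> rg \<tau> = rg \<sigma> \<and> f \<tau> \<noteq> 0 \<and> g (iv \<tau> \<cdot> \<sigma>) \<noteq> 0"
    then have "(f \<star> g) \<sigma> = (\<Sum>\<tau>\<in>{}. f \<tau> * g (iv \<tau> \<cdot> \<sigma>))"
      by (intro conv_eq_sum[OF f g \<sigma>]) auto
    then show False using nz by simp
  qed
  then show ?thesis using that \<sigma> by blast
qed

lemma equivariant_conv:
  assumes f: "f \<in> row_finite" and g: "equivariant g"
  shows "equivariant (f \<star> g)"
proof -
  have "(f \<star> g) (t \<odot> \<sigma>) = unit_inv t * (f \<star> g) \<sigma>" if *: "\<sigma> \<in> arr" "t dvd 1" for \<sigma> t
  proof -
    obtain F where F: "finite F" "F \<subseteq> arr" "inj_on q F" "\<And>\<tau>. \<tau> \<in> F \<Longrightarrow> rg \<tau> = rg \<sigma>"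
      "\<And>\<tau>. \<tau> \<in> arr \<Longrightarrow> rg \<tau> = rg \<sigma> \<Longrightarrow> f \<tau> \<noteq> 0 \<Longrightarrow> q \<tau> \<in> q ` F"
      using ex_transversal[OF f S.rng_units[OF *(1)]] by metis
    have "(f \<star> g) (t \<odot> \<sigma>) = (\<Sum>\<tau>\<in>F. f \<tau> * g (iv \<tau> \<cdot> t \<odot> \<sigma>))"
      by (rule conv_eq_sum[OF f g _ F(1-3)]) (use * F in simp_all)
    also have "\<dots> = (\<Sum>\<tau>\<in>F. unit_inv t * (f \<tau> * g (iv \<tau> \<cdot> \<sigma>)))"
    proof (rule sum.cong[OF refl])
      fix \<tau> assume "\<tau> \<in> F"
      then have "\<tau> \<in> arr" "rg \<tau> = rg \<sigma>" using F by auto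
      then have "g (iv \<tau> \<cdot> t \<odot> \<sigma>) = unit_inv t * g (iv \<tau> \<cdot> \<sigma>)"
        using * g by (simp add: equivariantD(1))
      then show "f \<tau> * g (iv \<tau> \<cdot> t \<odot> \<sigma>) = unit_inv t * (f \<tau> * g (iv \<tau> \<cdot> \<sigma>))"
        by (simp add: mult_ac)
    qed
    also have "\<dots> = unit_inv t * (f \<star> g) \<sigma>"
      unfolding sum_distrib_left[symmetric]
      by (subst conv_eq_sum[OF f g *(1) F(1-3)]) (use F in auto)
    finally show ?thesis .
  qed
  then show ?thesis by (simp add: equivariant_def conv_outside)
qed

text \<open>For a fixed range there are finitely many possible first factors, and each of them fixes
  the range of the second factor, hence leaves finitely many of those.\<close>

lemma row_finite_conv:
  assumes f: "f \<in> row_finite" and g: "g \<in> row_finite"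
  shows "f \<star> g \<in> row_finite"
proof -
  have ge: "equivariant g" using g row_finite_equivariant by blast
  have "finite {\<alpha> \<in> q ` supp \<Sigma> (f \<star> g). g_rng G \<alpha> = x}" for x
  proof (cases "\<exists>\<sigma> \<in> arr. q (rg \<sigma>) = x")
    case False
    then have "{\<alpha> \<in> q ` supp \<Sigma> (f \<star> g). g_rng G \<alpha> = x} = {}" by (auto simp: supp_def)
    then show ?thesis by (simp only: finite.emptyI)
  next
    case True
    then obtain \<sigma>0 where \<sigma>0: "\<sigma>0 \<in> arr" "q (rg \<sigma>0) = x" by blast
    obtain F where F: "finite F" "F \<subseteq> arr" "\<And>\<tau>. \<tau> \<in> F \<Longrightarrow> rg \<tau> = rg \<sigma>0"
      "\<And>\<tau>. \<tau> \<in> arr \<Longrightarrow> rg \<tau> = rg \<sigma>0 \<Longrightarrow> f \<tau> \<noteq> 0 \<Longrightarrow> q \<tau> \<in> q ` F"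
      using ex_transversal[OF f S.rng_units[OF \<sigma>0(1)]] by metis
    have "\<exists>H. finite H \<and> H \<subseteq> arr \<and> (\<forall>\<rho>\<in>H. rg \<rho> = sr \<tau>) \<and>
        (\<forall>\<rho>\<in>arr. rg \<rho> = sr \<tau> \<longrightarrow> g \<rho> \<noteq> 0 \<longrightarrow> q \<rho> \<in> q ` H)" if "\<tau> \<in> F" for \<tau>
    proof -
      have "sr \<tau> \<in> g_units \<Sigma>" using that F by auto
      from ex_transversal[OF g this] show ?thesis by metis
    qed
    then obtain H where H: "\<And>\<tau>. \<tau> \<in> F \<Longrightarrow> finite (H \<tau>) \<and> H \<tau> \<subseteq> arr \<and> (\<forall>\<rho>\<in>H \<tau>. rg \<rho> = sr \<tau>) \<and>
        (\<forall>\<rho>\<in>arr. rg \<rho> = sr \<tau> \<longrightarrow> g \<rho> \<noteq> 0 \<longrightarrow> q \<rho> \<in> q ` H \<tau>)" by metis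
    have "{\<alpha> \<in> q ` supp \<Sigma> (f \<star> g). g_rng G \<alpha> = x} \<subseteq> (\<Union>\<tau>\<in>F. (\<lambda>\<rho>. g_mul G (q \<tau>) (q \<rho>)) ` H \<tau>)"
    proof
      fix \<alpha> assume "\<alpha> \<in> {\<alpha> \<in> q ` supp \<Sigma> (f \<star> g). g_rng G \<alpha> = x}"
      then obtain \<sigma> where s: "\<sigma> \<in> arr" "(f \<star> g) \<sigma> \<noteq> 0" "\<alpha> = q \<sigma>" "g_rng G (q \<sigma>) = x"
        by (auto simp: supp_def)
      then have rs: "rg \<sigma> = rg \<sigma>0" using \<sigma>0 rg_eq_iff[of \<sigma> \<sigma>0] by simp
      obtain \<tau> where t: "\<tau> \<in> arr" "rg \<tau> = rg \<sigma>" "f \<tau> \<noteq> 0" "g (iv \<tau> \<cdot> \<sigma>) \<noteq> 0"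
        using conv_nonzeroE[OF f ge s(2)] by metis
      obtain \<tau>' where t': "\<tau>' \<in> F" "q \<tau>' = q \<tau>" using F(4)[OF t(1)] t rs by (metis image_iff)
      have ta: "\<tau>' \<in> arr" using t' F by blast
      have st: "sr \<tau>' = sr \<tau>" using t' ta t sr_eq_iff by metis
      have "q (iv \<tau> \<cdot> \<sigma>) \<in> q ` H \<tau>'"
      proof -
        have "iv \<tau> \<cdot> \<sigma> \<in> arr" "rg (iv \<tau> \<cdot> \<sigma>) = sr \<tau>'" using t s st by simp_all
        then show ?thesis using H[OF t'(1)] t(4) by blast
      qed
      then obtain \<rho> where r: "\<rho> \<in> H \<tau>'" "q \<rho> = q (iv \<tau> \<cdot> \<sigma>)" by auto
      have "q (\<tau> \<cdot> (iv \<tau> \<cdot> \<sigma>)) = g_mul G (q \<tau>) (q (iv \<tau> \<cdot> \<sigma>))"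
        by (rule q_mul) (use t s in simp_all)
      then have "g_mul G (q \<tau>') (q \<rho>) = q (\<tau> \<cdot> (iv \<tau> \<cdot> \<sigma>))"
        unfolding t'(2) r(2) by (rule sym)
      then have "\<alpha> = g_mul G (q \<tau>') (q \<rho>)" using t s by simp
      then show "\<alpha> \<in> (\<Union>\<tau>\<in>F. (\<lambda>\<rho>. g_mul G (q \<tau>) (q \<rho>)) ` H \<tau>)" using t' r by blast
    qed
    moreover have "finite (\<Union>\<tau>\<in>F. (\<lambda>\<rho>. g_mul G (q \<tau>) (q \<rho>)) ` H \<tau>)" using F H by blast
    ultimately show ?thesis by (rule finite_subset)
  qed
  then show ?thesis using equivariant_conv[OF f ge] unfolding row_finite_def by blast
qed

text \<open>Both sides become the same double sum. The transversal \<open>E\<close> of products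
  serves the outer sum on the left and, translated by \<open>iv \<tau>\<close>, every inner sum on
  the right, so the sums can be exchanged.\<close>

lemma conv_assoc:
  assumes f: "f \<in> row_finite" and g: "g \<in> row_finite" and h: "equivariant h"
  shows "(f \<star> g) \<star> h = f \<star> (g \<star> h)"
proof
  fix \<sigma>
  have fe: "equivariant f" and ge: "equivariant g" using f g row_finite_equivariant by auto
  have fg: "f \<star> g \<in> row_finite" and gh: "equivariant (g \<star> h)"
    using row_finite_conv[OF f g] equivariant_conv[OF g h] by auto
  show "((f \<star> g) \<star> h) \<sigma> = (f \<star> (g \<star> h)) \<sigma>"
  proof (cases "\<sigma> \<in> arr")
    case False then show ?thesis by (simp add: conv_outside)
  next
    case \<sigma>: True
    obtain F where F: "finite F" "F \<subseteq> arr" "inj_on q F" "\<And>\<tau>. \<tau> \<in> F \<Longrightarrow> rg \<tau> = rg \<sigma>"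
      "\<And>\<tau>. \<tau> \<in> arr \<Longrightarrow> rg \<tau> = rg \<sigma> \<Longrightarrow> f \<tau> \<noteq> 0 \<Longrightarrow> q \<tau> \<in> q ` F"
      using ex_transversal[OF f S.rng_units[OF \<sigma>]] by metis
    have "\<exists>H. finite H \<and> H \<subseteq> arr \<and> (\<forall>\<rho>\<in>H. rg \<rho> = sr \<tau>) \<and>
        (\<forall>\<rho>\<in>arr. rg \<rho> = sr \<tau> \<longrightarrow> g \<rho> \<noteq> 0 \<longrightarrow> q \<rho> \<in> q ` H)" if "\<tau> \<in> F" for \<tau>
    proof -
      have "sr \<tau> \<in> g_units \<Sigma>" using that F by auto
      from ex_transversal[OF g this] show ?thesis by metis
    qed
    then obtain H where H: "\<And>\<tau>. \<tau> \<in> F \<Longrightarrow> finite (H \<tau>) \<and> H \<tau> \<subseteq> arr \<and> (\<forall>\<rho>\<in>H \<tau>. rg \<rho> = sr \<tau>) \<and>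
        (\<forall>\<rho>\<in>arr. rg \<rho> = sr \<tau> \<longrightarrow> g \<rho> \<noteq> 0 \<longrightarrow> q \<rho> \<in> q ` H \<tau>)" by metis
    define M where "M = (\<Union>\<tau>\<in>F. (\<lambda>\<rho>. \<tau> \<cdot> \<rho>) ` H \<tau>)"
    have M: "finite M" "M \<subseteq> arr" "\<And>\<gamma>. \<gamma> \<in> M \<Longrightarrow> rg \<gamma> = rg \<sigma>"
      unfolding M_def using F H by (auto simp: subset_iff)
    \<comment> \<open>Different factorisations in \<open>M\<close> may lie over the same arrow of
      \<open>G\<close>; one lift is kept for each.\<close>
    define E where "E = inv_into M q ` (q ` M)"
    have E: "finite E" "E \<subseteq> M" "inj_on q E" "q ` E = q ` M"
    proof -
      show "finite E" unfolding E_def using M by blast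
      show "E \<subseteq> M" unfolding E_def by (auto simp: inv_into_into)
      show "inj_on q E" unfolding E_def by (auto simp: inj_on_def f_inv_into_f)
      show "q ` E = q ` M" unfolding E_def by (auto simp: image_image f_inv_into_f)
    qed
    have Ea: "E \<subseteq> arr" "\<And>\<gamma>. \<gamma> \<in> E \<Longrightarrow> rg \<gamma> = rg \<sigma>" using E M by auto
    have cover: "q (\<tau> \<cdot> \<rho>) \<in> q ` E"
      if \<tau>: "\<tau> \<in> F" and \<rho>: "\<rho> \<in> arr" "sr \<tau> = rg \<rho>" "g \<rho> \<noteq> 0" for \<tau> \<rho>
    proof -
      have ta: "\<tau> \<in> arr" using \<tau> F by blast
      obtain \<rho>' where r: "\<rho>' \<in> H \<tau>" "q \<rho>' = q \<rho>" using H[OF \<tau>] \<rho> by (metis image_iff)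
      then have ra: "\<rho>' \<in> arr" "rg \<rho>' = sr \<tau>" using H[OF \<tau>] by auto
      have "q (\<tau> \<cdot> \<rho>') = q (\<tau> \<cdot> \<rho>)" using r ra ta \<rho> by simp
      moreover have "\<tau> \<cdot> \<rho>' \<in> M" unfolding M_def using \<tau> r by blast
      ultimately show ?thesis unfolding E(4) by (metis image_eqI)
    qed
    have inner: "(g \<star> h) (iv \<tau> \<cdot> \<sigma>) = (\<Sum>\<gamma>\<in>E. g (iv \<tau> \<cdot> \<gamma>) * h (iv \<gamma> \<cdot> \<sigma>))" if \<tau>: "\<tau> \<in> F" for \<tau>
    proof -
      have ta: "\<tau> \<in> arr" "rg \<tau> = rg \<sigma>" using \<tau> F by auto
      have inj: "inj_on (\<lambda>\<gamma>. iv \<tau> \<cdot> \<gamma>) E"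
      proof (rule inj_onI)
        fix a b assume ab: "a \<in> E" "b \<in> E" "iv \<tau> \<cdot> a = iv \<tau> \<cdot> b"
        then have *: "a \<in> arr" "b \<in> arr" "rg \<tau> = rg a" "rg \<tau> = rg b" using Ea ta by auto
        have "a = \<tau> \<cdot> (iv \<tau> \<cdot> a)" using * ta by simp
        also have "\<dots> = \<tau> \<cdot> (iv \<tau> \<cdot> b)" by (simp only: ab(3))
        also have "\<dots> = b" using * ta by simp
        finally show "a = b" .
      qed
      have "(g \<star> h) (iv \<tau> \<cdot> \<sigma>) = (\<Sum>\<rho>\<in>(\<lambda>\<gamma>. iv \<tau> \<cdot> \<gamma>) ` E. g \<rho> * h (iv \<rho> \<cdot> (iv \<tau> \<cdot> \<sigma>)))"
      proof (rule conv_eq_sum[OF g h])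
        show "iv \<tau> \<cdot> \<sigma> \<in> arr" using ta \<sigma> by simp
        show "finite ((\<lambda>\<gamma>. iv \<tau> \<cdot> \<gamma>) ` E)" using E by blast
        show "(\<lambda>\<gamma>. iv \<tau> \<cdot> \<gamma>) ` E \<subseteq> arr" using Ea ta by auto
        show "inj_on q ((\<lambda>\<gamma>. iv \<tau> \<cdot> \<gamma>) ` E)"
        proof (rule inj_onI)
          fix a b assume ab: "a \<in> (\<lambda>\<gamma>. iv \<tau> \<cdot> \<gamma>) ` E" "b \<in> (\<lambda>\<gamma>. iv \<tau> \<cdot> \<gamma>) ` E" "q a = q b"
          then obtain a' b' where a': "a' \<in> E" "a = iv \<tau> \<cdot> a'" and b': "b' \<in> E" "b = iv \<tau> \<cdot> b'" by blast
          then have r: "a' \<in> arr" "b' \<in> arr" "rg a' = rg \<sigma>" "rg b' = rg \<sigma>" using Ea by auto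
          have "q (\<tau> \<cdot> a) = q (\<tau> \<cdot> b)" using ab(3) a' b' r ta by (subst (1 2) q_mul) simp_all
          then have "q a' = q b'" using a' b' r ta by simp
          then show "a = b" using a' b' E(3) by (auto dest: inj_onD)
        qed
        show "rg \<rho> = rg (iv \<tau> \<cdot> \<sigma>)" if "\<rho> \<in> (\<lambda>\<gamma>. iv \<tau> \<cdot> \<gamma>) ` E" for \<rho>
          using that Ea ta \<sigma> by auto
        fix \<rho> assume \<rho>: "\<rho> \<in> arr" "rg \<rho> = rg (iv \<tau> \<cdot> \<sigma>)" "g \<rho> \<noteq> 0"
        have "sr \<tau> = rg \<rho>" using \<rho> ta \<sigma> by simp
        from cover[OF \<tau> \<rho>(1) this \<rho>(3)] obtain \<gamma> where \<gamma>: "\<gamma> \<in> E" "q (\<tau> \<cdot> \<rho>) = q \<gamma>" by blast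
        have "q \<rho> = q (iv \<tau> \<cdot> (\<tau> \<cdot> \<rho>))" using ta \<rho> \<sigma> by simp
        also have "\<dots> = q (iv \<tau> \<cdot> \<gamma>)" using ta \<rho> \<sigma> \<gamma> Ea by (subst (1 2) q_mul) auto
        finally show "q \<rho> \<in> q ` (\<lambda>\<gamma>. iv \<tau> \<cdot> \<gamma>) ` E" using \<gamma> by blast
      qed
      also have "\<dots> = (\<Sum>\<gamma>\<in>E. g (iv \<tau> \<cdot> \<gamma>) * h (iv \<gamma> \<cdot> \<sigma>))"
      proof (subst sum.reindex[OF inj], rule sum.cong[OF refl])
        fix \<gamma> assume "\<gamma> \<in> E"
        then have "\<gamma> \<in> arr" "rg \<gamma> = rg \<sigma>" using Ea by auto
        then have "iv (iv \<tau> \<cdot> \<gamma>) \<cdot> (iv \<tau> \<cdot> \<sigma>) = iv \<gamma> \<cdot> \<sigma>"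
          using ta \<sigma> by (simp add: S.inv_mul_distrib S.mul_assoc)
        then show "((\<lambda>\<rho>. g \<rho> * h (iv \<rho> \<cdot> (iv \<tau> \<cdot> \<sigma>))) \<circ> (\<lambda>\<gamma>. iv \<tau> \<cdot> \<gamma>)) \<gamma> =
            g (iv \<tau> \<cdot> \<gamma>) * h (iv \<gamma> \<cdot> \<sigma>)" by simp
      qed
      finally show ?thesis .
    qed
    have fgE: "(f \<star> g) \<gamma> = (\<Sum>\<tau>\<in>F. f \<tau> * g (iv \<tau> \<cdot> \<gamma>))" if "\<gamma> \<in> E" for \<gamma>
      by (rule conv_eq_sum[OF f ge _ F(1-3)]) (use that Ea F in auto)
    have "((f \<star> g) \<star> h) \<sigma> = (\<Sum>\<gamma>\<in>E. (f \<star> g) \<gamma> * h (iv \<gamma> \<cdot> \<sigma>))"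
    proof (rule conv_eq_sum[OF fg h \<sigma> E(1) Ea(1) E(3) Ea(2)])
      fix \<gamma> assume \<gamma>: "\<gamma> \<in> arr" "rg \<gamma> = rg \<sigma>" "(f \<star> g) \<gamma> \<noteq> 0"
      obtain \<tau> where t: "\<tau> \<in> arr" "rg \<tau> = rg \<gamma>" "f \<tau> \<noteq> 0" "g (iv \<tau> \<cdot> \<gamma>) \<noteq> 0"
        using conv_nonzeroE[OF f ge \<gamma>(3)] by metis
      obtain \<tau>' where t': "\<tau>' \<in> F" "q \<tau>' = q \<tau>" using F(5)[OF t(1)] t \<gamma> by (metis image_iff)
      have ta: "\<tau>' \<in> arr" "rg \<tau>' = rg \<gamma>" using t' F \<gamma> by auto
      have "g (iv \<tau>' \<cdot> \<gamma>) \<noteq> 0"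
        using t(4) equivariant_zero_iff[OF ge, of "iv \<tau>' \<cdot> \<gamma>" "iv \<tau> \<cdot> \<gamma>"] ta t t' \<gamma> by simp
      then have "q (\<tau>' \<cdot> (iv \<tau>' \<cdot> \<gamma>)) \<in> q ` E"
        by (intro cover) (use t' ta \<gamma> in simp_all)
      then show "q \<gamma> \<in> q ` E" using ta \<gamma> by simp
    qed
    also have "\<dots> = (\<Sum>\<gamma>\<in>E. \<Sum>\<tau>\<in>F. f \<tau> * (g (iv \<tau> \<cdot> \<gamma>) * h (iv \<gamma> \<cdot> \<sigma>)))"
      by (rule sum.cong[OF refl]) (simp add: fgE sum_distrib_right mult.assoc)
    also have "\<dots> = (\<Sum>\<tau>\<in>F. f \<tau> * (\<Sum>\<gamma>\<in>E. g (iv \<tau> \<cdot> \<gamma>) * h (iv \<gamma> \<cdot> \<sigma>)))"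
      by (subst sum.swap) (simp add: sum_distrib_left)
    also have "\<dots> = (\<Sum>\<tau>\<in>F. f \<tau> * (g \<star> h) (iv \<tau> \<cdot> \<sigma>))"
      by (rule sum.cong[OF refl]) (simp add: inner)
    also have "\<dots> = (f \<star> (g \<star> h)) \<sigma>"
      by (rule conv_eq_sum[OF f gh \<sigma> F(1-4), symmetric]) (use F in auto)
    finally show ?thesis .
  qed
qed

section \<open>Bilinearity of convolution\<close>

lemma equivariant_add: "equivariant f \<Longrightarrow> equivariant g \<Longrightarrow> equivariant (\<lambda>\<sigma>. f \<sigma> + g \<sigma>)"
  by (simp add: equivariant_def algebra_simps)

lemma equivariant_smult: "equivariant f \<Longrightarrow> equivariant (\<lambda>\<sigma>. t * f \<sigma>)"
  by (simp add: equivariant_def algebra_simps)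

lemma row_finite_add: assumes "f \<in> row_finite" "g \<in> row_finite" shows "(\<lambda>\<sigma>. f \<sigma> + g \<sigma>) \<in> row_finite"
proof -
  have "finite {\<alpha> \<in> q ` supp \<Sigma> (\<lambda>\<sigma>. f \<sigma> + g \<sigma>). g_rng G \<alpha> = x}" for x
    by (rule finite_subset[of _ "{\<alpha> \<in> q ` supp \<Sigma> f. g_rng G \<alpha> = x} \<union> {\<alpha> \<in> q ` supp \<Sigma> g. g_rng G \<alpha> = x}"])
      (use assms in \<open>force simp: row_finite_def supp_def\<close>)+
  then show ?thesis using assms equivariant_add by (auto simp: row_finite_def)
qed

lemma row_finite_smult: assumes "f \<in> row_finite" shows "(\<lambda>\<sigma>. t * f \<sigma>) \<in> row_finite"
proof -
  have "finite {\<alpha> \<in> q ` supp \<Sigma> (\<lambda>\<sigma>. t * f \<sigma>). g_rng G \<alpha> = x}" for x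
    by (rule finite_subset[of _ "{\<alpha> \<in> q ` supp \<Sigma> f. g_rng G \<alpha> = x}"])
      (use assms in \<open>force simp: row_finite_def supp_def\<close>)+
  then show ?thesis using assms equivariant_smult by (auto simp: row_finite_def)
qed

lemma conv_add_right: "f \<star> (\<lambda>\<sigma>. g \<sigma> + h \<sigma>) = (\<lambda>\<sigma>. (f \<star> g) \<sigma> + (f \<star> h) \<sigma>)"
  by (rule ext) (simp add: convolution_def Let_def sum.distrib distrib_left)

lemma conv_smult_right: "f \<star> (\<lambda>\<sigma>. t * g \<sigma>) = (\<lambda>\<sigma>. t * (f \<star> g) \<sigma>)"
  by (rule ext) (simp add: convolution_def Let_def sum_distrib_left mult_ac)

text \<open>The range of summation depends on the left factor, so additivity there is not termwise:
  all three convolutions are evaluated on a transversal common to the supports of \<open>f\<close>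
  and \<open>g\<close>.\<close>

lemma conv_add_left:
  assumes f: "f \<in> row_finite" and g: "g \<in> row_finite" and h: "equivariant h"
  shows "(\<lambda>\<sigma>. f \<sigma> + g \<sigma>) \<star> h = (\<lambda>\<sigma>. (f \<star> h) \<sigma> + (g \<star> h) \<sigma>)"
proof
  fix \<sigma>
  show "((\<lambda>\<sigma>. f \<sigma> + g \<sigma>) \<star> h) \<sigma> = (f \<star> h) \<sigma> + (g \<star> h) \<sigma>"
  proof (cases "\<sigma> \<in> arr")
    case False then show ?thesis by (simp add: conv_outside)
  next
    case \<sigma>: True
    obtain F where F: "finite F" "F \<subseteq> arr" "\<And>\<tau>. \<tau> \<in> F \<Longrightarrow> rg \<tau> = rg \<sigma>"
      "\<And>\<tau>. \<tau> \<in> arr \<Longrightarrow> rg \<tau> = rg \<sigma> \<Longrightarrow> f \<tau> \<noteq> 0 \<Longrightarrow> q \<tau> \<in> q ` F"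
      using ex_transversal[OF f S.rng_units[OF \<sigma>]] by metis
    obtain H where H: "finite H" "H \<subseteq> arr" "\<And>\<tau>. \<tau> \<in> H \<Longrightarrow> rg \<tau> = rg \<sigma>"
      "\<And>\<tau>. \<tau> \<in> arr \<Longrightarrow> rg \<tau> = rg \<sigma> \<Longrightarrow> g \<tau> \<noteq> 0 \<Longrightarrow> q \<tau> \<in> q ` H"
      using ex_transversal[OF g S.rng_units[OF \<sigma>]] by metis
    define M where "M = F \<union> H"
    define E where "E = inv_into M q ` (q ` M)"
    have M: "finite M" "M \<subseteq> arr" "\<And>\<gamma>. \<gamma> \<in> M \<Longrightarrow> rg \<gamma> = rg \<sigma>"
      unfolding M_def using F H by auto
    have "E \<subseteq> M" unfolding E_def by (auto simp: inv_into_into)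
    moreover have "q ` E = q ` M" unfolding E_def by (auto simp: image_image f_inv_into_f)
    moreover have "inj_on q E" unfolding E_def by (auto simp: inj_on_def f_inv_into_f)
    ultimately have E: "finite E" "E \<subseteq> arr" "inj_on q E" "\<And>\<tau>. \<tau> \<in> E \<Longrightarrow> rg \<tau> = rg \<sigma>"
      "\<And>\<tau>. \<tau> \<in> arr \<Longrightarrow> rg \<tau> = rg \<sigma> \<Longrightarrow> f \<tau> \<noteq> 0 \<or> g \<tau> \<noteq> 0 \<Longrightarrow> q \<tau> \<in> q ` E"
      using M F(4) H(4) by (auto simp: M_def finite_subset image_Un)
    have "((\<lambda>\<sigma>. f \<sigma> + g \<sigma>) \<star> h) \<sigma> = (\<Sum>\<tau>\<in>E. (f \<tau> + g \<tau>) * h (iv \<tau> \<cdot> \<sigma>))"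
      by (rule conv_eq_sum[OF row_finite_add[OF f g] h \<sigma> E(1-4)]) (auto intro: E(5))
    moreover have "(f \<star> h) \<sigma> = (\<Sum>\<tau>\<in>E. f \<tau> * h (iv \<tau> \<cdot> \<sigma>))"
      by (rule conv_eq_sum[OF f h \<sigma> E(1-4)]) (auto intro: E(5))
    moreover have "(g \<star> h) \<sigma> = (\<Sum>\<tau>\<in>E. g \<tau> * h (iv \<tau> \<cdot> \<sigma>))"
      by (rule conv_eq_sum[OF g h \<sigma> E(1-4)]) (auto intro: E(5))
    ultimately show ?thesis by (simp add: sum.distrib distrib_right)
  qed
qed

lemma conv_smult_left:
  assumes f: "f \<in> row_finite" and h: "equivariant h"
  shows "(\<lambda>\<sigma>. t * f \<sigma>) \<star> h = (\<lambda>\<sigma>. t * (f \<star> h) \<sigma>)"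
proof
  fix \<sigma>
  show "((\<lambda>\<sigma>. t * f \<sigma>) \<star> h) \<sigma> = t * (f \<star> h) \<sigma>"
  proof (cases "\<sigma> \<in> arr")
    case False then show ?thesis by (simp add: conv_outside)
  next
    case \<sigma>: True
    obtain F where F: "finite F" "F \<subseteq> arr" "inj_on q F" "\<And>\<tau>. \<tau> \<in> F \<Longrightarrow> rg \<tau> = rg \<sigma>"
      "\<And>\<tau>. \<tau> \<in> arr \<Longrightarrow> rg \<tau> = rg \<sigma> \<Longrightarrow> f \<tau> \<noteq> 0 \<Longrightarrow> q \<tau> \<in> q ` F"
      using ex_transversal[OF f S.rng_units[OF \<sigma>]] by metis
    have "((\<lambda>\<sigma>. t * f \<sigma>) \<star> h) \<sigma> = (\<Sum>\<tau>\<in>F. t * f \<tau> * h (iv \<tau> \<cdot> \<sigma>))"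
      by (rule conv_eq_sum[OF row_finite_smult[OF f] h \<sigma> F(1-4)]) (auto intro: F(5))
    moreover have "(f \<star> h) \<sigma> = (\<Sum>\<tau>\<in>F. f \<tau> * h (iv \<tau> \<cdot> \<sigma>))"
      by (rule conv_eq_sum[OF f h \<sigma> F(1-4)]) (auto intro: F(5))
    ultimately show ?thesis by (simp add: sum_distrib_left mult.assoc)
  qed
qed

section \<open>Convolution with functions supported over the units\<close>

lemma diagonal_row_finite: assumes "f \<in> diagonal" shows "f \<in> row_finite"
proof -
  have "finite {\<alpha> \<in> q ` supp \<Sigma> f. g_rng G \<alpha> = x}" for x
    by (rule finite_subset[of _ "{x}"]) (use assms in \<open>auto simp: diagonal_def supp_def\<close>)
  then show ?thesis using assms by (simp add: row_finite_def diagonal_def)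
qed

text \<open>Up to the unit action, \<open>rg \<sigma>\<close> is the only arrow lying over a unit
  and having range \<open>rg \<sigma>\<close>.\<close>

lemma conv_diagonal_left:
  assumes b: "b \<in> diagonal" and f: "equivariant f" and \<sigma>: "\<sigma> \<in> arr"
  shows "(b \<star> f) \<sigma> = b (rg \<sigma>) * f \<sigma>"
proof -
  have "(b \<star> f) \<sigma> = (\<Sum>\<tau>\<in>{rg \<sigma>}. b \<tau> * f (iv \<tau> \<cdot> \<sigma>))"
  proof (rule conv_eq_sum[OF diagonal_row_finite[OF b] f \<sigma>])
    show "finite {rg \<sigma>}" "{rg \<sigma>} \<subseteq> arr" "inj_on q {rg \<sigma>}" using \<sigma> by simp_all
    show "rg \<tau> = rg \<sigma>" if "\<tau> \<in> {rg \<sigma>}" for \<tau> using that \<sigma> by simp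
    fix \<tau> assume *: "\<tau> \<in> arr" "rg \<tau> = rg \<sigma>" "b \<tau> \<noteq> 0"
    then have "q \<tau> \<in> g_units G" using b by (simp add: diagonal_def)
    then have "q \<tau> = q (rg \<tau>)" using * by (metis G.unit_rng q_rg)
    then show "q \<tau> \<in> q ` {rg \<sigma>}" using * by simp
  qed
  then show ?thesis using \<sigma> by simp
qed

text \<open>A summand survives only if \<open>iv \<tau> \<cdot> \<sigma>\<close> lies over a unit,
  which forces \<open>q \<tau> = q \<sigma>\<close>.\<close>

lemma conv_diagonal_right:
  assumes b: "b \<in> diagonal" and f: "f \<in> row_finite" and \<sigma>: "\<sigma> \<in> arr"
  shows "(f \<star> b) \<sigma> = f \<sigma> * b (sr \<sigma>)"
proof -
  have "(f \<star> b) \<sigma> = (\<Sum>\<tau>\<in>{\<sigma>}. f \<tau> * b (iv \<tau> \<cdot> \<sigma>))"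
  proof (rule conv_eq_sum[OF f diagonal_equivariant[OF b] \<sigma>])
    show "finite {\<sigma>}" "{\<sigma>} \<subseteq> arr" "inj_on q {\<sigma>}" using \<sigma> by simp_all
    show "rg \<tau> = rg \<sigma>" if "\<tau> \<in> {\<sigma>}" for \<tau> using that by simp
    fix \<tau> assume *: "\<tau> \<in> arr" "rg \<tau> = rg \<sigma>" "b (iv \<tau> \<cdot> \<sigma>) \<noteq> 0"
    then have "q (iv \<tau> \<cdot> \<sigma>) \<in> g_units G" using b \<sigma> by (simp add: diagonal_def del: q_mul)
    moreover have "q (iv \<tau> \<cdot> \<sigma>) = g_mul G (g_inv G (q \<tau>)) (q \<sigma>)" using * \<sigma> by simp
    moreover have "g_rng G (q \<tau>) = g_rng G (q \<sigma>)" using rg_eq_iff[OF *(1) \<sigma>] *(2) by blast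
    ultimately have "q \<tau> = q \<sigma>"
      using G.inv_mul_unitD[OF q_arr[OF *(1)] q_arr[OF \<sigma>]] by metis
    then show "q \<tau> \<in> q ` {\<sigma>}" by simp
  qed
  then show ?thesis by simp
qed

end

section \<open>Topological groupoids\<close>

lemma local_homeo_open_map:
  assumes "local_homeo X Y f" shows "open_map X Y f"
  unfolding open_map_def
proof (intro allI impI)
  fix A assume A: "openin X A"
  have "\<exists>T. openin Y T \<and> y \<in> T \<and> T \<subseteq> f ` A" if y: "y \<in> f ` A" for y
  proof -
    obtain x where x: "x \<in> A" "y = f x" using y by (auto simp: image_iff)
    then have "x \<in> topspace X" using A openin_subset by blast
    then obtain U where U: "openin X U" "x \<in> U" "openin Y (f ` U)"
      "homeomorphic_map (subtopology X U) (subtopology Y (f ` U)) f"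
      using assms unfolding local_homeo_def by blast
    have "openin (subtopology X U) (U \<inter> A)" using A openin_subtopology_Int2 by blast
    then have "openin (subtopology Y (f ` U)) (f ` (U \<inter> A))"
      using homeomorphic_imp_open_map[OF U(4)] unfolding open_map_def by blast
    then have "openin Y (f ` (U \<inter> A))" using U(3) openin_trans_full by blast
    then show ?thesis using x U(2) by blast
  qed
  then show "openin Y (f ` A)" using openin_subopen by blast
qed

text \<open>Supplies the continuous local inverses of \<open>q\<close> and of the range
  maps.\<close>

lemma continuous_inj_open_homeomorphic:
  assumes f: "continuous_map X Y f" and o: "open_map X Y f" and U: "openin X U" and i: "inj_on f U"
  shows "homeomorphic_map (subtopology X U) (subtopology Y (f ` U)) f"
proof (rule bijective_open_imp_homeomorphic_map)
  have UX: "U \<subseteq> topspace X" using U openin_subset by blast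
  show "continuous_map (subtopology X U) (subtopology Y (f ` U)) f"
    using f UX by (intro continuous_map_into_subtopology continuous_map_from_subtopology) auto
  show "open_map (subtopology X U) (subtopology Y (f ` U)) f"
    unfolding open_map_def
  proof (intro allI impI)
    fix V assume "openin (subtopology X U) V"
    then have V: "openin X V" "V \<subseteq> U" using U by (simp_all add: openin_open_subtopology)
    then have "openin Y (f ` V)" using o by (simp add: open_map_def)
    then have "openin (subtopology Y (f ` U)) (f ` U \<inter> f ` V)" by (rule openin_subtopology_Int2)
    moreover have "f ` U \<inter> f ` V = f ` V" using V(2) by blast
    ultimately show "openin (subtopology Y (f ` U)) (f ` V)" by simp
  qed
  have "f ` U \<subseteq> topspace Y" using f UX continuous_map_image_subset_topspace by blast
  then show "f ` topspace (subtopology X U) = topspace (subtopology Y (f ` U))"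
    using UX by (simp add: Int_absorb1)
  show "inj_on f (topspace (subtopology X U))" using UX i by (simp add: Int_absorb1)
qed

locale top_groupoid =
  fixes G :: "'g groupoid"
  assumes topological: "topological_groupoid G"
begin

sublocale alg_groupoid G
  using topological unfolding topological_groupoid_def by unfold_locales blast

lemma continuous_inv: "continuous_map (g_top G) (g_top G) (g_inv G)"
  using topological unfolding topological_groupoid_def by blast

lemma continuous_mul:
  assumes f: "continuous_map X (g_top G) f" and g: "continuous_map X (g_top G) g"
    and comp: "\<And>x. x \<in> topspace X \<Longrightarrow> g_src G (f x) = g_rng G (g x)"
  shows "continuous_map X (g_top G) (\<lambda>x. g_mul G (f x) (g x))"
proof -
  have "(f x, g x) \<in> g_comp G" if "x \<in> topspace X" for x
    using comp[OF that] that f g comp_iff continuous_map_image_subset_topspace by blast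
  then have "continuous_map X (subtopology (prod_topology (g_top G) (g_top G)) (g_comp G)) (\<lambda>x. (f x, g x))"
    using f g by (intro continuous_map_into_subtopology) (auto simp: continuous_map_paired)
  from continuous_map_compose[OF this] topological show ?thesis
    unfolding topological_groupoid_def by (fastforce simp: o_def)
qed

lemma continuous_rng: "continuous_map (g_top G) (g_top G) (g_rng G)"
proof -
  have "continuous_map (g_top G) (g_top G) (\<lambda>x. g_mul G x (g_inv G x))"
    by (rule continuous_mul) (use continuous_inv continuous_map_id in \<open>auto simp: id_def\<close>)
  then show ?thesis by simp
qed

lemma continuous_src: "continuous_map (g_top G) (g_top G) (g_src G)"
proof -
  have "continuous_map (g_top G) (g_top G) (\<lambda>x. g_mul G (g_inv G x) x)"
    by (rule continuous_mul) (use continuous_inv continuous_map_id in \<open>auto simp: id_def\<close>)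
  then show ?thesis by simp
qed

lemma open_inv_image: assumes "openin (g_top G) U" shows "openin (g_top G) (g_inv G ` U)"
proof -
  have "g_inv G ` U = {x \<in> g_arr G. g_inv G x \<in> U}"
    using openin_subset[OF assms] by (force simp: image_iff)
  then show ?thesis using openin_continuous_map_preimage[OF continuous_inv assms] by simp
qed

lemma compact_inv_image: "compactin (g_top G) K \<Longrightarrow> compactin (g_top G) (g_inv G ` K)"
  using image_compactin continuous_inv by blast

text \<open>An arrow and its range have the same range. If both lie in a set where the range map is
  injective they coincide, and near a unit both do.\<close>

lemma open_units:
  assumes "\<And>u. u \<in> g_units G \<Longrightarrow> \<exists>U. openin (g_top G) U \<and> u \<in> U \<and> inj_on (g_rng G) U"
  shows "openin (g_top G) (g_units G)"
proof (subst openin_subopen, intro ballI)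
  fix u assume u: "u \<in> g_units G"
  then obtain U where U: "openin (g_top G) U" "u \<in> U" "inj_on (g_rng G) U" using assms by blast
  let ?T = "{a \<in> U. g_rng G a \<in> U}"
  have "openin (g_top G) ?T"
    using openin_continuous_map_preimage_gen[OF continuous_rng U(1) U(1)] .
  moreover have "u \<in> ?T" using u U by simp
  moreover have "?T \<subseteq> g_units G"
  proof
    fix a assume a: "a \<in> ?T"
    then have "a \<in> g_arr G" using openin_subset[OF U(1)] by blast
    then have "g_rng G a = a" using a inj_onD[OF U(3), of "g_rng G a" a] by simp
    then show "a \<in> g_units G" using rng_units[OF \<open>a \<in> g_arr G\<close>] by simp
  qed
  ultimately show "\<exists>T. openin (g_top G) T \<and> u \<in> T \<and> T \<subseteq> g_units G" by blast
qed

lemma closed_units: assumes "Hausdorff_space (g_top G)" shows "closedin (g_top G) (g_units G)"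
proof -
  have *: "g_units G = {a \<in> g_arr G. g_rng G a = id a}"
    unfolding id_apply using units_iff_rng by blast
  show ?thesis
    unfolding * by (rule closedin_continuous_maps_eq[OF assms continuous_rng continuous_map_id])
qed

text \<open>In a Hausdorff groupoid the composable pairs are the equaliser of two continuous maps,
  hence closed, so the composable part of \<open>K \<times> L\<close> is compact.\<close>

lemma compact_setmul:
  assumes H: "Hausdorff_space (g_top G)" and K: "compactin (g_top G) K" and L: "compactin (g_top G) L"
  shows "compactin (g_top G) {g_mul G a b | a b. a \<in> K \<and> b \<in> L \<and> g_src G a = g_rng G b}"
proof -
  let ?P = "prod_topology (g_top G) (g_top G)"
  have "closedin ?P {p \<in> topspace ?P. (g_src G \<circ> fst) p = (g_rng G \<circ> snd) p}"
    by (rule closedin_continuous_maps_eq[OF H continuous_map_compose[OF continuous_map_fst continuous_src]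
          continuous_map_compose[OF continuous_map_snd continuous_rng]])
  moreover have "g_comp G = {p \<in> topspace ?P. (g_src G \<circ> fst) p = (g_rng G \<circ> snd) p}"
    by (auto simp: comp_iff)
  ultimately have c: "closedin ?P (g_comp G)" by simp
  have KL: "compactin ?P (K \<times> L)" using K L by (simp add: compactin_Times)
  have "compactin (subtopology ?P (g_comp G)) (g_comp G \<inter> K \<times> L)"
    using closed_Int_compactin[OF c KL] by (simp add: compactin_subtopology)
  then have "compactin (g_top G) ((\<lambda>(a, b). g_mul G a b) ` (g_comp G \<inter> K \<times> L))"
    using image_compactin topological unfolding topological_groupoid_def by blast
  moreover have "g_comp G \<inter> K \<times> L = {(a, b). a \<in> K \<and> b \<in> L \<and> g_src G a = g_rng G b}"
    using compactin_subset_topspace[OF K] compactin_subset_topspace[OF L]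
    by (auto simp: comp_iff)
  then have "(\<lambda>(a, b). g_mul G a b) ` (g_comp G \<inter> K \<times> L) =
      {g_mul G a b | a b. a \<in> K \<and> b \<in> L \<and> g_src G a = g_rng G b}"
    by force
  ultimately show ?thesis by simp
qed

end

lemma bisection_injD:
  assumes "bisection H D" "D \<subseteq> g_arr H" shows "inj_on (g_rng H) D" "inj_on (g_src H) D"
proof -
  obtain W where W: "D \<subseteq> W" "openin (g_top H) W"
    "homeomorphic_map (subtopology (g_top H) W) (subtopology (unit_space H) (g_rng H ` W)) (g_rng H)"
    "homeomorphic_map (subtopology (g_top H) W) (subtopology (unit_space H) (g_src H ` W)) (g_src H)"
    using assms unfolding bisection_def by auto
  show "inj_on (g_rng H) D" "inj_on (g_src H) D"
    using homeomorphic_imp_injective_map[OF W(3)] homeomorphic_imp_injective_map[OF W(4)]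
      openin_subset[OF W(2)] W(1) inj_on_subset by (auto simp: Int_absorb1)
qed

section \<open>Ample twists\<close>

context twist
begin

sublocale TG: top_groupoid G
  by unfold_locales (rule top_groupoid_G)

sublocale TS: top_groupoid \<Sigma>
  by unfold_locales (rule top_groupoid_S)

lemma open_map_rng: "open_map (g_top G) (unit_space G) (g_rng G)"
  using local_homeo_open_map[OF local_homeo_rng] .

lemma ex_open_inj_rng:
  assumes "\<alpha> \<in> g_arr G"
  obtains U where "openin (g_top G) U" "\<alpha> \<in> U" "inj_on (g_rng G) U"
proof -
  obtain U where U: "openin (g_top G) U" "\<alpha> \<in> U"
    "homeomorphic_map (subtopology (g_top G) U) (subtopology (unit_space G) (g_rng G ` U)) (g_rng G)"
    using local_homeo_rng assms unfolding local_homeo_def by blast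
  have "inj_on (g_rng G) U"
    using homeomorphic_imp_injective_map[OF U(3)] openin_subset[OF U(1)] by (simp add: Int_absorb1)
  then show ?thesis using U that by blast
qed

lemma open_units_G: "openin (g_top G) (g_units G)"
  by (rule TG.open_units) (metis ex_open_inj_rng G.units_arr)

text \<open>The range map is locally injective, so its fibres are discrete and a compact set meets
  each in finitely many arrows. This puts the Steinberg algebra inside
  \<open>row_finite\<close>.\<close>

lemma finite_compact_fibre:
  assumes K: "compactin (g_top G) K" shows "finite {\<alpha> \<in> K. g_rng G \<alpha> = x}"
proof -
  let ?U = "{U. openin (g_top G) U \<and> inj_on (g_rng G) U}"
  have "K \<subseteq> \<Union>?U"
    using compactin_subset_topspace[OF K] ex_open_inj_rng by blast
  then obtain F where F: "finite F" "F \<subseteq> ?U" "K \<subseteq> \<Union>F"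
    using compactinD[OF K, of ?U] by blast
  have "finite {\<alpha> \<in> U. g_rng G \<alpha> = x}" if "U \<in> F" for U
  proof -
    have "inj_on (g_rng G) {\<alpha> \<in> U. g_rng G \<alpha> = x}"
      using that F(2) by (auto intro: inj_on_subset)
    moreover have "finite (g_rng G ` {\<alpha> \<in> U. g_rng G \<alpha> = x})"
      by (rule finite_subset[of _ "{x}"]) auto
    ultimately show ?thesis using finite_imageD by blast
  qed
  then have "finite (\<Union>U\<in>F. {\<alpha> \<in> U. g_rng G \<alpha> = x})" using F(1) by blast
  moreover have "{\<alpha> \<in> K. g_rng G \<alpha> = x} \<subseteq> (\<Union>U\<in>F. {\<alpha> \<in> U. g_rng G \<alpha> = x})" using F(3) by blast
  ultimately show ?thesis using finite_subset by blast
qed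

lemma local_trivialisation:
  assumes "\<alpha> \<in> g_arr G"
  obtains D P where "\<alpha> \<in> D" "openin (g_top G) D" "bisection G D"
    "continuous_map (subtopology (g_top G) D) (g_top \<Sigma>) P" "\<And>\<beta>. \<beta> \<in> D \<Longrightarrow> q (P \<beta>) = \<beta>"
    "homeomorphic_map (prod_topology (subtopology (g_top G) D) (discrete_topology ring_units))
      (subtopology (g_top \<Sigma>) {\<sigma> \<in> arr. q \<sigma> \<in> D}) (\<lambda>(\<beta>, t). g_mul \<Sigma> (i (g_rng G \<beta>, t)) (P \<beta>))"
proof -
  have "\<forall>\<alpha> \<in> g_arr G. \<exists>D P.
      \<alpha> \<in> D \<and> openin (g_top G) D \<and> bisection G D \<and>
      continuous_map (subtopology (g_top G) D) (g_top \<Sigma>) P \<and>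
      (\<forall>\<beta> \<in> D. q (P \<beta>) = \<beta>) \<and>
      homeomorphic_map
        (prod_topology (subtopology (g_top G) D) (discrete_topology ring_units))
        (subtopology (g_top \<Sigma>) {\<sigma> \<in> g_arr \<Sigma>. q \<sigma> \<in> D})
        (\<lambda>(\<beta>, t). g_mul \<Sigma> (i (g_rng G \<beta>, t)) (P \<beta>))"
    using twist unfolding discrete_twist_def by (elim conjE)
  from bspec[OF this assms] show ?thesis using that by blast
qed

text \<open>By (DT2), \<open>\<Sigma>\<close> is locally a disjoint union of open sheets over \<open>G\<close>.\<close>

lemma sheet:
  assumes V: "openin (g_top \<Sigma>) V" and \<sigma>: "\<sigma> \<in> V"
  obtains D s where "openin (g_top G) D" "q \<sigma> \<in> D" "inj_on (g_rng G) D" "inj_on (g_src G) D"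
    "continuous_map (subtopology (g_top G) D) (g_top \<Sigma>) s" "\<And>\<beta>. \<beta> \<in> D \<Longrightarrow> s \<beta> \<in> V"
    "\<And>\<beta>. \<beta> \<in> D \<Longrightarrow> q (s \<beta>) = \<beta>" "s (q \<sigma>) = \<sigma>"
    "\<And>E. openin (g_top G) E \<Longrightarrow> E \<subseteq> D \<Longrightarrow> openin (g_top \<Sigma>) (s ` E)"
proof -
  have sa: "\<sigma> \<in> arr" using assms openin_subset by blast
  obtain D P where D: "q \<sigma> \<in> D" "openin (g_top G) D" "bisection G D"
    "continuous_map (subtopology (g_top G) D) (g_top \<Sigma>) P" "\<And>\<beta>. \<beta> \<in> D \<Longrightarrow> q (P \<beta>) = \<beta>"
    "homeomorphic_map (prod_topology (subtopology (g_top G) D) (discrete_topology ring_units))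
      (subtopology (g_top \<Sigma>) {\<sigma> \<in> arr. q \<sigma> \<in> D}) (\<lambda>(\<beta>, t). g_mul \<Sigma> (i (g_rng G \<beta>, t)) (P \<beta>))"
    using local_trivialisation[OF q_arr[OF sa]] by blast
  let ?\<phi> = "\<lambda>(\<beta>, t). g_mul \<Sigma> (i (g_rng G \<beta>, t)) (P \<beta>)"
  have Dsub: "D \<subseteq> g_arr G" using D(2) openin_subset by blast
  have PD: "P \<beta> \<in> arr" if "\<beta> \<in> D" for \<beta>
    using D(4) that Dsub unfolding continuous_map_def by (auto simp: Int_absorb1)
  have \<phi>: "?\<phi> (\<beta>, t) = t \<odot> P \<beta>" if "\<beta> \<in> D" for \<beta> t
    using that PD[OF that] D(5)[OF that] by (simp add: act_def)
  have oD: "openin (g_top \<Sigma>) {\<sigma> \<in> arr. q \<sigma> \<in> D}"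
    using openin_continuous_map_preimage[OF continuous_q D(2)] .
  have "\<sigma> \<in> ?\<phi> ` (D \<times> ring_units)"
    using homeomorphic_imp_surjective_map[OF D(6)] Dsub sa D(1) openin_subset[OF oD]
    by (simp add: Int_absorb1)
  then obtain \<beta> t where bs: "\<beta> \<in> D" "t dvd 1" "\<sigma> = t \<odot> P \<beta>" using \<phi> by auto
  have q\<sigma>: "q \<sigma> = \<beta>" using bs PD D(5) by simp
  \<comment> \<open>The scalar \<open>t\<close> singles out, among the translates of the local
    section \<open>P\<close>, the one that passes through \<open>\<sigma>\<close>.\<close>
  define s where "s = (\<lambda>\<beta>. ?\<phi> (\<beta>, t))"
  have s: "s \<beta> = t \<odot> P \<beta>" if "\<beta> \<in> D" for \<beta> using \<phi>[OF that] by (simp add: s_def)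
  have cs: "continuous_map (subtopology (g_top G) D) (g_top \<Sigma>) s"
  proof -
    have "continuous_map (subtopology (g_top G) D)
        (prod_topology (subtopology (g_top G) D) (discrete_topology ring_units)) (\<lambda>\<beta>. (\<beta>, t))"
      using bs by (simp add: continuous_map_paired)
    moreover have "continuous_map (prod_topology (subtopology (g_top G) D) (discrete_topology ring_units))
        (g_top \<Sigma>) ?\<phi>"
      using homeomorphic_imp_continuous_map[OF D(6)] continuous_map_in_subtopology by blast
    ultimately show ?thesis unfolding s_def using continuous_map_compose by (fastforce simp: o_def)
  qed
  have os: "openin (g_top \<Sigma>) (s ` E)" if E: "openin (g_top G) E" "E \<subseteq> D" for E
  proof -
    have "openin (prod_topology (subtopology (g_top G) D) (discrete_topology ring_units)) (E \<times> {t})"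
      using E D(2) bs by (simp add: openin_prod_Times_iff openin_open_subtopology)
    then have "openin (subtopology (g_top \<Sigma>) {\<sigma> \<in> arr. q \<sigma> \<in> D}) (?\<phi> ` (E \<times> {t}))"
      using homeomorphic_imp_open_map[OF D(6)] unfolding open_map_def by blast
    then have "openin (g_top \<Sigma>) (?\<phi> ` (E \<times> {t}))" using oD openin_trans_full by blast
    moreover have "?\<phi> ` (E \<times> {t}) = s ` E" unfolding s_def by auto
    ultimately show ?thesis by simp
  qed
  define D' where "D' = {\<beta> \<in> D. s \<beta> \<in> V}"
  have "openin (subtopology (g_top G) D) {\<beta> \<in> topspace (subtopology (g_top G) D). s \<beta> \<in> V}"
    by (rule openin_continuous_map_preimage[OF cs V])
  then have oD': "openin (g_top G) D'"
    using D(2) Dsub unfolding D'_def by (simp add: openin_open_subtopology Int_absorb1)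
  show ?thesis
  proof (rule that[of D' s])
    show "q \<sigma> \<in> D'" using D(1) \<sigma> s[OF D(1)] bs q\<sigma> by (simp add: D'_def)
    show "inj_on (g_rng G) D'" "inj_on (g_src G) D'"
      using bisection_injD[OF D(3) Dsub] by (auto simp: D'_def intro: inj_on_subset)
    show "continuous_map (subtopology (g_top G) D') (g_top \<Sigma>) s"
      using cs by (rule continuous_map_from_subtopology_mono) (auto simp: D'_def)
    show "q (s \<beta>) = \<beta>" if "\<beta> \<in> D'" for \<beta>
      using that s PD D(5) bs by (auto simp: D'_def)
    show "s (q \<sigma>) = \<sigma>" using q\<sigma> s bs by simp
  qed (use oD' os in \<open>auto simp: D'_def\<close>)
qed

lemma open_map_q: "open_map (g_top \<Sigma>) (g_top G) q"
  unfolding open_map_def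
proof (intro allI impI)
  fix V assume V: "openin (g_top \<Sigma>) V"
  show "openin (g_top G) (q ` V)"
  proof (subst openin_subopen, intro ballI)
    fix \<alpha> assume "\<alpha> \<in> q ` V"
    then obtain \<sigma> where s: "\<sigma> \<in> V" "\<alpha> = q \<sigma>" by blast
    obtain D s where "openin (g_top G) D" "q \<sigma> \<in> D" "\<And>\<beta>. \<beta> \<in> D \<Longrightarrow> s \<beta> \<in> V" "\<And>\<beta>. \<beta> \<in> D \<Longrightarrow> q (s \<beta>) = \<beta>"
      using sheet[OF V s(1)] by metis
    then show "\<exists>T. openin (g_top G) T \<and> \<alpha> \<in> T \<and> T \<subseteq> q ` V"
      using s by (metis image_eqI subsetI)
  qed
qed

lemma continuous_act: assumes "t dvd 1" shows "continuous_map (g_top \<Sigma>) (g_top \<Sigma>) (\<lambda>\<sigma>. t \<odot> \<sigma>)"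
proof -
  have 1: "continuous_map (g_top \<Sigma>) (g_top \<Sigma>) (\<lambda>\<sigma>. i (g_rng G (q \<sigma>), t))"
  proof -
    have "continuous_map (g_top \<Sigma>) (unit_space G) (\<lambda>\<sigma>. g_rng G (q \<sigma>))"
      using continuous_map_compose[OF continuous_q TG.continuous_rng]
      by (intro continuous_map_into_subtopology) (auto simp: o_def)
    then have "continuous_map (g_top \<Sigma>) (g_top (trivial_bundle G)) (\<lambda>\<sigma>. (g_rng G (q \<sigma>), t))"
      using assms by (simp add: trivial_bundle_def continuous_map_paired)
    from continuous_map_compose[OF this continuous_i] show ?thesis by (simp add: o_def)
  qed
  have "continuous_map (g_top \<Sigma>) (g_top \<Sigma>) (\<lambda>\<sigma>. i (g_rng G (q \<sigma>), t) \<cdot> \<sigma>)"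
    by (rule TS.continuous_mul[OF 1]) (use assms continuous_map_id in \<open>auto simp: id_def\<close>)
  then show ?thesis
    by (rule continuous_map_eq) (simp add: act_def)
qed

lemma open_act_image:
  assumes "t dvd 1" "openin (g_top \<Sigma>) V" shows "openin (g_top \<Sigma>) ((\<lambda>\<sigma>. t \<odot> \<sigma>) ` V)"
proof -
  have "(\<lambda>\<sigma>. t \<odot> \<sigma>) ` V = {\<sigma> \<in> arr. unit_inv t \<odot> \<sigma> \<in> V}"
  proof (intro equalityI subsetI)
    fix \<sigma> assume "\<sigma> \<in> {\<sigma> \<in> arr. unit_inv t \<odot> \<sigma> \<in> V}"
    then have "\<sigma> = t \<odot> (unit_inv t \<odot> \<sigma>)" "unit_inv t \<odot> \<sigma> \<in> V" using assms by simp_all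
    then show "\<sigma> \<in> (\<lambda>\<sigma>. t \<odot> \<sigma>) ` V" by blast
  qed (use assms openin_subset[OF assms(2)] in \<open>auto simp: subset_iff\<close>)
  then show ?thesis
    using openin_continuous_map_preimage[OF continuous_act assms(2)] assms(1) by simp
qed

text \<open>The range map of \<open>\<Sigma>\<close> is \<open>q\<close>, then the range map of
  \<open>G\<close>, then the inverse of the homeomorphism of unit spaces; all three are
  open.\<close>

lemma open_map_rg: "open_map (g_top \<Sigma>) (unit_space \<Sigma>) rg"
  unfolding open_map_def
proof (intro allI impI)
  fix V assume V: "openin (g_top \<Sigma>) V"
  have Va: "V \<subseteq> arr" using V openin_subset by blast
  have "openin (unit_space G) (g_rng G ` q ` V)"
    using V open_map_q open_map_rng unfolding open_map_def by blast
  then have "openin (unit_space \<Sigma>) {u \<in> topspace (unit_space \<Sigma>). q u \<in> g_rng G ` q ` V}"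
    using openin_continuous_map_preimage homeomorphic_imp_continuous_map[OF homeo_q_units] by blast
  moreover have "{u \<in> topspace (unit_space \<Sigma>). q u \<in> g_rng G ` q ` V} = rg ` V"
  proof (intro equalityI subsetI)
    fix u assume "u \<in> {u \<in> topspace (unit_space \<Sigma>). q u \<in> g_rng G ` q ` V}"
    then obtain \<sigma> where "u \<in> g_units \<Sigma>" "\<sigma> \<in> V" "q u = g_rng G (q \<sigma>)" by auto
    then have "u = rg \<sigma>" using units_eq_iff[of u "rg \<sigma>"] Va by auto
    then show "u \<in> rg ` V" using \<open>\<sigma> \<in> V\<close> by blast
  qed (use Va in auto)
  ultimately show "openin (unit_space \<Sigma>) (rg ` V)" by simp
qed

lemma open_map_sr: "open_map (g_top \<Sigma>) (unit_space \<Sigma>) sr"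
  unfolding open_map_def
proof (intro allI impI)
  fix V assume V: "openin (g_top \<Sigma>) V"
  then have "openin (unit_space \<Sigma>) (rg ` iv ` V)"
    using TS.open_inv_image open_map_rg unfolding open_map_def by blast
  moreover have "rg ` iv ` V = sr ` V"
    using openin_subset[OF V] by (force simp: image_iff)
  ultimately show "openin (unit_space \<Sigma>) (sr ` V)" by simp
qed

text \<open>Range and source are continuous open maps, so on an open set injectivity already makes
  them homeomorphisms onto open images; \<open>Y\<close> is its own witness.\<close>

lemma bisection_iff:
  assumes "openin (g_top \<Sigma>) Y"
  shows "bisection \<Sigma> Y \<longleftrightarrow> inj_on rg Y \<and> inj_on sr Y"
proof
  have Y: "Y \<subseteq> arr" using assms openin_subset by blast
  show "inj_on rg Y \<and> inj_on sr Y" if "bisection \<Sigma> Y" using bisection_injD[OF that Y] by blast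
  assume inj: "inj_on rg Y \<and> inj_on sr Y"
  have c: "continuous_map (g_top \<Sigma>) (unit_space \<Sigma>) rg" "continuous_map (g_top \<Sigma>) (unit_space \<Sigma>) sr"
    using TS.continuous_rng TS.continuous_src by (auto intro!: continuous_map_into_subtopology)
  show "bisection \<Sigma> Y"
    unfolding bisection_def
    using continuous_inj_open_homeomorphic[OF c(1) open_map_rg assms]
      continuous_inj_open_homeomorphic[OF c(2) open_map_sr assms] inj assms open_map_rg open_map_sr
    by (intro exI[of _ Y]) (auto simp: open_map_def)
qed

end

locale ample_twist = twist G \<Sigma> i q
  for G :: "'g groupoid" and \<Sigma> :: "'s groupoid"
    and i :: "'g \<times> 'r::comm_ring_1 \<Rightarrow> 's" and q :: "'s \<Rightarrow> 'g" +
  assumes Hausdorff_G: "Hausdorff_space (g_top G)"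
    and zero_dim: "\<lbrakk>openin (unit_space G) W; x \<in> W\<rbrakk> \<Longrightarrow>
      \<exists>K. compactin (g_top G) K \<and> openin (unit_space G) K \<and> x \<in> K \<and> K \<subseteq> W"
begin

text \<open>Arrows over different points are separated in \<open>G\<close>. Two lifts of the same
  arrow differ by a scalar \<open>t \<noteq> 1\<close>, and by freeness the sheet through one and
  its translate by \<open>t\<close> are disjoint.\<close>

lemma Hausdorff_S: "Hausdorff_space (g_top \<Sigma>)"
  unfolding Hausdorff_space_def
proof (intro allI impI, elim conjE)
  fix \<sigma> \<tau> assume *: "\<sigma> \<in> arr" "\<tau> \<in> arr" "\<sigma> \<noteq> \<tau>"
  show "\<exists>U V. openin (g_top \<Sigma>) U \<and> openin (g_top \<Sigma>) V \<and> \<sigma> \<in> U \<and> \<tau> \<in> V \<and> disjnt U V"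
  proof (cases "q \<sigma> = q \<tau>")
    case False
    then obtain U V where UV: "openin (g_top G) U" "openin (g_top G) V" "q \<sigma> \<in> U" "q \<tau> \<in> V" "disjnt U V"
      using Hausdorff_G * q_arr unfolding Hausdorff_space_def by metis
    have "disjnt {\<sigma> \<in> arr. q \<sigma> \<in> U} {\<sigma> \<in> arr. q \<sigma> \<in> V}" using UV(5) by (auto simp: disjnt_def)
    then show ?thesis
      using openin_continuous_map_preimage[OF continuous_q UV(1)]
        openin_continuous_map_preimage[OF continuous_q UV(2)] UV * by (metis (mono_tags, lifting) mem_Collect_eq)
  next
    case True
    then obtain t where t: "t dvd 1" "\<tau> = t \<odot> \<sigma>" using q_eqE * by metis
    obtain D s where D: "openin (g_top G) D" "q \<sigma> \<in> D" "\<And>\<beta>. \<beta> \<in> D \<Longrightarrow> s \<beta> \<in> arr"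
      "\<And>\<beta>. \<beta> \<in> D \<Longrightarrow> q (s \<beta>) = \<beta>" "s (q \<sigma>) = \<sigma>"
      "\<And>E. openin (g_top G) E \<Longrightarrow> E \<subseteq> D \<Longrightarrow> openin (g_top \<Sigma>) (s ` E)"
      using sheet[OF openin_topspace *(1)] by metis
    have o: "openin (g_top \<Sigma>) (s ` D)" using D by blast
    have "disjnt (s ` D) ((\<lambda>\<sigma>. t \<odot> \<sigma>) ` s ` D)"
    proof (rule ccontr)
      assume "\<not> disjnt (s ` D) ((\<lambda>\<sigma>. t \<odot> \<sigma>) ` s ` D)"
      then obtain a b where ab: "a \<in> D" "b \<in> D" "s a = t \<odot> s b" by (auto simp: disjnt_def)
      then have "a = b" using D(3,4) q_act[of "s b" t] t by metis
      then have "1 \<odot> s b = t \<odot> s b" using ab D(3) by simp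
      then have "1 = t" using act_free[OF D(3)[OF ab(2)] _ t(1), of 1] by simp
      then show False using t * by simp
    qed
    moreover have "\<sigma> \<in> s ` D" using D(2,5) by (metis image_eqI)
    moreover have "\<tau> \<in> (\<lambda>\<sigma>. t \<odot> \<sigma>) ` s ` D" using t(2) D(2,5) by (metis image_eqI)
    ultimately show ?thesis using o open_act_image[OF t(1) o] by blast
  qed
qed

section \<open>Compact open bisections of the twist and their products\<close>

definition cobis :: "'s set \<Rightarrow> bool" where
  "cobis Y \<longleftrightarrow> compactin (g_top \<Sigma>) Y \<and> openin (g_top \<Sigma>) Y \<and> inj_on rg Y \<and> inj_on sr Y"

lemma compact_open_bisection_iff: "compact_open_bisection \<Sigma> Y \<longleftrightarrow> cobis Y"
  unfolding compact_open_bisection_def cobis_def using bisection_iff by blast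

text \<open>A sheet over \<open>D\<close> is cut down to the arrows with range in a compact open set
  \<open>K\<close> of units. The local inverse of the range map followed by the section carries
  \<open>K\<close> onto the piece, which is therefore compact.\<close>

lemma cobis_basis:
  assumes V: "openin (g_top \<Sigma>) V" and \<sigma>: "\<sigma> \<in> V"
  obtains Y where "cobis Y" "\<sigma> \<in> Y" "Y \<subseteq> V"
proof -
  have sa: "\<sigma> \<in> arr" using assms openin_subset by blast
  obtain D s where D: "openin (g_top G) D" "q \<sigma> \<in> D" "inj_on (g_rng G) D" "inj_on (g_src G) D"
    "continuous_map (subtopology (g_top G) D) (g_top \<Sigma>) s" "\<And>\<beta>. \<beta> \<in> D \<Longrightarrow> s \<beta> \<in> V"
    "\<And>\<beta>. \<beta> \<in> D \<Longrightarrow> q (s \<beta>) = \<beta>" "s (q \<sigma>) = \<sigma>"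
    "\<And>E. openin (g_top G) E \<Longrightarrow> E \<subseteq> D \<Longrightarrow> openin (g_top \<Sigma>) (s ` E)"
    using sheet[OF assms] by metis
  have Da: "D \<subseteq> g_arr G" using D(1) openin_subset by blast
  have Va: "V \<subseteq> arr" using V openin_subset by blast
  have c: "continuous_map (g_top G) (unit_space G) (g_rng G)"
    using TG.continuous_rng by (auto intro!: continuous_map_into_subtopology)
  have oD: "openin (unit_space G) (g_rng G ` D)" using D(1) open_map_rng by (simp add: open_map_def)
  then obtain K where K: "compactin (g_top G) K" "openin (unit_space G) K" "g_rng G (q \<sigma>) \<in> K" "K \<subseteq> g_rng G ` D"
    using zero_dim[OF oD] D(2) by blast
  define E where "E = {\<beta> \<in> D. g_rng G \<beta> \<in> K}"
  have E: "openin (g_top G) E" "E \<subseteq> D"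
    using openin_continuous_map_preimage_gen[OF c D(1) K(2)] unfolding E_def by auto
  obtain g where g: "homeomorphic_maps (subtopology (g_top G) D) (subtopology (unit_space G) (g_rng G ` D)) (g_rng G) g"
    using continuous_inj_open_homeomorphic[OF c open_map_rng D(1,3)] homeomorphic_map_maps by blast
  have gr: "g (g_rng G \<beta>) = \<beta>" if "\<beta> \<in> D" for \<beta>
    using g that Da unfolding homeomorphic_maps_def by auto
  have "E = g ` K"
  proof (intro equalityI subsetI)
    fix \<beta> assume "\<beta> \<in> E"
    then show "\<beta> \<in> g ` K" using gr unfolding E_def by (metis (mono_tags, lifting) image_eqI mem_Collect_eq)
  next
    fix \<beta> assume "\<beta> \<in> g ` K"
    then obtain x where x: "x \<in> K" "\<beta> = g x" by blast
    then obtain \<gamma> where "\<gamma> \<in> D" "x = g_rng G \<gamma>" using K(4) by blast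
    then show "\<beta> \<in> E" using x gr unfolding E_def by simp
  qed
  moreover have "compactin (subtopology (unit_space G) (g_rng G ` D)) K"
    using K openin_subset[OF K(2)] by (simp add: compactin_subtopology)
  ultimately have "compactin (subtopology (g_top G) D) E"
    using g image_compactin unfolding homeomorphic_maps_def by metis
  then have "compactin (g_top \<Sigma>) (s ` E)" using image_compactin D(5) by blast
  moreover have "openin (g_top \<Sigma>) (s ` E)" using D(9) E by blast
  moreover have sE: "s \<beta> \<in> arr" "q (s \<beta>) = \<beta>" if "\<beta> \<in> E" for \<beta> using that E D(6,7) Va by auto
  moreover have "inj_on rg (s ` E)"
  proof (rule inj_onI)
    fix a b assume "a \<in> s ` E" "b \<in> s ` E" "rg a = rg b"
    then obtain x y where *: "x \<in> E" "y \<in> E" "a = s x" "b = s y" by blast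
    then have "g_rng G x = g_rng G y" using sE rg_eq_iff[of a b] \<open>rg a = rg b\<close> by simp
    then show "a = b" using * E(2) inj_onD[OF D(3)] by blast
  qed
  moreover have "inj_on sr (s ` E)"
  proof (rule inj_onI)
    fix a b assume "a \<in> s ` E" "b \<in> s ` E" "sr a = sr b"
    then obtain x y where *: "x \<in> E" "y \<in> E" "a = s x" "b = s y" by blast
    then have "g_src G x = g_src G y" using sE sr_eq_iff[of a b] \<open>sr a = sr b\<close> by simp
    then show "a = b" using * E(2) inj_onD[OF D(4)] by blast
  qed
  ultimately have "cobis (s ` E)" unfolding cobis_def by blast
  moreover have "\<sigma> \<in> s ` E" using D(2,8) K(3) unfolding E_def by (metis (mono_tags, lifting) image_eqI mem_Collect_eq)
  moreover have "s ` E \<subseteq> V" using E D(6) by blast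
  ultimately show ?thesis using that by blast
qed

lemma open_units_S: "openin (g_top \<Sigma>) (g_units \<Sigma>)"
proof (rule TS.open_units)
  fix u assume "u \<in> g_units \<Sigma>"
  then have "u \<in> arr" by simp
  then show "\<exists>U. openin (g_top \<Sigma>) U \<and> u \<in> U \<and> inj_on rg U"
    using cobis_basis[OF openin_topspace] unfolding cobis_def by metis
qed

lemma cobisD:
  assumes "cobis Y"
  shows "Y \<subseteq> arr" "compactin (g_top \<Sigma>) Y" "openin (g_top \<Sigma>) Y" "closedin (g_top \<Sigma>) Y"
    "inj_on rg Y" "inj_on sr Y"
  using assms openin_subset compactin_imp_closedin[OF Hausdorff_S] unfolding cobis_def by blast+

lemma cobis_inj_q: "cobis Y \<Longrightarrow> inj_on q Y"
  by (rule inj_onI) (use cobisD(1,5)[of Y] rg_eq_iff in \<open>metis inj_onD subsetD\<close>)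

lemma cobis_subset:
  assumes "cobis Y" "openin (g_top \<Sigma>) Z" "closedin (g_top \<Sigma>) Z" shows "cobis (Y \<inter> Z)"
proof -
  have "compactin (g_top \<Sigma>) (Y \<inter> Z)"
    using closed_Int_compactin[OF assms(3)] cobisD[OF assms(1)] by (simp add: Int_commute)
  then show ?thesis
    using assms cobisD[OF assms(1)] unfolding cobis_def by (auto intro: inj_on_subset)
qed

lemma cobis_Int: "cobis Y \<Longrightarrow> cobis Z \<Longrightarrow> cobis (Y \<inter> Z)"
  using cobis_subset[of Y Z] cobisD(3,4)[of Z] by blast

lemma cobis_units:
  assumes "compactin (g_top \<Sigma>) Y" "openin (g_top \<Sigma>) Y" "Y \<subseteq> g_units \<Sigma>" shows "cobis Y"
  using assms unfolding cobis_def by (auto simp: inj_on_def subset_iff)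

lemma cobis_inv: assumes "cobis Y" shows "cobis (iv ` Y)"
proof -
  have "inj_on rg (iv ` Y)" "inj_on sr (iv ` Y)"
    using cobisD[OF assms] by (auto simp: inj_on_def subset_iff)
  then show ?thesis
    using cobisD[OF assms] TS.open_inv_image TS.compact_inv_image unfolding cobis_def by blast
qed

definition setmul :: "'s set \<Rightarrow> 's set \<Rightarrow> 's set" where
  "setmul Y Z = {a \<cdot> b | a b. a \<in> Y \<and> b \<in> Z \<and> sr a = rg b}"

text \<open>For a bisection \<open>Y\<close> this is the arrow of \<open>Y\<close> with the same
  range as \<open>\<sigma>\<close>. Dividing by it turns membership in \<open>setmul Y Z\<close>
  into membership of \<open>iv (rsec Y \<sigma>) \<cdot> \<sigma>\<close> in \<open>Z\<close>, a
  condition on a continuous function of \<open>\<sigma>\<close>.\<close>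

definition rsec :: "'s set \<Rightarrow> 's \<Rightarrow> 's" where
  "rsec Y \<sigma> = the_inv_into Y rg (rg \<sigma>)"

lemma rsec:
  assumes "inj_on rg Y" "\<sigma> \<in> Y" "rg \<tau> = rg \<sigma>" shows "rsec Y \<tau> = \<sigma>"
  unfolding rsec_def using assms by (simp add: the_inv_into_f_f)

lemma open_rg_preimage:
  assumes "openin (g_top \<Sigma>) Y" shows "openin (g_top \<Sigma>) {\<sigma> \<in> arr. rg \<sigma> \<in> rg ` Y}"
proof -
  have "openin (g_top \<Sigma>) (rg ` Y)"
    using assms open_map_rg openin_open_subtopology[OF open_units_S] by (auto simp: open_map_def)
  then show ?thesis using openin_continuous_map_preimage[OF TS.continuous_rng] by blast
qed

lemma continuous_rsec_mul:
  assumes Y: "openin (g_top \<Sigma>) Y" "inj_on rg Y"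
  shows "continuous_map (subtopology (g_top \<Sigma>) {\<sigma> \<in> arr. rg \<sigma> \<in> rg ` Y}) (g_top \<Sigma>)
    (\<lambda>\<sigma>. iv (rsec Y \<sigma>) \<cdot> \<sigma>)"
proof -
  let ?W = "{\<sigma> \<in> arr. rg \<sigma> \<in> rg ` Y}"
  have Ya: "Y \<subseteq> arr" using Y openin_subset by blast
  have c: "continuous_map (g_top \<Sigma>) (unit_space \<Sigma>) rg"
    using TS.continuous_rng by (auto intro!: continuous_map_into_subtopology)
  obtain g where g: "homeomorphic_maps (subtopology (g_top \<Sigma>) Y) (subtopology (unit_space \<Sigma>) (rg ` Y)) rg g"
    using continuous_inj_open_homeomorphic[OF c open_map_rg Y] homeomorphic_map_maps by blast
  have gr: "g (rg \<sigma>) = \<sigma>" if "\<sigma> \<in> Y" for \<sigma>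
    using g that Ya unfolding homeomorphic_maps_def by auto
  have c1: "continuous_map (subtopology (g_top \<Sigma>) ?W) (subtopology (unit_space \<Sigma>) (rg ` Y)) rg"
    using TS.continuous_rng by (intro continuous_map_into_subtopology continuous_map_from_subtopology) auto
  have "continuous_map (subtopology (unit_space \<Sigma>) (rg ` Y)) (g_top \<Sigma>) g"
    using g unfolding homeomorphic_maps_def continuous_map_in_subtopology by blast
  from continuous_map_compose[OF c1 this]
  have c2: "continuous_map (subtopology (g_top \<Sigma>) ?W) (g_top \<Sigma>) (rsec Y)"
    by (rule continuous_map_eq) (auto simp: gr rsec[OF Y(2)])
  have r: "rsec Y \<sigma> \<in> arr \<and> rg (rsec Y \<sigma>) = rg \<sigma>" if "\<sigma> \<in> ?W" for \<sigma>
    using that Ya rsec[OF Y(2)] by auto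
  have c3: "continuous_map (subtopology (g_top \<Sigma>) ?W) (g_top \<Sigma>) (\<lambda>\<sigma>. iv (rsec Y \<sigma>))"
    using continuous_map_compose[OF c2 TS.continuous_inv] by (simp add: o_def)
  have c4: "continuous_map (subtopology (g_top \<Sigma>) ?W) (g_top \<Sigma>) (\<lambda>\<sigma>. \<sigma>)"
    using continuous_map_from_subtopology[OF continuous_map_id] by (simp add: id_def)
  show ?thesis
    by (rule TS.continuous_mul[OF c3 c4]) (use r in simp)
qed

lemma setmul_eq:
  assumes "Y \<subseteq> arr" "inj_on rg Y" "Z \<subseteq> arr"
  shows "setmul Y Z = {\<sigma> \<in> arr. rg \<sigma> \<in> rg ` Y \<and> iv (rsec Y \<sigma>) \<cdot> \<sigma> \<in> Z}"
proof (intro equalityI subsetI)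
  fix \<sigma> assume "\<sigma> \<in> setmul Y Z"
  then obtain a b where ab: "a \<in> Y" "b \<in> Z" "sr a = rg b" "\<sigma> = a \<cdot> b" unfolding setmul_def by blast
  then have *: "a \<in> arr" "b \<in> arr" using assms by auto
  then have "rsec Y \<sigma> = a" using ab by (intro rsec[OF assms(2)]) simp_all
  then show "\<sigma> \<in> {\<sigma> \<in> arr. rg \<sigma> \<in> rg ` Y \<and> iv (rsec Y \<sigma>) \<cdot> \<sigma> \<in> Z}"
    using ab * by auto
next
  fix \<sigma> assume s: "\<sigma> \<in> {\<sigma> \<in> arr. rg \<sigma> \<in> rg ` Y \<and> iv (rsec Y \<sigma>) \<cdot> \<sigma> \<in> Z}"
  then obtain a where a: "a \<in> Y" "rg \<sigma> = rg a" by blast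
  then have *: "a \<in> arr" "rsec Y \<sigma> = a" using assms rsec[OF assms(2)] by auto
  have "\<sigma> = a \<cdot> (iv a \<cdot> \<sigma>)" "sr a = rg (iv a \<cdot> \<sigma>)" using * a s by simp_all
  then show "\<sigma> \<in> setmul Y Z" unfolding setmul_def using a s * by blast
qed

lemma cobis_setmul: assumes Y: "cobis Y" and Z: "cobis Z" shows "cobis (setmul Y Z)"
proof -
  note y = cobisD[OF Y] and z = cobisD[OF Z]
  let ?W = "{\<sigma> \<in> arr. rg \<sigma> \<in> rg ` Y}"
  have "openin (subtopology (g_top \<Sigma>) ?W) {\<sigma> \<in> topspace (subtopology (g_top \<Sigma>) ?W). iv (rsec Y \<sigma>) \<cdot> \<sigma> \<in> Z}"
    by (rule openin_continuous_map_preimage[OF continuous_rsec_mul[OF y(3,5)] z(3)])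
  then have "openin (g_top \<Sigma>) {\<sigma> \<in> topspace (subtopology (g_top \<Sigma>) ?W). iv (rsec Y \<sigma>) \<cdot> \<sigma> \<in> Z}"
    using openin_trans_full open_rg_preimage[OF y(3)] by blast
  moreover have "{\<sigma> \<in> topspace (subtopology (g_top \<Sigma>) ?W). iv (rsec Y \<sigma>) \<cdot> \<sigma> \<in> Z} = setmul Y Z"
    unfolding setmul_eq[OF y(1,5) z(1)] by auto
  ultimately have "openin (g_top \<Sigma>) (setmul Y Z)" by simp
  moreover have "compactin (g_top \<Sigma>) (setmul Y Z)"
    unfolding setmul_def by (rule TS.compact_setmul[OF Hausdorff_S y(2) z(2)])
  moreover have "inj_on rg (setmul Y Z)"
  proof (rule inj_onI)
    fix \<sigma> \<tau> assume *: "\<sigma> \<in> setmul Y Z" "\<tau> \<in> setmul Y Z" "rg \<sigma> = rg \<tau>"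
    then obtain a b c d where ab: "a \<in> Y" "b \<in> Z" "sr a = rg b" "\<sigma> = a \<cdot> b"
      and cd: "c \<in> Y" "d \<in> Z" "sr c = rg d" "\<tau> = c \<cdot> d" unfolding setmul_def by blast
    have "a \<in> arr" "b \<in> arr" "c \<in> arr" "d \<in> arr" using ab cd y z by auto
    then have "a = c" using ab cd * inj_onD[OF y(5), of a c] by simp
    then have "b = d" using ab cd inj_onD[OF z(5), of b d] by simp
    then show "\<sigma> = \<tau>" using ab cd \<open>a = c\<close> by simp
  qed
  moreover have "inj_on sr (setmul Y Z)"
  proof (rule inj_onI)
    fix \<sigma> \<tau> assume *: "\<sigma> \<in> setmul Y Z" "\<tau> \<in> setmul Y Z" "sr \<sigma> = sr \<tau>"
    then obtain a b c d where ab: "a \<in> Y" "b \<in> Z" "sr a = rg b" "\<sigma> = a \<cdot> b"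
      and cd: "c \<in> Y" "d \<in> Z" "sr c = rg d" "\<tau> = c \<cdot> d" unfolding setmul_def by blast
    have "a \<in> arr" "b \<in> arr" "c \<in> arr" "d \<in> arr" using ab cd y z by auto
    then have "b = d" using ab cd * inj_onD[OF z(6), of b d] by simp
    then have "a = c" using ab cd inj_onD[OF y(6), of a c] by simp
    then show "\<sigma> = \<tau>" using ab cd \<open>b = d\<close> by simp
  qed
  ultimately show ?thesis unfolding cobis_def by blast
qed

end

section \<open>The twisted Steinberg algebra\<close>

lemma locally_constantD:
  assumes "locally_constant X f" shows "openin X {x \<in> topspace X. f x = c}"
proof (subst openin_subopen, intro ballI)
  fix x assume x: "x \<in> {x \<in> topspace X. f x = c}"
  then obtain U where U: "openin X U" "x \<in> U" "\<forall>y\<in>U. f y = f x"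
    using assms unfolding locally_constant_def by blast
  then have "U \<subseteq> {x \<in> topspace X. f x = c}"
    using x openin_subset[OF U(1)] by blast
  then show "\<exists>T. openin X T \<and> x \<in> T \<and> T \<subseteq> {x \<in> topspace X. f x = c}"
    using U by blast
qed

lemma locally_constant_combine:
  assumes "locally_constant X f" "locally_constant X g"
  shows "locally_constant X (\<lambda>x. h (f x) (g x))"
  unfolding locally_constant_def
proof
  fix x assume x: "x \<in> topspace X"
  let ?U = "{y \<in> topspace X. f y = f x} \<inter> {y \<in> topspace X. g y = g x}"
  have "openin X ?U"
    by (rule openin_Int[OF locally_constantD[OF assms(1)] locally_constantD[OF assms(2)]])
  then show "\<exists>U. openin X U \<and> x \<in> U \<and> (\<forall>y\<in>U. h (f y) (g y) = h (f x) (g x))"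
    using x by (intro exI[of _ ?U]) auto
qed

lemma alg_span_least:
  assumes "alg_zero A \<in> C" "\<And>t v w. v \<in> S \<Longrightarrow> w \<in> C \<Longrightarrow> alg_add A (alg_smult A t v) w \<in> C"
  shows "alg_span A S \<subseteq> C"
proof
  fix x assume "x \<in> alg_span A S"
  then show "x \<in> C" by induction (use assms in auto)
qed

lemma alg_span_mono: assumes "S \<subseteq> S'" shows "alg_span A S \<subseteq> alg_span A S'"
proof (rule alg_span_least)
  show "alg_zero A \<in> alg_span A S'" by (rule alg_span.zero)
  show "alg_add A (alg_smult A t v) w \<in> alg_span A S'" if "v \<in> S" "w \<in> alg_span A S'" for t v w
    using alg_span.step[of v S' w A t] that assms by blast
qed

locale indecomposable_twist = ample_twist G \<Sigma> i q
  for G :: "'g groupoid" and \<Sigma> :: "'s groupoid"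
    and i :: "'g \<times> 'r::comm_ring_1 \<Rightarrow> 's" and q :: "'s \<Rightarrow> 'g" +
  assumes zero_neq_one_ring: "(0::'r) \<noteq> 1"
    and idem_ring: "(e::'r) * e = e \<Longrightarrow> e = 0 \<or> e = 1"
begin

abbreviation "St \<equiv> steinberg_carrier G \<Sigma> i q"
abbreviation "A \<equiv> steinberg_algebra G \<Sigma> i q"
abbreviation "B \<equiv> diagonal_subalgebra G \<Sigma> i q"

lemma A_simps [simp]:
  "alg_carrier A = St" "alg_zero A = (\<lambda>\<sigma>. 0)" "alg_add A f g = (\<lambda>\<sigma>. f \<sigma> + g \<sigma>)"
  "alg_smult A t f = (\<lambda>\<sigma>. t * f \<sigma>)" "alg_mult A f g = f \<star> g"
  by (simp_all add: steinberg_algebra_def)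

lemma unit_nonzero: "(t::'r) dvd 1 \<Longrightarrow> t \<noteq> 0"
  using zero_neq_one_ring by auto

lemma St_iff:
  "f \<in> St \<longleftrightarrow> equivariant f \<and> locally_constant (g_top \<Sigma>) f \<and> compactin (g_top G) (q ` supp \<Sigma> f)"
  unfolding steinberg_carrier_def equivariant_def by auto

lemma St_equivariant: "f \<in> St \<Longrightarrow> equivariant f"
  by (simp add: St_iff)

lemma St_row_finite: assumes "f \<in> St" shows "f \<in> row_finite"
  using assms finite_compact_fibre unfolding St_iff row_finite_def by blast

text \<open>An equivariant function vanishes on a whole fibre of \<open>q\<close> or nowhere on it.
  The complement of the image of the support is therefore the image of the open zero set under the
  open map \<open>q\<close>.\<close>

lemma closed_q_supp:
  assumes f: "equivariant f" "locally_constant (g_top \<Sigma>) f" shows "closedin (g_top G) (q ` supp \<Sigma> f)"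
proof -
  have "openin (g_top G) (q ` {\<sigma> \<in> arr. f \<sigma> = 0})"
    using locally_constantD[OF f(2)] open_map_q by (simp add: open_map_def)
  moreover have "g_arr G - q ` supp \<Sigma> f = q ` {\<sigma> \<in> arr. f \<sigma> = 0}"
  proof (intro equalityI subsetI)
    fix \<alpha> assume "\<alpha> \<in> g_arr G - q ` supp \<Sigma> f"
    then show "\<alpha> \<in> q ` {\<sigma> \<in> arr. f \<sigma> = 0}" using q_surj by (auto simp: supp_def)
  next
    fix \<alpha> assume "\<alpha> \<in> q ` {\<sigma> \<in> arr. f \<sigma> = 0}"
    then obtain \<sigma> where s: "\<sigma> \<in> arr" "f \<sigma> = 0" "\<alpha> = q \<sigma>" by blast
    have "\<alpha> \<notin> q ` supp \<Sigma> f"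
    proof
      assume "\<alpha> \<in> q ` supp \<Sigma> f"
      then obtain \<tau> where "\<tau> \<in> arr" "f \<tau> \<noteq> 0" "q \<sigma> = q \<tau>" using s(3) by (auto simp: supp_def)
      then show False using equivariant_zero_iff[OF f(1) s(1)] s(2) by blast
    qed
    then show "\<alpha> \<in> g_arr G - q ` supp \<Sigma> f" using s by simp
  qed
  moreover have "q ` supp \<Sigma> f \<subseteq> g_arr G" by (auto simp: supp_def)
  ultimately show ?thesis by (simp add: closedin_def)
qed

text \<open>As the image of the support is closed, containment in some compact set suffices for its
  compactness.\<close>

lemma St_I:
  assumes "equivariant f" "locally_constant (g_top \<Sigma>) f" "compactin (g_top G) K" "q ` supp \<Sigma> f \<subseteq> K"
  shows "f \<in> St"
  unfolding St_iff using assms closed_compactin[OF assms(3,4) closed_q_supp[OF assms(1,2)]] by blast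

lemma St_zero [simp]: "(\<lambda>\<sigma>. 0) \<in> St"
  by (rule St_I[of _ "{}"]) (auto simp: equivariant_def locally_constant_def supp_def)

lemma St_add [simp]: assumes "f \<in> St" "g \<in> St" shows "(\<lambda>\<sigma>. f \<sigma> + g \<sigma>) \<in> St"
proof (rule St_I)
  show "compactin (g_top G) (q ` supp \<Sigma> f \<union> q ` supp \<Sigma> g)"
    using assms compactin_Un unfolding St_iff by blast
  show "q ` supp \<Sigma> (\<lambda>\<sigma>. f \<sigma> + g \<sigma>) \<subseteq> q ` supp \<Sigma> f \<union> q ` supp \<Sigma> g"
    by (force simp: supp_def)
qed (use assms equivariant_add locally_constant_combine[of _ f g "(+)"] in \<open>auto simp: St_iff\<close>)

lemma St_smult [simp]: assumes "f \<in> St" shows "(\<lambda>\<sigma>. t * f \<sigma>) \<in> St"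
proof (rule St_I)
  show "compactin (g_top G) (q ` supp \<Sigma> f)"
    using assms unfolding St_iff by blast
  show "q ` supp \<Sigma> (\<lambda>\<sigma>. t * f \<sigma>) \<subseteq> q ` supp \<Sigma> f"
    by (force simp: supp_def)
qed (use assms equivariant_smult locally_constant_combine[of _ f f "\<lambda>x y. t * x"] in \<open>auto simp: St_iff\<close>)

lemma B_iff: "f \<in> B \<longleftrightarrow> f \<in> St \<and> f \<in> diagonal"
  unfolding diagonal_subalgebra_def diagonal_def by (auto simp: St_iff supp_def)

text \<open>This will be \<open>tilde_one\<close> of \<open>Y\<close>. Equivariance dictates the
  value: if \<open>s \<odot> \<sigma>\<close> lies in \<open>Y\<close> and a function is
  \<open>1\<close> there, its value at \<open>\<sigma>\<close> must be \<open>s\<close>. The value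
  \<open>0\<close> is taken off the saturation of \<open>Y\<close>.\<close>

definition ind :: "'s set \<Rightarrow> 's \<Rightarrow> 'r" where
  "ind Y \<sigma> = (if \<sigma> \<in> arr \<and> (\<exists>s. s dvd 1 \<and> s \<odot> \<sigma> \<in> Y) then SOME s. s dvd 1 \<and> s \<odot> \<sigma> \<in> Y else 0)"

lemma ind_eq:
  assumes "inj_on q Y" "\<sigma> \<in> arr" "s dvd 1" "s \<odot> \<sigma> \<in> Y" shows "ind Y \<sigma> = s"
proof -
  have u: "t = s" if "t dvd 1" "t \<odot> \<sigma> \<in> Y" for t
  proof -
    have "t \<odot> \<sigma> = s \<odot> \<sigma>" using assms that inj_onD[OF assms(1), of "t \<odot> \<sigma>" "s \<odot> \<sigma>"] by simp
    then show ?thesis using act_free assms that by blast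
  qed
  have "(SOME s. s dvd 1 \<and> s \<odot> \<sigma> \<in> Y) = s"
    by (rule some_equality) (use assms(3,4) u in blast)+
  then show ?thesis using assms unfolding ind_def by auto
qed

lemma ind_nonzeroE:
  assumes "inj_on q Y" "ind Y \<sigma> \<noteq> 0"
  obtains s where "\<sigma> \<in> arr" "s dvd 1" "s \<odot> \<sigma> \<in> Y" "ind Y \<sigma> = s"
proof -
  obtain s where "\<sigma> \<in> arr" "s dvd 1" "s \<odot> \<sigma> \<in> Y" using assms(2) unfolding ind_def by (auto split: if_splits)
  then show ?thesis using that ind_eq[OF assms(1)] by blast
qed

lemma ind_eq_1: "inj_on q Y \<Longrightarrow> \<sigma> \<in> arr \<Longrightarrow> ind Y \<sigma> = 1 \<longleftrightarrow> \<sigma> \<in> Y"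
  using ind_eq[of Y \<sigma> 1] ind_nonzeroE[of Y \<sigma>] zero_neq_one_ring act_one by (metis one_dvd)

lemma ind_nonzero_iff:
  assumes "inj_on q Y" "Y \<subseteq> arr" "\<sigma> \<in> arr" shows "ind Y \<sigma> \<noteq> 0 \<longleftrightarrow> q \<sigma> \<in> q ` Y"
proof
  assume "ind Y \<sigma> \<noteq> 0"
  then show "q \<sigma> \<in> q ` Y" using ind_nonzeroE[OF assms(1)] q_act by (metis image_eqI)
next
  assume "q \<sigma> \<in> q ` Y"
  then obtain y where y: "y \<in> Y" "q \<sigma> = q y" by blast
  then obtain s where "s dvd 1" "y = s \<odot> \<sigma>" using q_eqE assms by (metis subsetD)
  then show "ind Y \<sigma> \<noteq> 0" using ind_eq[OF assms(1,3), of s] y unit_nonzero by metis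
qed

lemma ind_outside: "\<sigma> \<notin> arr \<Longrightarrow> ind Y \<sigma> = 0"
  by (simp add: ind_def)

lemma equivariant_ind:
  assumes "inj_on q Y" shows "equivariant (ind Y)"
proof -
  have "ind Y (t \<odot> \<sigma>) = unit_inv t * ind Y \<sigma>" if *: "\<sigma> \<in> arr" "t dvd 1" for \<sigma> t
  proof (cases "ind Y \<sigma> = 0")
    case False
    then obtain s where s: "s dvd 1" "s \<odot> \<sigma> \<in> Y" "ind Y \<sigma> = s" using ind_nonzeroE[OF assms] by blast
    have "(unit_inv t * s) \<odot> t \<odot> \<sigma> = s \<odot> \<sigma>" using * s by (simp add: mult_ac)
    then show ?thesis using ind_eq[OF assms, of "t \<odot> \<sigma>" "unit_inv t * s"] * s by simp
  next
    case True
    have "ind Y (t \<odot> \<sigma>) = 0"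
    proof (rule ccontr)
      assume "ind Y (t \<odot> \<sigma>) \<noteq> 0"
      then obtain s where s: "s dvd 1" "s \<odot> t \<odot> \<sigma> \<in> Y" using ind_nonzeroE[OF assms] by blast
      then have "ind Y \<sigma> = s * t" using * by (intro ind_eq[OF assms]) simp_all
      then show False using True unit_nonzero[of "s * t"] s * by simp
    qed
    then show ?thesis using True by simp
  qed
  then show ?thesis using ind_outside by (auto simp: equivariant_def)
qed

lemma q_supp_ind: "inj_on q Y \<Longrightarrow> Y \<subseteq> arr \<Longrightarrow> q ` supp \<Sigma> (ind Y) = q ` Y"
  by (auto simp: supp_def ind_nonzero_iff image_iff subset_iff) (metis ind_nonzero_iff image_eqI subsetI)

lemma compact_q_image: "cobis Y \<Longrightarrow> compactin (g_top G) (q ` Y)"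
  using image_compactin cobisD(2) continuous_q by blast

lemma clopen_saturation:
  assumes "cobis Y"
  shows "openin (g_top \<Sigma>) {\<sigma> \<in> arr. q \<sigma> \<in> q ` Y}" "closedin (g_top \<Sigma>) {\<sigma> \<in> arr. q \<sigma> \<in> q ` Y}"
proof -
  have "openin (g_top G) (q ` Y)" using cobisD(3)[OF assms] open_map_q by (simp add: open_map_def)
  then show "openin (g_top \<Sigma>) {\<sigma> \<in> arr. q \<sigma> \<in> q ` Y}"
    using openin_continuous_map_preimage[OF continuous_q] by blast
  have "closedin (g_top G) (q ` Y)"
    using compactin_imp_closedin[OF Hausdorff_G] compact_q_image[OF assms] by blast
  then show "closedin (g_top \<Sigma>) {\<sigma> \<in> arr. q \<sigma> \<in> q ` Y}"
    using closedin_continuous_map_preimage[OF continuous_q] by blast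
qed

lemma ind_St [simp]: assumes Y: "cobis Y" shows "ind Y \<in> St"
proof (rule St_I)
  note y = cobisD[OF Y] and inj = cobis_inj_q[OF Y]
  show "equivariant (ind Y)" using equivariant_ind[OF inj] .
  show "compactin (g_top G) (q ` Y)" using compact_q_image[OF Y] .
  show "q ` supp \<Sigma> (ind Y) \<subseteq> q ` Y" using q_supp_ind[OF inj y(1)] by simp
  show "locally_constant (g_top \<Sigma>) (ind Y)"
    unfolding locally_constant_def
  proof
    fix \<sigma> assume \<sigma>: "\<sigma> \<in> arr"
    show "\<exists>U. openin (g_top \<Sigma>) U \<and> \<sigma> \<in> U \<and> (\<forall>\<tau>\<in>U. ind Y \<tau> = ind Y \<sigma>)"
    proof (cases "ind Y \<sigma> = 0")
      case False
      then obtain s where s: "s dvd 1" "s \<odot> \<sigma> \<in> Y" "ind Y \<sigma> = s" using ind_nonzeroE[OF inj] by blast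
      let ?U = "{\<tau> \<in> arr. s \<odot> \<tau> \<in> Y}"
      have "openin (g_top \<Sigma>) ?U"
        using openin_continuous_map_preimage[OF continuous_act[OF s(1)] y(3)] .
      then show ?thesis using s \<sigma> ind_eq[OF inj] by (intro exI[of _ ?U]) auto
    next
      case True
      let ?U = "arr - {\<tau> \<in> arr. q \<tau> \<in> q ` Y}"
      have "openin (g_top \<Sigma>) ?U" using clopen_saturation(2)[OF Y] by (simp add: closedin_def)
      moreover have "\<sigma> \<in> ?U" using True ind_nonzero_iff[OF inj y(1) \<sigma>] \<sigma> by blast
      moreover have "ind Y \<tau> = ind Y \<sigma>" if "\<tau> \<in> ?U" for \<tau>
        using that ind_nonzero_iff[OF inj y(1), of \<tau>] True by auto
      ultimately show ?thesis by blast
    qed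
  qed
qed

section \<open>Products with functions of bisections\<close>

lemma ind_row_finite [simp]: "cobis Y \<Longrightarrow> ind Y \<in> row_finite"
  using St_row_finite ind_St by blast

text \<open>A bisection has a single arrow with the given range, so the sum has one term: left
  convolution with \<open>ind Y\<close> is translation along \<open>Y\<close>.\<close>

lemma ind_conv:
  assumes Y: "cobis Y" and g: "equivariant g" and y: "y \<in> Y" and \<sigma>: "\<sigma> \<in> arr" "rg y = rg \<sigma>"
  shows "(ind Y \<star> g) \<sigma> = g (iv y \<cdot> \<sigma>)"
proof -
  note Yd = cobisD[OF Y] and inj = cobis_inj_q[OF Y]
  have ya: "y \<in> arr" using y Yd by blast
  have "(ind Y \<star> g) \<sigma> = (\<Sum>\<tau>\<in>{y}. ind Y \<tau> * g (iv \<tau> \<cdot> \<sigma>))"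
  proof (rule conv_eq_sum[OF _ g \<sigma>(1)])
    show "ind Y \<in> row_finite" using Y by simp
    show "finite {y}" "{y} \<subseteq> arr" "inj_on q {y}" using ya by simp_all
    show "rg \<tau> = rg \<sigma>" if "\<tau> \<in> {y}" for \<tau> using that \<sigma> by simp
    fix \<tau> assume t: "\<tau> \<in> arr" "rg \<tau> = rg \<sigma>" "ind Y \<tau> \<noteq> 0"
    then obtain s where s: "s dvd 1" "s \<odot> \<tau> \<in> Y" using ind_nonzeroE[OF inj] by blast
    have "s \<odot> \<tau> = y" using s t \<sigma> y inj_onD[OF Yd(5), of "s \<odot> \<tau>" y] by simp
    then have "q \<tau> = q y" using q_act[OF t(1) s(1)] by simp
    then show "q \<tau> \<in> q ` {y}" by simp
  qed
  then show ?thesis using ind_eq_1[OF inj ya] y by simp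
qed

lemma ind_conv_zero:
  assumes Y: "cobis Y" and g: "equivariant g" and \<sigma>: "rg \<sigma> \<notin> rg ` Y"
  shows "(ind Y \<star> g) \<sigma> = 0"
proof (rule ccontr)
  assume "(ind Y \<star> g) \<sigma> \<noteq> 0"
  then obtain \<tau> where t: "\<tau> \<in> arr" "rg \<tau> = rg \<sigma>" "ind Y \<tau> \<noteq> 0"
    using conv_nonzeroE[OF ind_row_finite[OF Y] g] by metis
  then obtain s where "s dvd 1" "s \<odot> \<tau> \<in> Y" using ind_nonzeroE[OF cobis_inj_q[OF Y]] by blast
  then show False using \<sigma> t rg_act by (metis image_eqI)
qed

lemma ind_mult: assumes Y: "cobis Y" and Z: "cobis Z" shows "ind Y \<star> ind Z = ind (setmul Y Z)"
proof
  fix \<sigma>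
  note Yd = cobisD[OF Y] and Zd = cobisD[OF Z]
  have injZ: "inj_on q Z" and injYZ: "inj_on q (setmul Y Z)" and eZ: "equivariant (ind Z)"
    using cobis_inj_q Z cobis_setmul[OF Y Z] equivariant_ind by auto
  have YZa: "setmul Y Z \<subseteq> arr" using cobisD(1)[OF cobis_setmul[OF Y Z]] .
  consider "\<sigma> \<notin> arr" | "\<sigma> \<in> arr" "rg \<sigma> \<notin> rg ` Y" | y where "\<sigma> \<in> arr" "y \<in> Y" "rg y = rg \<sigma>"
    by (metis image_iff)
  then show "(ind Y \<star> ind Z) \<sigma> = ind (setmul Y Z) \<sigma>"
  proof cases
    case 1 then show ?thesis by (simp add: conv_outside ind_outside)
  next
    case 2
    have "ind (setmul Y Z) \<sigma> = 0"
    proof (rule ccontr)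
      assume "ind (setmul Y Z) \<sigma> \<noteq> 0"
      then obtain s where s: "s dvd 1" "s \<odot> \<sigma> \<in> setmul Y Z" using ind_nonzeroE[OF injYZ] by blast
      then have "rg (s \<odot> \<sigma>) \<in> rg ` Y"
        unfolding setmul_eq[OF Yd(1,5) Zd(1)] by blast
      then show False using 2 s by simp
    qed
    then show ?thesis using ind_conv_zero[OF Y eZ 2(2)] by simp
  next
    case 3
    have ya: "y \<in> arr" using 3 Yd by blast
    have r: "rsec Y (s \<odot> \<sigma>) = y" if "s dvd 1" for s using rsec[OF Yd(5) 3(2)] that 3 by simp
    have m: "s \<odot> \<sigma> \<in> setmul Y Z \<longleftrightarrow> s \<odot> (iv y \<cdot> \<sigma>) \<in> Z" if "s dvd 1" for s
      unfolding setmul_eq[OF Yd(1,5) Zd(1)] using r[OF that] that 3 ya imageI[OF 3(2), of rg] by simp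
    \<comment> \<open>By \<open>m\<close> the same scalars are admissible on both sides, so the two
      choices in the definition of \<open>ind\<close> are literally the same.\<close>
    have "ind (setmul Y Z) \<sigma> = ind Z (iv y \<cdot> \<sigma>)"
      unfolding ind_def using m 3 ya by (auto cong: conj_cong)
    then show ?thesis using ind_conv[OF Y eZ 3(2,1,3)] by simp
  qed
qed

text \<open>Over the ranges of \<open>Y\<close> the product is \<open>g\<close> after the continuous
  map \<open>\<sigma> \<mapsto> iv (rsec Y \<sigma>) \<cdot> \<sigma>\<close>; elsewhere it is zero.
  Both regions are open, the second because the set of ranges is compact and hence closed.\<close>

lemma locally_constant_ind_conv:
  assumes Y: "cobis Y" and g: "g \<in> St" shows "locally_constant (g_top \<Sigma>) (ind Y \<star> g)"
  unfolding locally_constant_def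
proof
  fix \<sigma> assume \<sigma>: "\<sigma> \<in> arr"
  note Yd = cobisD[OF Y]
  have ge: "equivariant g" using g St_equivariant by blast
  let ?W = "{\<sigma> \<in> arr. rg \<sigma> \<in> rg ` Y}"
  have W: "openin (g_top \<Sigma>) ?W" using open_rg_preimage[OF Yd(3)] .
  have val: "(ind Y \<star> g) \<tau> = g (iv (rsec Y \<tau>) \<cdot> \<tau>)" if "\<tau> \<in> ?W" for \<tau>
  proof -
    obtain y where y: "y \<in> Y" "rg \<tau> = rg y" using \<open>\<tau> \<in> ?W\<close> by blast
    show ?thesis using ind_conv[OF Y ge y(1)] rsec[OF Yd(5) y] y \<open>\<tau> \<in> ?W\<close> by simp
  qed
  show "\<exists>U. openin (g_top \<Sigma>) U \<and> \<sigma> \<in> U \<and> (\<forall>\<tau>\<in>U. (ind Y \<star> g) \<tau> = (ind Y \<star> g) \<sigma>)"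
  proof (cases "\<sigma> \<in> ?W")
    case True
    let ?V = "{\<rho> \<in> arr. g \<rho> = g (iv (rsec Y \<sigma>) \<cdot> \<sigma>)}"
    let ?U = "{\<tau> \<in> topspace (subtopology (g_top \<Sigma>) ?W). iv (rsec Y \<tau>) \<cdot> \<tau> \<in> ?V}"
    have lc: "locally_constant (g_top \<Sigma>) g" using g St_iff by blast
    have "openin (g_top \<Sigma>) ?V" by (rule locally_constantD[OF lc])
    then have "openin (subtopology (g_top \<Sigma>) ?W) ?U"
      by (rule openin_continuous_map_preimage[OF continuous_rsec_mul[OF Yd(3,5)]])
    then have "openin (g_top \<Sigma>) ?U" using W openin_trans_full by blast
    moreover have "iv (rsec Y \<sigma>) \<cdot> \<sigma> \<in> arr"
    proof -
      obtain y where "y \<in> Y" "rg \<sigma> = rg y" using True by blast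
      then show ?thesis using rsec[OF Yd(5)] Yd(1) \<sigma> by (auto simp: subset_iff)
    qed
    then have "\<sigma> \<in> ?U" using True by simp
    moreover have "(ind Y \<star> g) \<tau> = (ind Y \<star> g) \<sigma>" if "\<tau> \<in> ?U" for \<tau>
      using that val[OF True] val[of \<tau>] by simp
    ultimately show ?thesis by blast
  next
    case False
    have "compactin (g_top \<Sigma>) (rg ` Y)" using image_compactin Yd(2) TS.continuous_rng by blast
    then have "closedin (g_top \<Sigma>) (rg ` Y)" using compactin_imp_closedin[OF Hausdorff_S] by blast
    then have "closedin (g_top \<Sigma>) ?W" using closedin_continuous_map_preimage[OF TS.continuous_rng] by blast
    then have "openin (g_top \<Sigma>) (arr - ?W)" by (simp add: closedin_def)
    moreover have "\<sigma> \<in> arr - ?W" using False \<sigma> by blast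
    moreover have "(ind Y \<star> g) \<tau> = 0" if "\<tau> \<in> arr - ?W" for \<tau>
      using that ind_conv_zero[OF Y ge, of \<tau>] by blast
    ultimately show ?thesis by (intro exI[of _ "arr - ?W"]) simp
  qed
qed

text \<open>The support of a product lies over the product of two compact sets. Local constancy is
  left as a premise: it is known for left factors \<open>ind Y\<close> and reaches the others by
  linearity.\<close>

lemma St_conv_if_locally_constant:
  assumes f: "f \<in> St" and g: "g \<in> St" and lc: "locally_constant (g_top \<Sigma>) (f \<star> g)"
  shows "f \<star> g \<in> St"
proof (rule St_I[OF _ lc])
  have ge: "equivariant g" and fr: "f \<in> row_finite" using f g St_equivariant St_row_finite by auto
  show "equivariant (f \<star> g)" using equivariant_conv[OF fr ge] .
  let ?K = "{g_mul G a b | a b. a \<in> q ` supp \<Sigma> f \<and> b \<in> q ` supp \<Sigma> g \<and> g_src G a = g_rng G b}"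
  show "compactin (g_top G) ?K"
    using f g TG.compact_setmul[OF Hausdorff_G] unfolding St_iff by blast
  show "q ` supp \<Sigma> (f \<star> g) \<subseteq> ?K"
  proof
    fix \<alpha> assume "\<alpha> \<in> q ` supp \<Sigma> (f \<star> g)"
    then obtain \<sigma> where s: "\<alpha> = q \<sigma>" "(f \<star> g) \<sigma> \<noteq> 0" by (auto simp: supp_def)
    obtain \<tau> where t: "\<sigma> \<in> arr" "\<tau> \<in> arr" "rg \<tau> = rg \<sigma>" "f \<tau> \<noteq> 0" "g (iv \<tau> \<cdot> \<sigma>) \<noteq> 0"
      using conv_nonzeroE[OF fr ge s(2)] by metis
    let ?\<rho> = "iv \<tau> \<cdot> \<sigma>"
    have r: "?\<rho> \<in> arr" "sr \<tau> = rg ?\<rho>" "\<tau> \<cdot> ?\<rho> = \<sigma>" using t by simp_all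
    have "\<alpha> = g_mul G (q \<tau>) (q ?\<rho>)" using q_mul[OF t(2) r(1,2)] r(3) s(1) by simp
    moreover have "g_src G (q \<tau>) = g_rng G (q ?\<rho>)" using sr_rg_eq_iff[OF t(2) r(1)] r(2) by blast
    moreover have "q \<tau> \<in> q ` supp \<Sigma> f" "q ?\<rho> \<in> q ` supp \<Sigma> g" using t r unfolding supp_def by blast+
    ultimately show "\<alpha> \<in> ?K" by blast
  qed
qed

text \<open>Induction on the number of bisections needed to cover the support: subtracting a multiple
  of \<open>ind Y\<close> clears the saturation of \<open>Y\<close> and changes nothing outside of it.\<close>

lemma span_ind_cover:
  assumes \<Y>: "\<And>Y. Y \<in> \<Y> \<Longrightarrow> cobis Y"
    "\<And>Y Z. Y \<in> \<Y> \<Longrightarrow> openin (g_top \<Sigma>) Z \<Longrightarrow> closedin (g_top \<Sigma>) Z \<Longrightarrow> Y \<inter> Z \<in> \<Y>"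
    and "finite J" "J \<subseteq> \<Y>" "f \<in> St" "q ` supp \<Sigma> f \<subseteq> (\<Union>Y\<in>J. q ` Y)"
    "\<And>Y. Y \<in> J \<Longrightarrow> \<exists>c. \<forall>y\<in>Y. f y = c"
  shows "f \<in> alg_span A (ind ` \<Y>)"
  using assms(3-)
\<comment> \<open>The induction is on the cardinality and not on the set, because the next cover
  consists of new sets \<open>Z \<inter> Q\<close>, some of which may coincide.\<close>
proof (induction "card J" arbitrary: J f rule: less_induct)
  case less
  show ?case
  proof (cases "J = {}")
    case True
    then have "supp \<Sigma> f = {}" using less by auto
    then have "f = (\<lambda>\<sigma>. 0)"
      using in_supp_iff[OF St_equivariant[OF less(4)]] by auto
    then show ?thesis using alg_span.zero[of A] by simp
  next
    case False
    then obtain Y J' where J: "J = insert Y J'" "Y \<notin> J'" "finite J'"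
      using less(2) by (metis finite_insert all_not_in_conv mk_disjoint_insert)
    have Y: "cobis Y" using \<Y>(1) less(3) J by blast
    note inj = cobis_inj_q[OF Y] and Ya = cobisD(1)[OF Y]
    obtain c where c: "\<And>y. y \<in> Y \<Longrightarrow> f y = c" using less(6)[of Y] J by blast
    have fe: "equivariant f" using less(4) St_equivariant by blast
    define f' where "f' = (\<lambda>\<sigma>. f \<sigma> + (- c) * ind Y \<sigma>)"
    have f': "f' \<in> St" unfolding f'_def using less(4) Y by (intro St_add St_smult ind_St)
    \<comment> \<open>The complement of the saturation of \<open>Y\<close> is clopen, so the cut
      pieces stay in the family; \<open>f'\<close> agrees with \<open>f\<close> there, so it is
      still constant on each piece.\<close>
    define Q where "Q = arr - {\<sigma> \<in> arr. q \<sigma> \<in> q ` Y}"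
    have Q: "openin (g_top \<Sigma>) Q" "closedin (g_top \<Sigma>) Q"
      using clopen_saturation[OF Y] unfolding Q_def by auto
    have out: "f' \<sigma> = f \<sigma>" if "\<sigma> \<in> Q" for \<sigma>
      using that ind_nonzero_iff[OF inj Ya, of \<sigma>] unfolding Q_def f'_def by auto
    have ins: "f' \<sigma> = 0" if \<sigma>: "\<sigma> \<in> arr" "q \<sigma> \<in> q ` Y" for \<sigma>
    proof -
      obtain s where s: "s dvd 1" "s \<odot> \<sigma> \<in> Y" "ind Y \<sigma> = s"
        using ind_nonzeroE[OF inj] ind_nonzero_iff[OF inj Ya \<sigma>(1)] \<sigma>(2) by metis
      have "c = unit_inv s * f \<sigma>" using c[OF s(2)] equivariantD(1)[OF fe \<sigma>(1) s(1)] by simp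
      then have "f \<sigma> = c * s" using s(1) by (metis mult.commute unit_inv_dvd unit_inv_inv unit_mult_eq_iff)
      then show ?thesis using s by (simp add: f'_def)
    qed
    let ?J = "(\<lambda>Z. Z \<inter> Q) ` J'"
    have "f' \<in> alg_span A (ind ` \<Y>)"
    proof -
      have card: "card ?J < card J" using card_image_le[OF J(3), of "\<lambda>Z. Z \<inter> Q"] J by simp
      have sub: "?J \<subseteq> \<Y>" using less(3) J \<Y>(2) Q by blast
      have cov: "q ` supp \<Sigma> f' \<subseteq> (\<Union>Z\<in>J'. q ` (Z \<inter> Q))"
      proof
        fix \<alpha> assume "\<alpha> \<in> q ` supp \<Sigma> f'"
        then obtain \<sigma> where s: "\<sigma> \<in> arr" "f' \<sigma> \<noteq> 0" "\<alpha> = q \<sigma>" by (auto simp: supp_def)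
        then have nY: "q \<sigma> \<notin> q ` Y" using ins by blast
        then have "f \<sigma> \<noteq> 0" using out[of \<sigma>] s by (simp add: Q_def)
        then have "q \<sigma> \<in> q ` supp \<Sigma> f" using s by (auto simp: supp_def)
        then obtain Z where Z: "Z \<in> J'" "q \<sigma> \<in> q ` Z" using less(5) J nY by auto
        then obtain z where z: "z \<in> Z" "q \<sigma> = q z" by blast
        moreover have "z \<in> arr" using z Z less(3) J \<Y>(1) cobisD(1) by blast
        ultimately have "z \<in> Z \<inter> Q" using nY unfolding Q_def by auto
        then show "\<alpha> \<in> (\<Union>Z\<in>J'. q ` (Z \<inter> Q))" using Z z s by blast
      qed
      have con: "\<exists>c. \<forall>y\<in>Z. f' y = c" if "Z \<in> ?J" for Z
      proof -
        obtain Z' where "Z' \<in> J'" "Z = Z' \<inter> Q" using \<open>Z \<in> ?J\<close> by blast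
        moreover then obtain d where "\<forall>y\<in>Z'. f y = d" using less(6)[of Z'] J by blast
        ultimately show ?thesis using out by (intro exI[of _ d]) auto
      qed
      show ?thesis
        by (rule less(1)[OF card _ sub f' _ con]) (use J cov in auto)
    qed
    then have "alg_add A (alg_smult A c (ind Y)) f' \<in> alg_span A (ind ` \<Y>)"
      using alg_span.step less(3) J by (metis image_eqI insert_subset)
    moreover have "alg_add A (alg_smult A c (ind Y)) f' = f" by (simp add: f'_def)
    ultimately show ?thesis by simp
  qed
qed


lemma supp_cover:
  assumes f: "f \<in> St" and U: "\<And>U. U \<in> \<U> \<Longrightarrow> openin (g_top \<Sigma>) U"
    and cover: "\<And>\<sigma>. f \<sigma> \<noteq> 0 \<Longrightarrow> \<exists>U\<in>\<U>. q \<sigma> \<in> q ` U"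
  obtains J where "finite J" "J \<subseteq> \<U>" "q ` supp \<Sigma> f \<subseteq> (\<Union>U\<in>J. q ` U)"
proof -
  have K: "compactin (g_top G) (q ` supp \<Sigma> f)" using f St_iff by blast
  have "\<exists>F. finite F \<and> F \<subseteq> (\<lambda>U. q ` U) ` \<U> \<and> q ` supp \<Sigma> f \<subseteq> \<Union>F"
  proof (rule compactinD[OF K])
    show "openin (g_top G) V" if "V \<in> (\<lambda>U. q ` U) ` \<U>" for V
      using that U open_map_q by (auto simp: open_map_def)
    show "q ` supp \<Sigma> f \<subseteq> \<Union>((\<lambda>U. q ` U) ` \<U>)"
      using cover by (auto simp: supp_def)
  qed
  then obtain F where F: "finite F" "F \<subseteq> (\<lambda>U. q ` U) ` \<U>" "q ` supp \<Sigma> f \<subseteq> \<Union>F" by blast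
  obtain J where "J \<subseteq> \<U>" "finite J" "F = (\<lambda>U. q ` U) ` J"
    using finite_subset_image[OF F(1,2)] by metis
  then show ?thesis using that F(3) by metis
qed

text \<open>Closure of the family under clopen cuts allows a refinement to pieces on which
  \<open>f\<close> is constant, and compactness leaves finitely many. The family is a parameter
  because the same argument serves the whole algebra and its diagonal.\<close>

lemma span_ind:
  assumes \<Y>: "\<And>Y. Y \<in> \<Y> \<Longrightarrow> cobis Y"
    "\<And>Y Z. Y \<in> \<Y> \<Longrightarrow> openin (g_top \<Sigma>) Z \<Longrightarrow> closedin (g_top \<Sigma>) Z \<Longrightarrow> Y \<inter> Z \<in> \<Y>"
    and f: "f \<in> St" and cover: "\<And>\<sigma>. f \<sigma> \<noteq> 0 \<Longrightarrow> \<exists>Y\<in>\<Y>. q \<sigma> \<in> q ` Y"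
  shows "f \<in> alg_span A (ind ` \<Y>)"
proof -
  let ?U = "{Y \<in> \<Y>. \<exists>c. \<forall>y\<in>Y. f y = c}"
  have fe: "equivariant f" and lc: "locally_constant (g_top \<Sigma>) f" using f St_iff by auto
  have "\<exists>Y\<in>?U. q \<sigma> \<in> q ` Y" if nz: "f \<sigma> \<noteq> 0" for \<sigma>
  proof -
    obtain Y y where y: "Y \<in> \<Y>" "y \<in> Y" "q \<sigma> = q y" using cover[OF nz] by blast
    have Y: "cobis Y" using \<Y>(1) y by blast
    let ?V = "Y \<inter> {x \<in> arr. f x = f y}"
    have ya: "y \<in> arr" using cobisD(1)[OF Y] y by blast
    have "openin (g_top \<Sigma>) ?V" using cobisD(3)[OF Y] locally_constantD[OF lc] by blast
    then obtain Z where Z: "cobis Z" "y \<in> Z" "Z \<subseteq> ?V" using cobis_basis[of ?V y] y ya by blast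
    have "Y \<inter> Z \<in> \<Y>" using \<Y>(2)[OF y(1)] cobisD(3,4)[OF Z(1)] by blast
    moreover have "\<forall>x\<in>Y \<inter> Z. f x = f y" using Z(3) by blast
    ultimately have "Y \<inter> Z \<in> ?U" by blast
    moreover have "q \<sigma> \<in> q ` (Y \<inter> Z)" using y Z by blast
    ultimately show ?thesis by blast
  qed
  then have cover': "\<And>\<sigma>. f \<sigma> \<noteq> 0 \<Longrightarrow> \<exists>Y\<in>?U. q \<sigma> \<in> q ` Y" by blast
  have op: "openin (g_top \<Sigma>) Y" if "Y \<in> ?U" for Y using that \<Y>(1) cobisD(3) by blast
  obtain J where J: "finite J" "J \<subseteq> ?U" "q ` supp \<Sigma> f \<subseteq> (\<Union>Y\<in>J. q ` Y)"
    by (rule supp_cover[OF f op cover'])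
  show ?thesis
    by (rule span_ind_cover[OF \<Y> J(1) _ f J(3)]) (use J(2) in auto)
qed

lemma St_span: "St \<subseteq> alg_span A (ind ` Collect cobis)"
proof
  fix f assume f: "f \<in> St"
  show "f \<in> alg_span A (ind ` Collect cobis)"
  proof (rule span_ind[OF _ _ f])
    fix \<sigma> assume "f \<sigma> \<noteq> 0"
    then have "\<sigma> \<in> arr" using equivariantD(3)[OF St_equivariant[OF f]] by blast
    then obtain Y where "cobis Y" "\<sigma> \<in> Y" using cobis_basis[OF openin_topspace] by blast
    then show "\<exists>Y\<in>Collect cobis. q \<sigma> \<in> q ` Y" by blast
  qed (use cobis_subset in auto)
qed

section \<open>The algebra axioms\<close>

lemma zero_conv [simp]: "(\<lambda>\<sigma>. 0) \<star> g = (\<lambda>\<sigma>. 0)"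
  by (rule ext) (simp add: convolution_def supp_def)

text \<open>For fixed \<open>g\<close> the admissible left factors are closed under linear
  combinations and contain every \<open>ind Y\<close>, hence contain the span of these, which is
  everything.\<close>

lemma St_conv [simp]: assumes f: "f \<in> St" and g: "g \<in> St" shows "f \<star> g \<in> St"
proof -
  have "alg_span A (ind ` Collect cobis) \<subseteq> {f \<in> St. f \<star> g \<in> St}"
  proof (rule alg_span_least)
    show "alg_zero A \<in> {f \<in> St. f \<star> g \<in> St}" by simp
    fix t v w assume vw: "v \<in> ind ` Collect cobis" "w \<in> {f \<in> St. f \<star> g \<in> St}"
    then obtain Y where Y: "cobis Y" "v = ind Y" by blast
    have v: "v \<in> St" "v \<star> g \<in> St"
      using Y g locally_constant_ind_conv[OF Y(1) g] St_conv_if_locally_constant by auto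
    have "(\<lambda>\<sigma>. t * v \<sigma> + w \<sigma>) \<star> g = (\<lambda>\<sigma>. t * (v \<star> g) \<sigma> + (w \<star> g) \<sigma>)"
      using conv_add_left[of "\<lambda>\<sigma>. t * v \<sigma>" w g] conv_smult_left[of v g t] v vw g
      by (simp add: row_finite_smult St_row_finite St_equivariant)
    then show "alg_add A (alg_smult A t v) w \<in> {f \<in> St. f \<star> g \<in> St}"
      using v vw by simp
  qed
  then show ?thesis using St_span f by blast
qed

lemma St_conv_assoc: "\<lbrakk>f \<in> St; g \<in> St; h \<in> St\<rbrakk> \<Longrightarrow> (f \<star> g) \<star> h = f \<star> (g \<star> h)"
  by (simp add: conv_assoc St_row_finite St_equivariant)

lemma r_algebra_A: "r_algebra A"
proof -
  have "\<exists>b\<in>St. (\<lambda>\<sigma>. a \<sigma> + b \<sigma>) = (\<lambda>\<sigma>. 0)" if "a \<in> St" for a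
    using St_smult[OF that, of "-1"] by (intro bexI[of _ "\<lambda>\<sigma>. - 1 * a \<sigma>"]) simp_all
  then show ?thesis
    unfolding r_algebra_def Let_def A_simps
    by (simp add: St_conv_assoc conv_add_left conv_add_right conv_smult_left conv_smult_right
        St_row_finite St_equivariant algebra_simps)
qed

section \<open>The diagonal subalgebra\<close>

lemma diagonal_unit:
  assumes "\<sigma> \<in> arr" "q \<sigma> \<in> g_units G"
  obtains t where "t dvd 1" "\<sigma> = t \<odot> rg \<sigma>"
proof -
  have "q (rg \<sigma>) = q \<sigma>" using assms by simp
  then show ?thesis using q_eqE[of "rg \<sigma>" \<sigma>] assms that by auto
qed

text \<open>Every arrow over a unit of \<open>G\<close> is a scalar multiple of a unit of
  \<open>\<Sigma>\<close>, so equivariance determines a diagonal function by its values on units.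
  There products are pointwise, which makes the diagonal commutative.\<close>

lemma diagonal_ext:
  assumes f: "f \<in> diagonal" and g: "g \<in> diagonal" and eq: "\<And>u. u \<in> g_units \<Sigma> \<Longrightarrow> f u = g u"
  shows "f = g"
proof
  fix \<sigma>
  show "f \<sigma> = g \<sigma>"
  proof (cases "\<sigma> \<in> arr \<and> q \<sigma> \<in> g_units G")
    case True
    then obtain t where t: "t dvd 1" "\<sigma> = t \<odot> rg \<sigma>" using diagonal_unit by blast
    have "f (t \<odot> rg \<sigma>) = g (t \<odot> rg \<sigma>)"
      using equivariantD(1)[OF diagonal_equivariant[OF f], of "rg \<sigma>" t]
        equivariantD(1)[OF diagonal_equivariant[OF g], of "rg \<sigma>" t] eq[of "rg \<sigma>"] t(1) True by simp
    then show ?thesis using t(2) by simp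
  next
    case False
    have z: "h \<sigma> = 0" if h: "h \<in> diagonal" for h
    proof (rule ccontr)
      assume nz: "h \<sigma> \<noteq> 0"
      then have "\<sigma> \<in> arr" using equivariantD(3)[OF diagonal_equivariant[OF h]] by blast
      then show False using h nz False by (simp add: diagonal_def)
    qed
    show ?thesis using z[OF f] z[OF g] by simp
  qed
qed

lemma B_St: "b \<in> B \<Longrightarrow> b \<in> St" and B_diagonal: "b \<in> B \<Longrightarrow> b \<in> diagonal"
  by (simp_all add: B_iff)

lemma B_zero [simp]: "(\<lambda>\<sigma>. 0) \<in> B"
  using St_equivariant[OF St_zero] by (simp add: B_iff diagonal_def)

lemma B_add: "f \<in> B \<Longrightarrow> g \<in> B \<Longrightarrow> (\<lambda>\<sigma>. f \<sigma> + g \<sigma>) \<in> B"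
  using equivariant_add by (fastforce simp: B_iff diagonal_def)

lemma B_smult: "f \<in> B \<Longrightarrow> (\<lambda>\<sigma>. t * f \<sigma>) \<in> B"
  using equivariant_smult by (fastforce simp: B_iff diagonal_def)

lemma diagonal_conv: assumes b: "b \<in> diagonal" and c: "c \<in> diagonal" shows "b \<star> c \<in> diagonal"
  using equivariant_conv[OF diagonal_row_finite[OF b] diagonal_equivariant[OF c]]
    conv_diagonal_left[OF b diagonal_equivariant[OF c]] c
  by (auto simp: diagonal_def)

lemma B_conv: "b \<in> B \<Longrightarrow> c \<in> B \<Longrightarrow> b \<star> c \<in> B"
  using diagonal_conv by (simp add: B_iff)

lemma diagonal_conv_commute:
  assumes b: "b \<in> diagonal" and c: "c \<in> diagonal" shows "b \<star> c = c \<star> b"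
proof (rule diagonal_ext[OF diagonal_conv[OF b c] diagonal_conv[OF c b]])
  fix u assume "u \<in> g_units \<Sigma>"
  then show "(b \<star> c) u = (c \<star> b) u"
    using conv_diagonal_left[OF b diagonal_equivariant[OF c], of u]
      conv_diagonal_left[OF c diagonal_equivariant[OF b], of u] by simp
qed

lemma comm_subalgebra_B: "comm_subalgebra A B"
  unfolding comm_subalgebra_def A_simps
  using B_St diagonal_conv_commute[OF B_diagonal B_diagonal]
  by (intro conjI ballI allI subsetI) (simp_all add: B_add B_conv B_smult)

lemma ind_units_diagonal:
  assumes "Y \<subseteq> g_units \<Sigma>" shows "ind Y \<in> diagonal"
proof -
  have "inj_on q Y" "Y \<subseteq> arr" using inj_on_subset[OF inj_q_units assms] assms by auto
  then show ?thesis
    using equivariant_ind ind_nonzero_iff[of Y] assms by (auto simp: diagonal_def)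
qed

lemma ind_unit:
  assumes "Y \<subseteq> g_units \<Sigma>" "u \<in> g_units \<Sigma>" shows "ind Y u = (if u \<in> Y then 1 else 0)"
proof -
  have Y: "inj_on q Y" "Y \<subseteq> arr" using inj_on_subset[OF inj_q_units assms(1)] assms by auto
  have "u \<in> arr" using assms by simp
  moreover have "q u \<in> q ` Y \<longleftrightarrow> u \<in> Y" using assms units_eq_iff by blast
  ultimately show ?thesis using ind_eq_1[OF Y(1)] ind_nonzero_iff[OF Y] by auto
qed

text \<open>Membership in the algebra controls images under \<open>q\<close>. On an open set where
  \<open>q\<close> is injective it is a homeomorphism, and compactness can be pulled back.\<close>

lemma compact_of_q_image:
  assumes Y: "openin (g_top \<Sigma>) Y" "inj_on q Y" "compactin (g_top G) (q ` Y)"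
  shows "compactin (g_top \<Sigma>) Y"
proof -
  have Ya: "Y \<subseteq> arr" using Y(1) openin_subset by blast
  obtain g where g: "homeomorphic_maps (subtopology (g_top \<Sigma>) Y) (subtopology (g_top G) (q ` Y)) q g"
    using continuous_inj_open_homeomorphic[OF continuous_q open_map_q Y(1,2)] homeomorphic_map_maps by blast
  have "g (q y) = y" if "y \<in> Y" for y using g that Ya unfolding homeomorphic_maps_def by auto
  then have "g ` q ` Y = Y" by force
  moreover have "compactin (subtopology (g_top G) (q ` Y)) (q ` Y)" using Y(3) by (simp add: compactin_subtopology)
  ultimately have "compactin (subtopology (g_top \<Sigma>) Y) Y"
    using g image_compactin unfolding homeomorphic_maps_def by metis
  then show ?thesis by (simp add: compactin_subtopology)
qed

lemma setmul_units:
  assumes "E \<subseteq> g_units \<Sigma>" "Z \<subseteq> arr" shows "setmul E Z = {z \<in> Z. rg z \<in> E}"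
proof (intro equalityI subsetI)
  fix z assume "z \<in> setmul E Z"
  then obtain a b where ab: "a \<in> E" "b \<in> Z" "sr a = rg b" "z = a \<cdot> b" unfolding setmul_def by blast
  then have "a = rg b" "b \<in> arr" using assms S.unit_src[of a] by auto
  then show "z \<in> {z \<in> Z. rg z \<in> E}" using ab by simp
next
  fix z assume z: "z \<in> {z \<in> Z. rg z \<in> E}"
  then have "z = rg z \<cdot> z" "sr (rg z) = rg z" using assms by auto
  then show "z \<in> setmul E Z" unfolding setmul_def using z by blast
qed

section \<open>Idempotents of the diagonal and local units\<close>

lemma ind_idem:
  assumes "cobis Y" "Y \<subseteq> g_units \<Sigma>" shows "ind Y \<in> idems A B"
proof -
  have "setmul Y Y = Y" using setmul_units[OF assms(2) cobisD(1)[OF assms(1)]] assms(2) by auto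
  then show ?thesis
    using ind_mult[OF assms(1,1)] ind_units_diagonal[OF assms(2)] assms(1)
    unfolding idems_def A_simps B_iff by simp
qed

text \<open>On units the product is pointwise, so the values there are idempotents of the ring and
  by indecomposability only \<open>0\<close> and \<open>1\<close>. The units with value
  \<open>1\<close> form the required set.\<close>

lemma idemsE:
  assumes e: "e \<in> idems A B"
  obtains Y where "cobis Y" "Y \<subseteq> g_units \<Sigma>" "e = ind Y"
proof -
  have eB: "e \<in> B" "e \<star> e = e" using e by (simp_all add: idems_def)
  have ed: "e \<in> diagonal" and eS: "e \<in> St" using eB B_iff by auto
  have val: "e u = 0 \<or> e u = 1" if "u \<in> g_units \<Sigma>" for u
    using conv_diagonal_left[OF ed diagonal_equivariant[OF ed], of u] eB(2) that idem_ring by simp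
  define Y where "Y = g_units \<Sigma> \<inter> {\<sigma> \<in> arr. e \<sigma> = 1}"
  have Yu: "Y \<subseteq> g_units \<Sigma>" unfolding Y_def by blast
  have lc: "locally_constant (g_top \<Sigma>) e" using eS St_iff by blast
  have oY: "openin (g_top \<Sigma>) Y" unfolding Y_def by (rule openin_Int[OF open_units_S locally_constantD[OF lc]])
  have "q ` Y = q ` supp \<Sigma> e"
  proof (intro equalityI subsetI)
    fix \<alpha> assume "\<alpha> \<in> q ` Y"
    then show "\<alpha> \<in> q ` supp \<Sigma> e" using zero_neq_one_ring unfolding Y_def supp_def by force
  next
    fix \<alpha> assume "\<alpha> \<in> q ` supp \<Sigma> e"
    then obtain \<sigma> where s: "\<sigma> \<in> arr" "e \<sigma> \<noteq> 0" "\<alpha> = q \<sigma>" by (auto simp: supp_def)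
    then have u: "q \<sigma> \<in> g_units G" using ed by (simp add: diagonal_def)
    then have "q (rg \<sigma>) = q \<sigma>" using s by simp
    moreover have "e (rg \<sigma>) \<noteq> 0"
      using equivariant_zero_iff[OF diagonal_equivariant[OF ed], of "rg \<sigma>" \<sigma>] s calculation by simp
    then have "rg \<sigma> \<in> Y" using val[of "rg \<sigma>"] s unfolding Y_def by simp
    ultimately show "\<alpha> \<in> q ` Y" using s by (metis image_eqI)
  qed
  then have "compactin (g_top \<Sigma>) Y"
    using compact_of_q_image[OF oY inj_on_subset[OF inj_q_units Yu]] eS unfolding St_iff by simp
  then have Y: "cobis Y" using cobis_units oY Yu by blast
  have "e = ind Y"
  proof (rule diagonal_ext[OF ed ind_units_diagonal[OF Yu]])
    fix u assume u: "u \<in> g_units \<Sigma>"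
    then show "e u = ind Y u" using ind_unit[OF Yu u] val[OF u] unfolding Y_def by auto
  qed
  then show ?thesis using that Y Yu by blast
qed

lemma cobis_rg: assumes "cobis Y" shows "cobis (rg ` Y)" "rg ` Y \<subseteq> g_units \<Sigma>"
proof -
  show u: "rg ` Y \<subseteq> g_units \<Sigma>" using cobisD(1)[OF assms] by auto
  have "compactin (g_top \<Sigma>) (rg ` Y)"
    using image_compactin cobisD(2)[OF assms] TS.continuous_rng by blast
  moreover have "openin (g_top \<Sigma>) (rg ` Y)"
    using open_map_rg cobisD(3)[OF assms] openin_open_subtopology[OF open_units_S] by (auto simp: open_map_def)
  ultimately show "cobis (rg ` Y)" using cobis_units u by blast
qed

lemma rg_iv_image: "cobis Y \<Longrightarrow> rg ` iv ` Y = sr ` Y"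
  using cobisD(1) by (force simp: image_iff)

lemma cobis_sr: assumes "cobis Y" shows "cobis (sr ` Y)" "sr ` Y \<subseteq> g_units \<Sigma>"
  using cobis_rg[OF cobis_inv[OF assms]] rg_iv_image[OF assms] by simp_all

text \<open>The supports of finitely many elements are covered by finitely many bisections. The
  ranges and sources of these bisections together form a compact open set \<open>E\<close> of units,
  and \<open>ind E\<close> is an identity on both sides.\<close>

lemma local_units:
  assumes F: "finite F" "F \<subseteq> St"
  obtains e where "e \<in> idems A B" "\<And>a. a \<in> F \<Longrightarrow> e \<star> a = a" "\<And>a. a \<in> F \<Longrightarrow> a \<star> e = a"
proof -
  have "\<exists>J. finite J \<and> J \<subseteq> Collect cobis \<and> q ` supp \<Sigma> f \<subseteq> (\<Union>Y\<in>J. q ` Y)" if "f \<in> F" for f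
  proof -
    have f: "f \<in> St" using that F by blast
    have "\<exists>Y\<in>Collect cobis. q \<sigma> \<in> q ` Y" if "f \<sigma> \<noteq> 0" for \<sigma>
    proof -
      have "\<sigma> \<in> arr" using equivariantD(3)[OF St_equivariant[OF f]] that by blast
      then obtain Y where "cobis Y" "\<sigma> \<in> Y" using cobis_basis[OF openin_topspace] by blast
      then show ?thesis by blast
    qed
    then show ?thesis using supp_cover[OF f, of "Collect cobis"] cobisD(3) by (metis mem_Collect_eq)
  qed
  then obtain J where J: "\<And>f. f \<in> F \<Longrightarrow> finite (J f) \<and> J f \<subseteq> Collect cobis \<and> q ` supp \<Sigma> f \<subseteq> (\<Union>Y\<in>J f. q ` Y)"
    by metis
  define E where "E = (\<Union>Y\<in>(\<Union>f\<in>F. J f). rg ` Y \<union> sr ` Y)"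
  have fin: "finite (\<Union>f\<in>F. J f)" using F J by blast
  have cob: "cobis Y" if "Y \<in> (\<Union>f\<in>F. J f)" for Y using that J by blast
  have Eu: "E \<subseteq> g_units \<Sigma>" unfolding E_def using cob cobis_rg(2) cobis_sr(2) by blast
  have "compactin (g_top \<Sigma>) E" unfolding E_def
  proof (rule compactin_Union)
    show "compactin (g_top \<Sigma>) Z" if Z: "Z \<in> (\<lambda>Y. rg ` Y \<union> sr ` Y) ` (\<Union>f\<in>F. J f)" for Z
    proof -
      obtain Y where Y: "cobis Y" "Z = rg ` Y \<union> sr ` Y" using Z cob by blast
      show ?thesis
        unfolding Y(2) by (rule compactin_Un[OF cobisD(2)[OF cobis_rg(1)[OF Y(1)]] cobisD(2)[OF cobis_sr(1)[OF Y(1)]]])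
    qed
  qed (use fin in blast)
  moreover have "openin (g_top \<Sigma>) E" unfolding E_def
  proof (rule openin_Union)
    show "openin (g_top \<Sigma>) Z" if Z: "Z \<in> (\<lambda>Y. rg ` Y \<union> sr ` Y) ` (\<Union>f\<in>F. J f)" for Z
    proof -
      obtain Y where Y: "cobis Y" "Z = rg ` Y \<union> sr ` Y" using Z cob by blast
      show ?thesis
        unfolding Y(2) by (rule openin_Un[OF cobisD(3)[OF cobis_rg(1)[OF Y(1)]] cobisD(3)[OF cobis_sr(1)[OF Y(1)]]])
    qed
  qed
  ultimately have E: "cobis E" using cobis_units Eu by blast
  have mem: "rg \<sigma> \<in> E \<and> sr \<sigma> \<in> E" if f: "f \<in> F" and s: "\<sigma> \<in> arr" "f \<sigma> \<noteq> 0" for f \<sigma>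
  proof -
    have "q \<sigma> \<in> q ` supp \<Sigma> f" using s by (auto simp: supp_def)
    then obtain Y y where y: "Y \<in> J f" "y \<in> Y" "q \<sigma> = q y" using J[OF f] by blast
    have "y \<in> arr" using y cob f cobisD(1) by blast
    then have "rg \<sigma> = rg y" "sr \<sigma> = sr y" using rg_eq_iff[of \<sigma> y] sr_eq_iff[of \<sigma> y] s(1) y(3) by simp_all
    then show ?thesis unfolding E_def using y f by blast
  qed
  note Ed = ind_units_diagonal[OF Eu]
  show ?thesis
  proof (rule that[of "ind E"])
    show "ind E \<in> idems A B" using ind_idem[OF E Eu] .
    fix a assume a: "a \<in> F"
    then have aS: "a \<in> St" using F by blast
    show "ind E \<star> a = a"
    proof
      fix \<sigma> show "(ind E \<star> a) \<sigma> = a \<sigma>"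
        using conv_diagonal_left[OF Ed St_equivariant[OF aS], of \<sigma>] mem[OF a, of \<sigma>] ind_unit[OF Eu, of "rg \<sigma>"]
          conv_outside[of \<sigma>] equivariantD(2)[OF St_equivariant[OF aS], of \<sigma>]
        by (cases "\<sigma> \<in> arr"; cases "a \<sigma> = 0") simp_all
    qed
    show "a \<star> ind E = a"
    proof
      fix \<sigma> show "(a \<star> ind E) \<sigma> = a \<sigma>"
        using conv_diagonal_right[OF Ed St_row_finite[OF aS], of \<sigma>] mem[OF a, of \<sigma>] ind_unit[OF Eu, of "sr \<sigma>"]
          conv_outside[of \<sigma>] equivariantD(2)[OF St_equivariant[OF aS], of \<sigma>]
        by (cases "\<sigma> \<in> arr"; cases "a \<sigma> = 0") simp_all
    qed
  qed
qed

lemma idem_torsion_free: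
  assumes e: "e \<in> idems A B" "e \<noteq> (\<lambda>\<sigma>. 0)" "(\<lambda>\<sigma>. t * e \<sigma>) = (\<lambda>\<sigma>. 0)" shows "t = 0"
proof -
  obtain Y where Y: "cobis Y" "Y \<subseteq> g_units \<Sigma>" "e = ind Y" using idemsE[OF e(1)] by blast
  obtain \<sigma> where "e \<sigma> \<noteq> 0" using e(2) by blast
  then obtain s where s: "s dvd 1" "e \<sigma> = s" using ind_nonzeroE[OF cobis_inj_q[OF Y(1)]] Y(3) by metis
  have "t * s = 0" using fun_cong[OF e(3), of \<sigma>] s by simp
  then show ?thesis using s(1) by (metis mult.commute mult_zero_right unit_mult_eq_iff)
qed

lemma B_span: "B = alg_span A (idems A B)"
proof
  show "alg_span A (idems A B) \<subseteq> B"
    by (rule alg_span_least) (auto simp: idems_def intro: B_add B_smult)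
  let ?Y = "{Y. cobis Y \<and> Y \<subseteq> g_units \<Sigma>}"
  have "B \<subseteq> alg_span A (ind ` ?Y)"
  proof
    fix f assume f: "f \<in> B"
    show "f \<in> alg_span A (ind ` ?Y)"
    proof (rule span_ind[OF _ _ B_St[OF f]])
      show "cobis Y" if "Y \<in> ?Y" for Y using that by blast
      show "Y \<inter> Z \<in> ?Y" if "Y \<in> ?Y" "openin (g_top \<Sigma>) Z" "closedin (g_top \<Sigma>) Z" for Y Z
        using that cobis_subset by blast
      fix \<sigma> assume s: "f \<sigma> \<noteq> 0"
      have d: "f \<in> diagonal" using f B_diagonal by blast
      have a: "\<sigma> \<in> arr" using equivariantD(3)[OF diagonal_equivariant[OF d] s] .
      then have "q \<sigma> \<in> g_units G" using d s by (simp add: diagonal_def)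
      then have qq: "q (rg \<sigma>) = q \<sigma>" using a by simp
      obtain Y where "cobis Y" "rg \<sigma> \<in> Y" "Y \<subseteq> g_units \<Sigma>"
        using cobis_basis[OF open_units_S S.rng_units[OF a]] by blast
      then show "\<exists>Y\<in>?Y. q \<sigma> \<in> q ` Y" using qq by (metis (mono_tags, lifting) image_eqI mem_Collect_eq)
    qed
  qed
  also have "\<dots> \<subseteq> alg_span A (idems A B)" by (rule alg_span_mono) (use ind_idem in auto)
  finally show "B \<subseteq> alg_span A (idems A B)" .
qed

section \<open>The conditional expectation\<close>

definition expect :: "('s \<Rightarrow> 'r) \<Rightarrow> 's \<Rightarrow> 'r" where
  "expect f \<sigma> = (if \<sigma> \<in> arr \<and> q \<sigma> \<in> g_units G then f \<sigma> else 0)"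

text \<open>The units of \<open>G\<close> are open because the range map is locally injective and
  closed because \<open>G\<close> is Hausdorff. Restricting a function to the arrows over them
  therefore keeps it locally constant.\<close>

lemma clopen_isotropy_units:
  "openin (g_top \<Sigma>) {\<sigma> \<in> arr. q \<sigma> \<in> g_units G}" "closedin (g_top \<Sigma>) {\<sigma> \<in> arr. q \<sigma> \<in> g_units G}"
  using openin_continuous_map_preimage[OF continuous_q open_units_G]
    closedin_continuous_map_preimage[OF continuous_q TG.closed_units[OF Hausdorff_G]] by auto

lemma expect_B: assumes f: "f \<in> St" shows "expect f \<in> B"
proof -
  have fe: "equivariant f" and lc: "locally_constant (g_top \<Sigma>) f" using f St_iff by auto
  have e: "equivariant (expect f)" using fe by (auto simp: equivariant_def expect_def)
  moreover have "expect f \<in> St"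
  proof (rule St_I[OF e])
    show "compactin (g_top G) (q ` supp \<Sigma> f)" using f St_iff by blast
    show "q ` supp \<Sigma> (expect f) \<subseteq> q ` supp \<Sigma> f" by (rule image_mono) (auto simp: supp_def expect_def)
    have "locally_constant (g_top \<Sigma>) (\<lambda>\<sigma>. \<sigma> \<in> arr \<and> q \<sigma> \<in> g_units G)"
      unfolding locally_constant_def
    proof
      fix \<sigma> assume s: "\<sigma> \<in> arr"
      let ?U = "{\<sigma> \<in> arr. q \<sigma> \<in> g_units G}"
      have "openin (g_top \<Sigma>) (arr - ?U)" using clopen_isotropy_units(2) by (simp add: closedin_def)
      then show "\<exists>U. openin (g_top \<Sigma>) U \<and> \<sigma> \<in> U \<and>
          (\<forall>\<tau>\<in>U. (\<tau> \<in> arr \<and> q \<tau> \<in> g_units G) = (\<sigma> \<in> arr \<and> q \<sigma> \<in> g_units G))"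
        using clopen_isotropy_units(1) s
        by (cases "\<sigma> \<in> ?U") (intro exI[of _ ?U], simp, intro exI[of _ "arr - ?U"], auto)
    qed
    from locally_constant_combine[OF this lc, of "\<lambda>b x. if b then x else 0"]
    show "locally_constant (g_top \<Sigma>) (expect f)"
      unfolding expect_def .
  qed
  ultimately show ?thesis by (auto simp: B_iff diagonal_def expect_def)
qed

lemma cond_expectation_expect: "cond_expectation A B expect"
  unfolding cond_expectation_def A_simps
proof (intro conjI ballI allI)
  show "expect ` St \<subseteq> B" using expect_B by blast
  show "expect (\<lambda>\<sigma>. a \<sigma> + a' \<sigma>) = (\<lambda>\<sigma>. expect a \<sigma> + expect a' \<sigma>)" for a a'
    by (auto simp: expect_def)
  show "expect (\<lambda>\<sigma>. t * a \<sigma>) = (\<lambda>\<sigma>. t * expect a \<sigma>)" for a t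
    by (auto simp: expect_def)
  show "expect b = b" if "b \<in> B" for b
  proof
    fix \<sigma> show "expect b \<sigma> = b \<sigma>"
      using B_diagonal[OF that] unfolding expect_def diagonal_def equivariant_def by auto
  qed
  fix a b b' assume a: "a \<in> St" and b: "b \<in> B" "b' \<in> B"
  have val: "((b \<star> f) \<star> b') \<sigma> = b (rg \<sigma>) * f \<sigma> * b' (sr \<sigma>)" if "f \<in> St" "\<sigma> \<in> arr" for f \<sigma>
    using conv_diagonal_right[OF B_diagonal[OF b(2)] St_row_finite[OF St_conv[OF B_St[OF b(1)] that(1)]] that(2)]
      conv_diagonal_left[OF B_diagonal[OF b(1)] St_equivariant[OF that(1)] that(2)] by simp
  show "expect ((b \<star> a) \<star> b') = (b \<star> expect a) \<star> b'"
  proof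
    fix \<sigma> show "expect ((b \<star> a) \<star> b') \<sigma> = ((b \<star> expect a) \<star> b') \<sigma>"
      using val[OF a] val[OF B_St[OF expect_B[OF a]]] conv_outside[of \<sigma>]
      by (cases "\<sigma> \<in> arr") (auto simp: expect_def)
  qed
qed

section \<open>Functions of bisections as normalisers, and uniqueness of the dagger\<close>

lemma setmul_iv: assumes Y: "cobis Y" shows "setmul Y (iv ` Y) = rg ` Y"
proof (intro equalityI subsetI)
  note Yd = cobisD[OF Y]
  fix z assume "z \<in> setmul Y (iv ` Y)"
  then obtain a b where ab: "a \<in> Y" "b \<in> Y" "sr a = rg (iv b)" "z = a \<cdot> iv b" unfolding setmul_def by blast
  have "a \<in> arr" "b \<in> arr" using ab Yd(1) by auto
  then have "a = b" using ab inj_onD[OF Yd(6), of a b] by simp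
  then show "z \<in> rg ` Y" using ab by simp
next
  fix z assume "z \<in> rg ` Y"
  then obtain y where y: "y \<in> Y" "z = rg y" by blast
  then have "y \<in> arr" using cobisD(1)[OF Y] by blast
  then have "z = y \<cdot> iv y" "sr y = rg (iv y)" using y by simp_all
  then show "z \<in> setmul Y (iv ` Y)" unfolding setmul_def using y by blast
qed

lemma setmul_rg: "cobis Y \<Longrightarrow> setmul (rg ` Y) Y = Y"
  using setmul_units[OF cobis_rg(2) cobisD(1), of Y Y] by auto

lemma iv_iv_image: "cobis Y \<Longrightarrow> iv ` iv ` Y = Y"
  using cobisD(1) by (force simp: image_iff)

text \<open>If the product is nonzero at \<open>\<sigma>\<close>, some \<open>y\<close> in
  \<open>Y\<close> has \<open>y \<cdot> \<sigma>\<close> in \<open>Y\<close> up to a scalar. Both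
  have the same range, so they agree over \<open>G\<close>, and cancelling \<open>y\<close> leaves a
  unit.\<close>

lemma ind_conj_B: assumes Y: "cobis Y" and b: "b \<in> B" shows "(ind (iv ` Y) \<star> b) \<star> ind Y \<in> B"
proof -
  note Yd = cobisD[OF Y] and Y' = cobis_inv[OF Y]
  have bY: "b \<star> ind Y \<in> St" using B_St[OF b] Y by simp
  have eq: "(ind (iv ` Y) \<star> b) \<star> ind Y = ind (iv ` Y) \<star> (b \<star> ind Y)"
    using St_conv_assoc Y Y' B_St[OF b] by simp
  have St: "ind (iv ` Y) \<star> (b \<star> ind Y) \<in> St" using bY Y' by simp
  moreover have "q \<sigma> \<in> g_units G" if s: "\<sigma> \<in> arr" and nz: "(ind (iv ` Y) \<star> (b \<star> ind Y)) \<sigma> \<noteq> 0" for \<sigma>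
  proof -
    have "rg \<sigma> \<in> rg ` iv ` Y" using ind_conv_zero[OF Y' St_equivariant[OF bY]] nz by blast
    then obtain y where y: "y \<in> Y" "rg (iv y) = rg \<sigma>" by auto
    have ya: "y \<in> arr" using y Yd by blast
    have "(b \<star> ind Y) (y \<cdot> \<sigma>) \<noteq> 0"
      using ind_conv[OF Y' St_equivariant[OF bY] imageI[OF y(1)] s y(2)] nz ya by simp
    then have "ind Y (y \<cdot> \<sigma>) \<noteq> 0"
      using conv_diagonal_left[OF B_diagonal[OF b] equivariant_ind[OF cobis_inj_q[OF Y]], of "y \<cdot> \<sigma>"] ya s y by auto
    then obtain t where t: "t dvd 1" "t \<odot> (y \<cdot> \<sigma>) \<in> Y" using ind_nonzeroE[OF cobis_inj_q[OF Y]] by blast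
    have sy: "sr y = rg \<sigma>" using y ya by simp
    then have ysa: "y \<cdot> \<sigma> \<in> arr" using ya s by simp
    have "t \<odot> (y \<cdot> \<sigma>) = y" using inj_onD[OF Yd(5), of "t \<odot> (y \<cdot> \<sigma>)" y] t y ya s sy by simp
    then have "q (y \<cdot> \<sigma>) = q y" using q_act[OF ysa t(1)] by simp
    then have e: "g_mul G (q y) (q \<sigma>) = q y" using ya s sy by simp
    have "g_src G (q y) = g_rng G (q \<sigma>)" using sr_rg_eq_iff[OF ya s] sy by blast
    from G.inv_mul_cancel[OF q_arr[OF ya] q_arr[OF s] this]
    have "q \<sigma> = g_src G (q y)" unfolding e by simp
    then show ?thesis using ya by simp
  qed
  ultimately show ?thesis unfolding eq B_iff diagonal_def using St_equivariant by blast
qed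

lemma ind_is_dagger: assumes Y: "cobis Y" shows "is_dagger A B (ind Y) (ind (iv ` Y))"
proof -
  note Y' = cobis_inv[OF Y]
  have 1: "(ind Y \<star> ind (iv ` Y)) \<star> ind Y = ind Y" if "cobis Y" for Y
    using that by (simp add: ind_mult cobis_inv cobis_rg setmul_iv setmul_rg)
  have 2: "(ind (iv ` Y) \<star> ind Y) \<star> ind (iv ` Y) = ind (iv ` Y)"
    using 1[OF Y'] iv_iv_image[OF Y] by simp
  show ?thesis
    unfolding is_dagger_def A_simps
    using 1[OF Y] 2 ind_conj_B[OF Y] ind_conj_B[OF Y'] iv_iv_image[OF Y] ind_St[OF Y'] by simp
qed

lemma ind_normaliser: "cobis Y \<Longrightarrow> ind Y \<in> normalisers A B"
  using ind_is_dagger ind_St unfolding normalisers_def A_simps by blast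

lemma is_dagger_St: "is_dagger A B n k \<Longrightarrow> k \<in> St"
  by (simp add: is_dagger_def)

text \<open>\<open>B\<close> may have no identity to insert between \<open>k\<close> and
  \<open>n\<close>; a local unit for the two elements takes its place.\<close>

lemma dagger_mult_B:
  assumes "n \<in> St" "is_dagger A B n k" shows "k \<star> n \<in> B" "n \<star> k \<in> B"
proof -
  obtain e where e: "e \<in> idems A B" "e \<star> n = n" "e \<star> k = k"
    using local_units[of "{n, k}"] assms is_dagger_St by (metis empty_subsetI finite.emptyI finite_insert insertI1 insertI2 insert_subset)
  have eB: "e \<in> B" using e by (simp add: idems_def)
  have "(k \<star> e) \<star> n \<in> B" "(n \<star> e) \<star> k \<in> B" using assms(2) eB unfolding is_dagger_def A_simps by blast+
  then show "k \<star> n \<in> B" "n \<star> k \<in> B"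
    using e assms eB is_dagger_St by (simp_all add: St_conv_assoc B_St)
qed

text \<open>The uniqueness argument of inverse semigroup theory: the four products of
  \<open>n\<close> with \<open>k\<close> and \<open>k'\<close> lie in the commutative algebra
  \<open>B\<close>, and commuting them turns both daggers into
  \<open>(k' \<star> n) \<star> k\<close>.\<close>

lemma dagger_unique:
  assumes n: "n \<in> St" and k: "is_dagger A B n k" and k': "is_dagger A B n k'" shows "k = k'"
proof -
  note B = dagger_mult_B[OF n k] dagger_mult_B[OF n k']
  have S: "k \<in> St" "k' \<in> St" using k k' is_dagger_St by auto
  have e: "(k \<star> n) \<star> k = k" "(n \<star> k) \<star> n = n" "(k' \<star> n) \<star> k' = k'" "(n \<star> k') \<star> n = n"
    using k k' by (simp_all add: is_dagger_def)
  have c: "(k \<star> n) \<star> (k' \<star> n) = (k' \<star> n) \<star> (k \<star> n)" "(n \<star> k) \<star> (n \<star> k') = (n \<star> k') \<star> (n \<star> k)"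
    using B diagonal_conv_commute B_diagonal by blast+
  have "k = (k \<star> ((n \<star> k') \<star> n)) \<star> k" using e by simp
  also have "\<dots> = ((k \<star> n) \<star> (k' \<star> n)) \<star> k" using n S by (simp add: St_conv_assoc)
  also have "\<dots> = (k' \<star> ((n \<star> k) \<star> n)) \<star> k" unfolding c using n S by (simp add: St_conv_assoc)
  also have "\<dots> = (k' \<star> n) \<star> k" using e by simp
  finally have 1: "k = (k' \<star> n) \<star> k" .
  have "k' = (k' \<star> ((n \<star> k) \<star> n)) \<star> k'" using e by simp
  also have "\<dots> = k' \<star> ((n \<star> k) \<star> (n \<star> k'))" using n S by (simp add: St_conv_assoc)
  also have "\<dots> = k' \<star> (((n \<star> k') \<star> n) \<star> k)" unfolding c using n S by (simp add: St_conv_assoc)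
  also have "\<dots> = (k' \<star> n) \<star> k" using e n S by (simp add: St_conv_assoc)
  finally show ?thesis using 1 by simp
qed

lemma dagger_ind: "cobis Y \<Longrightarrow> dagger A B (ind Y) = ind (iv ` Y)"
  unfolding dagger_def using dagger_unique[OF ind_St] ind_is_dagger by blast

text \<open>Multiplication by the function of an inverse bisection moves a nonzero value from
  \<open>\<sigma>\<close> to the unit \<open>sr \<sigma>\<close>, where the expectation sees
  it.\<close>

lemma faithful_expect: "faithful_expectation A B expect"
  unfolding faithful_expectation_def A_simps
proof (intro ballI impI)
  fix a assume a: "a \<in> St" "a \<noteq> (\<lambda>\<sigma>. 0)"
  then obtain \<sigma> where nz: "a \<sigma> \<noteq> 0" by blast
  have ae: "equivariant a" using a St_equivariant by blast
  have s: "\<sigma> \<in> arr" using equivariantD(3)[OF ae nz] .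
  obtain Y where Y: "cobis Y" "\<sigma> \<in> Y" using cobis_basis[OF openin_topspace s] by metis
  have "(ind (iv ` Y) \<star> a) (sr \<sigma>) = a (iv (iv \<sigma>) \<cdot> sr \<sigma>)"
    by (rule ind_conv[OF cobis_inv[OF Y(1)] ae imageI[OF Y(2)]]) (use s in simp_all)
  then have "expect (ind (iv ` Y) \<star> a) (sr \<sigma>) = a \<sigma>"
    using s by (simp add: expect_def)
  then have "expect (ind (iv ` Y) \<star> a) \<noteq> (\<lambda>\<sigma>. 0)" using nz by metis
  then show "\<exists>n\<in>normalisers A B. expect (n \<star> a) \<noteq> (\<lambda>\<sigma>. 0)"
    using ind_normaliser[OF cobis_inv[OF Y(1)]] by blast
qed

text \<open>\<open>E\<close> consists of the ranges of the part of \<open>Y\<close> over the units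
  of \<open>G\<close>, which are also its sources. As \<open>Y\<close> is a bisection, an arrow of
  \<open>Y\<close> with either end in \<open>E\<close> belongs to this part, so cutting by
  \<open>E\<close> on the left or on the right has the same effect.\<close>

lemma expect_ind:
  assumes Y: "cobis Y" obtains e where "e \<in> idems A B" "expect (ind Y) = ind Y \<star> e" "expect (ind Y) = e \<star> ind Y"
proof -
  define Y0 where "Y0 = Y \<inter> {\<sigma> \<in> arr. q \<sigma> \<in> g_units G}"
  define E where "E = rg ` Y0"
  note Yd = cobisD[OF Y]
  have Y0: "cobis Y0" unfolding Y0_def by (rule cobis_subset[OF Y clopen_isotropy_units])
  note E = cobis_rg[OF Y0, folded E_def]
  have mem: "(rg \<sigma> \<in> E \<longleftrightarrow> q \<sigma> \<in> g_units G) \<and> (sr \<sigma> \<in> E \<longleftrightarrow> q \<sigma> \<in> g_units G)"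
    if s: "\<sigma> \<in> arr" "ind Y \<sigma> \<noteq> 0" for \<sigma>
  proof -
    obtain t where t: "t dvd 1" "t \<odot> \<sigma> \<in> Y" using ind_nonzeroE[OF cobis_inj_q[OF Y] s(2)] by blast
    let ?y = "t \<odot> \<sigma>"
    have y: "?y \<in> arr" "rg ?y = rg \<sigma>" "sr ?y = sr \<sigma>" "q ?y = q \<sigma>" using s t by simp_all
    have unit_eq: "rg z = sr z" if "z \<in> Y0" for z
    proof -
      have "z \<in> arr" "q z \<in> g_units G" using that unfolding Y0_def by auto
      then show ?thesis
        using G.unit_rng[of "q z"] G.unit_src[of "q z"] sr_rg_eq_iff[of z z] by simp
    qed
    have "?y \<in> Y0" if "q \<sigma> \<in> g_units G" using that t(2) y unfolding Y0_def by auto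
    then have 1: "rg \<sigma> \<in> E \<and> sr \<sigma> \<in> E" if "q \<sigma> \<in> g_units G"
      using that y unit_eq[of ?y] unfolding E_def by (metis image_eqI)
    have 2: "q \<sigma> \<in> g_units G" if r: "rg \<sigma> \<in> E"
    proof -
      obtain z where z: "z \<in> Y0" "rg z = rg \<sigma>" using r unfolding E_def by auto
      then have "z = ?y" using inj_onD[OF Yd(5), of z ?y] t y unfolding Y0_def by simp
      then show ?thesis using z(1) y(4) unfolding Y0_def by auto
    qed
    have 3: "q \<sigma> \<in> g_units G" if r: "sr \<sigma> \<in> E"
    proof -
      obtain z where z: "z \<in> Y0" "rg z = sr \<sigma>" using r unfolding E_def by auto
      then have "z = ?y" using unit_eq[of z] inj_onD[OF Yd(6), of z ?y] t y unfolding Y0_def by simp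
      then show ?thesis using z(1) y(4) unfolding Y0_def by auto
    qed
    show ?thesis using 1 2 3 by blast
  qed
  note Ed = ind_units_diagonal[OF E(2)] and iu = ind_unit[OF E(2)]
  show ?thesis
  proof (rule that[of "ind E"])
    show "ind E \<in> idems A B" using ind_idem[OF E] .
    show "expect (ind Y) = ind Y \<star> ind E"
    proof
      fix \<sigma> show "expect (ind Y) \<sigma> = (ind Y \<star> ind E) \<sigma>"
        using conv_diagonal_right[OF Ed ind_row_finite[OF Y], of \<sigma>] mem[of \<sigma>] iu[of "sr \<sigma>"] conv_outside[of \<sigma>]
        by (cases "\<sigma> \<in> arr"; cases "ind Y \<sigma> = 0") (simp_all add: expect_def)
    qed
    show "expect (ind Y) = ind E \<star> ind Y"
    proof
      fix \<sigma> show "expect (ind Y) \<sigma> = (ind E \<star> ind Y) \<sigma>"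
        using conv_diagonal_left[OF Ed equivariant_ind[OF cobis_inj_q[OF Y]], of \<sigma>] mem[of \<sigma>] iu[of "rg \<sigma>"] conv_outside[of \<sigma>]
        by (cases "\<sigma> \<in> arr"; cases "ind Y \<sigma> = 0") (simp_all add: expect_def)
    qed
  qed
qed

lemma normaliser_span: "St = alg_span A (normalisers A B)"
proof
  have "ind ` Collect cobis \<subseteq> normalisers A B" using ind_normaliser by blast
  then show "St \<subseteq> alg_span A (normalisers A B)" using St_span alg_span_mono by blast
  show "alg_span A (normalisers A B) \<subseteq> St"
    by (rule alg_span_least) (auto simp: normalisers_def)
qed

text \<open>Implementation by idempotents is the one condition that quantifies over all normalisers;
  it waits for their description.\<close>

lemma quasi_cartan_if_normalisers:
  assumes "\<And>n. n \<in> normalisers A B \<Longrightarrow> \<exists>Y. cobis Y \<and> n = ind Y"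
  shows "alg_quasi_cartan_pair A B"
proof -
  have "implemented_by_idems A B expect"
    unfolding implemented_by_idems_def A_simps
  proof
    fix n assume "n \<in> normalisers A B"
    then obtain Y where "cobis Y" "n = ind Y" using assms by blast
    then show "\<exists>e\<in>idems A B. expect n = n \<star> e \<and> expect n = e \<star> n" using expect_ind by metis
  qed
  moreover have "\<exists>e\<in>idems A B. \<forall>a\<in>F. e \<star> a = a \<and> a \<star> e = a" if "finite F \<and> F \<subseteq> St" for F
    using local_units[of F] that by metis
  ultimately show ?thesis
    unfolding alg_quasi_cartan_pair_def
    using r_algebra_A comm_subalgebra_B B_span normaliser_span cond_expectation_expect faithful_expect
    by (auto intro: idem_torsion_free)
qed

end

section \<open>Normalisers\<close>

text \<open>The positive elements of a translation invariant total order, kept as a set so that the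
  order can be reversed freely and no order need be fixed on the type.\<close>

definition positive_cone :: "'d::ab_group_add set \<Rightarrow> bool" where
  "positive_cone P \<longleftrightarrow> 0 \<notin> P \<and> (\<forall>x\<in>P. \<forall>y\<in>P. x + y \<in> P) \<and> (\<forall>x. x \<noteq> 0 \<longrightarrow> x \<in> P \<or> - x \<in> P)"

lemma positive_coneD:
  assumes "positive_cone P"
  shows "0 \<notin> P" "x \<in> P \<Longrightarrow> y \<in> P \<Longrightarrow> x + y \<in> P" "x \<noteq> 0 \<Longrightarrow> x \<in> P \<or> - x \<in> P"
  using assms unfolding positive_cone_def by blast+

lemma positive_cone_uminus: "positive_cone P \<Longrightarrow> positive_cone (uminus ` P)"
proof -
  assume P: "positive_cone P"
  have mem: "x \<in> uminus ` P \<longleftrightarrow> - x \<in> P" for x :: 'a by (metis image_iff minus_minus)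
  show ?thesis
    unfolding positive_cone_def Ball_def mem
    using positive_coneD[OF P] by (metis minus_add_distrib minus_minus minus_zero neg_equal_0_iff_equal)
qed

lemma positive_cone_finite_max:
  assumes P: "positive_cone P" and S: "finite S" "S \<noteq> {}"
  obtains s where "s \<in> S" "\<And>t. t \<in> S \<Longrightarrow> t - s \<notin> P"
proof -
  have "\<exists>s\<in>S. \<forall>t\<in>S. t - s \<notin> P"
    using S
  proof (induction S rule: finite_ne_induct)
    case (singleton x)
    then show ?case using positive_coneD(1)[OF P] by simp
  next
    case (insert x F)
    then obtain s where s: "s \<in> F" "\<And>t. t \<in> F \<Longrightarrow> t - s \<notin> P" by blast
    show ?case
    proof (cases "x - s \<in> P")
      case False
      then show ?thesis using s by (intro bexI[of _ s]) auto
    next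
      case True
      have "t - x \<notin> P" if "t \<in> F" for t
      proof
        assume "t - x \<in> P"
        then have "(t - x) + (x - s) \<in> P" using True positive_coneD(2)[OF P] by blast
        then show False using s(2)[OF that] by simp
      qed
      then show ?thesis using positive_coneD(1)[OF P] by (intro bexI[of _ x]) auto
    qed
  qed
  then show ?thesis using that by blast
qed

text \<open>Beyond topology, this is all that the description of normalisers takes from a
  Deaconu--Renault groupoid: a cocycle into an orderable group that separates arrows with the same
  range and source.\<close>

locale graded_twist = indecomposable_twist G \<Sigma> i q
  for G :: "'g groupoid" and \<Sigma> :: "'s groupoid"
    and i :: "'g \<times> 'r::comm_ring_1 \<Rightarrow> 's" and q :: "'s \<Rightarrow> 'g" +
  fixes deg :: "'g \<Rightarrow> 'd::ab_group_add"
  assumes reduced_ring: "(a::'r) * a = 0 \<Longrightarrow> a = 0"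
    and deg_mul: "\<lbrakk>\<alpha> \<in> g_arr G; \<beta> \<in> g_arr G; g_src G \<alpha> = g_rng G \<beta>\<rbrakk> \<Longrightarrow>
      deg (g_mul G \<alpha> \<beta>) = deg \<alpha> + deg \<beta>"
    and deg_inj: "\<lbrakk>\<alpha> \<in> g_arr G; \<beta> \<in> g_arr G; g_rng G \<alpha> = g_rng G \<beta>; g_src G \<alpha> = g_src G \<beta>; deg \<alpha> = deg \<beta>\<rbrakk>
      \<Longrightarrow> \<alpha> = \<beta>"
    and ex_cone: "\<exists>P::'d set. positive_cone P"
begin

abbreviation dg :: "'s \<Rightarrow> 'd" where "dg \<sigma> \<equiv> deg (q \<sigma>)"

lemma deg_unit: assumes "u \<in> g_units G" shows "deg u = 0"
  using deg_mul[of u u] assms by simp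

lemma dg_mul: "\<lbrakk>\<sigma> \<in> arr; \<tau> \<in> arr; sr \<sigma> = rg \<tau>\<rbrakk> \<Longrightarrow> dg (\<sigma> \<cdot> \<tau>) = dg \<sigma> + dg \<tau>"
  using deg_mul[of "q \<sigma>" "q \<tau>"] sr_rg_eq_iff[of \<sigma> \<tau>] by simp

lemma dg_iv: assumes "\<sigma> \<in> arr" shows "dg (iv \<sigma>) = - dg \<sigma>"
proof -
  have "dg (\<sigma> \<cdot> iv \<sigma>) = dg \<sigma> + dg (iv \<sigma>)" using assms by (intro dg_mul) simp_all
  moreover have "dg (\<sigma> \<cdot> iv \<sigma>) = 0" using assms deg_unit[of "q (rg \<sigma>)"] by simp
  ultimately show ?thesis by (metis add.commute add_eq_0_iff)
qed

lemma dg_inj: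
  assumes "\<sigma> \<in> arr" "\<tau> \<in> arr" "rg \<sigma> = rg \<tau>" "sr \<sigma> = sr \<tau>" "dg \<sigma> = dg \<tau>" shows "q \<sigma> = q \<tau>"
  using deg_inj[of "q \<sigma>" "q \<tau>"] rg_eq_iff[of \<sigma> \<tau>] sr_eq_iff[of \<sigma> \<tau>] assms by simp

section \<open>Point masses at units\<close>

lemma delta_diagonal [simp]: "x \<in> g_units \<Sigma> \<Longrightarrow> ind {x} \<in> diagonal"
  by (simp add: ind_units_diagonal)

lemma delta_row_finite [simp]: "x \<in> g_units \<Sigma> \<Longrightarrow> ind {x} \<in> row_finite"
  by (simp add: diagonal_row_finite)

lemma delta_equivariant [simp]: "x \<in> g_units \<Sigma> \<Longrightarrow> equivariant (ind {x})"
  by (simp add: diagonal_equivariant)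

lemma delta_conv_diagonal:
  assumes "x \<in> g_units \<Sigma>" "d \<in> diagonal"
  shows "ind {x} \<star> d = (\<lambda>\<sigma>. d x * ind {x} \<sigma>)" "d \<star> ind {x} = (\<lambda>\<sigma>. d x * ind {x} \<sigma>)"
proof -
  have d: "(\<lambda>\<sigma>. d x * ind {x} \<sigma>) \<in> diagonal"
    using delta_diagonal[OF assms(1)] equivariant_smult[of "ind {x}" "d x"] by (auto simp: diagonal_def)
  show 1: "ind {x} \<star> d = (\<lambda>\<sigma>. d x * ind {x} \<sigma>)"
  proof (rule diagonal_ext[OF diagonal_conv[OF delta_diagonal[OF assms(1)] assms(2)] d])
    fix u assume u: "u \<in> g_units \<Sigma>"
    then show "(ind {x} \<star> d) u = d x * ind {x} u"
      using conv_diagonal_left[OF delta_diagonal[OF assms(1)] diagonal_equivariant[OF assms(2)], of u]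
        ind_unit[of "{x}" u] assms by simp
  qed
  show "d \<star> ind {x} = (\<lambda>\<sigma>. d x * ind {x} \<sigma>)"
    using 1 diagonal_conv_commute[OF assms(2) delta_diagonal[OF assms(1)]] by simp
qed

lemma delta_self: "x \<in> g_units \<Sigma> \<Longrightarrow> ind {x} x = 1"
  using ind_unit[of "{x}" x] by simp

lemma delta_left:
  "\<lbrakk>x \<in> g_units \<Sigma>; equivariant f; \<sigma> \<in> arr\<rbrakk> \<Longrightarrow> (ind {x} \<star> f) \<sigma> = (if rg \<sigma> = x then f \<sigma> else 0)"
  using conv_diagonal_left[of "ind {x}" f \<sigma>] ind_unit[of "{x}" "rg \<sigma>"] by simp

lemma delta_right:
  "\<lbrakk>x \<in> g_units \<Sigma>; f \<in> row_finite; \<sigma> \<in> arr\<rbrakk> \<Longrightarrow> (f \<star> ind {x}) \<sigma> = (if sr \<sigma> = x then f \<sigma> else 0)"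
  using conv_diagonal_right[of "ind {x}" f \<sigma>] ind_unit[of "{x}" "sr \<sigma>"] by simp

text \<open>Unless \<open>x\<close> is isolated, \<open>ind {x}\<close> is not in the algebra; on one arrow at a time it may be
  replaced by an idempotent of \<open>B\<close>.\<close>

lemma delta_approx:
  assumes n: "n \<in> row_finite" and k: "equivariant k" and x: "x \<in> g_units \<Sigma>" and \<sigma>: "\<sigma> \<in> arr"
  obtains E where "cobis E" "E \<subseteq> g_units \<Sigma>" "(n \<star> (ind {x} \<star> k)) \<sigma> = (n \<star> (ind E \<star> k)) \<sigma>"
proof -
  obtain F where F: "finite F" "F \<subseteq> arr" "inj_on q F" "\<And>\<tau>. \<tau> \<in> F \<Longrightarrow> rg \<tau> = rg \<sigma>"
    "\<And>\<tau>. \<tau> \<in> arr \<Longrightarrow> rg \<tau> = rg \<sigma> \<Longrightarrow> n \<tau> \<noteq> 0 \<Longrightarrow> q \<tau> \<in> q ` F"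
    using ex_transversal[OF n S.rng_units[OF \<sigma>]] by metis
  \<comment> \<open>The row of \<open>n\<close> at \<open>rg \<sigma>\<close> meets finitely many
    sources. A compact open \<open>E\<close> containing \<open>x\<close> but none of the others
    cannot be told apart from \<open>x\<close> on this row.\<close>
  have "closedin (g_top \<Sigma>) (sr ` F - {x})"
  proof -
    have "finite (sr ` F - {x})" "sr ` F - {x} \<subseteq> arr" using F(1,2) by auto
    then show ?thesis
      using Hausdorff_imp_t1_space[OF Hausdorff_S] unfolding t1_space_closedin_finite by blast
  qed
  then have "openin (g_top \<Sigma>) (g_units \<Sigma> - (sr ` F - {x}))"
    using open_units_S openin_diff by blast
  then obtain E where E: "cobis E" "x \<in> E" "E \<subseteq> g_units \<Sigma> - (sr ` F - {x})"
    using cobis_basis[of "g_units \<Sigma> - (sr ` F - {x})" x] x by blast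
  have Eu: "E \<subseteq> g_units \<Sigma>" using E by blast
  note Ed = ind_units_diagonal[OF Eu]
  have "(n \<star> (ind {x} \<star> k)) \<sigma> = (\<Sum>\<tau>\<in>F. n \<tau> * (ind {x} \<star> k) (iv \<tau> \<cdot> \<sigma>))"
    by (rule conv_eq_sum[OF n equivariant_conv[OF delta_row_finite[OF x] k] \<sigma> F(1-4)]) (auto intro: F(5))
  also have "\<dots> = (\<Sum>\<tau>\<in>F. n \<tau> * (ind E \<star> k) (iv \<tau> \<cdot> \<sigma>))"
  proof (rule sum.cong[OF refl])
    fix \<tau> assume t: "\<tau> \<in> F"
    then have ta: "\<tau> \<in> arr" "rg \<tau> = rg \<sigma>" "sr \<tau> \<in> g_units \<Sigma>" using F(2,4) by auto
    have "ind E (sr \<tau>) = (if sr \<tau> = x then 1 else 0)"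
      using ind_unit[OF Eu ta(3)] E(2,3) t by auto
    then have "(ind E \<star> k) (iv \<tau> \<cdot> \<sigma>) = (if sr \<tau> = x then k (iv \<tau> \<cdot> \<sigma>) else 0)"
      using conv_diagonal_left[OF Ed k, of "iv \<tau> \<cdot> \<sigma>"] ta \<sigma> by simp
    then show "n \<tau> * (ind {x} \<star> k) (iv \<tau> \<cdot> \<sigma>) = n \<tau> * (ind E \<star> k) (iv \<tau> \<cdot> \<sigma>)"
      using delta_left[OF x k, of "iv \<tau> \<cdot> \<sigma>"] ta \<sigma> by simp
  qed
  also have "\<dots> = (n \<star> (ind E \<star> k)) \<sigma>"
    by (rule conv_eq_sum[OF n equivariant_conv[OF diagonal_row_finite[OF Ed] k] \<sigma> F(1-4), symmetric]) (auto intro: F(5))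
  finally show ?thesis using that E(1) Eu by blast
qed

lemma is_dagger_sym: "n \<in> St \<Longrightarrow> is_dagger A B n k \<Longrightarrow> is_dagger A B k n"
  unfolding is_dagger_def A_simps by blast

text \<open>Vanishing off the arrows over units is tested one arrow at a time, and at each arrow the
  point mass may be exchanged for an idempotent of \<open>B\<close>, to which the normaliser
  condition applies.\<close>

lemma delta_sandwich_diagonal:
  assumes n: "n \<in> St" and k: "is_dagger A B n k" and x: "x \<in> g_units \<Sigma>"
  shows "n \<star> (ind {x} \<star> k) \<in> diagonal"
proof -
  have kS: "k \<in> St" using k is_dagger_St by blast
  have ke: "equivariant k" and nr: "n \<in> row_finite" using kS n St_equivariant St_row_finite by auto
  have "q \<sigma> \<in> g_units G" if s: "\<sigma> \<in> arr" and nz: "(n \<star> (ind {x} \<star> k)) \<sigma> \<noteq> 0" for \<sigma>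
  proof -
    obtain E where E: "cobis E" "E \<subseteq> g_units \<Sigma>" "(n \<star> (ind {x} \<star> k)) \<sigma> = (n \<star> (ind E \<star> k)) \<sigma>"
      using delta_approx[OF nr ke x s] by blast
    have "ind E \<in> B" using ind_idem[OF E(1,2)] by (simp add: idems_def)
    then have "(n \<star> ind E) \<star> k \<in> B" using k unfolding is_dagger_def A_simps by blast
    then have "n \<star> (ind E \<star> k) \<in> diagonal"
      using St_conv_assoc[OF n ind_St[OF E(1)] kS] B_diagonal by simp
    then show ?thesis using nz s E(3) by (simp add: diagonal_def)
  qed
  moreover have "equivariant (n \<star> (ind {x} \<star> k))"
    using equivariant_conv[OF nr equivariant_conv[OF delta_row_finite[OF x] ke]] .
  ultimately show ?thesis by (simp add: diagonal_def)
qed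

text \<open>Everything follows from one scalar \<open>c\<close>, the value at \<open>y\<close> of
  the diagonal element \<open>n \<star> (?dx \<star> k)\<close>. Multiplication by \<open>c\<close>
  fixes the values of \<open>n\<close> on arrows from \<open>x\<close> to \<open>y\<close> and kills
  those on arrows from other sources to \<open>y\<close>. As \<open>c\<close> is idempotent and
  fixes \<open>n \<sigma> \<noteq> 0\<close>, it is \<open>1\<close>.\<close>

lemma dagger_row:
  assumes n: "n \<in> St" and k: "is_dagger A B n k" and \<sigma>: "n \<sigma> \<noteq> 0"
  shows "\<And>\<tau>. n \<tau> \<noteq> 0 \<Longrightarrow> rg \<tau> = rg \<sigma> \<Longrightarrow> sr \<tau> = sr \<sigma>"
    and "(n \<star> k) (rg \<sigma>) = 1"
    and "\<exists>\<kappa>. k \<kappa> \<noteq> 0 \<and> rg \<kappa> = sr \<sigma> \<and> sr \<kappa> = rg \<sigma>"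
proof -
  have kS: "k \<in> St" using k is_dagger_St by blast
  have ne: "equivariant n" and ke: "equivariant k" and nr: "n \<in> row_finite" and kr: "k \<in> row_finite"
    using kS n St_equivariant St_row_finite by auto
  have s: "\<sigma> \<in> arr" using equivariantD(3)[OF ne \<sigma>] .
  define x y where "x = sr \<sigma>" and "y = rg \<sigma>"
  have x: "x \<in> g_units \<Sigma>" and y: "y \<in> g_units \<Sigma>" using s by (simp_all add: x_def y_def)
  let ?dx = "ind {x}" and ?dy = "ind {y}"
  have ya: "y \<in> arr" using y by simp
  note rf = row_finite_conv delta_row_finite[OF x] delta_row_finite[OF y] nr kr
    equivariant_conv delta_equivariant[OF x] delta_equivariant[OF y] ne ke
  define c where "c = (n \<star> (?dx \<star> k)) y"
  define d where "d = (k \<star> n) x"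
  note sand = delta_sandwich_diagonal[OF n k x]
  have kn: "k \<star> n \<in> diagonal" and nk: "n \<star> k \<in> diagonal" using dagger_mult_B[OF n k] B_diagonal by auto
  have nkn: "n \<star> (k \<star> n) = n"
    using k n kS by (simp_all add: is_dagger_def St_conv_assoc)
  have 1: "?dy \<star> (n \<star> (?dx \<star> k)) = (\<lambda>\<sigma>. c * ?dy \<sigma>)"
    using delta_conv_diagonal(1)[OF y sand] by (simp add: c_def)
  have 2: "?dx \<star> (k \<star> n) = (\<lambda>\<sigma>. d * ?dx \<sigma>)" "(k \<star> n) \<star> ?dx = (\<lambda>\<sigma>. d * ?dx \<sigma>)"
    using delta_conv_diagonal[OF x kn] by (simp_all add: d_def)
  have 3: "n \<star> ?dx = (\<lambda>\<sigma>. d * (n \<star> ?dx) \<sigma>)"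
  proof -
    have "n \<star> ?dx = (n \<star> (k \<star> n)) \<star> ?dx" using nkn by simp
    also have "\<dots> = n \<star> ((k \<star> n) \<star> ?dx)" by (rule conv_assoc) (intro rf)+
    also have "\<dots> = (\<lambda>\<sigma>. d * (n \<star> ?dx) \<sigma>)" unfolding 2 by (rule conv_smult_right)
    finally show ?thesis .
  qed
  \<comment> \<open>Multiply 1 on the right by \<open>n\<close>. The diagonal element
    \<open>k \<star> n\<close> meets \<open>?dx\<close> and becomes the scalar \<open>d\<close>,
    which \<open>n \<star> ?dx\<close> absorbs by 3.\<close>
  have 4: "(\<lambda>\<sigma>. c * (?dy \<star> n) \<sigma>) = ?dy \<star> (n \<star> ?dx)"
  proof -
    have "(\<lambda>\<sigma>. c * (?dy \<star> n) \<sigma>) = (\<lambda>\<sigma>. c * ?dy \<sigma>) \<star> n"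
      by (rule conv_smult_left[symmetric]) (intro rf)+
    also have "\<dots> = (?dy \<star> (n \<star> (?dx \<star> k))) \<star> n" by (simp only: 1)
    also have "\<dots> = ?dy \<star> ((n \<star> (?dx \<star> k)) \<star> n)" by (rule conv_assoc) (intro rf)+
    also have "(n \<star> (?dx \<star> k)) \<star> n = n \<star> ((?dx \<star> k) \<star> n)" by (rule conv_assoc) (intro rf)+
    also have "(?dx \<star> k) \<star> n = ?dx \<star> (k \<star> n)" by (rule conv_assoc) (intro rf)+
    also have "n \<star> (?dx \<star> (k \<star> n)) = (\<lambda>\<sigma>. d * (n \<star> ?dx) \<sigma>)" unfolding 2 by (rule conv_smult_right)
    also have "\<dots> = n \<star> ?dx" by (rule 3[symmetric])
    finally show ?thesis .
  qed
  have val: "c * n \<tau> = (if sr \<tau> = x then n \<tau> else 0)" if t: "\<tau> \<in> arr" "rg \<tau> = y" for \<tau>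
  proof -
    have "c * (?dy \<star> n) \<tau> = (?dy \<star> (n \<star> ?dx)) \<tau>" using fun_cong[OF 4, of \<tau>] .
    moreover have "(?dy \<star> n) \<tau> = n \<tau>" using delta_left[OF y ne t(1)] t(2) by simp
    moreover have "equivariant (n \<star> ?dx)" by (intro rf)
    then have "(?dy \<star> (n \<star> ?dx)) \<tau> = (n \<star> ?dx) \<tau>" using delta_left[OF y _ t(1)] t(2) by simp
    moreover have "(n \<star> ?dx) \<tau> = (if sr \<tau> = x then n \<tau> else 0)" using delta_right[OF x nr t(1)] .
    ultimately show ?thesis by simp
  qed
  \<comment> \<open>Multiply 4 on the right by \<open>?dx \<star> k\<close>: the left side becomes
    \<open>c * c\<close> times \<open>?dy\<close>, and the right side is again the compression in 1,
    which is \<open>c\<close> times \<open>?dy\<close>.\<close>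
  have "c * c = c"
  proof -
    have dd: "?dx \<star> ?dx = ?dx"
      using delta_conv_diagonal(1)[OF x delta_diagonal[OF x]] delta_self[OF x] by simp
    have e: "equivariant (?dx \<star> k)" by (intro rf)
    have "(\<lambda>\<sigma>. c * (?dy \<star> n) \<sigma>) \<star> (?dx \<star> k) = (\<lambda>\<sigma>. c * ((?dy \<star> n) \<star> (?dx \<star> k)) \<sigma>)"
      by (rule conv_smult_left) (intro rf)+
    also have "(?dy \<star> n) \<star> (?dx \<star> k) = ?dy \<star> (n \<star> (?dx \<star> k))" by (rule conv_assoc) (intro rf)+
    finally have "(\<lambda>\<sigma>. c * (c * ?dy \<sigma>)) = (?dy \<star> (n \<star> ?dx)) \<star> (?dx \<star> k)"
      unfolding 1 4 by simp
    also have "\<dots> = ?dy \<star> ((n \<star> ?dx) \<star> (?dx \<star> k))" by (rule conv_assoc) (intro rf)+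
    also have "(n \<star> ?dx) \<star> (?dx \<star> k) = n \<star> (?dx \<star> (?dx \<star> k))" by (rule conv_assoc) (intro rf)+
    also have "?dx \<star> (?dx \<star> k) = ?dx \<star> k"
      using conv_assoc[OF delta_row_finite[OF x] delta_row_finite[OF x] ke] dd by simp
    finally have "(\<lambda>\<sigma>. c * (c * ?dy \<sigma>)) = (\<lambda>\<sigma>. c * ?dy \<sigma>)" unfolding 1 .
    from fun_cong[OF this, of y] show ?thesis using delta_self[OF y] by simp
  qed
  then have "c = 0 \<or> c = 1" by (rule idem_ring)
  moreover have "c \<noteq> 0" using val[OF s] \<sigma> by (auto simp: x_def y_def)
  ultimately have c1: "c = 1" by blast
  show row: "sr \<tau> = sr \<sigma>" if t: "n \<tau> \<noteq> 0" "rg \<tau> = rg \<sigma>" for \<tau>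
    using val[of \<tau>] equivariantD(3)[OF ne t(1)] t c1 by (auto simp: x_def y_def split: if_splits)
  show "(n \<star> k) (rg \<sigma>) = 1"
  proof -
    have "(?dy \<star> n) \<tau> = (?dy \<star> (n \<star> ?dx)) \<tau>" for \<tau> using fun_cong[OF 4, of \<tau>] c1 by simp
    then have eq: "?dy \<star> n = ?dy \<star> (n \<star> ?dx)" by blast
    have "?dy \<star> (n \<star> k) = (?dy \<star> n) \<star> k" by (rule conv_assoc[symmetric]) (intro rf)+
    also have "\<dots> = ?dy \<star> ((n \<star> ?dx) \<star> k)" unfolding eq by (rule conv_assoc) (intro rf)+
    also have "(n \<star> ?dx) \<star> k = n \<star> (?dx \<star> k)" by (rule conv_assoc) (intro rf)+
    finally have "(\<lambda>\<sigma>. (n \<star> k) y * ?dy \<sigma>) = (\<lambda>\<sigma>. c * ?dy \<sigma>)"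
      unfolding 1 delta_conv_diagonal(1)[OF y nk] .
    from fun_cong[OF this, of y] show ?thesis using delta_self[OF y] c1 by (simp add: y_def)
  qed
  have e: "equivariant (?dx \<star> k)" by (intro rf)
  have "(n \<star> (?dx \<star> k)) y \<noteq> 0" using c1 zero_neq_one_ring by (simp add: c_def)
  then obtain \<tau> where t: "\<tau> \<in> arr" "rg \<tau> = rg y" "(?dx \<star> k) (iv \<tau> \<cdot> y) \<noteq> 0"
    using conv_nonzeroE[OF nr e] by metis
  have "iv \<tau> \<cdot> y = iv \<tau>" using t y by simp
  then have "sr \<tau> = x \<and> k (iv \<tau>) \<noteq> 0" using t delta_left[OF x ke, of "iv \<tau>"] by (auto split: if_splits)
  then show "\<exists>\<kappa>. k \<kappa> \<noteq> 0 \<and> rg \<kappa> = sr \<sigma> \<and> sr \<kappa> = rg \<sigma>"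
    using t y by (intro exI[of _ "iv \<tau>"]) (simp add: x_def y_def)
qed

text \<open>The argument that a unit of a group ring of an ordered group over a reduced ring has
  pairwise annihilating coefficients: multiplying the coefficient of \<open>n \<star> k\<close> at the largest
  offending degree by the offending product shows that its square vanishes.\<close>

lemma dagger_annihilate:
  assumes P: "positive_cone P" and n: "n \<in> St" and k: "is_dagger A B n k"
    and \<tau>0: "n \<tau>0 \<noteq> 0" and \<rho>0: "k \<rho>0 \<noteq> 0" and comp0: "sr \<tau>0 = rg \<rho>0" and pos0: "dg \<tau>0 + dg \<rho>0 \<in> P"
  shows "n \<tau>0 * k \<rho>0 = 0"
proof (rule ccontr)
  assume bad0: "n \<tau>0 * k \<rho>0 \<noteq> 0"
  have kS: "k \<in> St" using k is_dagger_St by blast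
  have ne: "equivariant n" and ke: "equivariant k" and nr: "n \<in> row_finite" and kr: "k \<in> row_finite"
    using kS n St_equivariant St_row_finite by auto
  have nk: "n \<star> k \<in> diagonal" using dagger_mult_B[OF n k] B_diagonal by auto
  have t0: "\<tau>0 \<in> arr" using equivariantD(3)[OF ne \<tau>0] .
  define x y where "x = sr \<tau>0" and "y = rg \<tau>0"
  have row: "sr \<tau> = x" if "n \<tau> \<noteq> 0" "rg \<tau> = y" for \<tau>
    using dagger_row(1)[OF n k \<tau>0 that(1)] that(2) by (simp add: x_def y_def)
  \<comment> \<open>Only offending degrees in the cone are collected, and finite rows make them
    finitely many. Degrees of the other sign will be covered by the opposite cone.\<close>
  define S where "S = {dg \<tau> + dg \<rho> | \<tau> \<rho>. rg \<tau> = y \<and> rg \<rho> = x \<and> n \<tau> * k \<rho> \<noteq> 0 \<and> dg \<tau> + dg \<rho> \<in> P}"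
  have "finite S"
  proof -
    let ?N = "{\<alpha> \<in> q ` supp \<Sigma> n. g_rng G \<alpha> = q y}" and ?K = "{\<alpha> \<in> q ` supp \<Sigma> k. g_rng G \<alpha> = q x}"
    have "finite ((\<lambda>(a, b). deg a + deg b) ` (?N \<times> ?K))"
      using nr kr by (auto simp: row_finite_def)
    moreover have "S \<subseteq> (\<lambda>(a, b). deg a + deg b) ` (?N \<times> ?K)"
    proof
      fix s assume "s \<in> S"
      then obtain \<tau> \<rho> where *: "s = dg \<tau> + dg \<rho>" "rg \<tau> = y" "rg \<rho> = x" and "n \<tau> * k \<rho> \<noteq> 0"
        unfolding S_def by blast
      then have nz: "n \<tau> \<noteq> 0" "k \<rho> \<noteq> 0" by auto
      then have a: "\<tau> \<in> supp \<Sigma> n" "\<rho> \<in> supp \<Sigma> k" "\<tau> \<in> arr" "\<rho> \<in> arr"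
        using in_supp_iff ne ke equivariantD(3) by auto
      then have "q \<tau> \<in> ?N" "q \<rho> \<in> ?K" using * q_rg[of \<tau>] q_rg[of \<rho>] by auto
      then show "s \<in> (\<lambda>(a, b). deg a + deg b) ` (?N \<times> ?K)" using *(1) by force
    qed
    ultimately show ?thesis by (rule finite_subset[rotated])
  qed
  moreover have "S \<noteq> {}" using bad0 comp0 pos0 unfolding S_def x_def y_def by force
  ultimately obtain s where s: "s \<in> S" "\<And>t. t \<in> S \<Longrightarrow> t - s \<notin> P"
    using positive_cone_finite_max[OF P] by metis
  then obtain \<tau> \<rho> where tr: "s = dg \<tau> + dg \<rho>" "rg \<tau> = y" "rg \<rho> = x" "n \<tau> * k \<rho> \<noteq> 0" "s \<in> P"
    unfolding S_def by auto
  have nz: "n \<tau> \<noteq> 0" "k \<rho> \<noteq> 0" using tr(4) by auto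
  have ta: "\<tau> \<in> arr" and ra: "\<rho> \<in> arr" using equivariantD(3) ne ke nz by auto
  have st: "sr \<tau> = x" using row nz(1) tr(2) by blast
  define \<sigma> where "\<sigma> = \<tau> \<cdot> \<rho>"
  have sa: "\<sigma> \<in> arr" "rg \<sigma> = y" "dg \<sigma> = s" using ta ra st tr dg_mul[of \<tau> \<rho>] by (simp_all add: \<sigma>_def)
  \<comment> \<open>A degree above \<open>s\<close> is again positive, since \<open>s\<close> is; a
    nonzero product there would belong to \<open>S\<close> and contradict the choice of
    \<open>s\<close>.\<close>
  have max: "n \<tau>' * k \<rho>' = 0"
    if "rg \<tau>' = y" "rg \<rho>' = x" "dg \<tau>' + dg \<rho>' - s \<in> P" for \<tau>' \<rho>'
  proof (rule ccontr)
    assume "n \<tau>' * k \<rho>' \<noteq> 0"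
    moreover have "dg \<tau>' + dg \<rho>' \<in> P" using positive_coneD(2)[OF P that(3) tr(5)] by simp
    ultimately have "dg \<tau>' + dg \<rho>' \<in> S" unfolding S_def using that by blast
    then show False using s(2) that(3) by blast
  qed
  have "q \<sigma> \<notin> g_units G" using deg_unit[of "q \<sigma>"] sa(3) tr(5) positive_coneD(1)[OF P] by auto
  then have zero: "(n \<star> k) \<sigma> = 0" using nk sa(1) unfolding diagonal_def by blast
  have yu: "y \<in> g_units \<Sigma>" using t0 by (simp add: y_def)
  \<comment> \<open>The transversal is made to contain the chosen \<open>\<tau>\<close> itself, so
    that its summand is exactly the offending product \<open>n \<tau> * k \<rho>\<close>.\<close>
  obtain F where F: "finite F" "F \<subseteq> arr" "inj_on q F" "\<And>\<tau>. \<tau> \<in> F \<Longrightarrow> rg \<tau> = y" "\<And>\<tau>. \<tau> \<in> F \<Longrightarrow> n \<tau> \<noteq> 0"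
    "\<And>\<tau>. \<tau> \<in> arr \<Longrightarrow> rg \<tau> = y \<Longrightarrow> n \<tau> \<noteq> 0 \<Longrightarrow> q \<tau> \<in> q ` F" "\<tau> \<in> F"
    using ex_transversal[OF nr yu, of \<tau>] nz(1) tr(2) by metis
  have "(n \<star> k) \<sigma> = (\<Sum>\<tau>'\<in>F. n \<tau>' * k (iv \<tau>' \<cdot> \<sigma>))"
    by (rule conv_eq_sum[OF nr ke sa(1) F(1-3)]) (use F sa in auto)
  then have "0 = (\<Sum>\<tau>'\<in>F. n \<tau>' * k (iv \<tau>' \<cdot> \<sigma>)) * (n \<tau> * k \<rho>)" using zero by simp
  also have "\<dots> = (\<Sum>\<tau>'\<in>F. n \<tau>' * k (iv \<tau>' \<cdot> \<sigma>) * (n \<tau> * k \<rho>))" by (rule sum_distrib_right)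
  also have "\<dots> = (\<Sum>\<tau>'\<in>{\<tau>}. n \<tau>' * k (iv \<tau>' \<cdot> \<sigma>) * (n \<tau> * k \<rho>))"
  proof (rule sum.mono_neutral_right)
    show "\<forall>\<tau>'\<in>F - {\<tau>}. n \<tau>' * k (iv \<tau>' \<cdot> \<sigma>) * (n \<tau> * k \<rho>) = 0"
    proof
      fix \<tau>' assume t': "\<tau>' \<in> F - {\<tau>}"
      have a: "\<tau>' \<in> arr" "rg \<tau>' = y" "sr \<tau>' = x" using t' F row by auto
      have "q \<tau>' \<noteq> q \<tau>" using t' F(3,7) by (auto dest: inj_onD)
      then have "dg \<tau>' - dg \<tau> \<noteq> 0" using dg_inj[OF a(1) ta] a tr(2) st by auto
      \<comment> \<open>If the degree of \<open>\<tau>'\<close> is larger, then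
        \<open>n \<tau>' * k \<rho>\<close> has degree above \<open>s\<close>; if it is smaller,
        then \<open>n \<tau> * k (iv \<tau>' \<cdot> \<sigma>)\<close> has. Either product is a
        factor of the term and vanishes by \<open>max\<close>.\<close>
      then consider "dg \<tau>' - dg \<tau> \<in> P" | "- (dg \<tau>' - dg \<tau>) \<in> P" using positive_coneD(3)[OF P] by blast
      then show "n \<tau>' * k (iv \<tau>' \<cdot> \<sigma>) * (n \<tau> * k \<rho>) = 0"
      proof cases
        case 1
        have "n \<tau>' * k \<rho> = 0" by (rule max) (use a tr 1 in simp_all)
        then show ?thesis by (metis mult.assoc mult.commute mult_zero_left)
      next
        case 2
        have b: "iv \<tau>' \<cdot> \<sigma> \<in> arr" "rg (iv \<tau>' \<cdot> \<sigma>) = x" using a sa by simp_all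
        have "dg (iv \<tau>' \<cdot> \<sigma>) = s - dg \<tau>'" using dg_mul[of "iv \<tau>'" \<sigma>] dg_iv[OF a(1)] a sa by simp
        then have "n \<tau> * k (iv \<tau>' \<cdot> \<sigma>) = 0" by (intro max) (use tr b 2 in simp_all)
        then show ?thesis by (metis mult.assoc mult.commute mult_zero_left)
      qed
    qed
  qed (use F in auto)
  also have "\<dots> = (n \<tau> * k \<rho>) * (n \<tau> * k \<rho>)" using ta ra st tr(3) by (simp add: \<sigma>_def)
  finally show False using reduced_ring tr(4) by metis
qed

text \<open>A nonzero degree lies in a given cone or in its negative, and the negative is a cone as
  well.\<close>

lemma dagger_annihilate':
  assumes n: "n \<in> St" and k: "is_dagger A B n k"
    and "sr \<tau> = rg \<rho>" "dg \<tau> + dg \<rho> \<noteq> 0"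
  shows "n \<tau> * k \<rho> = 0"
proof (cases "n \<tau> = 0 \<or> k \<rho> = 0")
  case True then show ?thesis by auto
next
  case False
  obtain P :: "'d set" where P: "positive_cone P" using ex_cone by blast
  then consider "dg \<tau> + dg \<rho> \<in> P" | "dg \<tau> + dg \<rho> \<in> uminus ` P"
    using positive_coneD(3)[OF P assms(4)] by (metis image_eqI minus_minus)
  then show ?thesis
    using dagger_annihilate[OF P n k _ _ assms(3)] dagger_annihilate[OF positive_cone_uminus[OF P] n k _ _ assms(3)] False
    by cases auto
qed

text \<open>Along a row the products \<open>e \<tau>\<close> of \<open>n \<tau>\<close> and
  \<open>k (iv \<tau>)\<close> sum to \<open>1\<close>. Different arrows of the row have the same
  ends, so their degrees differ and the cross products vanish; the \<open>e \<tau>\<close> are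
  orthogonal idempotents, and indecomposability makes one of them \<open>1\<close>. There
  \<open>n\<close> is a unit, and multiplying any other value of the row by this \<open>1\<close>
  gives zero.\<close>

lemma normaliser_values:
  assumes n: "n \<in> St" and k: "is_dagger A B n k" and \<sigma>: "n \<sigma> \<noteq> 0"
  shows "n \<sigma> dvd 1" and "\<And>\<tau>. n \<tau> \<noteq> 0 \<Longrightarrow> rg \<tau> = rg \<sigma> \<Longrightarrow> q \<tau> = q \<sigma>"
proof -
  have kS: "k \<in> St" using k is_dagger_St by blast
  have ne: "equivariant n" and ke: "equivariant k" and nr: "n \<in> row_finite"
    using kS n St_equivariant St_row_finite by auto
  have s: "\<sigma> \<in> arr" using equivariantD(3)[OF ne \<sigma>] .
  define y where "y = rg \<sigma>"
  have y: "y \<in> g_units \<Sigma>" "y \<in> arr" using s by (simp_all add: y_def)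
  obtain F where F: "finite F" "F \<subseteq> arr" "inj_on q F" "\<And>\<tau>. \<tau> \<in> F \<Longrightarrow> rg \<tau> = y" "\<And>\<tau>. \<tau> \<in> F \<Longrightarrow> n \<tau> \<noteq> 0"
    "\<And>\<tau>. \<tau> \<in> arr \<Longrightarrow> rg \<tau> = y \<Longrightarrow> n \<tau> \<noteq> 0 \<Longrightarrow> q \<tau> \<in> q ` F"
    using ex_transversal[OF nr y(1)] by metis
  define e where "e \<tau> = n \<tau> * k (iv \<tau>)" for \<tau>
  have "(n \<star> k) y = (\<Sum>\<tau>\<in>F. n \<tau> * k (iv \<tau> \<cdot> y))"
    by (rule conv_eq_sum[OF nr ke y(2) F(1-3)]) (use F y in auto)
  also have "\<dots> = (\<Sum>\<tau>\<in>F. e \<tau>)"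
    by (rule sum.cong[OF refl]) (use F(2,4) y in \<open>auto simp: e_def subset_iff\<close>)
  finally have sum1: "(\<Sum>\<tau>\<in>F. e \<tau>) = 1"
    using dagger_row(2)[OF n k \<sigma>] by (simp add: y_def)
  have cross: "n \<tau> * k (iv \<tau>') = 0"
    if "n \<tau> \<noteq> 0" "n \<tau>' \<noteq> 0" "rg \<tau> = y" "rg \<tau>' = y" "q \<tau> \<noteq> q \<tau>'" for \<tau> \<tau>'
  proof -
    have a: "\<tau> \<in> arr" "\<tau>' \<in> arr" using equivariantD(3)[OF ne] that by auto
    have "sr \<tau> = sr \<tau>'" using dagger_row(1)[OF n k that(1), of \<tau>'] that by simp
    moreover from this have "dg \<tau> \<noteq> dg \<tau>'" using dg_inj[OF a] that by auto
    ultimately show ?thesis using dg_iv[OF a(2)] a by (intro dagger_annihilate'[OF n k]) simp_all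
  qed
  have idem: "e \<tau> * e \<tau> = e \<tau>" if t: "\<tau> \<in> F" for \<tau>
  proof -
    have "e \<tau> = (\<Sum>\<tau>'\<in>F. e \<tau> * e \<tau>')" unfolding sum_distrib_left[symmetric] sum1 by simp
    also have "\<dots> = (\<Sum>\<tau>'\<in>{\<tau>}. e \<tau> * e \<tau>')"
    proof (rule sum.mono_neutral_right)
      show "\<forall>\<tau>'\<in>F - {\<tau>}. e \<tau> * e \<tau>' = 0"
      proof
        fix \<tau>' assume t': "\<tau>' \<in> F - {\<tau>}"
        have "q \<tau> \<noteq> q \<tau>'" using t t' F(3) by (auto dest: inj_onD)
        then have "n \<tau> * k (iv \<tau>') = 0" using t t' F(4,5) by (intro cross) auto
        then show "e \<tau> * e \<tau>' = 0" unfolding e_def by (metis mult.assoc mult.commute mult_zero_left)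
      qed
    qed (use F t in auto)
    finally show ?thesis by simp
  qed
  have "\<exists>\<tau>\<in>F. e \<tau> \<noteq> 0" using sum1 zero_neq_one_ring by (metis sum.neutral)
  then obtain \<tau> where t: "\<tau> \<in> F" "e \<tau> = 1" using idem idem_ring by blast
  have all: "q \<tau>' = q \<tau>" if "n \<tau>' \<noteq> 0" "rg \<tau>' = y" for \<tau>'
  proof (rule ccontr)
    assume "q \<tau>' \<noteq> q \<tau>"
    then have "n \<tau>' * k (iv \<tau>) = 0" using that t F(4,5) by (intro cross) auto
    then have "n \<tau>' * e \<tau> = 0" unfolding e_def by (metis mult.assoc mult.commute mult_zero_left)
    then show False using t that by simp
  qed
  then have qs: "q \<sigma> = q \<tau>" using \<sigma> by (simp add: y_def)
  then show "q \<tau>' = q \<sigma>" if "n \<tau>' \<noteq> 0" "rg \<tau>' = rg \<sigma>" for \<tau>' using all that by (simp add: y_def)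
  have ta: "\<tau> \<in> arr" using t F by blast
  obtain u where u: "u dvd 1" "\<sigma> = u \<odot> \<tau>" using q_eqE[OF ta s] qs by metis
  have "n \<tau> dvd 1" using t(2) unfolding e_def by (metis dvd_triv_left)
  then show "n \<sigma> dvd 1" using equivariantD(1)[OF ne ta u(1)] u by simp
qed

lemma normaliser_ind:
  assumes "n \<in> normalisers A B" obtains Y where "cobis Y" "n = ind Y"
proof -
  obtain k where n: "n \<in> St" and k: "is_dagger A B n k"
    using assms unfolding normalisers_def A_simps by blast
  have kS: "k \<in> St" using k is_dagger_St by blast
  have ne: "equivariant n" and lc: "locally_constant (g_top \<Sigma>) n" using n St_iff by auto
  note k' = is_dagger_sym[OF n k]
  \<comment> \<open>Injectivity on sources is obtained through the dagger: the row of
    \<open>k\<close> at the common source has a single source, and this is the range of both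
    \<open>\<sigma>\<close> and \<open>\<tau>\<close>.\<close>
  have same_src: "q \<tau> = q \<sigma>" if nz: "n \<sigma> \<noteq> 0" "n \<tau> \<noteq> 0" and sr: "sr \<tau> = sr \<sigma>" for \<sigma> \<tau>
  proof -
    obtain \<kappa> where \<kappa>: "k \<kappa> \<noteq> 0" "rg \<kappa> = sr \<sigma>" "sr \<kappa> = rg \<sigma>" using dagger_row(3)[OF n k nz(1)] by blast
    obtain \<mu> where \<mu>: "k \<mu> \<noteq> 0" "rg \<mu> = sr \<tau>" "sr \<mu> = rg \<tau>" using dagger_row(3)[OF n k nz(2)] by blast
    have "sr \<kappa> = sr \<mu>" using dagger_row(1)[OF kS k' \<mu>(1) \<kappa>(1)] \<kappa> \<mu> sr by simp
    then show ?thesis using normaliser_values(2)[OF n k nz] \<kappa> \<mu> by simp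
  qed
  define Y where "Y = {\<sigma> \<in> arr. n \<sigma> = 1}"
  have nY: "n y = 1" "n y \<noteq> 0" if "y \<in> Y" for y
    using that zero_neq_one_ring by (auto simp: Y_def)
  have Ya: "Y \<subseteq> arr" by (auto simp: Y_def)
  have oY: "openin (g_top \<Sigma>) Y" unfolding Y_def by (rule locally_constantD[OF lc])
  have inj: "inj_on q Y"
  proof (rule inj_onI)
    fix a b assume ab: "a \<in> Y" "b \<in> Y" "q a = q b"
    then have aa: "a \<in> arr" "b \<in> arr" using Ya by auto
    obtain t where t: "t dvd 1" "b = t \<odot> a" using q_eqE[OF aa ab(3)] by blast
    have "unit_inv t = 1" using equivariantD(1)[OF ne aa(1) t(1)] t(2) nY ab by simp
    then show "a = b" using t aa by simp
  qed
  have rgi: "inj_on rg Y"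
    by (rule inj_onI) (use normaliser_values(2)[OF n k] nY inj in \<open>metis inj_onD\<close>)
  have sri: "inj_on sr Y"
    by (rule inj_onI) (use same_src nY inj in \<open>metis inj_onD\<close>)
  \<comment> \<open>The value \<open>n \<sigma>\<close> is itself the scalar that moves
    \<open>\<sigma>\<close> to a place where \<open>n\<close> is \<open>1\<close>, which is the
    recipe of \<open>ind\<close>.\<close>
  have lift: "n \<sigma> dvd 1 \<and> n \<sigma> \<odot> \<sigma> \<in> Y" if nz: "n \<sigma> \<noteq> 0" for \<sigma>
  proof -
    have u: "n \<sigma> dvd 1" using normaliser_values(1)[OF n k nz] .
    have a: "\<sigma> \<in> arr" using equivariantD(3)[OF ne nz] .
    have "n (n \<sigma> \<odot> \<sigma>) = 1" using equivariantD(1)[OF ne a u] u by simp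
    then show ?thesis using u a by (simp add: Y_def)
  qed
  have "q ` Y = q ` supp \<Sigma> n"
  proof (intro equalityI subsetI)
    fix \<alpha> assume "\<alpha> \<in> q ` Y"
    then show "\<alpha> \<in> q ` supp \<Sigma> n" using nY Ya in_supp_iff[OF ne] by blast
  next
    fix \<alpha> assume "\<alpha> \<in> q ` supp \<Sigma> n"
    then obtain \<sigma> where s: "\<sigma> \<in> arr" "n \<sigma> \<noteq> 0" "\<alpha> = q \<sigma>" by (auto simp: supp_def)
    then show "\<alpha> \<in> q ` Y" using lift[of \<sigma>] q_act[of \<sigma> "n \<sigma>"] by (metis image_eqI)
  qed
  then have "compactin (g_top G) (q ` Y)" using n unfolding St_iff by simp
  then have Y: "cobis Y" using compact_of_q_image[OF oY inj] oY rgi sri unfolding cobis_def by blast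
  have "n = ind Y"
  proof
    fix \<sigma> show "n \<sigma> = ind Y \<sigma>"
    proof (cases "n \<sigma> = 0")
      case False
      then show ?thesis using ind_eq[OF inj, of \<sigma> "n \<sigma>"] lift[OF False] equivariantD(3)[OF ne False] by simp
    next
      case True
      have "ind Y \<sigma> = 0"
      proof (rule ccontr)
        assume "ind Y \<sigma> \<noteq> 0"
        then obtain s where "\<sigma> \<in> arr" "s dvd 1" "s \<odot> \<sigma> \<in> Y" using ind_nonzeroE[OF inj] by metis
        then show False using equivariantD(1)[OF ne, of \<sigma> s] nY[of "s \<odot> \<sigma>"] True by simp
      qed
      then show ?thesis using True by simp
    qed
  qed
  then show ?thesis using that Y by blast
qed

lemma normalisers_eq: "normalisers A B = ind ` Collect cobis"
  using normaliser_ind ind_normaliser by blast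

lemma quasi_cartan: "alg_quasi_cartan_pair A B"
  using quasi_cartan_if_normalisers normaliser_ind by metis

section \<open>Ultrafilters of normalisers\<close>

definition point_filter :: "'s \<Rightarrow> ('s \<Rightarrow> 'r) set" where
  "point_filter \<sigma> = {n \<in> normalisers A B. n \<sigma> = 1}"

lemma ind_eq_1_cobis: "cobis Y \<Longrightarrow> ind Y \<sigma> = 1 \<longleftrightarrow> \<sigma> \<in> Y"
  using ind_eq_1[OF cobis_inj_q] cobisD(1) ind_outside zero_neq_one_ring by (metis subsetD)

lemma ind_inject: "cobis Y \<Longrightarrow> cobis Z \<Longrightarrow> ind Y = ind Z \<longleftrightarrow> Y = Z"
  using ind_eq_1_cobis by (metis subsetI subset_antisym)

lemma cobis_empty [simp]: "cobis {}"
  by (simp add: cobis_def)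

lemma ind_empty: "ind {} = (\<lambda>\<sigma>. 0)"
  by (rule ext) (simp add: ind_def)

lemma ind_eq_zero: "cobis Y \<Longrightarrow> ind Y = (\<lambda>\<sigma>. 0) \<longleftrightarrow> Y = {}"
  using ind_inject[of Y "{}"] ind_empty by simp

lemma norm_le_ind: assumes Y: "cobis Y" and Z: "cobis Z" shows "norm_le A B (ind Y) (ind Z) \<longleftrightarrow> Y \<subseteq> Z"
proof -
  have "norm_le A B (ind Y) (ind Z) \<longleftrightarrow> ind Y = ind (setmul (rg ` Y) Z)"
    unfolding norm_le_def A_simps dagger_ind[OF Y]
    by (simp add: ind_mult cobis_inv cobis_rg setmul_iv Y Z)
  also have "\<dots> \<longleftrightarrow> Y = setmul (rg ` Y) Z"
    by (rule ind_inject[OF Y cobis_setmul[OF cobis_rg(1)[OF Y] Z]])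
  also have "\<dots> \<longleftrightarrow> Y \<subseteq> Z"
  proof
    have eq: "setmul (rg ` Y) Z = {z \<in> Z. rg z \<in> rg ` Y}"
      by (rule setmul_units[OF cobis_rg(2)[OF Y] cobisD(1)[OF Z]])
    show "Y = setmul (rg ` Y) Z \<Longrightarrow> Y \<subseteq> Z" unfolding eq by blast
    assume sub: "Y \<subseteq> Z"
    show "Y = setmul (rg ` Y) Z" unfolding eq
      using sub inj_onD[OF cobisD(5)[OF Z]] by blast
  qed
  finally show ?thesis .
qed

lemma point_filter_iff: "ind Y \<in> point_filter \<sigma> \<longleftrightarrow> \<sigma> \<in> Y" if "cobis Y"
  using that ind_normaliser ind_eq_1_cobis by (simp add: point_filter_def)

lemma point_filter_eq: "point_filter \<sigma> = ind ` {Y. cobis Y \<and> \<sigma> \<in> Y}"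
  using ind_eq_1_cobis unfolding point_filter_def normalisers_eq by auto

lemma up_set_ind:
  assumes "\<S> \<subseteq> Collect cobis"
  shows "up_set A B (ind ` \<S>) = ind ` {Z. cobis Z \<and> (\<exists>Y\<in>\<S>. Y \<subseteq> Z)}"
proof (intro equalityI subsetI)
  fix m assume "m \<in> up_set A B (ind ` \<S>)"
  then obtain Z Y where "cobis Z" "m = ind Z" "Y \<in> \<S>" "norm_le A B (ind Y) (ind Z)"
    unfolding up_set_def normalisers_eq by blast
  moreover from this have "Y \<subseteq> Z" using assms norm_le_ind[of Y Z] by blast
  ultimately show "m \<in> ind ` {Z. cobis Z \<and> (\<exists>Y\<in>\<S>. Y \<subseteq> Z)}" by blast
next
  fix m assume "m \<in> ind ` {Z. cobis Z \<and> (\<exists>Y\<in>\<S>. Y \<subseteq> Z)}"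
  then obtain Z Y where *: "cobis Z" "m = ind Z" "Y \<in> \<S>" "Y \<subseteq> Z" by blast
  then have "norm_le A B (ind Y) (ind Z)" using assms norm_le_ind[of Y Z] by blast
  then show "m \<in> up_set A B (ind ` \<S>)" unfolding up_set_def normalisers_eq using * by blast
qed

section \<open>Filters of normalisers as families of bisections\<close>

lemma norm_filterD:
  assumes U: "norm_filter A B U"
  shows "U \<subseteq> ind ` Collect cobis"
    "\<And>Y. cobis Y \<Longrightarrow> ind Y \<in> U \<Longrightarrow> Y \<noteq> {}"
    "\<And>Y Z. cobis Y \<Longrightarrow> ind Y \<in> U \<Longrightarrow> cobis Z \<Longrightarrow> Y \<subseteq> Z \<Longrightarrow> ind Z \<in> U"
    "\<And>Y Z. cobis Y \<Longrightarrow> ind Y \<in> U \<Longrightarrow> cobis Z \<Longrightarrow> ind Z \<in> U \<Longrightarrow>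
      \<exists>W. cobis W \<and> ind W \<in> U \<and> W \<subseteq> Y \<and> W \<subseteq> Z"
proof -
  show sub: "U \<subseteq> ind ` Collect cobis" using U unfolding norm_filter_def normalisers_eq by blast
  show "Y \<noteq> {}" if "cobis Y" "ind Y \<in> U" for Y
    using U that ind_empty unfolding norm_filter_def by auto
  show "ind Z \<in> U" if "cobis Y" "ind Y \<in> U" "cobis Z" "Y \<subseteq> Z" for Y Z
  proof -
    have "norm_le A B (ind Y) (ind Z)" using norm_le_ind that by blast
    then have "ind Z \<in> up_set A B U" unfolding up_set_def using ind_normaliser that by blast
    then show ?thesis using U unfolding norm_filter_def by blast
  qed
  show "\<exists>W. cobis W \<and> ind W \<in> U \<and> W \<subseteq> Y \<and> W \<subseteq> Z"
    if YZ: "cobis Y" "ind Y \<in> U" "cobis Z" "ind Z \<in> U" for Y Z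
  proof -
    obtain l where l: "l \<in> U" "norm_le A B l (ind Y)" "norm_le A B l (ind Z)"
      using U YZ unfolding norm_filter_def by blast
    then obtain W where "cobis W" "l = ind W" using sub by blast
    then show ?thesis using l norm_le_ind YZ by blast
  qed
qed

lemma point_filter_filter: assumes "\<sigma> \<in> arr" shows "norm_filter A B (point_filter \<sigma>)"
  unfolding norm_filter_def
proof (intro conjI ballI)
  show "point_filter \<sigma> \<subseteq> normalisers A B - {alg_zero A}"
    using zero_neq_one_ring by (auto simp: point_filter_def)
  show "point_filter \<sigma> = up_set A B (point_filter \<sigma>)"
    unfolding point_filter_eq by (subst up_set_ind) auto
  fix m n assume "m \<in> point_filter \<sigma>" "n \<in> point_filter \<sigma>"
  then obtain Y Z where YZ: "cobis Y" "cobis Z" "m = ind Y" "n = ind Z" "\<sigma> \<in> Y" "\<sigma> \<in> Z"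
    unfolding point_filter_eq by blast
  then have c: "cobis (Y \<inter> Z)" using cobis_Int by blast
  then have "ind (Y \<inter> Z) \<in> point_filter \<sigma>" using point_filter_iff YZ by blast
  then show "\<exists>l\<in>point_filter \<sigma>. norm_le A B l m \<and> norm_le A B l n"
    using norm_le_ind c YZ by (metis Int_lower1 Int_lower2)
qed

lemma ex_cobis: assumes "\<sigma> \<in> arr" obtains Y where "cobis Y" "\<sigma> \<in> Y"
  using cobis_basis[OF openin_topspace assms] by metis

lemma point_filter_nonempty: assumes "\<sigma> \<in> arr" shows "point_filter \<sigma> \<noteq> {}"
  using ex_cobis[OF assms] point_filter_iff by (metis empty_iff)

text \<open>A further member \<open>Z\<close> would miss \<open>\<sigma>\<close>. Being closed, it
  is disjoint from some bisection around \<open>\<sigma>\<close>, and the two members have no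
  nonempty common lower bound.\<close>

lemma point_filter_maximal:
  assumes \<sigma>: "\<sigma> \<in> arr" and V: "norm_filter A B V" and sub: "point_filter \<sigma> \<subseteq> V"
  shows "V = point_filter \<sigma>"
proof (rule ccontr)
  assume "V \<noteq> point_filter \<sigma>"
  then obtain Z where Z: "cobis Z" "ind Z \<in> V" "\<sigma> \<notin> Z"
    using sub norm_filterD(1)[OF V] point_filter_iff by blast
  have "openin (g_top \<Sigma>) (arr - Z)" using cobisD(4)[OF Z(1)] by (simp add: closedin_def)
  then obtain Y where Y: "cobis Y" "\<sigma> \<in> Y" "Y \<subseteq> arr - Z" using cobis_basis \<sigma> Z(3) by (metis DiffI)
  then have "ind Y \<in> V" using sub point_filter_iff by blast
  then obtain W where "cobis W" "ind W \<in> V" "W \<subseteq> Y" "W \<subseteq> Z" using norm_filterD(4)[OF V Y(1) _ Z(1,2)] by blast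
  then show False using norm_filterD(2)[OF V] Y(3) by blast
qed

text \<open>Members are closed and one of them is compact, so they have a common point
  \<open>\<sigma>\<close>. The ultrafilter is then contained in
  \<open>point_filter \<sigma>\<close>, and maximality gives equality.\<close>

lemma ultrafilters_eq: "ultrafilters A B = point_filter ` arr"
proof (intro equalityI subsetI)
  fix U assume "U \<in> point_filter ` arr"
  then show "U \<in> ultrafilters A B"
    using point_filter_filter point_filter_nonempty point_filter_maximal unfolding ultrafilters_def by blast
next
  fix U assume "U \<in> ultrafilters A B"
  then have U: "norm_filter A B U" "U \<noteq> {}" "\<And>V. norm_filter A B V \<Longrightarrow> U \<subseteq> V \<Longrightarrow> V = U"
    unfolding ultrafilters_def by blast+
  note f = norm_filterD[OF U(1)]
  let ?C = "{Y. cobis Y \<and> ind Y \<in> U}"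
  obtain Y0 where Y0: "Y0 \<in> ?C" using U(2) f(1) by blast
  \<comment> \<open>A member below finitely many others and \<open>Y0\<close>, as the finite
    intersection criterion for the compact set \<open>Y0\<close> demands; it is nonempty because
    filters omit zero.\<close>
  have fin: "\<exists>W\<in>?C. W \<subseteq> Y0 \<inter> \<Inter>F" if "finite F" "F \<subseteq> ?C" for F
    using that
  proof (induction F rule: finite_induct)
    case empty
    then show ?case using Y0 by blast
  next
    case (insert Y F)
    then obtain W where W: "W \<in> ?C" "W \<subseteq> Y0 \<inter> \<Inter>F" by blast
    obtain W' where "cobis W'" "ind W' \<in> U" "W' \<subseteq> W" "W' \<subseteq> Y" using f(4)[of W Y] W(1) insert(4) by blast
    then show ?case using W by (intro bexI[of _ W']) auto
  qed
  have "Y0 \<inter> \<Inter>?C \<noteq> {}"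
  proof -
    have "compactin (g_top \<Sigma>) Y0" using Y0 cobisD(2) by blast
    moreover have "closedin (g_top \<Sigma>) C" if "C \<in> ?C" for C using that cobisD(4) by blast
    moreover have "Y0 \<inter> \<Inter>F \<noteq> {}" if "finite F" "F \<subseteq> ?C" for F
      using fin[OF that] f(2) by blast
    ultimately show ?thesis unfolding compactin_fip by blast
  qed
  then obtain \<sigma> where s: "\<sigma> \<in> Y0" "\<And>Y. Y \<in> ?C \<Longrightarrow> \<sigma> \<in> Y" by blast
  have sa: "\<sigma> \<in> arr" using s(1) Y0 cobisD(1) by blast
  have "U \<subseteq> point_filter \<sigma>"
    using f(1) s(2) point_filter_iff by blast
  then have "U = point_filter \<sigma>" using U(3) point_filter_filter[OF sa] by blast
  then show "U \<in> point_filter ` arr" using sa by blast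
qed

lemma inj_point_filter: "inj_on point_filter arr"
proof (rule inj_onI)
  fix \<sigma> \<tau> assume *: "\<sigma> \<in> arr" "\<tau> \<in> arr" "point_filter \<sigma> = point_filter \<tau>"
  show "\<sigma> = \<tau>"
  proof (rule ccontr)
    assume "\<sigma> \<noteq> \<tau>"
    then obtain U V where UV: "openin (g_top \<Sigma>) U" "openin (g_top \<Sigma>) V" "\<sigma> \<in> U" "\<tau> \<in> V" "disjnt U V"
      using Hausdorff_S *(1,2) unfolding Hausdorff_space_def by metis
    obtain Y where Y: "cobis Y" "\<sigma> \<in> Y" "Y \<subseteq> U" using cobis_basis[OF UV(1,3)] by blast
    then have "ind Y \<in> point_filter \<tau>" using point_filter_iff * by blast
    then have "\<tau> \<in> Y" using point_filter_iff Y by blast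
    then show False using Y UV by (auto simp: disjnt_def)
  qed
qed

section \<open>The map \<open>Phi\<close> on arrows\<close>

lemma tilde_one_ind: assumes Y: "cobis Y" shows "tilde_one G \<Sigma> i q Y = ind Y"
  unfolding tilde_one_def
proof (rule the_equality)
  note Ya = cobisD(1)[OF Y] and inj = cobis_inj_q[OF Y]
  show "ind Y \<in> St \<and> supp \<Sigma> (ind Y) \<subseteq> {t \<odot> y | t y. t \<in> ring_units \<and> y \<in> Y} \<and> (\<forall>y\<in>Y. ind Y y = 1)"
  proof (intro conjI ballI subsetI)
    fix \<sigma> assume "\<sigma> \<in> supp \<Sigma> (ind Y)"
    then obtain s where s: "\<sigma> \<in> arr" "s dvd 1" "s \<odot> \<sigma> \<in> Y"
      using ind_nonzeroE[OF inj] unfolding supp_def by blast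
    then have "\<sigma> = unit_inv s \<odot> s \<odot> \<sigma>" by simp
    then show "\<sigma> \<in> {t \<odot> y | t y. t \<in> ring_units \<and> y \<in> Y}" using s by fastforce
  qed (use Y ind_eq_1_cobis in auto)
  fix f assume f: "f \<in> St \<and> supp \<Sigma> f \<subseteq> {t \<odot> y | t y. t \<in> ring_units \<and> y \<in> Y} \<and> (\<forall>y\<in>Y. f y = 1)"
  then have fe: "equivariant f" using St_equivariant by blast
  show "f = ind Y"
  proof
    fix \<sigma> show "f \<sigma> = ind Y \<sigma>"
    proof (cases "\<exists>t y. t dvd 1 \<and> y \<in> Y \<and> \<sigma> = t \<odot> y")
      case True
      then obtain t y where t: "t dvd 1" "y \<in> Y" "\<sigma> = t \<odot> y" by blast
      have ya: "y \<in> arr" using t Ya by blast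
      have "f y = 1" "ind Y y = 1" using f t ind_eq_1_cobis[OF Y] by auto
      then show ?thesis
        using equivariantD(1)[OF fe ya t(1)] equivariantD(1)[OF equivariant_ind[OF inj] ya t(1)] t(3) by simp
    next
      case False
      have "f \<sigma> = 0" using f False in_supp_iff[OF fe, of \<sigma>] by blast
      moreover have "ind Y \<sigma> = 0"
      proof (rule ccontr)
        assume "ind Y \<sigma> \<noteq> 0"
        then obtain s where s: "\<sigma> \<in> arr" "s dvd 1" "s \<odot> \<sigma> \<in> Y" using ind_nonzeroE[OF inj] by blast
        then have "\<sigma> = unit_inv s \<odot> s \<odot> \<sigma>" by simp
        then show False using False s unit_inv_dvd by blast
      qed
      ultimately show ?thesis by simp
    qed
  qed
qed

lemma setmul_units_right:
  assumes "E \<subseteq> g_units \<Sigma>" "Z \<subseteq> arr" shows "setmul Z E = {z \<in> Z. sr z \<in> E}"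
proof (intro equalityI subsetI)
  fix z assume "z \<in> setmul Z E"
  then obtain a b where ab: "a \<in> Z" "b \<in> E" "sr a = rg b" "z = a \<cdot> b" unfolding setmul_def by blast
  then have "b = sr a" "a \<in> arr" using assms S.unit_rng[of b] by auto
  then have "z = a" using ab by (metis S.mul_src_id)
  then show "z \<in> {z \<in> Z. sr z \<in> E}" using ab \<open>b = sr a\<close> by blast
next
  fix z assume z: "z \<in> {z \<in> Z. sr z \<in> E}"
  then have "z = z \<cdot> sr z" "sr z = rg (sr z)" using assms by auto
  then show "z \<in> setmul Z E" unfolding setmul_def using z by blast
qed

lemma unit_filter_eq:
  "unit_filter A B u = ind ` {E. cobis E \<and> E \<subseteq> g_units \<Sigma> \<and> u \<in> E}"
proof (intro equalityI subsetI)
  fix e assume e: "e \<in> unit_filter A B u"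
  then obtain E where "cobis E" "E \<subseteq> g_units \<Sigma>" "e = ind E" unfolding unit_filter_def by (blast elim: idemsE)
  then show "e \<in> ind ` {E. cobis E \<and> E \<subseteq> g_units \<Sigma> \<and> u \<in> E}"
    using e ind_eq_1_cobis unfolding unit_filter_def by auto
qed (use ind_idem ind_eq_1_cobis in \<open>auto simp: unit_filter_def\<close>)

text \<open>Multiplication by \<open>E\<close> cuts \<open>Y\<close> to the arrows with source in
  \<open>E\<close>. For a bisection \<open>Z\<close> through \<open>\<sigma>\<close> the choice of
  the sources of \<open>Y \<inter> Z\<close> puts the product inside \<open>Z\<close>, since the
  source map is injective on \<open>Y\<close>.\<close>

lemma Phi_via_eq: assumes Y: "cobis Y" and \<sigma>: "\<sigma> \<in> Y" shows "Phi_via G \<Sigma> i q Y \<sigma> = point_filter \<sigma>"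
proof -
  note Yd = cobisD[OF Y]
  let ?E = "{E. cobis E \<and> E \<subseteq> g_units \<Sigma> \<and> sr \<sigma> \<in> E}"
  have "alg_mult A (ind Y) ` unit_filter A B (sr \<sigma>) = ind ` (setmul Y ` ?E)"
    unfolding unit_filter_eq image_image by (rule image_cong) (use ind_mult Y in auto)
  then have "Phi_via G \<Sigma> i q Y \<sigma> = ind ` {Z. cobis Z \<and> (\<exists>W\<in>setmul Y ` ?E. W \<subseteq> Z)}"
    unfolding Phi_via_def Let_def tilde_one_ind[OF Y]
    using up_set_ind[of "setmul Y ` ?E"] cobis_setmul[OF Y] by (metis (mono_tags, lifting) image_subsetI mem_Collect_eq)
  also have "{Z. cobis Z \<and> (\<exists>W\<in>setmul Y ` ?E. W \<subseteq> Z)} = {Z. cobis Z \<and> \<sigma> \<in> Z}"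
  proof (intro Collect_cong conj_cong refl)
    fix Z assume Z: "cobis Z"
    show "(\<exists>W\<in>setmul Y ` ?E. W \<subseteq> Z) \<longleftrightarrow> \<sigma> \<in> Z"
    proof
      assume "\<exists>W\<in>setmul Y ` ?E. W \<subseteq> Z"
      then obtain E where E: "E \<in> ?E" "setmul Y E \<subseteq> Z" by blast
      then have "\<sigma> \<in> setmul Y E" using setmul_units_right[of E Y] Yd(1) \<sigma> by blast
      then show "\<sigma> \<in> Z" using E by blast
    next
      assume sZ: "\<sigma> \<in> Z"
      let ?W = "Y \<inter> Z"
      have W: "cobis ?W" using cobis_Int Y Z by blast
      have "sr ` ?W \<in> ?E" using cobis_sr[OF W] \<sigma> sZ by blast
      moreover have "setmul Y (sr ` ?W) \<subseteq> Z"
        unfolding setmul_units_right[OF cobis_sr(2)[OF W] Yd(1)] using inj_onD[OF Yd(6)] by blast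
      ultimately show "\<exists>W\<in>setmul Y ` ?E. W \<subseteq> Z" by blast
    qed
  qed
  finally show ?thesis unfolding point_filter_eq .
qed

lemma Phi_eq: assumes "\<sigma> \<in> arr" shows "Phi G \<Sigma> i q \<sigma> = point_filter \<sigma>"
proof -
  have "\<exists>Y. compact_open_bisection \<Sigma> Y \<and> \<sigma> \<in> Y"
    using ex_cobis[OF assms] compact_open_bisection_iff by metis
  from someI_ex[OF this] show ?thesis
    unfolding Phi_def using Phi_via_eq compact_open_bisection_iff by blast
qed

section \<open>The groupoid of ultrafilters in terms of arrows\<close>

abbreviation "UF \<equiv> uf_groupoid A B"

lemma UF_top: "g_top UF = topology_generated_by {{U \<in> ultrafilters A B. n \<in> U} | n. n \<in> normalisers A B}"
  by (simp add: uf_groupoid_def)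

lemma UF_basic: assumes Y: "cobis Y" shows "{U \<in> ultrafilters A B. ind Y \<in> U} = point_filter ` Y"
  unfolding ultrafilters_eq using point_filter_iff[OF Y] cobisD(1)[OF Y] by auto

lemma UF_arr: "g_arr UF = point_filter ` arr"
proof -
  have eq: "{{U \<in> ultrafilters A B. n \<in> U} | n. n \<in> normalisers A B} = (\<lambda>Y. point_filter ` Y) ` Collect cobis"
    unfolding normalisers_eq using UF_basic by auto
  have un: "\<Union>(Collect cobis) = arr" using ex_cobis cobisD(1) by blast
  show ?thesis unfolding UF_top topology_generated_by_topspace eq image_Union[symmetric] un ..
qed

text \<open>The generating open set given by the normaliser \<open>ind Y\<close> is the image of
  \<open>Y\<close>, so the bisections and the generating sets correspond.\<close>

lemma homeomorphic_point_filter: "homeomorphic_map (g_top \<Sigma>) (g_top UF) point_filter"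
proof (rule bijective_open_imp_homeomorphic_map)
  show "point_filter ` arr = g_arr UF" using UF_arr by simp
  show "inj_on point_filter arr" using inj_point_filter .
  show "continuous_map (g_top \<Sigma>) (g_top UF) point_filter"
    unfolding UF_top
  proof (rule continuous_on_generated_topo)
    fix W assume "W \<in> {{U \<in> ultrafilters A B. n \<in> U} | n. n \<in> normalisers A B}"
    then obtain Y where Y: "cobis Y" "W = point_filter ` Y"
      unfolding normalisers_eq using UF_basic by auto
    have "point_filter -` W \<inter> arr = Y"
      using Y(2) cobisD(1)[OF Y(1)] inj_point_filter by (auto dest: inj_onD)
    then show "openin (g_top \<Sigma>) (point_filter -` W \<inter> arr)" using cobisD(3)[OF Y(1)] by simp
  next
    show "point_filter ` arr \<subseteq> \<Union>{{U \<in> ultrafilters A B. n \<in> U} | n. n \<in> normalisers A B}"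
      using UF_arr unfolding UF_top topology_generated_by_topspace by (rule equalityD2)
  qed
  show "open_map (g_top \<Sigma>) (g_top UF) point_filter"
    unfolding open_map_def
  proof (intro allI impI)
    fix V assume V: "openin (g_top \<Sigma>) V"
    have "V = \<Union>{Y. cobis Y \<and> Y \<subseteq> V}" using cobis_basis[OF V] by blast
    then have "point_filter ` V = \<Union>((\<lambda>Y. point_filter ` Y) ` {Y. cobis Y \<and> Y \<subseteq> V})" by blast
    moreover have "openin (g_top UF) (\<Union>((\<lambda>Y. point_filter ` Y) ` {Y. cobis Y \<and> Y \<subseteq> V}))"
    proof (rule openin_Union)
      fix W assume "W \<in> (\<lambda>Y. point_filter ` Y) ` {Y. cobis Y \<and> Y \<subseteq> V}"
      then obtain Y where Y: "cobis Y" "W = {U \<in> ultrafilters A B. ind Y \<in> U}" using UF_basic by blast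
      show "openin (g_top UF) W"
        unfolding UF_top by (rule topology_generated_by_Basis) (use Y ind_normaliser in blast)
    qed
    ultimately show "openin (g_top UF) (point_filter ` V)" by simp
  qed
qed

text \<open>If the ends differ, bisections around the arrows can be shrunk until the sources of one
  and the ranges of the other are disjoint; their product is then zero. If they agree, every product
  contains \<open>\<sigma> \<cdot> \<tau>\<close>.\<close>

lemma UF_comp:
  assumes \<sigma>: "\<sigma> \<in> arr" and \<tau>: "\<tau> \<in> arr"
  shows "(point_filter \<sigma>, point_filter \<tau>) \<in> g_comp UF \<longleftrightarrow> sr \<sigma> = rg \<tau>"
proof
  assume "(point_filter \<sigma>, point_filter \<tau>) \<in> g_comp UF"
  then have nz: "m \<star> n \<noteq> (\<lambda>\<sigma>. 0)" if "m \<in> point_filter \<sigma>" "n \<in> point_filter \<tau>" for m n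
    using that by (simp add: uf_groupoid_def)
  show "sr \<sigma> = rg \<tau>"
  proof (rule ccontr)
    assume "sr \<sigma> \<noteq> rg \<tau>"
    then obtain U V where UV: "openin (g_top \<Sigma>) U" "openin (g_top \<Sigma>) V" "sr \<sigma> \<in> U" "rg \<tau> \<in> V" "disjnt U V"
      using Hausdorff_S \<sigma> \<tau> S.src_arr S.rng_arr unfolding Hausdorff_space_def by metis
    have "openin (g_top \<Sigma>) {\<sigma> \<in> arr. sr \<sigma> \<in> U}" "openin (g_top \<Sigma>) {\<sigma> \<in> arr. rg \<sigma> \<in> V}"
      using openin_continuous_map_preimage TS.continuous_src TS.continuous_rng UV by blast+
    then obtain Y Z where YZ: "cobis Y" "\<sigma> \<in> Y" "Y \<subseteq> {\<sigma> \<in> arr. sr \<sigma> \<in> U}"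
      "cobis Z" "\<tau> \<in> Z" "Z \<subseteq> {\<sigma> \<in> arr. rg \<sigma> \<in> V}"
      using cobis_basis[of _ \<sigma>] cobis_basis[of _ \<tau>] \<sigma> \<tau> UV(3,4) by (metis (mono_tags, lifting) mem_Collect_eq)
    have "setmul Y Z = {}"
    proof (rule ccontr)
      assume "setmul Y Z \<noteq> {}"
      then obtain a b where "a \<in> Y" "b \<in> Z" "sr a = rg b" unfolding setmul_def by blast
      moreover from this have "sr a \<in> U" "rg b \<in> V" using YZ(3,6) by blast+
      ultimately show False using UV(5) by (metis disjnt_iff)
    qed
    then have "ind Y \<star> ind Z = (\<lambda>\<sigma>. 0)" using ind_mult YZ ind_empty by simp
    then show False using nz point_filter_iff YZ by blast
  qed
next
  assume c: "sr \<sigma> = rg \<tau>"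
  have "m \<star> n \<noteq> (\<lambda>\<sigma>. 0)" if mn: "m \<in> point_filter \<sigma>" "n \<in> point_filter \<tau>" for m n
  proof -
    obtain Y Z where YZ: "cobis Y" "m = ind Y" "\<sigma> \<in> Y" "cobis Z" "n = ind Z" "\<tau> \<in> Z"
      using mn unfolding point_filter_eq by blast
    have "\<sigma> \<cdot> \<tau> \<in> setmul Y Z" unfolding setmul_def using YZ c by blast
    then show ?thesis using ind_mult YZ ind_eq_zero[OF cobis_setmul] by (metis empty_iff)
  qed
  then show "(point_filter \<sigma>, point_filter \<tau>) \<in> g_comp UF"
    using \<sigma> \<tau> ultrafilters_eq by (simp add: uf_groupoid_def)
qed

lemma UF_mul:
  assumes \<sigma>: "\<sigma> \<in> arr" and \<tau>: "\<tau> \<in> arr" and c: "sr \<sigma> = rg \<tau>"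
  shows "g_mul UF (point_filter \<sigma>) (point_filter \<tau>) = point_filter (\<sigma> \<cdot> \<tau>)"
proof -
  let ?S = "{setmul Y Z | Y Z. cobis Y \<and> cobis Z \<and> \<sigma> \<in> Y \<and> \<tau> \<in> Z}"
  have "{alg_mult A m n | m n. m \<in> point_filter \<sigma> \<and> n \<in> point_filter \<tau>} = ind ` ?S"
  proof (intro equalityI subsetI)
    fix f assume "f \<in> {alg_mult A m n | m n. m \<in> point_filter \<sigma> \<and> n \<in> point_filter \<tau>}"
    then obtain Y Z where YZ: "cobis Y" "\<sigma> \<in> Y" "cobis Z" "\<tau> \<in> Z" "f = ind Y \<star> ind Z"
      unfolding point_filter_eq by auto
    then have "f = ind (setmul Y Z)" using ind_mult by simp
    then show "f \<in> ind ` ?S" using YZ by blast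
  next
    fix f assume "f \<in> ind ` ?S"
    then obtain Y Z where YZ: "cobis Y" "\<sigma> \<in> Y" "cobis Z" "\<tau> \<in> Z" "f = ind (setmul Y Z)" by blast
    then have "f = alg_mult A (ind Y) (ind Z)" using ind_mult by simp
    then show "f \<in> {alg_mult A m n | m n. m \<in> point_filter \<sigma> \<and> n \<in> point_filter \<tau>}"
      using YZ point_filter_iff by blast
  qed
  then have "g_mul UF (point_filter \<sigma>) (point_filter \<tau>) = up_set A B (ind ` ?S)"
    by (simp add: uf_groupoid_def)
  also have "\<dots> = ind ` {W. cobis W \<and> (\<exists>V\<in>?S. V \<subseteq> W)}"
    by (rule up_set_ind) (use cobis_setmul in auto)
  also have "{W. cobis W \<and> (\<exists>V\<in>?S. V \<subseteq> W)} = {W. cobis W \<and> \<sigma> \<cdot> \<tau> \<in> W}"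
  proof (intro Collect_cong conj_cong refl)
    fix W assume W: "cobis W"
    show "(\<exists>V\<in>?S. V \<subseteq> W) \<longleftrightarrow> \<sigma> \<cdot> \<tau> \<in> W"
    proof
      assume "\<exists>V\<in>?S. V \<subseteq> W"
      then obtain Y Z where "\<sigma> \<in> Y" "\<tau> \<in> Z" "setmul Y Z \<subseteq> W" by blast
      then show "\<sigma> \<cdot> \<tau> \<in> W" using c unfolding setmul_def by blast
    next
      assume s: "\<sigma> \<cdot> \<tau> \<in> W"
      obtain Y where Y: "cobis Y" "\<sigma> \<in> Y" using ex_cobis[OF \<sigma>] by blast
      \<comment> \<open>Dividing \<open>W\<close> by \<open>Y\<close> gives a bisection through
        \<open>\<tau>\<close>; multiplying back by \<open>Y\<close> stays inside \<open>W\<close>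
        because the source map is injective on \<open>Y\<close>.\<close>
      let ?Z = "setmul (iv ` Y) W"
      have "iv \<sigma> \<cdot> (\<sigma> \<cdot> \<tau>) \<in> ?Z"
        unfolding setmul_def using Y s \<sigma> \<tau> c by (intro CollectI exI[of _ "iv \<sigma>"] exI[of _ "\<sigma> \<cdot> \<tau>"]) simp
      then have t: "\<tau> \<in> ?Z" using \<sigma> \<tau> c by simp
      have Z: "cobis ?Z" using cobis_setmul[OF cobis_inv[OF Y(1)] W] .
      have "setmul Y ?Z \<subseteq> W"
      proof
        fix x assume "x \<in> setmul Y ?Z"
        then obtain a z where a: "a \<in> Y" "z \<in> ?Z" "sr a = rg z" "x = a \<cdot> z" unfolding setmul_def by blast
        then obtain b w where b: "b \<in> Y" "w \<in> W" "sr (iv b) = rg w" "z = iv b \<cdot> w" unfolding setmul_def by blast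
        have aa: "a \<in> arr" "b \<in> arr" "w \<in> arr" using a b cobisD(1) Y(1) W by auto
        then have "a = b" using a b inj_onD[OF cobisD(6)[OF Y(1)], of a b] by simp
        then have "x = w" using a b aa by simp
        then show "x \<in> W" using b by simp
      qed
      then show "\<exists>V\<in>?S. V \<subseteq> W" using Y Z t by blast
    qed
  qed
  finally show ?thesis unfolding point_filter_eq .
qed

lemma UF_inv: assumes \<sigma>: "\<sigma> \<in> arr" shows "g_inv UF (point_filter \<sigma>) = point_filter (iv \<sigma>)"
proof -
  have "g_inv UF (point_filter \<sigma>) = dagger A B ` ind ` {Y. cobis Y \<and> \<sigma> \<in> Y}"
    by (simp add: uf_groupoid_def point_filter_eq)
  also have "\<dots> = ind ` (\<lambda>Y. iv ` Y) ` {Y. cobis Y \<and> \<sigma> \<in> Y}"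
    unfolding image_image by (rule image_cong) (use dagger_ind in auto)
  also have "(\<lambda>Y. iv ` Y) ` {Y. cobis Y \<and> \<sigma> \<in> Y} = {Y. cobis Y \<and> iv \<sigma> \<in> Y}"
  proof (intro equalityI subsetI)
    fix Z assume "Z \<in> {Y. cobis Y \<and> iv \<sigma> \<in> Y}"
    then have Z: "cobis Z" "iv \<sigma> \<in> Z" by auto
    have "Z = iv ` iv ` Z" using iv_iv_image[OF Z(1)] by simp
    moreover have "\<sigma> \<in> iv ` Z" using Z(2) \<sigma> S.inv_inv by (metis image_eqI)
    ultimately show "Z \<in> (\<lambda>Y. iv ` Y) ` {Y. cobis Y \<and> \<sigma> \<in> Y}" using cobis_inv[OF Z(1)] by blast
  qed (use cobis_inv in auto)
  finally show ?thesis unfolding point_filter_eq .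
qed

text \<open>Scaling the function of a bisection by a unit translates the bisection. The inner claim
  \<open>sm\<close> covers all units because both \<open>t\<close> and its inverse occur.\<close>

lemma smult_point_filter:
  assumes \<sigma>: "\<sigma> \<in> arr" and t: "t dvd 1"
  shows "smult_set A t (point_filter \<sigma>) = point_filter (t \<odot> \<sigma>)"
proof -
  have sm: "(\<lambda>x. s * ind Y x) = ind ((\<lambda>\<sigma>. s \<odot> \<sigma>) ` Y) \<and> cobis ((\<lambda>\<sigma>. s \<odot> \<sigma>) ` Y)"
    if Y: "cobis Y" and s: "s dvd 1" for s Y
  proof -
    note Yd = cobisD[OF Y]
    have c: "cobis ((\<lambda>\<sigma>. s \<odot> \<sigma>) ` Y)"
      unfolding cobis_def
    proof (intro conjI)
      show "compactin (g_top \<Sigma>) ((\<lambda>\<sigma>. s \<odot> \<sigma>) ` Y)" using image_compactin Yd(2) continuous_act[OF s] by blast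
      show "openin (g_top \<Sigma>) ((\<lambda>\<sigma>. s \<odot> \<sigma>) ` Y)" using open_act_image[OF s Yd(3)] .
      show "inj_on rg ((\<lambda>\<sigma>. s \<odot> \<sigma>) ` Y)"
        using Yd(1,5) s by (auto simp: inj_on_def subset_iff)
      show "inj_on sr ((\<lambda>\<sigma>. s \<odot> \<sigma>) ` Y)"
        using Yd(1,6) s by (auto simp: inj_on_def subset_iff)
    qed
    have "s * ind Y \<tau> = ind ((\<lambda>\<sigma>. s \<odot> \<sigma>) ` Y) \<tau>" for \<tau>
    proof (cases "ind Y \<tau> = 0")
      case False
      then obtain u where u: "\<tau> \<in> arr" "u dvd 1" "u \<odot> \<tau> \<in> Y" "ind Y \<tau> = u"
        using ind_nonzeroE[OF cobis_inj_q[OF Y]] by blast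
      have "(s * u) \<odot> \<tau> = s \<odot> u \<odot> \<tau>" using u s by simp
      then have "(s * u) \<odot> \<tau> \<in> (\<lambda>\<sigma>. s \<odot> \<sigma>) ` Y" using u(3) by (metis image_eqI)
      then show ?thesis using ind_eq[OF cobis_inj_q[OF c] u(1), of "s * u"] u s by simp
    next
      case True
      have "ind ((\<lambda>\<sigma>. s \<odot> \<sigma>) ` Y) \<tau> = 0"
      proof (rule ccontr)
        assume nz: "ind ((\<lambda>\<sigma>. s \<odot> \<sigma>) ` Y) \<tau> \<noteq> 0"
        obtain u where u: "\<tau> \<in> arr" "u dvd 1" "u \<odot> \<tau> \<in> (\<lambda>\<sigma>. s \<odot> \<sigma>) ` Y"
          by (rule ind_nonzeroE[OF cobis_inj_q[OF c] nz])
        then obtain y where y: "y \<in> Y" "u \<odot> \<tau> = s \<odot> y" by blast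
        have ya: "y \<in> arr" using y Yd by blast
        have "q \<tau> = q y" using y u s ya q_act by metis
        then show False using True ind_nonzero_iff[OF cobis_inj_q[OF Y] Yd(1) u(1)] y(1) by blast
      qed
      then show ?thesis using True by simp
    qed
    then show ?thesis using c by blast
  qed
  have val: "n (t \<odot> \<sigma>) = unit_inv t * n \<sigma>" if "n \<in> normalisers A B" for n
    using that equivariantD(1)[OF St_equivariant \<sigma> t] unfolding normalisers_def A_simps by blast
  show ?thesis
  proof (intro equalityI subsetI)
    fix n assume "n \<in> smult_set A t (point_filter \<sigma>)"
    then obtain Y where Y: "cobis Y" "\<sigma> \<in> Y" "n = (\<lambda>x. t * ind Y x)"
      unfolding smult_set_def point_filter_eq by auto
    then show "n \<in> point_filter (t \<odot> \<sigma>)" using sm[OF Y(1) t] point_filter_iff by (metis image_eqI)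
  next
    fix n assume n: "n \<in> point_filter (t \<odot> \<sigma>)"
    then obtain Y where Y: "cobis Y" "t \<odot> \<sigma> \<in> Y" "n = ind Y" unfolding point_filter_eq by blast
    let ?m = "\<lambda>x. unit_inv t * ind Y x"
    have "\<sigma> \<in> (\<lambda>\<sigma>. unit_inv t \<odot> \<sigma>) ` Y"
      using Y(2) \<sigma> t by (intro image_eqI[of _ _ "t \<odot> \<sigma>"]) simp_all
    then have "?m \<in> point_filter \<sigma>" using sm[OF Y(1) unit_inv_dvd[OF t]] point_filter_iff by metis
    moreover have "n = alg_smult A t ?m" using Y(3) t by (simp add: mult.assoc[symmetric])
    ultimately show "n \<in> smult_set A t (point_filter \<sigma>)" unfolding smult_set_def by blast
  qed
qed

text \<open>Scalars act on point filters as they act on \<open>\<Sigma>\<close>, so the equivalence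
  classes are the images of the fibres of \<open>q\<close>.\<close>

lemma uf_q_point_filter:
  assumes \<sigma>: "\<sigma> \<in> arr" shows "uf_q A B (point_filter \<sigma>) = point_filter ` {\<tau> \<in> arr. q \<tau> = q \<sigma>}"
proof (intro equalityI subsetI)
  fix W assume "W \<in> uf_q A B (point_filter \<sigma>)"
  then obtain \<tau> t where t: "\<tau> \<in> arr" "W = point_filter \<tau>" "t dvd 1" "point_filter \<sigma> = smult_set A t (point_filter \<tau>)"
    unfolding uf_q_def ultrafilters_eq by blast
  then have "\<sigma> = t \<odot> \<tau>" using smult_point_filter inj_onD[OF inj_point_filter, of \<sigma> "t \<odot> \<tau>"] \<sigma> by simp
  then show "W \<in> point_filter ` {\<tau> \<in> arr. q \<tau> = q \<sigma>}" using t by simp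
next
  fix W assume "W \<in> point_filter ` {\<tau> \<in> arr. q \<tau> = q \<sigma>}"
  then obtain \<tau> where t: "\<tau> \<in> arr" "q \<tau> = q \<sigma>" "W = point_filter \<tau>" by blast
  then obtain s where s: "s dvd 1" "\<sigma> = s \<odot> \<tau>" using q_eqE[OF t(1) \<sigma>] by blast
  then have "point_filter \<sigma> = smult_set A s W" using smult_point_filter[OF t(1) s(1)] t by simp
  then show "W \<in> uf_q A B (point_filter \<sigma>)" unfolding uf_q_def ultrafilters_eq using s t by blast
qed

end

section \<open>Transport of structure\<close>

lemma homeomorphic_map_inverse:
  assumes "homeomorphic_map X Y f"
  obtains g where "homeomorphic_map Y X g" "\<And>x. x \<in> topspace X \<Longrightarrow> g (f x) = x" "\<And>y. y \<in> topspace Y \<Longrightarrow> f (g y) = y"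
proof -
  obtain g where g: "homeomorphic_maps X Y f g" using assms homeomorphic_map_maps by blast
  then have "homeomorphic_map Y X g" using homeomorphic_maps_sym homeomorphic_map_maps by blast
  then show ?thesis using that g unfolding homeomorphic_maps_def by blast
qed

lemma continuous_map_transport:
  assumes r: "continuous_map X Y r" and f: "homeomorphic_map X X' f" and k: "homeomorphic_map Y Y' k"
    and eq: "\<And>x. x \<in> topspace X \<Longrightarrow> r' (f x) = k (r x)"
  shows "continuous_map X' Y' r'"
proof -
  obtain g where g: "homeomorphic_map X' X g" "\<And>y. y \<in> topspace X' \<Longrightarrow> f (g y) = y"
    using homeomorphic_map_inverse[OF f] by metis
  have "continuous_map X' Y' (k \<circ> (r \<circ> g))"
    using r g(1) k homeomorphic_imp_continuous_map continuous_map_compose by metis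
  moreover have "(k \<circ> (r \<circ> g)) x = r' x" if "x \<in> topspace X'" for x
  proof -
    have "g x \<in> topspace X" using that homeomorphic_imp_surjective_map[OF g(1)] by blast
    then show ?thesis using eq[of "g x"] g(2)[OF that] by simp
  qed
  ultimately show ?thesis using continuous_map_eq by blast
qed

lemma homeomorphic_map_transport:
  assumes r: "homeomorphic_map X Y r" and f: "homeomorphic_map X X' f" and k: "homeomorphic_map Y Y' k"
    and eq: "\<And>x. x \<in> topspace X \<Longrightarrow> r' (f x) = k (r x)"
  shows "homeomorphic_map X' Y' r'"
proof -
  obtain g where g: "homeomorphic_map X' X g" "\<And>y. y \<in> topspace X' \<Longrightarrow> f (g y) = y"
    using homeomorphic_map_inverse[OF f] by metis
  have "homeomorphic_map X' Y' (k \<circ> (r \<circ> g))"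
    using r g(1) k homeomorphic_map_compose by metis
  moreover have "(k \<circ> (r \<circ> g)) x = r' x" if "x \<in> topspace X'" for x
  proof -
    have "g x \<in> topspace X" using that homeomorphic_imp_surjective_map[OF g(1)] by blast
    then show ?thesis using eq[of "g x"] g(2)[OF that] by simp
  qed
  ultimately show ?thesis using homeomorphic_map_eq by blast
qed

lemma homeomorphic_map_restrict:
  assumes f: "homeomorphic_map X Y f" and S: "S \<subseteq> topspace X"
  shows "homeomorphic_map (subtopology X S) (subtopology Y (f ` S)) f"
proof (rule homeomorphic_map_subtopologies[OF f])
  show "f ` (topspace X \<inter> S) = topspace Y \<inter> f ` S"
    using S homeomorphic_imp_surjective_map[OF f] by auto
qed

lemma homeomorphic_map_prod_id:
  assumes "homeomorphic_map X Y f"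
  shows "homeomorphic_map (prod_topology X Z) (prod_topology Y Z) (\<lambda>(x, z). (f x, z))"
proof -
  obtain g where g: "homeomorphic_maps X Y f g" using assms homeomorphic_map_maps by blast
  have "homeomorphic_maps Z Z id id" by (simp add: homeomorphic_maps_id)
  with g have "homeomorphic_maps (prod_topology X Z) (prod_topology Y Z) (\<lambda>(x, y). (f x, id y)) (\<lambda>(x, y). (g x, id y))"
    unfolding homeomorphic_maps_prod by blast
  then show ?thesis using homeomorphic_map_maps by auto
qed

text \<open>\<open>H'\<close> is raw data compatible with a homeomorphism; that it is a topological
  groupoid is a conclusion. In this way nothing about associativity or continuity has to be verified
  on ultrafilters or on their classes.\<close>

locale groupoid_transport = top_groupoid H for H :: "'a groupoid" +
  fixes H' :: "'b groupoid" and f :: "'a \<Rightarrow> 'b"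
  assumes homeo: "homeomorphic_map (g_top H) (g_top H') f"
    and comp': "g_comp H' = (\<lambda>(a, b). (f a, f b)) ` g_comp H"
    and mul': "\<And>a b. (a, b) \<in> g_comp H \<Longrightarrow> g_mul H' (f a) (f b) = f (g_mul H a b)"
    and inv': "\<And>a. a \<in> g_arr H \<Longrightarrow> g_inv H' (f a) = f (g_inv H a)"
begin

lemma arr': "g_arr H' = f ` g_arr H"
  using homeomorphic_imp_surjective_map[OF homeo] by simp

lemma inj: "inj_on f (g_arr H)"
  using homeomorphic_imp_injective_map[OF homeo] .

lemma f_arr: "a \<in> g_arr H \<Longrightarrow> f a \<in> g_arr H'"
  using arr' by blast

lemma comp'_iff: "a \<in> g_arr H \<Longrightarrow> b \<in> g_arr H \<Longrightarrow> (f a, f b) \<in> g_comp H' \<longleftrightarrow> (a, b) \<in> g_comp H"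
proof
  assume ab: "a \<in> g_arr H" "b \<in> g_arr H" and "(f a, f b) \<in> g_comp H'"
  then obtain c d where "(c, d) \<in> g_comp H" "f a = f c" "f b = f d" unfolding comp' by auto
  moreover from this have "a = c" "b = d" using inj_onD[OF inj] ab comp_arr by blast+
  ultimately show "(a, b) \<in> g_comp H" by simp
qed (auto simp: comp')

lemma comp'E:
  assumes "(x, y) \<in> g_comp H'"
  obtains a b where "(a, b) \<in> g_comp H" "x = f a" "y = f b" "a \<in> g_arr H" "b \<in> g_arr H"
  using assms comp_arr unfolding comp' by auto

lemma algebraic': "algebraic_groupoid H'"
  unfolding algebraic_groupoid_def
proof (intro conjI)
  show "g_comp H' \<subseteq> g_arr H' \<times> g_arr H'"
    using comp_arr f_arr unfolding comp' by auto
  show "\<forall>(a, b)\<in>g_comp H'. g_mul H' a b \<in> g_arr H'"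
    using mul' comp_mul f_arr unfolding comp' by auto
  show "\<forall>a\<in>g_arr H'. g_inv H' a \<in> g_arr H' \<and> g_inv H' (g_inv H' a) = a \<and> (g_inv H' a, a) \<in> g_comp H'"
  proof
    fix x assume "x \<in> g_arr H'"
    then obtain a where a: "a \<in> g_arr H" "x = f a" unfolding arr' by blast
    then have "(f (g_inv H a), f a) \<in> g_comp H'" using comp'_iff[of "g_inv H a" a] inv_comp by simp
    then show "g_inv H' x \<in> g_arr H' \<and> g_inv H' (g_inv H' x) = x \<and> (g_inv H' x, x) \<in> g_comp H'"
      using a inv' f_arr by simp
  qed
  show "\<forall>a b c. (a, b) \<in> g_comp H' \<and> (b, c) \<in> g_comp H' \<longrightarrow>
      (g_mul H' a b, c) \<in> g_comp H' \<and> (a, g_mul H' b c) \<in> g_comp H' \<and>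
      g_mul H' (g_mul H' a b) c = g_mul H' a (g_mul H' b c)"
  proof (intro allI impI, elim conjE)
    fix x y z assume xy: "(x, y) \<in> g_comp H'" and yz: "(y, z) \<in> g_comp H'"
    obtain a b where ab: "(a, b) \<in> g_comp H" "x = f a" "y = f b" "a \<in> g_arr H" "b \<in> g_arr H"
      by (rule comp'E[OF xy])
    obtain b' c where bc: "(b', c) \<in> g_comp H" "y = f b'" "z = f c" "b' \<in> g_arr H" "c \<in> g_arr H"
      by (rule comp'E[OF yz])
    have "b' = b" using inj_onD[OF inj] ab bc by metis
    then have bc: "(b, c) \<in> g_comp H" "z = f c" "c \<in> g_arr H" using bc by simp_all
    note as = comp_assoc[OF ab(1) bc(1)]
    have "(f (g_mul H a b), f c) \<in> g_comp H'" "(f a, f (g_mul H b c)) \<in> g_comp H'"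
      using as comp'_iff comp_mul ab bc by blast+
    then show "(g_mul H' x y, z) \<in> g_comp H' \<and> (x, g_mul H' y z) \<in> g_comp H' \<and>
      g_mul H' (g_mul H' x y) z = g_mul H' x (g_mul H' y z)"
      using ab bc as mul'[OF ab(1)] mul'[OF bc(1)] mul'[OF as(1)] mul'[OF as(2)] by simp
  qed
  show "\<forall>(a, b)\<in>g_comp H'. g_mul H' (g_inv H' a) (g_mul H' a b) = b \<and> g_mul H' (g_mul H' a b) (g_inv H' b) = a"
  proof (intro ballI, clarify)
    fix x y assume "(x, y) \<in> g_comp H'"
    then obtain a b where ab: "(a, b) \<in> g_comp H" "x = f a" "y = f b" "a \<in> g_arr H" "b \<in> g_arr H"
      by (rule comp'E)
    have s: "g_src H a = g_rng H b" using ab comp_iff by blast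
    have "(g_inv H a, g_mul H a b) \<in> g_comp H" "(g_mul H a b, g_inv H b) \<in> g_comp H"
      using ab s by (simp_all add: comp_iff)
    then show "g_mul H' (g_inv H' x) (g_mul H' x y) = y \<and> g_mul H' (g_mul H' x y) (g_inv H' y) = x"
      using ab s mul'[OF ab(1)] inv' mul' by simp
  qed
qed

lemma topological': "topological_groupoid H'"
  unfolding topological_groupoid_def
proof (intro conjI algebraic')
  let ?P = "prod_topology (g_top H) (g_top H)" and ?P' = "prod_topology (g_top H') (g_top H')"
  obtain g where g: "homeomorphic_maps (g_top H) (g_top H') f g" using homeo homeomorphic_map_maps by blast
  have "homeomorphic_map ?P ?P' (\<lambda>(a, b). (f a, f b))"
    using homeomorphic_maps_prod[of "g_top H" "g_top H" "g_top H'" "g_top H'" f f g g] g homeomorphic_map_maps by blast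
  moreover have "g_comp H \<subseteq> topspace ?P" using comp_arr by auto
  ultimately have h: "homeomorphic_map (subtopology ?P (g_comp H)) (subtopology ?P' (g_comp H')) (\<lambda>(a, b). (f a, f b))"
    unfolding comp' by (rule homeomorphic_map_restrict)
  have c: "continuous_map (subtopology ?P (g_comp H)) (g_top H) (\<lambda>(a, b). g_mul H a b)"
    using topological unfolding topological_groupoid_def by blast
  show "continuous_map (subtopology ?P' (g_comp H')) (g_top H') (\<lambda>(a, b). g_mul H' a b)"
    by (rule continuous_map_transport[OF c h homeo]) (auto simp: mul')
  show "continuous_map (g_top H') (g_top H') (g_inv H')"
    by (rule continuous_map_transport[OF continuous_inv homeo homeo inv'])
qed

sublocale H': top_groupoid H'
  by unfold_locales (rule topological')

lemma rng': "a \<in> g_arr H \<Longrightarrow> g_rng H' (f a) = f (g_rng H a)"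
  using mul'[OF comp_inv] inv' by (simp del: mul_inv H'.mul_inv add: g_rng_def)

lemma src': "a \<in> g_arr H \<Longrightarrow> g_src H' (f a) = f (g_src H a)"
  using mul'[OF inv_comp] inv' by (simp del: inv_mul H'.inv_mul add: g_src_def)

lemma units': "g_units H' = f ` g_units H"
  unfolding g_units_def arr' image_image by (rule image_cong) (simp_all add: rng')

lemma iso: "topological_groupoid_iso H H' f"
  unfolding topological_groupoid_iso_def groupoid_hom_def
  using topological topological' homeo comp'_iff mul' f_arr comp' by auto

lemma open': "openin (g_top H) U \<Longrightarrow> openin (g_top H') (f ` U)"
  using homeomorphic_imp_open_map[OF homeo] by (simp add: open_map_def)

lemma homeo_restrict: "S \<subseteq> g_arr H \<Longrightarrow> homeomorphic_map (subtopology (g_top H) S) (subtopology (g_top H') (f ` S)) f"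
  by (rule homeomorphic_map_restrict[OF homeo])

lemma homeo_units: "homeomorphic_map (unit_space H) (unit_space H') f"
  unfolding units' by (rule homeo_restrict) auto

lemma open_units': "openin (unit_space H) U \<Longrightarrow> openin (unit_space H') (f ` U)"
  using homeomorphic_imp_open_map[OF homeo_units] by (simp add: open_map_def)

lemma restrict_units_homeo:
  assumes U: "U \<subseteq> g_arr H" and r: "r ` U \<subseteq> g_units H" and eq: "\<And>a. a \<in> g_arr H \<Longrightarrow> r' (f a) = f (r a)"
    and h: "homeomorphic_map (subtopology (g_top H) U) (subtopology (unit_space H) (r ` U)) r"
  shows "r' ` f ` U = f ` r ` U"
    "homeomorphic_map (subtopology (g_top H') (f ` U)) (subtopology (unit_space H') (r' ` f ` U)) r'"
proof -
  show im: "r' ` f ` U = f ` r ` U"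
    unfolding image_image by (rule image_cong) (use eq U in auto)
  have "homeomorphic_map (subtopology (unit_space H) (r ` U)) (subtopology (unit_space H') (f ` r ` U)) f"
    by (rule homeomorphic_map_restrict[OF homeo_units]) (use r in auto)
  then show "homeomorphic_map (subtopology (g_top H') (f ` U)) (subtopology (unit_space H') (r' ` f ` U)) r'"
    unfolding im
    by (rule homeomorphic_map_transport[OF h homeo_restrict[OF U]]) (use eq in auto)
qed

lemma bisection': assumes "bisection H D" shows "bisection H' (f ` D)"
proof -
  obtain W where W: "D \<subseteq> W" "openin (g_top H) W"
    "openin (unit_space H) (g_rng H ` W)" "openin (unit_space H) (g_src H ` W)"
    "homeomorphic_map (subtopology (g_top H) W) (subtopology (unit_space H) (g_rng H ` W)) (g_rng H)"
    "homeomorphic_map (subtopology (g_top H) W) (subtopology (unit_space H) (g_src H ` W)) (g_src H)"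
    using assms unfolding bisection_def by auto
  have Wa: "W \<subseteq> g_arr H" using openin_subset[OF W(2)] .
  have u: "g_rng H ` W \<subseteq> g_units H" "g_src H ` W \<subseteq> g_units H" using Wa by auto
  show ?thesis
    unfolding bisection_def
    using W open'[OF W(2)] restrict_units_homeo[OF Wa u(1) rng' W(5)] restrict_units_homeo[OF Wa u(2) src' W(6)]
      open_units'[OF W(3)] open_units'[OF W(4)]
    by (intro exI[of _ "f ` W"]) auto
qed

lemma etale': assumes "etale_groupoid H" shows "etale_groupoid H'"
  unfolding etale_groupoid_def local_homeo_def
proof (intro conjI topological' ballI)
  show "g_rng H' ` g_arr H' \<subseteq> topspace (unit_space H')" by auto
  fix x assume "x \<in> g_arr H'"
  then obtain a where a: "a \<in> g_arr H" "x = f a" unfolding arr' by blast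
  then obtain U where U: "openin (g_top H) U" "a \<in> U" "openin (unit_space H) (g_rng H ` U)"
    "homeomorphic_map (subtopology (g_top H) U) (subtopology (unit_space H) (g_rng H ` U)) (g_rng H)"
    using assms unfolding etale_groupoid_def local_homeo_def by blast
  have Ua: "U \<subseteq> g_arr H" using openin_subset[OF U(1)] .
  have u: "g_rng H ` U \<subseteq> g_units H" using Ua by auto
  note r = restrict_units_homeo[OF Ua u rng' U(4)]
  show "\<exists>U. openin (g_top H') U \<and> x \<in> U \<and> openin (unit_space H') (g_rng H' ` U) \<and>
      homeomorphic_map (subtopology (g_top H') U) (subtopology (unit_space H') (g_rng H' ` U)) (g_rng H')"
    using r open'[OF U(1)] open_units'[OF U(3)] U(2) a(2) by (intro exI[of _ "f ` U"]) auto
qed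

end

section \<open>Transport of a twist\<close>

lemma units_trivial_bundle:
  fixes G :: "'g groupoid"
  assumes "g_units G \<subseteq> g_arr G"
  shows "g_units (trivial_bundle G :: ('g \<times> 'r::comm_ring_1) groupoid) = g_units G \<times> {1}"
proof -
  have a: "g_arr (trivial_bundle G :: ('g \<times> 'r) groupoid) = g_units G \<times> ring_units"
    using assms by (simp add: trivial_bundle_def Int_absorb1)
  have r: "g_rng (trivial_bundle G) (x, t) = (x, 1)" if "t dvd 1" for x and t :: 'r
    using that by (simp add: g_rng_def trivial_bundle_def)
  show ?thesis
    unfolding g_units_def[of "trivial_bundle G"] a
  proof (intro equalityI subsetI)
    fix p :: "'g \<times> 'r" assume "p \<in> g_units G \<times> {1}"
    then have "p = g_rng (trivial_bundle G) p" "p \<in> g_units G \<times> ring_units" using r by auto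
    then show "p \<in> g_rng (trivial_bundle G) ` (g_units G \<times> ring_units)" by blast
  qed (use r in auto)
qed

context twist
begin

text \<open>Each clause of the definition speaks of data intertwined by \<open>f\<close> and
  \<open>F\<close> and is moved along a commuting square. A local section \<open>P\<close> over
  \<open>D\<close> becomes \<open>f\<close> after \<open>P\<close> after the inverse of
  \<open>F\<close>.\<close>

lemma transport_twist:
  assumes tS: "groupoid_transport \<Sigma> \<Sigma>' f" and tG: "groupoid_transport G G' F"
    and q': "\<And>\<sigma>. \<sigma> \<in> arr \<Longrightarrow> q' (f \<sigma>) = F (q \<sigma>)"
    and i': "\<And>x t. x \<in> g_units G \<Longrightarrow> t dvd 1 \<Longrightarrow> i' (F x, t) = f (i (x, t))"
  shows "discrete_twist G' \<Sigma>' i' q'"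
proof -
  interpret fS: groupoid_transport \<Sigma> \<Sigma>' f by (rule tS)
  interpret fG: groupoid_transport G G' F by (rule tG)
  let ?U = "ring_units :: 'r set"
  let ?T = "\<lambda>(x, t). (F x, t :: 'r)"
  have uG: "g_units G \<subseteq> g_arr G" "g_units G' \<subseteq> g_arr G'" using fG.H'.units_arr by auto
  have FU: "F ` g_units G = g_units G'" using fG.units' by simp
  have top_tb: "g_top (trivial_bundle G :: ('g \<times> 'r) groupoid) = prod_topology (unit_space G) (discrete_topology ?U)"
    "g_top (trivial_bundle G' :: (_ \<times> 'r) groupoid) = prod_topology (unit_space G') (discrete_topology ?U)"
    by (simp_all add: trivial_bundle_def)
  have arr_tb: "g_arr (trivial_bundle G :: ('g \<times> 'r) groupoid) = g_units G \<times> ?U"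
    "g_arr (trivial_bundle G' :: (_ \<times> 'r) groupoid) = g_units G' \<times> ?U"
    using uG by (simp_all add: trivial_bundle_def Int_absorb1)
  have tb: "homeomorphic_map (g_top (trivial_bundle G)) (g_top (trivial_bundle G')) ?T"
    unfolding top_tb by (rule homeomorphic_map_prod_id[OF fG.homeo_units])
  have inv_F: "inv_into (g_arr G) F (F \<beta>) = \<beta>" if "\<beta> \<in> g_arr G" for \<beta>
    using inv_into_f_f[OF fG.inj that] .
  show ?thesis
    unfolding discrete_twist_def
  proof (intro conjI)
    show "etale_groupoid G'"
      using fG.etale' twist unfolding discrete_twist_def by blast
    show "topological_groupoid \<Sigma>'" using fS.topological' .
    show "g_units \<Sigma>' = i' ` (g_units G' \<times> {1})"
      unfolding fS.units' units_S FU[symmetric] using i' by (force simp: image_iff)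
    show "continuous_map (g_top (trivial_bundle G')) (g_top \<Sigma>') i'"
      by (rule continuous_map_transport[OF continuous_i tb fS.homeo]) (use arr_tb i' in auto)
    show "groupoid_hom (trivial_bundle G') \<Sigma>' i'"
      unfolding groupoid_hom_def
    proof (intro conjI)
      show "i' ` g_arr (trivial_bundle G') \<subseteq> g_arr \<Sigma>'"
        unfolding arr_tb FU[symmetric] using i' i_arr fS.f_arr by auto
      show "\<forall>(a, b)\<in>g_comp (trivial_bundle G'). (i' a, i' b) \<in> g_comp \<Sigma>' \<and>
          i' (g_mul (trivial_bundle G') a b) = g_mul \<Sigma>' (i' a) (i' b)"
      proof (intro ballI, clarify)
        fix x' t y' u assume "((x', t), (y', u)) \<in> g_comp (trivial_bundle G' :: (_ \<times> 'r) groupoid)"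
        then have *: "x' \<in> g_units G'" "y' = x'" "t dvd 1" "u dvd 1" by (auto simp: trivial_bundle_def)
        then obtain x where x: "x \<in> g_units G" "x' = F x" using FU by blast
        have "(i (x, t), i (x, u)) \<in> g_comp \<Sigma>" using x * by (simp add: S.comp_iff)
        then show "(i' (x', t), i' (y', u)) \<in> g_comp \<Sigma>' \<and>
            i' (g_mul (trivial_bundle G') (x', t) (y', u)) = g_mul \<Sigma>' (i' (x', t)) (i' (y', u))"
          using x * i' fS.comp'_iff[of "i (x, t)" "i (x, u)"] fS.mul'[of "i (x, t)" "i (x, u)"]
          by (simp add: trivial_bundle_def)
      qed
    qed
    have uTB: "?T ` (g_units G \<times> {1}) = g_units G' \<times> {1}" unfolding FU[symmetric] by force
    have "homeomorphic_map (unit_space (trivial_bundle G)) (subtopology (g_top (trivial_bundle G')) (?T ` (g_units G \<times> {1}))) ?T"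
      unfolding units_trivial_bundle[OF uG(1)] by (rule homeomorphic_map_restrict[OF tb]) (use arr_tb in auto)
    then have h: "homeomorphic_map (unit_space (trivial_bundle G)) (unit_space (trivial_bundle G')) ?T"
      unfolding uTB units_trivial_bundle[OF uG(2)] .
    have hi: "homeomorphic_map (unit_space (trivial_bundle G)) (unit_space \<Sigma>) i"
      using twist unfolding discrete_twist_def by blast
    show "homeomorphic_map (unit_space (trivial_bundle G')) (unit_space \<Sigma>') i'"
      by (rule homeomorphic_map_transport[OF hi h fS.homeo_units])
        (use i' in \<open>auto simp: units_trivial_bundle[OF uG(1)]\<close>)
    show "continuous_map (g_top \<Sigma>') (g_top G') q'"
      by (rule continuous_map_transport[OF continuous_q fS.homeo fG.homeo q'])
    show "groupoid_hom \<Sigma>' G' q'"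
      unfolding groupoid_hom_def
    proof (intro conjI)
      show "q' ` g_arr \<Sigma>' \<subseteq> g_arr G'" unfolding fS.arr' fG.arr' using q' by auto
      show "\<forall>(a, b)\<in>g_comp \<Sigma>'. (q' a, q' b) \<in> g_comp G' \<and> q' (g_mul \<Sigma>' a b) = g_mul G' (q' a) (q' b)"
      proof (intro ballI, clarify)
        fix x y assume "(x, y) \<in> g_comp \<Sigma>'"
        then obtain a b where ab: "(a, b) \<in> g_comp \<Sigma>" "x = f a" "y = f b" "a \<in> arr" "b \<in> arr"
          by (rule fS.comp'E)
        have "(q a, q b) \<in> g_comp G" "q (a \<cdot> b) = g_mul G (q a) (q b)"
          using hom_q ab(1) unfolding groupoid_hom_def by auto
        then show "(q' x, q' y) \<in> g_comp G' \<and> q' (g_mul \<Sigma>' x y) = g_mul G' (q' x) (q' y)"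
          using ab q' fG.comp'_iff fS.mul'[OF ab(1)] fG.mul' S.comp_mul[OF ab(1)] by simp
      qed
    qed
    show "homeomorphic_map (unit_space \<Sigma>') (unit_space G') q'"
      by (rule homeomorphic_map_transport[OF homeo_q_units fS.homeo_units fG.homeo_units]) (use q' in auto)
    show "\<forall>x\<in>g_units G'. i' ` ({x} \<times> ring_units) = {\<sigma> \<in> g_arr \<Sigma>'. q' \<sigma> = x}"
    proof
      fix x' assume "x' \<in> g_units G'"
      then obtain x where x: "x \<in> g_units G" "x' = F x" using FU by blast
      have "i' ` ({x'} \<times> ?U) = f ` i ` ({x} \<times> ?U)" using x i' by (force simp: image_iff)
      also have "\<dots> = f ` {\<sigma> \<in> arr. q \<sigma> = x}" using i_fibre[OF x(1)] by simp
      also have "\<dots> = {\<sigma> \<in> g_arr \<Sigma>'. q' \<sigma> = x'}"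
        unfolding fS.arr' using q' x uG(1) q_arr inj_onD[OF fG.inj] by (auto 0 3)
      finally show "i' ` ({x'} \<times> ring_units) = {\<sigma> \<in> g_arr \<Sigma>'. q' \<sigma> = x'}" .
    qed
    show "inj_on i' (g_units G' \<times> ring_units)"
    proof (rule inj_onI, clarify)
      fix x' t y' u assume *: "x' \<in> g_units G'" "y' \<in> g_units G'" "t dvd (1::'r)" "u dvd 1" "i' (x', t) = i' (y', u)"
      then obtain x y where xy: "x \<in> g_units G" "x' = F x" "y \<in> g_units G" "y' = F y" using FU by blast
      then have "f (i (x, t)) = f (i (y, u))" using i' * by simp
      then have "i (x, t) = i (y, u)" using inj_onD[OF fS.inj] i_arr xy * by blast
      then show "x' = y' \<and> t = u" using inj_onD[OF inj_i, of "(x, t)" "(y, u)"] xy * by simp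
    qed
    show "q' ` g_arr \<Sigma>' = g_arr G'"
      unfolding fS.arr' fG.arr' q_surj[symmetric] image_image by (rule image_cong) (use q' in auto)
    show "\<forall>\<alpha> \<in> g_arr G'. \<exists>D P.
        \<alpha> \<in> D \<and> openin (g_top G') D \<and> bisection G' D \<and>
        continuous_map (subtopology (g_top G') D) (g_top \<Sigma>') P \<and>
        (\<forall>\<beta> \<in> D. q' (P \<beta>) = \<beta>) \<and>
        homeomorphic_map
          (prod_topology (subtopology (g_top G') D) (discrete_topology ring_units))
          (subtopology (g_top \<Sigma>') {\<sigma> \<in> g_arr \<Sigma>'. q' \<sigma> \<in> D})
          (\<lambda>(\<beta>, t). g_mul \<Sigma>' (i' (g_rng G' \<beta>, t)) (P \<beta>))"
    proof
      fix \<alpha>' assume "\<alpha>' \<in> g_arr G'"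
      then obtain \<alpha> where \<alpha>: "\<alpha> \<in> g_arr G" "\<alpha>' = F \<alpha>" unfolding fG.arr' by blast
      obtain D P where D: "\<alpha> \<in> D" "openin (g_top G) D" "bisection G D"
        "continuous_map (subtopology (g_top G) D) (g_top \<Sigma>) P" "\<And>\<beta>. \<beta> \<in> D \<Longrightarrow> q (P \<beta>) = \<beta>"
        "homeomorphic_map (prod_topology (subtopology (g_top G) D) (discrete_topology ring_units))
          (subtopology (g_top \<Sigma>) {\<sigma> \<in> arr. q \<sigma> \<in> D}) (\<lambda>(\<beta>, t). g_mul \<Sigma> (i (g_rng G \<beta>, t)) (P \<beta>))"
        using local_trivialisation[OF \<alpha>(1)] by blast
      have Da: "D \<subseteq> g_arr G" using openin_subset[OF D(2)] .
      have PD: "P \<beta> \<in> arr" if "\<beta> \<in> D" for \<beta>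
        using D(4) that Da unfolding continuous_map_def by (auto simp: Int_absorb1)
      define P' where "P' \<beta> = f (P (inv_into (g_arr G) F \<beta>))" for \<beta>
      have P': "P' (F \<beta>) = f (P \<beta>)" if "\<beta> \<in> D" for \<beta> using inv_F that Da unfolding P'_def by auto
      have top_D: "topspace (subtopology (g_top G) D) = D" using Da by auto
      note FD = fG.homeo_restrict[OF Da]
      have c: "continuous_map (subtopology (g_top G') (F ` D)) (g_top \<Sigma>') P'"
        by (rule continuous_map_transport[OF D(4) FD fS.homeo]) (use P' top_D in auto)
      have pre: "f ` {\<sigma> \<in> arr. q \<sigma> \<in> D} = {\<sigma> \<in> g_arr \<Sigma>'. q' \<sigma> \<in> F ` D}"
      proof (intro equalityI subsetI)
        fix \<sigma>' assume "\<sigma>' \<in> {\<sigma> \<in> g_arr \<Sigma>'. q' \<sigma> \<in> F ` D}"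
        then obtain \<sigma> \<beta> where s: "\<sigma> \<in> arr" "\<sigma>' = f \<sigma>" "\<beta> \<in> D" "q' (f \<sigma>) = F \<beta>" unfolding fS.arr' by blast
        then have "q \<sigma> = \<beta>" using q' inj_onD[OF fG.inj, of "q \<sigma>" \<beta>] Da by auto
        then show "\<sigma>' \<in> f ` {\<sigma> \<in> arr. q \<sigma> \<in> D}" using s by blast
      qed (use q' fS.arr' in auto)
      have hS: "homeomorphic_map (subtopology (g_top \<Sigma>) {\<sigma> \<in> arr. q \<sigma> \<in> D})
          (subtopology (g_top \<Sigma>') {\<sigma> \<in> g_arr \<Sigma>'. q' \<sigma> \<in> F ` D}) f"
        unfolding pre[symmetric] by (rule fS.homeo_restrict) auto
      have h: "homeomorphic_map (prod_topology (subtopology (g_top G') (F ` D)) (discrete_topology ring_units))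
          (subtopology (g_top \<Sigma>') {\<sigma> \<in> g_arr \<Sigma>'. q' \<sigma> \<in> F ` D})
          (\<lambda>(\<beta>, t). g_mul \<Sigma>' (i' (g_rng G' \<beta>, t)) (P' \<beta>))"
      proof (rule homeomorphic_map_transport[OF D(6) homeomorphic_map_prod_id[OF FD] hS])
        fix p :: "'g \<times> 'r"
        assume "p \<in> topspace (prod_topology (subtopology (g_top G) D) (discrete_topology ring_units))"
        then obtain \<beta> t where p: "p = (\<beta>, t)" "\<beta> \<in> D" "t dvd 1" using top_D by (cases p) auto
        have ba: "\<beta> \<in> g_arr G" "P \<beta> \<in> arr" "q (P \<beta>) = \<beta>" using p(2) Da PD D(5) by auto
        have "rg (P \<beta>) = i (g_rng G \<beta>, 1)" using i_rg_one[OF ba(2)] ba(3) by simp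
        then have "(i (g_rng G \<beta>, t), P \<beta>) \<in> g_comp \<Sigma>" using ba p by (simp add: S.comp_iff)
        then show "(case case p of (x, z) \<Rightarrow> (F x, z) of (\<beta>, t) \<Rightarrow> g_mul \<Sigma>' (i' (g_rng G' \<beta>, t)) (P' \<beta>)) =
            f (case p of (\<beta>, t) \<Rightarrow> g_mul \<Sigma> (i (g_rng G \<beta>, t)) (P \<beta>))"
          using p ba fG.rng' i' P' fS.mul' by simp
      qed
      show "\<exists>D P.
        \<alpha>' \<in> D \<and> openin (g_top G') D \<and> bisection G' D \<and>
        continuous_map (subtopology (g_top G') D) (g_top \<Sigma>') P \<and>
        (\<forall>\<beta> \<in> D. q' (P \<beta>) = \<beta>) \<and>
        homeomorphic_map
          (prod_topology (subtopology (g_top G') D) (discrete_topology ring_units))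
          (subtopology (g_top \<Sigma>') {\<sigma> \<in> g_arr \<Sigma>'. q' \<sigma> \<in> D})
          (\<lambda>(\<beta>, t). g_mul \<Sigma>' (i' (g_rng G' \<beta>, t)) (P \<beta>))"
      proof (intro exI conjI)
        show "\<alpha>' \<in> F ` D" using \<alpha> D(1) by blast
        show "openin (g_top G') (F ` D)" by (rule fG.open'[OF D(2)])
        show "bisection G' (F ` D)" by (rule fG.bisection'[OF D(3)])
        show "\<forall>\<beta>\<in>F ` D. q' (P' \<beta>) = \<beta>" using P' q' PD D(5) by auto
      qed (use c h in blast)+
    qed
    show "\<forall>\<sigma>\<in>g_arr \<Sigma>'. \<forall>t\<in>ring_units.
        g_mul \<Sigma>' (i' (q' (g_rng \<Sigma>' \<sigma>), t)) \<sigma> = g_mul \<Sigma>' \<sigma> (i' (q' (g_src \<Sigma>' \<sigma>), t))"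
    proof (intro ballI)
      fix \<sigma>' and t :: 'r assume "\<sigma>' \<in> g_arr \<Sigma>'" "t \<in> ring_units"
      then obtain \<sigma> where s: "\<sigma> \<in> arr" "\<sigma>' = f \<sigma>" "t dvd 1" unfolding fS.arr' by blast
      have c: "(i (q (rg \<sigma>), t), \<sigma>) \<in> g_comp \<Sigma>" "(\<sigma>, i (q (sr \<sigma>), t)) \<in> g_comp \<Sigma>"
        using s by (simp_all add: S.comp_iff)
      have 1: "q' (g_rng \<Sigma>' \<sigma>') = F (q (rg \<sigma>))" "q' (g_src \<Sigma>' \<sigma>') = F (q (sr \<sigma>))"
        using s fS.rng' fS.src' q' S.rng_arr S.src_arr by metis+
      have u: "q (rg \<sigma>) \<in> g_units G" "q (sr \<sigma>) \<in> g_units G" using s by simp_all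
      have "i (q (rg \<sigma>), t) \<cdot> \<sigma> = \<sigma> \<cdot> i (q (sr \<sigma>), t)"
        using twist_commute[OF s(1,3)] by (simp only: act_def)
      then show "g_mul \<Sigma>' (i' (q' (g_rng \<Sigma>' \<sigma>'), t)) \<sigma>' = g_mul \<Sigma>' \<sigma>' (i' (q' (g_src \<Sigma>' \<sigma>'), t))"
        unfolding 1 i'[OF u(1) s(3)] i'[OF u(2) s(3)] unfolding s(2) fS.mul'[OF c(1)] fS.mul'[OF c(2)] by simp
    qed
  qed
qed

end

section \<open>Reconstruction\<close>

lemma topspace_quotient_topology: "topspace (quotient_topology X f) = f ` topspace X"
proof -
  have "{x \<in> topspace X. f x \<in> f ` topspace X} = topspace X" by blast
  then have "openin (quotient_topology X f) (f ` topspace X)"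
    by (simp add: openin_quotient_topology)
  then show ?thesis
    using openin_quotient_topology[of X f "topspace (quotient_topology X f)"] openin_subset by blast
qed

context graded_twist
begin

section \<open>The recovered twist as a transported copy of the given one\<close>

lemma transport_point_filter: "groupoid_transport \<Sigma> UF point_filter"
proof (unfold_locales)
  show "homeomorphic_map (g_top \<Sigma>) (g_top UF) point_filter" by (rule homeomorphic_point_filter)
  show "g_comp UF = (\<lambda>(a, b). (point_filter a, point_filter b)) ` g_comp \<Sigma>"
  proof (intro equalityI subsetI)
    fix p assume p: "p \<in> g_comp UF"
    then obtain U V where "p = (U, V)" "U \<in> ultrafilters A B" "V \<in> ultrafilters A B"
      by (auto simp: uf_groupoid_def)
    then obtain \<sigma> \<tau> where "p = (point_filter \<sigma>, point_filter \<tau>)" "\<sigma> \<in> arr" "\<tau> \<in> arr"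
      unfolding ultrafilters_eq by blast
    then show "p \<in> (\<lambda>(a, b). (point_filter a, point_filter b)) ` g_comp \<Sigma>"
      using UF_comp[of \<sigma> \<tau>] S.comp_iff p by auto
  qed (use UF_comp S.comp_iff in auto)
qed (use UF_mul UF_inv S.comp_iff in auto)

interpretation fS: groupoid_transport \<Sigma> UF point_filter
  by (rule transport_point_filter)

abbreviation "GQ \<equiv> uf_quotient A B"

text \<open>The class of \<open>point_filter \<sigma>\<close> depends only on
  \<open>q \<sigma>\<close>; written as a function on \<open>G\<close>, it is the candidate for the
  induced map on base groupoids.\<close>

definition fibre_filter :: "'g \<Rightarrow> ('s \<Rightarrow> 'r) set set" where
  "fibre_filter \<alpha> = point_filter ` {\<tau> \<in> arr. q \<tau> = \<alpha>}"

lemma uf_q_eq: "\<sigma> \<in> arr \<Longrightarrow> uf_q A B (point_filter \<sigma>) = fibre_filter (q \<sigma>)"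
  unfolding fibre_filter_def by (rule uf_q_point_filter)

lemma ex_lift: assumes "\<alpha> \<in> g_arr G" obtains \<sigma> where "\<sigma> \<in> arr" "q \<sigma> = \<alpha>"
  using assms unfolding q_surj[symmetric] by (rule imageE) (metis that)

lemma inj_fibre_filter: "inj_on fibre_filter (g_arr G)"
proof (rule inj_onI)
  fix \<alpha> \<beta> assume *: "\<alpha> \<in> g_arr G" "\<beta> \<in> g_arr G" "fibre_filter \<alpha> = fibre_filter \<beta>"
  obtain \<sigma> where s: "\<sigma> \<in> arr" "q \<sigma> = \<alpha>" by (rule ex_lift[OF *(1)])
  then have "point_filter \<sigma> \<in> fibre_filter \<beta>" using *(3) unfolding fibre_filter_def by blast
  then obtain \<tau> where "\<tau> \<in> arr" "q \<tau> = \<beta>" "point_filter \<sigma> = point_filter \<tau>" unfolding fibre_filter_def by blast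
  then show "\<alpha> = \<beta>" using s inj_onD[OF inj_point_filter] by blast
qed

lemma GQ_arr: "g_arr GQ = fibre_filter ` g_arr G"
proof -
  have "g_arr GQ = uf_q A B ` point_filter ` arr"
    unfolding uf_quotient_def Let_def by (simp add: topspace_quotient_topology UF_arr)
  also have "\<dots> = (\<lambda>\<sigma>. fibre_filter (q \<sigma>)) ` arr"
    unfolding image_image by (rule image_cong) (use uf_q_eq in auto)
  also have "\<dots> = fibre_filter ` g_arr G" unfolding q_surj[symmetric] image_image ..
  finally show ?thesis .
qed

lemma openin_GQ:
  "openin (g_top GQ) V \<longleftrightarrow> V \<subseteq> g_arr GQ \<and> openin (g_top UF) {U \<in> g_arr UF. uf_q A B U \<in> V}"
  unfolding GQ_arr[symmetric]
  by (simp add: uf_quotient_def Let_def openin_quotient_topology topspace_quotient_topology)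

text \<open>As \<open>q\<close> is an open continuous surjection, \<open>G\<close> carries the
  quotient topology from \<open>\<Sigma>\<close>. Under \<open>point_filter\<close> both base spaces
  are quotients by the same relation.\<close>

lemma homeomorphic_fibre_filter: "homeomorphic_map (g_top G) (g_top GQ) fibre_filter"
proof (rule bijective_open_imp_homeomorphic_map)
  show "fibre_filter ` g_arr G = g_arr GQ" using GQ_arr by simp
  show "inj_on fibre_filter (g_arr G)" by (rule inj_fibre_filter)
  show "continuous_map (g_top G) (g_top GQ) fibre_filter"
    unfolding continuous_map_def
  proof (intro conjI allI impI)
    show "fibre_filter \<in> g_arr G \<rightarrow> g_arr GQ" using GQ_arr by blast
    fix V assume "openin (g_top GQ) V"
    then have "openin (g_top UF) {U \<in> g_arr UF. uf_q A B U \<in> V}" using openin_GQ by blast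
    then have "openin (g_top \<Sigma>) {\<sigma> \<in> arr. point_filter \<sigma> \<in> {U \<in> g_arr UF. uf_q A B U \<in> V}}"
      by (rule openin_continuous_map_preimage[OF homeomorphic_imp_continuous_map[OF homeomorphic_point_filter]])
    moreover have "{\<sigma> \<in> arr. point_filter \<sigma> \<in> {U \<in> g_arr UF. uf_q A B U \<in> V}} = {\<sigma> \<in> arr. fibre_filter (q \<sigma>) \<in> V}"
      using uf_q_eq UF_arr by auto
    ultimately have "openin (g_top G) (q ` {\<sigma> \<in> arr. fibre_filter (q \<sigma>) \<in> V})"
      using open_map_q by (simp add: open_map_def)
    moreover have "q ` {\<sigma> \<in> arr. fibre_filter (q \<sigma>) \<in> V} = {\<alpha> \<in> g_arr G. fibre_filter \<alpha> \<in> V}"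
      using q_surj by auto
    ultimately show "openin (g_top G) {\<alpha> \<in> g_arr G. fibre_filter \<alpha> \<in> V}" by simp
  qed
  show "open_map (g_top G) (g_top GQ) fibre_filter"
    unfolding open_map_def
  proof (intro allI impI)
    fix W assume W: "openin (g_top G) W"
    have Wa: "W \<subseteq> g_arr G" using openin_subset[OF W] .
    have "{U \<in> g_arr UF. uf_q A B U \<in> fibre_filter ` W} = point_filter ` {\<sigma> \<in> arr. q \<sigma> \<in> W}"
    proof (intro equalityI subsetI)
      fix U assume "U \<in> {U \<in> g_arr UF. uf_q A B U \<in> fibre_filter ` W}"
      then obtain \<sigma> \<alpha> where s: "\<sigma> \<in> arr" "U = point_filter \<sigma>" "\<alpha> \<in> W" "fibre_filter (q \<sigma>) = fibre_filter \<alpha>"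
        unfolding UF_arr using uf_q_eq by auto
      then have "q \<sigma> = \<alpha>" using inj_onD[OF inj_fibre_filter, of "q \<sigma>" \<alpha>] Wa by auto
      then show "U \<in> point_filter ` {\<sigma> \<in> arr. q \<sigma> \<in> W}" using s by blast
    qed (use uf_q_eq UF_arr in auto)
    moreover have "openin (g_top UF) (point_filter ` {\<sigma> \<in> arr. q \<sigma> \<in> W})"
      by (rule fS.open'[OF openin_continuous_map_preimage[OF continuous_q W]])
    ultimately show "openin (g_top GQ) (fibre_filter ` W)"
      unfolding openin_GQ GQ_arr using Wa by auto
  qed
qed

lemma uf_q_comp:
  assumes "(\<sigma>, \<tau>) \<in> g_comp \<Sigma>"
  shows "(uf_q A B (point_filter \<sigma>), uf_q A B (point_filter \<tau>)) = (fibre_filter (q \<sigma>), fibre_filter (q \<tau>))"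
    "uf_q A B (g_mul UF (point_filter \<sigma>) (point_filter \<tau>)) = fibre_filter (g_mul G (q \<sigma>) (q \<tau>))"
  using assms uf_q_eq UF_mul by (auto simp: S.comp_iff)

lemma lift_comp:
  assumes "(\<alpha>, \<beta>) \<in> g_comp G"
  obtains \<sigma> \<tau> where "(\<sigma>, \<tau>) \<in> g_comp \<Sigma>" "q \<sigma> = \<alpha>" "q \<tau> = \<beta>"
proof -
  have ab: "\<alpha> \<in> g_arr G" "\<beta> \<in> g_arr G" "g_src G \<alpha> = g_rng G \<beta>" using assms G.comp_iff by auto
  obtain \<sigma> where s: "\<sigma> \<in> arr" "q \<sigma> = \<alpha>" by (rule ex_lift[OF ab(1)])
  obtain \<tau> where t: "\<tau> \<in> arr" "q \<tau> = \<beta>" by (rule ex_lift[OF ab(2)])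
  have "sr \<sigma> = rg \<tau>" using sr_rg_eq_iff[OF s(1) t(1)] ab(3) s t by simp
  then show ?thesis using that s t S.comp_iff by blast
qed

lemma transport_fibre_filter: "groupoid_transport G GQ fibre_filter"
proof (unfold_locales)
  show "homeomorphic_map (g_top G) (g_top GQ) fibre_filter" by (rule homeomorphic_fibre_filter)
  show "g_comp GQ = (\<lambda>(a, b). (fibre_filter a, fibre_filter b)) ` g_comp G"
  proof (intro equalityI subsetI)
    fix p assume "p \<in> g_comp GQ"
    then obtain U V where UV: "(U, V) \<in> g_comp UF" "p = (uf_q A B U, uf_q A B V)"
      by (auto simp: uf_quotient_def Let_def)
    then obtain \<sigma> \<tau> where st: "(\<sigma>, \<tau>) \<in> g_comp \<Sigma>" "U = point_filter \<sigma>" "V = point_filter \<tau>"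
      using fS.comp'E by metis
    then have "(q \<sigma>, q \<tau>) \<in> g_comp G" using hom_q unfolding groupoid_hom_def by auto
    then show "p \<in> (\<lambda>(a, b). (fibre_filter a, fibre_filter b)) ` g_comp G"
      using UV(2) uf_q_comp(1)[OF st(1)] st by force
  next
    fix p assume "p \<in> (\<lambda>(a, b). (fibre_filter a, fibre_filter b)) ` g_comp G"
    then obtain \<alpha> \<beta> where ab: "(\<alpha>, \<beta>) \<in> g_comp G" "p = (fibre_filter \<alpha>, fibre_filter \<beta>)" by auto
    obtain \<sigma> \<tau> where st: "(\<sigma>, \<tau>) \<in> g_comp \<Sigma>" "q \<sigma> = \<alpha>" "q \<tau> = \<beta>" by (rule lift_comp[OF ab(1)])
    have "p = (uf_q A B (point_filter \<sigma>), uf_q A B (point_filter \<tau>))" using uf_q_comp(1)[OF st(1)] st ab by simp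
    moreover have "(point_filter \<sigma>, point_filter \<tau>) \<in> g_comp UF" unfolding fS.comp' using st(1) by force
    ultimately show "p \<in> g_comp GQ" by (auto simp: uf_quotient_def Let_def)
  qed
  show "g_mul GQ (fibre_filter \<alpha>) (fibre_filter \<beta>) = fibre_filter (g_mul G \<alpha> \<beta>)" if ab: "(\<alpha>, \<beta>) \<in> g_comp G" for \<alpha> \<beta>
  proof -
    obtain \<sigma> \<tau> where st: "(\<sigma>, \<tau>) \<in> g_comp \<Sigma>" "q \<sigma> = \<alpha>" "q \<tau> = \<beta>" by (rule lift_comp[OF ab])
    have aa: "\<alpha> \<in> g_arr G" "\<beta> \<in> g_arr G" using ab G.comp_arr by auto
    have "(THE c. \<exists>U V. (U, V) \<in> g_comp UF \<and> fibre_filter \<alpha> = uf_q A B U \<and> fibre_filter \<beta> = uf_q A B V \<and>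
        c = uf_q A B (g_mul UF U V)) = fibre_filter (g_mul G \<alpha> \<beta>)"
    proof (rule the_equality)
      have "(point_filter \<sigma>, point_filter \<tau>) \<in> g_comp UF" unfolding fS.comp' using st(1) by force
      then show "\<exists>U V. (U, V) \<in> g_comp UF \<and> fibre_filter \<alpha> = uf_q A B U \<and> fibre_filter \<beta> = uf_q A B V \<and>
          fibre_filter (g_mul G \<alpha> \<beta>) = uf_q A B (g_mul UF U V)"
        using uf_q_comp[OF st(1)] st by (intro exI[of _ "point_filter \<sigma>"] exI[of _ "point_filter \<tau>"]) simp
      fix c assume "\<exists>U V. (U, V) \<in> g_comp UF \<and> fibre_filter \<alpha> = uf_q A B U \<and> fibre_filter \<beta> = uf_q A B V \<and>
        c = uf_q A B (g_mul UF U V)"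
      then obtain U V where UV: "(U, V) \<in> g_comp UF" "fibre_filter \<alpha> = uf_q A B U" "fibre_filter \<beta> = uf_q A B V"
        "c = uf_q A B (g_mul UF U V)" by blast
      \<comment> \<open>Any other representatives lie over the same arrows, as
        \<open>fibre_filter\<close> is injective. This is the well-definedness of the product of
        classes.\<close>
      obtain \<sigma>' \<tau>' where st': "(\<sigma>', \<tau>') \<in> g_comp \<Sigma>" "U = point_filter \<sigma>'" "V = point_filter \<tau>'"
        by (rule fS.comp'E[OF UV(1)])
      have "\<sigma>' \<in> arr" "\<tau>' \<in> arr" using st'(1) S.comp_arr by auto
      then have "q \<sigma>' = \<alpha>" "q \<tau>' = \<beta>"
        using UV(2,3) st'(2,3) uf_q_eq inj_onD[OF inj_fibre_filter] aa q_arr by metis+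
      then show "c = fibre_filter (g_mul G \<alpha> \<beta>)" using UV(4) uf_q_comp(2)[OF st'(1)] st' by simp
    qed
    then show ?thesis by (simp add: uf_quotient_def Let_def)
  qed
  show "g_inv GQ (fibre_filter \<alpha>) = fibre_filter (g_inv G \<alpha>)" if a: "\<alpha> \<in> g_arr G" for \<alpha>
  proof -
    obtain \<sigma> where s: "\<sigma> \<in> arr" "q \<sigma> = \<alpha>" by (rule ex_lift[OF a])
    have val: "uf_q A B (g_inv UF (point_filter \<tau>)) = fibre_filter (g_inv G (q \<tau>))" if "\<tau> \<in> arr" for \<tau>
      using that UF_inv uf_q_eq by simp
    have "(THE c. \<exists>U\<in>g_arr UF. fibre_filter \<alpha> = uf_q A B U \<and> c = uf_q A B (g_inv UF U)) = fibre_filter (g_inv G \<alpha>)"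
    proof (rule the_equality)
      show "\<exists>U\<in>g_arr UF. fibre_filter \<alpha> = uf_q A B U \<and> fibre_filter (g_inv G \<alpha>) = uf_q A B (g_inv UF U)"
        using s val[OF s(1)] uf_q_eq[OF s(1)] UF_arr by auto
      fix c assume "\<exists>U\<in>g_arr UF. fibre_filter \<alpha> = uf_q A B U \<and> c = uf_q A B (g_inv UF U)"
      then obtain \<tau> where t: "\<tau> \<in> arr" "fibre_filter \<alpha> = uf_q A B (point_filter \<tau>)" "c = uf_q A B (g_inv UF (point_filter \<tau>))"
        unfolding UF_arr by blast
      then have "q \<tau> = \<alpha>" using uf_q_eq inj_onD[OF inj_fibre_filter] a q_arr by metis
      then show "c = fibre_filter (g_inv G \<alpha>)" using t val by simp
    qed
    then show ?thesis by (simp add: uf_quotient_def Let_def)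
  qed
qed

interpretation fG: groupoid_transport G GQ fibre_filter
  by (rule transport_fibre_filter)

text \<open>Since \<open>q\<close> is injective on units, the class over a unit contains just one
  unit of the groupoid of ultrafilters, so the definite description in \<open>uf_i\<close> is
  proper.\<close>

lemma uf_i_eq:
  assumes x: "x \<in> g_units G" and t: "t dvd 1"
  shows "uf_i A B (fibre_filter x, t) = point_filter (i (x, t))"
proof -
  have u: "i (x, 1) \<in> g_units \<Sigma>" "i (x, 1) \<in> arr" "q (i (x, 1)) = x" using x by simp_all
  have "(THE U. U \<in> g_units UF \<and> uf_q A B U = fibre_filter x) = point_filter (i (x, 1))"
  proof (rule the_equality)
    show "point_filter (i (x, 1)) \<in> g_units UF \<and> uf_q A B (point_filter (i (x, 1))) = fibre_filter x"
      using u uf_q_eq fS.units' by auto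
    fix U assume U: "U \<in> g_units UF \<and> uf_q A B U = fibre_filter x"
    then obtain v where v: "v \<in> g_units \<Sigma>" "U = point_filter v" unfolding fS.units' by blast
    then have "fibre_filter (q v) = fibre_filter x" using U uf_q_eq[of v] by simp
    then have "q v = x" using inj_onD[OF inj_fibre_filter, of "q v" x] v x by simp
    then show "U = point_filter (i (x, 1))" using v i_q_unit by auto
  qed
  then have "uf_i A B (fibre_filter x, t) = point_filter (t \<odot> i (x, 1))"
    using smult_point_filter[OF u(2) t] by (simp add: uf_i_def)
  moreover have "t \<odot> i (x, 1) = i (x, t)" using x t by (simp add: act_def)
  ultimately show ?thesis by simp
qed

lemma reconstruction:
  "alg_quasi_cartan_pair A B \<and>
    (\<forall>\<sigma> \<in> g_arr \<Sigma>.
       (\<exists>Y. compact_open_bisection \<Sigma> Y \<and> \<sigma> \<in> Y) \<and>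
       (\<forall>Y. compact_open_bisection \<Sigma> Y \<and> \<sigma> \<in> Y \<longrightarrow> Phi G \<Sigma> i q \<sigma> = Phi_via G \<Sigma> i q Y \<sigma>)) \<and>
    topological_groupoid_iso \<Sigma> (uf_groupoid A B) (Phi G \<Sigma> i q) \<and>
    induces_twist_iso G \<Sigma> i q (uf_quotient A B) (uf_groupoid A B) (uf_i A B) (uf_q A B)
      (Phi G \<Sigma> i q)"
proof (intro conjI ballI allI impI)
  show "alg_quasi_cartan_pair A B" by (rule quasi_cartan)
  show "\<exists>Y. compact_open_bisection \<Sigma> Y \<and> \<sigma> \<in> Y" if "\<sigma> \<in> arr" for \<sigma>
    using ex_cobis[OF that] compact_open_bisection_iff by metis
  show "Phi G \<Sigma> i q \<sigma> = Phi_via G \<Sigma> i q Y \<sigma>"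
    if "\<sigma> \<in> arr" "compact_open_bisection \<Sigma> Y \<and> \<sigma> \<in> Y" for \<sigma> Y
    using that Phi_eq Phi_via_eq compact_open_bisection_iff by simp
  \<comment> \<open>\<open>Phi\<close> agrees with \<open>point_filter\<close> on arrows only, so
    the transport is established for it afresh instead of by rewriting.\<close>
  have tr: "groupoid_transport \<Sigma> UF (Phi G \<Sigma> i q)"
  proof (unfold_locales)
    show "homeomorphic_map (g_top \<Sigma>) (g_top UF) (Phi G \<Sigma> i q)"
      by (rule homeomorphic_map_eq[OF homeomorphic_point_filter]) (simp add: Phi_eq)
    show "g_comp UF = (\<lambda>(a, b). (Phi G \<Sigma> i q a, Phi G \<Sigma> i q b)) ` g_comp \<Sigma>"
      unfolding fS.comp' by (rule image_cong) (auto simp: Phi_eq S.comp_iff)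
  qed (use fS.mul' fS.inv' in \<open>auto simp: Phi_eq S.comp_iff\<close>)
  show "topological_groupoid_iso \<Sigma> UF (Phi G \<Sigma> i q)"
    by (rule groupoid_transport.iso[OF tr])
  have "discrete_twist GQ UF (uf_i A B) (uf_q A B)"
    by (rule transport_twist[OF transport_point_filter transport_fibre_filter uf_q_eq uf_i_eq])
  then show "induces_twist_iso G \<Sigma> i q GQ UF (uf_i A B) (uf_q A B) (Phi G \<Sigma> i q)"
    unfolding induces_twist_iso_def
    using twist fG.iso by (intro conjI exI[of _ fibre_filter]) (auto simp: Phi_eq uf_q_eq uf_i_eq)
qed

end

section \<open>Deaconu--Renault groupoids\<close>

text \<open>Components are points. In a locally compact Hausdorff space a compact component inside
  an open set has a clopen neighbourhood inside that set.\<close>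

lemma totally_disconnected_basis:
  assumes X: "totally_disconnected_space X" "locally_compact_space X" "Hausdorff_space X"
    and W: "openin X W" "x \<in> W"
  obtains K where "compactin X K" "openin X K" "x \<in> K" "K \<subseteq> W"
proof -
  have "neighbourhood_base_of (compactin X) X"
    using X locally_compact_space_neighbourhood_base by blast
  \<comment> \<open>\<open>V\<close> is taken inside a compact \<open>C\<close>, so that a clopen
    subset of \<open>V\<close> is compact.\<close>
  then obtain V C where V: "openin X V" "compactin X C" "x \<in> V" "V \<subseteq> C" "C \<subseteq> W"
    using W unfolding neighbourhood_base_of by meson
  have x: "x \<in> topspace X" using W openin_subset by blast
  have "connectedin X (connected_component_of_set X x)" by (rule connectedin_connected_component_of)
  then obtain a where "connected_component_of_set X x \<subseteq> {a}"
    using X(1) unfolding totally_disconnected_space_def by blast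
  moreover have "x \<in> connected_component_of_set X x" using x by (simp add: connected_component_of_refl)
  ultimately have "connected_component_of_set X x = {x}" by blast
  then have "{x} \<in> connected_components_of X" using x by (metis connected_component_in_connected_components_of)
  moreover have "compactin X {x}" "{x} \<subseteq> V" using x V by simp_all
  ultimately obtain U U' where U: "openin X U" "openin X U'" "disjnt U U'" "U \<union> U' = topspace X" "{x} \<subseteq> U" "U \<subseteq> V"
    using wilder_locally_compact_component_thm[OF X(2,3) _ _ V(1)] by metis
  have "topspace X - U = U'" using U(3,4) by (auto simp: disjnt_def)
  then have "closedin X U" using U by (auto simp: closedin_def)
  then have "compactin X U" using closed_compactin[OF V(2), of U] V(4) U(6) by blast
  then show ?thesis using that U V by blast
qed

text \<open>The lexicographic order: a vector is positive when its first nonzero coordinate is, the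
  coordinates being listed by the injection \<open>h\<close>.\<close>

lemma ex_positive_cone: "\<exists>P :: (int ^ 'k::finite) set. positive_cone P"
proof -
  obtain h :: "'k \<Rightarrow> nat" where h: "inj h"
    using finite_imp_inj_to_nat_seg[of "UNIV :: 'k set"] by auto
  define P where "P = {v :: int ^ 'k. \<exists>j. v $ j > 0 \<and> (\<forall>l. h l < h j \<longrightarrow> v $ l = 0)}"
  have "positive_cone P"
    unfolding positive_cone_def
  proof (intro conjI ballI allI impI)
    show "0 \<notin> P" by (simp add: P_def)
    fix v w assume "v \<in> P" "w \<in> P"
    then obtain j l where j: "v $ j > 0" "\<forall>m. h m < h j \<longrightarrow> v $ m = 0"
      and l: "w $ l > 0" "\<forall>m. h m < h l \<longrightarrow> w $ m = 0" unfolding P_def by blast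
    consider "h j < h l" | "j = l" | "h l < h j" using injD[OF h] by (metis linorder_neqE_nat)
    then show "v + w \<in> P"
    proof cases
      case 1
      then show ?thesis using j l unfolding P_def by (intro CollectI exI[of _ j]) auto
    next
      case 2
      then show ?thesis using j l unfolding P_def by (intro CollectI exI[of _ j]) auto
    next
      case 3
      then show ?thesis using j l unfolding P_def by (intro CollectI exI[of _ l]) auto
    qed
  next
    fix v :: "int ^ 'k" assume "v \<noteq> 0"
    then obtain j0 where j0: "v $ j0 \<noteq> 0" by (metis vec_eq_iff zero_index)
    obtain j where j: "v $ j \<noteq> 0" "\<And>l. v $ l \<noteq> 0 \<Longrightarrow> h j \<le> h l"
      using ex_has_least_nat[of "\<lambda>j. v $ j \<noteq> 0" j0 h] j0 by blast
    then have "\<forall>l. h l < h j \<longrightarrow> v $ l = 0" by (metis not_le)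
    then show "v \<in> P \<or> - v \<in> P"
      using j(1) unfolding P_def by (cases "v $ j > 0") (auto intro!: exI[of _ j])
  qed
  then show ?thesis by blast
qed

context
  fixes X :: "'x topology" and T :: "nat ^ 'k::finite \<Rightarrow> 'x \<Rightarrow> 'x"
    and G :: "('x \<times> (int ^ 'k) \<times> 'x) groupoid"
  assumes T: "local_homeo_action X T" and G: "G = deaconu_renault X T"
begin

lemma dr_top: "g_top G = topology_generated_by {dr_cylinder T U m n V | U m n V. openin X U \<and> openin X V}"
  by (simp add: G deaconu_renault_def Let_def)

lemma dr_cylinder_open: "openin X U \<Longrightarrow> openin X V \<Longrightarrow> openin (g_top G) (dr_cylinder T U m n V)"
  unfolding dr_top by (rule topology_generated_by_Basis) blast

lemma dr_arrD:
  assumes "(x, p, y) \<in> g_arr G"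
  obtains m n where "x \<in> topspace X" "y \<in> topspace X" "p = vec_diff m n" "T m x = T n y"
  using assms openin_subset unfolding dr_top topology_generated_by_topspace dr_cylinder_def by blast

lemma dr_arrI:
  assumes "x \<in> topspace X" "y \<in> topspace X" "T m x = T n y" shows "(x, vec_diff m n, y) \<in> g_arr G"
proof -
  have "(x, vec_diff m n, y) \<in> dr_cylinder T (topspace X) m n (topspace X)"
    using assms by (auto simp: dr_cylinder_def)
  then show ?thesis using openin_subset[OF dr_cylinder_open] openin_topspace by blast
qed

lemma dr_rng: "g_rng G (x, p, y) = (x, 0, x)" and dr_src: "g_src G (x, p, y) = (y, 0, y)"
  and dr_mul: "g_mul G (x, p, y) (y', p', z) = (x, p + p', z)"
  by (simp_all add: g_rng_def g_src_def G deaconu_renault_def Let_def)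

lemma dr_units: "g_units G = (\<lambda>x. (x, 0, x)) ` topspace X"
proof (intro equalityI subsetI)
  fix u assume "u \<in> g_units G"
  then obtain x p y where a: "(x, p, y) \<in> g_arr G" "u = (x, 0, x)"
    unfolding g_units_def using dr_rng by (metis imageE prod_cases3)
  then show "u \<in> (\<lambda>x. (x, 0, x)) ` topspace X" using dr_arrD[OF a(1)] by blast
next
  fix u assume "u \<in> (\<lambda>x. (x, 0 :: int ^ 'k, x)) ` topspace X"
  then obtain x where x: "x \<in> topspace X" "u = (x, 0, x)" by blast
  have "vec_diff 0 0 = (0 :: int ^ 'k)" by (simp add: vec_diff_def vec_eq_iff)
  then have "u \<in> g_arr G" using dr_arrI[of x x 0 0] x by simp
  moreover have "u = g_rng G u" using x dr_rng by simp
  ultimately show "u \<in> g_units G" unfolding g_units_def by blast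
qed

text \<open>A given degree is the difference of many pairs \<open>(m, n)\<close>, so the arrows with
  ends in \<open>U\<close> and \<open>V\<close> and degree in \<open>Q\<close> form a union of
  cylinders over all such pairs. This makes both ends and the degree continuous.\<close>

lemma dr_box_open:
  assumes "openin X U" "openin X V"
  shows "openin (g_top G) {a \<in> g_arr G. fst a \<in> U \<and> fst (snd a) \<in> Q \<and> snd (snd a) \<in> V}"
proof -
  have "{a \<in> g_arr G. fst a \<in> U \<and> fst (snd a) \<in> Q \<and> snd (snd a) \<in> V} =
      \<Union>((\<lambda>(m, n). dr_cylinder T U m n V) ` {(m, n). vec_diff m n \<in> Q})"
  proof (intro equalityI subsetI)
    fix a assume *: "a \<in> {a \<in> g_arr G. fst a \<in> U \<and> fst (snd a) \<in> Q \<and> snd (snd a) \<in> V}"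
    obtain x p y where a: "a = (x, p, y)" by (cases a) auto
    have "(x, p, y) \<in> g_arr G" using * a by simp
    then obtain m n where mn: "p = vec_diff m n" "T m x = T n y" by (rule dr_arrD)
    then have "a \<in> dr_cylinder T U m n V" using * a unfolding dr_cylinder_def by simp
    moreover have "(m, n) \<in> {(m, n). vec_diff m n \<in> Q}" using * a mn by simp
    ultimately show "a \<in> \<Union>((\<lambda>(m, n). dr_cylinder T U m n V) ` {(m, n). vec_diff m n \<in> Q})" by blast
  next
    fix a assume "a \<in> \<Union>((\<lambda>(m, n). dr_cylinder T U m n V) ` {(m, n). vec_diff m n \<in> Q})"
    then obtain m n x y where a: "vec_diff m n \<in> Q" "a = (x, vec_diff m n, y)" "x \<in> U" "y \<in> V" "T m x = T n y"
      unfolding dr_cylinder_def by auto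
    have "x \<in> topspace X" "y \<in> topspace X"
      using a openin_subset[OF assms(1)] openin_subset[OF assms(2)] by auto
    then show "a \<in> {a \<in> g_arr G. fst a \<in> U \<and> fst (snd a) \<in> Q \<and> snd (snd a) \<in> V}"
      using dr_arrI a by simp
  qed
  moreover have "openin (g_top G) (\<Union>((\<lambda>(m, n). dr_cylinder T U m n V) ` {(m, n). vec_diff m n \<in> Q}))"
    by (rule openin_Union) (use dr_cylinder_open[OF assms] in auto)
  ultimately show ?thesis by simp
qed

lemma dr_arr_ends: "a \<in> g_arr G \<Longrightarrow> fst a \<in> topspace X \<and> snd (snd a) \<in> topspace X"
  by (cases a) (auto elim: dr_arrD)

lemma dr_continuous_fst: "continuous_map (g_top G) X fst"
  unfolding continuous_map_def
proof (intro conjI allI impI)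
  fix U assume U: "openin X U"
  have eq: "{a \<in> g_arr G. fst a \<in> U} = {a \<in> g_arr G. fst a \<in> U \<and> fst (snd a) \<in> UNIV \<and> snd (snd a) \<in> topspace X}"
    using dr_arr_ends by blast
  show "openin (g_top G) {a \<in> g_arr G. fst a \<in> U}"
    unfolding eq by (rule dr_box_open[OF U openin_topspace])
qed (use dr_arr_ends in blast)

lemma dr_continuous_snd: "continuous_map (g_top G) X (\<lambda>a. snd (snd a))"
  unfolding continuous_map_def
proof (intro conjI allI impI)
  fix U assume U: "openin X U"
  have eq: "{a \<in> g_arr G. snd (snd a) \<in> U} = {a \<in> g_arr G. fst a \<in> topspace X \<and> fst (snd a) \<in> UNIV \<and> snd (snd a) \<in> U}"
    using dr_arr_ends by blast
  show "openin (g_top G) {a \<in> g_arr G. snd (snd a) \<in> U}"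
    unfolding eq by (rule dr_box_open[OF openin_topspace U])
qed (use dr_arr_ends in blast)

lemma dr_continuous_deg: "continuous_map (g_top G) (discrete_topology UNIV) (\<lambda>a. fst (snd a))"
  unfolding continuous_map_def
proof (intro conjI allI impI)
  fix Q :: "(int ^ 'k) set"
  have eq: "{a \<in> g_arr G. fst (snd a) \<in> Q} = {a \<in> g_arr G. fst a \<in> topspace X \<and> fst (snd a) \<in> Q \<and> snd (snd a) \<in> topspace X}"
    using dr_arr_ends by blast
  show "openin (g_top G) {a \<in> g_arr G. fst (snd a) \<in> Q}"
    unfolding eq by (rule dr_box_open[OF openin_topspace openin_topspace])
qed auto

text \<open>The topology is finer than the one induced from the product of \<open>X\<close>, the
  discrete group of degrees and \<open>X\<close>.\<close>

lemma dr_Hausdorff: assumes "Hausdorff_space X" shows "Hausdorff_space (g_top G)"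
proof (rule Hausdorff_space_injective_preimage)
  show "Hausdorff_space (prod_topology X (prod_topology (discrete_topology (UNIV :: (int ^ 'k) set)) X))"
    using assms by (simp add: Hausdorff_space_prod_topology)
  show "continuous_map (g_top G) (prod_topology X (prod_topology (discrete_topology UNIV) X))
      (\<lambda>a. (fst a, fst (snd a), snd (snd a)))"
    unfolding continuous_map_paired
    using dr_continuous_fst dr_continuous_snd dr_continuous_deg by blast
  show "inj_on (\<lambda>a. (fst a, fst (snd a), snd (snd a))) (g_arr G)" by (auto simp: inj_on_def)
qed

lemma dr_continuous_unit: "continuous_map X (unit_space G) (\<lambda>x. (x, 0, x))"
proof (rule continuous_map_into_subtopology)
  show "continuous_map X (g_top G) (\<lambda>x. (x, 0, x))"
    unfolding dr_top
  proof (rule continuous_on_generated_topo)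
    fix W assume "W \<in> {dr_cylinder T U m n V | U m n V. openin X U \<and> openin X V}"
    then obtain U m n V where W: "W = dr_cylinder T U m n V" "openin X U" "openin X V" by blast
    \<comment> \<open>A cylinder meets the units only if \<open>m = n\<close>, and then the equation
      of the cylinder holds at every unit.\<close>
    have z: "vec_diff m n = 0 \<longleftrightarrow> m = n" by (auto simp: vec_diff_def vec_eq_iff)
    have "(\<lambda>x. (x, 0, x)) -` W \<inter> topspace X = (if m = n then U \<inter> V else {})"
      using W(2,3) z openin_subset unfolding W(1) dr_cylinder_def by (auto simp: eq_commute[of 0])
    then show "openin X ((\<lambda>x. (x, 0, x)) -` W \<inter> topspace X)" using W by auto
  next
    show "(\<lambda>x. (x, 0, x)) ` topspace X \<subseteq> \<Union>{dr_cylinder T U m n V | U m n V. openin X U \<and> openin X V}"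
    proof -
      have "g_units G \<subseteq> g_arr G"
        unfolding dr_units using dr_arrI[of _ _ 0 0] by (auto simp: vec_diff_def zero_vec_def)
      then show ?thesis unfolding dr_units dr_top topology_generated_by_topspace .
    qed
  qed
  show "(\<lambda>x. (x, 0, x)) \<in> topspace X \<rightarrow> g_units G" unfolding dr_units by blast
qed

lemma dr_zero_dim:
  assumes X: "totally_disconnected_space X" "locally_compact_space X" "Hausdorff_space X"
    and W: "openin (unit_space G) W" "a \<in> W"
  shows "\<exists>K. compactin (g_top G) K \<and> openin (unit_space G) K \<and> a \<in> K \<and> K \<subseteq> W"
proof -
  have Wu: "W \<subseteq> g_units G" and ua: "g_units G \<subseteq> g_arr G"
    using openin_subset[OF W(1)] dr_arrI[of _ _ 0 0] unfolding dr_units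
    by (auto simp: vec_diff_def zero_vec_def)
  obtain x where x: "x \<in> topspace X" "a = (x, 0, x)" using W(2) Wu unfolding dr_units by blast
  have o: "openin X {x \<in> topspace X. (x, 0, x) \<in> W}"
    by (rule openin_continuous_map_preimage[OF dr_continuous_unit W(1)])
  have m: "x \<in> {x \<in> topspace X. (x, 0, x) \<in> W}" using x W by simp
  obtain C where C: "compactin X C" "openin X C" "x \<in> C" "C \<subseteq> {x \<in> topspace X. (x, 0, x) \<in> W}"
    by (rule totally_disconnected_basis[OF X o m])
  let ?K = "(\<lambda>x. (x, 0, x)) ` C"
  have "compactin (unit_space G) ?K" using image_compactin C(1) dr_continuous_unit by blast
  then have "compactin (g_top G) ?K" by (simp add: compactin_subtopology)
  moreover have "openin (unit_space G) ?K"
  proof -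
    have "openin (unit_space G) {a \<in> topspace (unit_space G). fst a \<in> C}"
      by (rule openin_continuous_map_preimage[OF continuous_map_from_subtopology[OF dr_continuous_fst] C(2)])
    moreover have "{a \<in> topspace (unit_space G). fst a \<in> C} = ?K"
      using ua openin_subset[OF C(2)] unfolding topspace_subtopology dr_units by auto
    ultimately show ?thesis by simp
  qed
  ultimately show ?thesis using C(3,4) x(2) by blast
qed

end

theorem corollary9p4:
  fixes X :: "'x topology"
    and T :: "nat ^ 'k::finite \<Rightarrow> 'x \<Rightarrow> 'x"
    and G :: "('x \<times> (int ^ 'k) \<times> 'x) groupoid"
    and \<Sigma> :: "'s groupoid"
    and i :: "('x \<times> (int ^ 'k) \<times> 'x) \<times> 'r::comm_ring_1 \<Rightarrow> 's"
    and q :: "'s \<Rightarrow> 'x \<times> (int ^ 'k) \<times> 'x"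
    and A :: "('r, 's \<Rightarrow> 'r) nu_algebra"
    and B :: "('s \<Rightarrow> 'r) set"
  assumes "totally_disconnected_space X" and "locally_compact_space X" and "Hausdorff_space X"
    and "local_homeo_action X T"
    and "G = deaconu_renault X T"
    and reduced: "\<forall>(a::'r) n. a ^ n = 0 \<longrightarrow> a = 0"
    and indecomposable: "(0::'r) \<noteq> 1 \<and> (\<forall>e::'r. e * e = e \<longrightarrow> e = 0 \<or> e = 1)"
    and "discrete_twist G \<Sigma> i q"
    and "A = steinberg_algebra G \<Sigma> i q"
    and "B = diagonal_subalgebra G \<Sigma> i q"
  shows "alg_quasi_cartan_pair A B \<and>
    (\<forall>\<sigma> \<in> g_arr \<Sigma>.
       (\<exists>Y. compact_open_bisection \<Sigma> Y \<and> \<sigma> \<in> Y) \<and>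
       (\<forall>Y. compact_open_bisection \<Sigma> Y \<and> \<sigma> \<in> Y \<longrightarrow> Phi G \<Sigma> i q \<sigma> = Phi_via G \<Sigma> i q Y \<sigma>)) \<and>
    topological_groupoid_iso \<Sigma> (uf_groupoid A B) (Phi G \<Sigma> i q) \<and>
    induces_twist_iso G \<Sigma> i q (uf_quotient A B) (uf_groupoid A B) (uf_i A B) (uf_q A B)
      (Phi G \<Sigma> i q)"
proof -
  note T = assms(4) and G = assms(5)
  have "graded_twist G \<Sigma> i q (\<lambda>\<alpha>. fst (snd \<alpha>))"
  proof (unfold_locales)
    show "discrete_twist G \<Sigma> i q" by (rule assms(8))
    show "Hausdorff_space (g_top G)" by (rule dr_Hausdorff[OF T G assms(3)])
    show "\<exists>K. compactin (g_top G) K \<and> openin (unit_space G) K \<and> x \<in> K \<and> K \<subseteq> W"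
      if "openin (unit_space G) W" "x \<in> W" for W x
      by (rule dr_zero_dim[OF T G assms(1-3) that])
    show "(0::'r) \<noteq> 1" using indecomposable by blast
    show "e = 0 \<or> e = 1" if "e * e = e" for e :: 'r using indecomposable that by blast
    show "a = 0" if "a * a = 0" for a :: 'r using reduced that by (metis power2_eq_square)
    show "fst (snd (g_mul G \<alpha> \<beta>)) = fst (snd \<alpha>) + fst (snd \<beta>)" for \<alpha> \<beta>
      by (cases \<alpha>; cases \<beta>) (simp add: dr_mul[OF T G])
    \<comment> \<open>An arrow is the triple of its range, degree and source, so the degree
      separates isotropy.\<close>
    show "\<alpha> = \<beta>" if "g_rng G \<alpha> = g_rng G \<beta>" "g_src G \<alpha> = g_src G \<beta>" "fst (snd \<alpha>) = fst (snd \<beta>)" for \<alpha> \<beta>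
      using that by (cases \<alpha>; cases \<beta>) (simp add: dr_rng[OF T G] dr_src[OF T G])
    show "\<exists>P :: (int ^ 'k) set. positive_cone P" by (rule ex_positive_cone)
  qed
  from graded_twist.reconstruction[OF this] show ?thesis unfolding assms(9,10) .
qed

end
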